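(* Let $p\ge1$, let $D,f,g,r,B,\xi,i_0$ be as in the context. Suppose there exist functions $V\in C^{2,1}(\mathbb{R}^d\times\mathbb{R}_+\times S;\mathbb{R}_+)$, $\gamma:\mathbb{R}_+\to\mathbb{R}_+$, $\psi\in L^1(\mathbb{R}_+;\mathbb{R}_+)$ and positive constants $c_1,c_2,\lambda,\alpha$ such that $\int_0^\infty e^{\lambda t}\gamma(t)\,dt<\infty$ and, for all $x,y\in\mathbb{R}^d$, $t\ge0$, $i\in S$, $$c_1|x|^p\le V(x,t,i)\le c_2|x|^p,$$ $$LV(x,y,t,i)\le\gamma(t)+(\psi(t)-\lambda)V(x-D(y,i),t,i),$$ $$|g^T(x,y,t,i)V_x(x-D(y,i),t,i)^T|^2+\int_{\mathbb{R}}|V(x-D(y,i),t,i+\bar h(i,l))-V(x-D(y,i),t,i)|^2\,dl\le\alpha V^2(x-D(y,i),t,i).$$ Then the exact solution $X$ of the neutral stochastic differential delay equation with Markov switching $$d[X(t)-D(X(t-\tau),r(t))]=f(X(t),X(t-\tau),t,r(t))\,dt+g(X(t),X(t-\tau),t,r(t))\,dB_t,\quad t\ge 0,$$ with initial data $X(s)=\xi(s)$ for $s\in[-\tau,0]$, $r(0)=i_0$, is $p$-th moment exponentially stable and almost surely exponentially stable, that is, $$\limsup_{t\to\infty}\frac1t\log\mathbb{E}|X(t)|^p<0,$$ and there is a constant $\kappa>0$ such that $\limsup_{t\to\infty}\frac1t\log|X(t)|\le-\kappa$ almost surely.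
   Context: Setting. $(\Omega,\mathscr{F},P)$ is a probability space with a complete filtration $(\mathscr{F}_t)_{t\ge0}$; $d,m\in\mathbb{N}$ and $\tau>0$ are fixed. $|\cdot|$ is the Euclidean norm, $\langle\cdot,\cdot\rangle$ the inner product, and $\|\cdot\|$ the Hilbert-Schmidt norm of matrices (also written $|\cdot|$). $r(t)$, $t\ge0$, is a right-continuous $(\mathscr{F}_t)$-adapted Markov chain with values in the finite set $S=\{1,\dots,N\}$ and generator $\Gamma=(\gamma_{ij})_{N\times N}$: $P(r(t+\delta)=j\mid r(t)=i)=\gamma_{ij}\delta+o(\delta)$ for $i\ne j$, where $\gamma_{ij}\ge0$ for $i\neq j$ and $\gamma_{ii}=-\sum_{j\ne i}\gamma_{ij}$. $(B_t)_{t\ge0}$ is an $m$-dimensional standard $(\mathscr{F}_t)$-Brownian motion independent of $r$. The initial datum $\xi=\{\xi(s):s\in[-\tau,0]\}$ is a bounded, $\mathscr{F}_0$-measurable, $C([-\tau,0];\mathbb{R}^d)$-valued random variable, and $r(0)=i_0\in S$. Representation of the chain. $r$ is represented as $dr(t)=\int_{\mathbb{R}}\bar h(r(t-),l)\,\nu(dt,dl)$, where $\nu$ is a Poisson random measure with intensity $dt\times dl$ ($dl$ Lebesgue measure on $\mathbb{R}$), and $\bar h:S\times\mathbb{R}\to\mathbb{R}$ is the standard jump function: choose consecutive, pairwise disjoint, left-closed right-open intervals $\Delta_{ij}\subset\mathbb{R}$ ($i\ne j$ in $S$) with $\Delta_{ij}$ of length $\gamma_{ij}$, and set $\bar h(i,l)=j-i$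 if $l\in\Delta_{ij}$ for some $j\neq i$, and $\bar h(i,l)=0$ otherwise. Coefficients and standing assumptions. $D:\mathbb{R}^d\times S\to\mathbb{R}^d$, $f:\mathbb{R}^d\times\mathbb{R}^d\times\mathbb{R}_+\times S\to\mathbb{R}^d$, $g:\mathbb{R}^d\times\mathbb{R}^d\times\mathbb{R}_+\times S\to\mathbb{R}^{d\times m}$ are Borel measurable and satisfy: - local Lipschitz condition: for each $R>0$ there is $L_R>0$ with $|f(x,y,t,i)-f(\bar x,\bar y,t,i)|\vee|g(x,y,t,i)-g(\bar x,\bar y,t,i)|\le L_R(|x-\bar x|+|y-\bar y|)$ for all $(t,i)\in\mathbb{R}_+\times S$ and $|x|\vee|y|\vee|\bar x|\vee|\bar y|\le R$; - there is $0<\beta<1$ with $|D(x,i)-D(y,i)|\le\beta|x-y|$ for all $x,y\in\mathbb{R}^d$, $i\in S$; - $D(0,i)=0$, $f(0,0,t,i)=0$, $g(0,0,t,i)=0$ for all $(t,i)\in\mathbb{R}_+\times S$. The exact solution $X(t)$, $t\ge-\tau$, is the unique global solution of the equation with the given initial data (under the hypotheses of the claim, such a solution exists and is unique). Operator $L$. For $V\in C^{2,1}(\mathbb{R}^d\times\mathbb{R}_+\times S;\mathbb{R}_+)$ (twice continuously differentiable in $x$, once in $t$), $LV:\mathbb{R}^d\times\mathbb{R}^d\times\mathbb{R}_+\times S\to\mathbb{R}$ is $$LV(x,y,t,i)=V_t(x-D(y,i),t,i)+V_x(x-D(y,i),t,i)f(x,y,t,i)+\tfrac12\mathrm{trace}\big[g^T(x,y,t,i)V_{xx}(x-D(y,i),t,i)g(x,y,t,i)\big]+\sum_{j=1}^N\gamma_{ij}V(x-D(y,i),t,j),$$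 where $V_t=\partial V/\partial t$, $V_x=(\partial V/\partial x_1,\dots,\partial V/\partial x_d)$ (row vector), $V_{xx}=(\partial^2V/\partial x_l\partial x_j)_{d\times d}$. *)

theory Defs
  imports "HOL-Probability.Probability"
begin

text \<open>Time is of type \<^typ>\<open>real\<close>; processes and filtrations are only ever inspected at the times stated
  (\<open>t \<ge> 0\<close>, or \<open>t \<ge> -\<tau>\<close> for the solution).  The state space \<open>{1,\<dots>,N}\<close> of the chain is
  the set \<open>{1..int N}\<close>, so that \<open>i + h(i,l)\<close> below is literally a state.  On matrices
  \<^typ>\<open>real^'m^'d\<close> the library norm is the Hilbert-Schmidt norm.\<close>

section \<open>Filtration and driving processes\<close>

definition complete_filtration :: "'w measure \<Rightarrow> (real \<Rightarrow> 'w measure) \<Rightarrow> bool" where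
  "complete_filtration M F \<longleftrightarrow>
     (\<forall>t\<ge>0. subalgebra M (F t)) \<and>
     (\<forall>s t. 0 \<le> s \<and> s \<le> t \<longrightarrow> sets (F s) \<subseteq> sets (F t)) \<and>
     (\<forall>A\<in>null_sets M. \<forall>B\<subseteq>A. B \<in> sets (F 0))"

definition brownian_motion ::
    "'w measure \<Rightarrow> (real \<Rightarrow> 'w measure) \<Rightarrow> (real \<Rightarrow> 'w \<Rightarrow> real^'m) \<Rightarrow> bool" where
  "brownian_motion M F B \<longleftrightarrow>
     (\<forall>t\<ge>0. B t \<in> borel_measurable (F t)) \<and>
     (AE \<omega> in M. B 0 \<omega> = 0) \<and>
     (AE \<omega> in M. continuous_on {0..} (\<lambda>t. B t \<omega>)) \<and>
     (\<forall>s t. 0 \<le> s \<and> s < t \<longrightarrow>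
        distributed M lborel (\<lambda>\<omega>. B t \<omega> - B s \<omega>)
          (\<lambda>x. ennreal (\<Prod>k\<in>UNIV. normal_density 0 (sqrt (t - s)) (x $ k))) \<and>
        prob_space.indep_set M (sets (F s))
          (sets (vimage_algebra (space M) (\<lambda>\<omega>. B t \<omega> - B s \<omega>) borel)))"

definition generator :: "nat \<Rightarrow> (int \<Rightarrow> int \<Rightarrow> real) \<Rightarrow> bool" where
  "generator N \<Gamma> \<longleftrightarrow>
     (\<forall>i\<in>{1..int N}. \<forall>j\<in>{1..int N}. i \<noteq> j \<longrightarrow> \<Gamma> i j \<ge> 0) \<and>
     (\<forall>i\<in>{1..int N}. \<Gamma> i i = - (\<Sum>j\<in>{1..int N} - {i}. \<Gamma> i j))"

text \<open>The Markov property is taken with respect to the given filtration, and the chain is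
  time-homogeneous: \<open>p \<delta> i j\<close> is \<open>P(r(t+\<delta>) = j | r(t) = i)\<close>, whatever \<open>t\<close>.\<close>

definition markov_chain ::
    "'w measure \<Rightarrow> (real \<Rightarrow> 'w measure) \<Rightarrow> nat \<Rightarrow> (int \<Rightarrow> int \<Rightarrow> real) \<Rightarrow> (real \<Rightarrow> 'w \<Rightarrow> int) \<Rightarrow> bool"
  where
  "markov_chain M F N \<Gamma> r \<longleftrightarrow>
     (\<forall>t\<ge>0. r t \<in> measurable (F t) (count_space UNIV)) \<and>
     (\<forall>\<omega>\<in>space M. \<forall>t\<ge>0. r t \<omega> \<in> {1..int N} \<and> continuous (at_right t) (\<lambda>s. r s \<omega>)) \<and>
     (\<exists>p :: real \<Rightarrow> int \<Rightarrow> int \<Rightarrow> real.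
        (\<forall>t\<ge>0. \<forall>\<delta>\<ge>0. \<forall>j\<in>{1..int N}. AE \<omega> in M.
           real_cond_exp M (F t) (indicator {\<omega>'\<in>space M. r (t + \<delta>) \<omega>' = j}) \<omega> = p \<delta> (r t \<omega>) j) \<and>
        (\<forall>i\<in>{1..int N}. \<forall>j\<in>{1..int N}. i \<noteq> j \<longrightarrow>
           (\<lambda>\<delta>. p \<delta> i j - \<Gamma> i j * \<delta>) \<in> o[at_right 0](\<lambda>\<delta>. \<delta>)))"

definition indep_processes ::
    "'w measure \<Rightarrow> (real \<Rightarrow> 'w \<Rightarrow> real^'m) \<Rightarrow> (real \<Rightarrow> 'w \<Rightarrow> int) \<Rightarrow> bool" where
  "indep_processes M B r \<longleftrightarrow>
     prob_space.indep_set M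
       (sets (vimage_algebra (space M) (\<lambda>\<omega>. \<lambda>t\<in>{0..}. B t \<omega>) (PiM {0..} (\<lambda>_. borel))))
       (sets (vimage_algebra (space M) (\<lambda>\<omega>. \<lambda>t\<in>{0..}. r t \<omega>)
          (PiM {0..} (\<lambda>_. count_space UNIV))))"

section \<open>Poisson representation of the chain\<close>

text \<open>Consecutive intervals are intervals without gaps between them, i.e. their union is again an
  interval.  No particular order of the pairs \<open>(i,j)\<close> is imposed.\<close>

definition jump_intervals ::
    "nat \<Rightarrow> (int \<Rightarrow> int \<Rightarrow> real) \<Rightarrow> (int \<Rightarrow> int \<Rightarrow> real set) \<Rightarrow> bool" where
  "jump_intervals N \<Gamma> \<Delta> \<longleftrightarrow>
     (let I = {(i, j). i \<in> {1..int N} \<and> j \<in> {1..int N} \<and> i \<noteq> j} in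
        (\<forall>(i, j)\<in>I. \<exists>a. \<Delta> i j = {a ..< a + \<Gamma> i j}) \<and>
        disjoint_family_on (\<lambda>(i, j). \<Delta> i j) I \<and>
        is_interval (\<Union>(i, j)\<in>I. \<Delta> i j))"

definition jump_fun :: "nat \<Rightarrow> (int \<Rightarrow> int \<Rightarrow> real set) \<Rightarrow> int \<Rightarrow> real \<Rightarrow> int" where
  "jump_fun N \<Delta> i l =
     (if \<exists>j\<in>{1..int N} - {i}. l \<in> \<Delta> i j
      then (THE j. j \<in> {1..int N} - {i} \<and> l \<in> \<Delta> i j) - i else 0)"

text \<open>A random measure on \<open>[0,\<infinity>) \<times> \<real>\<close> is given as a Borel measure on the plane which is only
  evaluated on subsets of that half-plane.  The last two clauses say that it is Poisson relative
  to the filtration.\<close>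

definition poisson_random_measure ::
    "'w measure \<Rightarrow> (real \<Rightarrow> 'w measure) \<Rightarrow> ('w \<Rightarrow> (real \<times> real) measure) \<Rightarrow> bool" where
  "poisson_random_measure M F \<nu> \<longleftrightarrow>
     (\<forall>\<omega>\<in>space M. sets (\<nu> \<omega>) = sets borel) \<and>
     (\<forall>A\<in>sets borel. A \<subseteq> {0..} \<times> UNIV \<longrightarrow>
        (\<lambda>\<omega>. emeasure (\<nu> \<omega>) A) \<in> borel_measurable M \<and>
        (emeasure lborel A < \<infinity> \<longrightarrow>
           (\<forall>k. measure M {\<omega>\<in>space M. emeasure (\<nu> \<omega>) A = of_nat k}
                  = measure lborel A ^ k / fact k * exp (- measure lborel A)))) \<and>
     (\<forall>n. \<forall>A :: nat \<Rightarrow> (real \<times> real) set.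
        (\<forall>k<n. A k \<in> sets borel \<and> A k \<subseteq> {0..} \<times> UNIV) \<and> disjoint_family_on A {..<n} \<longrightarrow>
        prob_space.indep_vars M (\<lambda>_. borel) (\<lambda>k \<omega>. emeasure (\<nu> \<omega>) (A k)) {..<n}) \<and>
     (\<forall>t\<ge>0. \<forall>A\<in>sets borel. A \<subseteq> {0..t} \<times> UNIV \<longrightarrow>
        (\<lambda>\<omega>. emeasure (\<nu> \<omega>) A) \<in> borel_measurable (F t)) \<and>
     (\<forall>t\<ge>0. prob_space.indep_set M (sets (F t))
        (sigma_sets (space M)
          {(\<lambda>\<omega>. emeasure (\<nu> \<omega>) A) -` E \<inter> space M | A E.
             A \<in> sets borel \<and> A \<subseteq> {t<..} \<times> UNIV \<and> E \<in> sets borel}))"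

text \<open>\<open>dr(t) = \<integral> h(r(t-),l) \<nu>(dt,dl)\<close>.\<close>

definition poisson_representation ::
    "'w measure \<Rightarrow> ('w \<Rightarrow> (real \<times> real) measure) \<Rightarrow> (int \<Rightarrow> real \<Rightarrow> int) \<Rightarrow> (real \<Rightarrow> 'w \<Rightarrow> int) \<Rightarrow> bool"
  where
  "poisson_representation M \<nu> h r \<longleftrightarrow>
     (AE \<omega> in M. \<forall>t\<ge>0.
        set_integrable (\<nu> \<omega>) ({0<..t} \<times> UNIV)
          (\<lambda>(s, l). real_of_int (h (Lim (at_left s) (\<lambda>u. r u \<omega>)) l)) \<and>
        real_of_int (r t \<omega>) = real_of_int (r 0 \<omega>) +
          (LINT z:{0<..t} \<times> UNIV|\<nu> \<omega>.
             (case z of (s, l) \<Rightarrow> real_of_int (h (Lim (at_left s) (\<lambda>u. r u \<omega>)) l))))"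

section \<open>The It\^o integral\<close>

text \<open>The measurability clause matters: \<^const>\<open>measure\<close> vanishes on non-measurable sets.\<close>

definition null_in_prob :: "'w measure \<Rightarrow> (nat \<Rightarrow> 'w \<Rightarrow> ennreal) \<Rightarrow> bool" where
  "null_in_prob M Z \<longleftrightarrow>
     (\<forall>n. Z n \<in> borel_measurable M) \<and>
     (\<forall>\<epsilon>>0. (\<lambda>n. measure M {\<omega>\<in>space M. Z n \<omega> > ennreal \<epsilon>}) \<longlonglongrightarrow> 0)"

definition progressive ::
    "'w measure \<Rightarrow> (real \<Rightarrow> 'w measure) \<Rightarrow> (real \<Rightarrow> 'w \<Rightarrow> 'b::topological_space) \<Rightarrow> bool" where
  "progressive M F G \<longleftrightarrow>
     (\<forall>T\<ge>0. (\<lambda>(s, \<omega>). G s \<omega>) \<in> borel_measurable (restrict_space borel {0..T} \<Otimes>\<^sub>M F T))"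

text \<open>A simple process \<open>\<Sum>k<n. \<eta> k \<cdot> 1_(u k, u (k+1)]\<close> with bounded \<open>F (u k)\<close>-measurable \<open>\<eta> k\<close>,
  and its elementary stochastic integral.\<close>

definition simple_process ::
    "'w measure \<Rightarrow> (real \<Rightarrow> 'w measure) \<Rightarrow> nat \<Rightarrow> (nat \<Rightarrow> real) \<Rightarrow> (nat \<Rightarrow> 'w \<Rightarrow> real^'m^'d) \<Rightarrow> bool"
  where
  "simple_process M F n u \<eta> \<longleftrightarrow>
     0 \<le> u 0 \<and> (\<forall>k<n. u k \<le> u (Suc k)) \<and>
     (\<forall>k<n. \<eta> k \<in> borel_measurable (F (u k))) \<and>
     (\<exists>C. \<forall>k<n. \<forall>\<omega>\<in>space M. norm (\<eta> k \<omega>) \<le> C)"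

definition simple_val ::
    "nat \<Rightarrow> (nat \<Rightarrow> real) \<Rightarrow> (nat \<Rightarrow> 'w \<Rightarrow> real^'m^'d) \<Rightarrow> real \<Rightarrow> 'w \<Rightarrow> real^'m^'d" where
  "simple_val n u \<eta> s \<omega> = (\<Sum>k<n. indicator {u k<..u (Suc k)} s *\<^sub>R \<eta> k \<omega>)"

definition simple_integral ::
    "(real \<Rightarrow> 'w \<Rightarrow> real^'m) \<Rightarrow> nat \<Rightarrow> (nat \<Rightarrow> real) \<Rightarrow> (nat \<Rightarrow> 'w \<Rightarrow> real^'m^'d) \<Rightarrow> real \<Rightarrow> 'w \<Rightarrow> real^'d"
  where
  "simple_integral B n u \<eta> t \<omega> =
     (\<Sum>k<n. \<eta> k \<omega> *v (B (min t (u (Suc k))) \<omega> - B (min t (u k)) \<omega>))"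

text \<open>\<open>I\<close> is a continuous adapted version of \<open>\<integral>\<^sub>0\<^sup>t G(s) dB\<^sub>s\<close>, for a progressively measurable \<open>G\<close>
  with \<open>\<integral>\<^sub>0\<^sup>T \<bar>G(s)\<bar>\<^sup>2 ds < \<infinity>\<close> almost surely: the limit in probability of the integrals of simple processes
  that converge to \<open>G\<close> in \<open>L\<^sup>2([0,T])\<close> in probability.\<close>

definition ito_integral ::
    "'w measure \<Rightarrow> (real \<Rightarrow> 'w measure) \<Rightarrow> (real \<Rightarrow> 'w \<Rightarrow> real^'m) \<Rightarrow> (real \<Rightarrow> 'w \<Rightarrow> real^'m^'d) \<Rightarrow>
     (real \<Rightarrow> 'w \<Rightarrow> real^'d) \<Rightarrow> bool" where
  "ito_integral M F B G I \<longleftrightarrow>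
     progressive M F G \<and>
     (AE \<omega> in M. \<forall>T\<ge>0. (\<integral>\<^sup>+s\<in>{0..T}. ennreal ((norm (G s \<omega>))\<^sup>2) \<partial>lborel) < \<infinity>) \<and>
     (\<forall>t\<ge>0. I t \<in> borel_measurable (F t)) \<and>
     (AE \<omega> in M. continuous_on {0..} (\<lambda>t. I t \<omega>)) \<and>
     (\<exists>n u \<eta>.
        (\<forall>j :: nat. simple_process M F (n j) (u j) (\<eta> j)) \<and>
        (\<forall>T\<ge>0. null_in_prob M (\<lambda>j \<omega>.
           \<integral>\<^sup>+s\<in>{0..T}. ennreal ((norm (simple_val (n j) (u j) (\<eta> j) s \<omega> - G s \<omega>))\<^sup>2) \<partial>lborel)) \<and>
        (\<forall>t\<ge>0. null_in_prob M (\<lambda>j \<omega>.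
           ennreal (norm (simple_integral B (n j) (u j) (\<eta> j) t \<omega> - I t \<omega>)))))"

section \<open>The equation\<close>

definition local_lipschitz_coeffs ::
    "nat \<Rightarrow> (real^'d \<Rightarrow> real^'d \<Rightarrow> real \<Rightarrow> int \<Rightarrow> real^'d) \<Rightarrow>
     (real^'d \<Rightarrow> real^'d \<Rightarrow> real \<Rightarrow> int \<Rightarrow> real^'m^'d) \<Rightarrow> bool" where
  "local_lipschitz_coeffs N f g \<longleftrightarrow>
     (\<forall>R>0. \<exists>L>0. \<forall>x y x' y' t i.
        t \<ge> 0 \<and> i \<in> {1..int N} \<and> norm x \<le> R \<and> norm y \<le> R \<and> norm x' \<le> R \<and> norm y' \<le> R \<longrightarrow>
        max (norm (f x y t i - f x' y' t i)) (norm (g x y t i - g x' y' t i))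
          \<le> L * (norm (x - x') + norm (y - y')))"

text \<open>The Borel \<open>\<sigma>\<close>-algebra of \<open>C([-\<tau>,0];\<real>\<^sup>d)\<close> is generated by the evaluations, so \<open>F 0\<close>-measurability
  of the path-valued variable is that of each \<open>\<xi> s\<close>.\<close>

definition initial_datum ::
    "'w measure \<Rightarrow> (real \<Rightarrow> 'w measure) \<Rightarrow> real \<Rightarrow> (real \<Rightarrow> 'w \<Rightarrow> real^'d) \<Rightarrow> bool" where
  "initial_datum M F \<tau> \<xi> \<longleftrightarrow>
     (\<forall>s\<in>{-\<tau>..0}. \<xi> s \<in> borel_measurable (F 0)) \<and>
     (\<forall>\<omega>\<in>space M. continuous_on {-\<tau>..0} (\<lambda>s. \<xi> s \<omega>)) \<and>
     (\<exists>K. \<forall>\<omega>\<in>space M. \<forall>s\<in>{-\<tau>..0}. norm (\<xi> s \<omega>) \<le> K)"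

text \<open>Solutions are cadlag, not continuous: \<open>X(t) - D(X(t-\<tau>), r(t))\<close> is continuous, but
  \<open>D(X(t-\<tau>), r(t))\<close> may jump with the chain.  On \<open>[-\<tau>,0]\<close> adapted means \<open>F 0\<close>-measurable.\<close>

definition nsdde_solution ::
    "'w measure \<Rightarrow> (real \<Rightarrow> 'w measure) \<Rightarrow> (real \<Rightarrow> 'w \<Rightarrow> int) \<Rightarrow> (real \<Rightarrow> 'w \<Rightarrow> real^'m) \<Rightarrow>
     (real^'d \<Rightarrow> int \<Rightarrow> real^'d) \<Rightarrow>
     (real^'d \<Rightarrow> real^'d \<Rightarrow> real \<Rightarrow> int \<Rightarrow> real^'d) \<Rightarrow>
     (real^'d \<Rightarrow> real^'d \<Rightarrow> real \<Rightarrow> int \<Rightarrow> real^'m^'d) \<Rightarrow>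
     real \<Rightarrow> (real \<Rightarrow> 'w \<Rightarrow> real^'d) \<Rightarrow> (real \<Rightarrow> 'w \<Rightarrow> real^'d) \<Rightarrow> bool" where
  "nsdde_solution M F r B D f g \<tau> \<xi> X \<longleftrightarrow>
     (\<forall>t\<ge>-\<tau>. X t \<in> borel_measurable (F (max 0 t))) \<and>
     (\<forall>\<omega>\<in>space M.
        (\<forall>t\<ge>-\<tau>. continuous (at_right t) (\<lambda>s. X s \<omega>)) \<and>
        (\<forall>t>-\<tau>. \<exists>l. ((\<lambda>s. X s \<omega>) \<longlongrightarrow> l) (at_left t))) \<and>
     (AE \<omega> in M. \<forall>s\<in>{-\<tau>..0}. X s \<omega> = \<xi> s \<omega>) \<and>
     (AE \<omega> in M. \<forall>t\<ge>0. set_integrable lborel {0..t} (\<lambda>s. f (X s \<omega>) (X (s - \<tau>) \<omega>) s (r s \<omega>))) \<and>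
     (\<exists>I. ito_integral M F B (\<lambda>s \<omega>. g (X s \<omega>) (X (s - \<tau>) \<omega>) s (r s \<omega>)) I \<and>
        (AE \<omega> in M. \<forall>t\<ge>0.
           X t \<omega> - D (X (t - \<tau>) \<omega>) (r t \<omega>) =
             X 0 \<omega> - D (X (- \<tau>) \<omega>) (r 0 \<omega>)
             + (LINT s:{0..t}|lborel. f (X s \<omega>) (X (s - \<tau>) \<omega>) s (r s \<omega>))
             + I t \<omega>))"

section \<open>Lyapunov functions and the operator L\<close>

definition partial :: "'d \<Rightarrow> (real^'d \<Rightarrow> real) \<Rightarrow> real^'d \<Rightarrow> real" where
  "partial k h x = deriv (\<lambda>s. h (x + s *\<^sub>R axis k 1)) 0"

definition has_partial :: "'d \<Rightarrow> (real^'d \<Rightarrow> real) \<Rightarrow> real^'d \<Rightarrow> bool" where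
  "has_partial k h x \<longleftrightarrow> (\<lambda>s. h (x + s *\<^sub>R axis k 1)) field_differentiable (at 0)"

text \<open>The time derivative at \<open>t = 0\<close> is one-sided.\<close>

definition V_t :: "(real^'d \<Rightarrow> real \<Rightarrow> int \<Rightarrow> real) \<Rightarrow> real^'d \<Rightarrow> real \<Rightarrow> int \<Rightarrow> real" where
  "V_t V x t i = vector_derivative (\<lambda>s. V x s i) (at t within {0..})"

definition V_x :: "(real^'d \<Rightarrow> real \<Rightarrow> int \<Rightarrow> real) \<Rightarrow> real^'d \<Rightarrow> real \<Rightarrow> int \<Rightarrow> real^'d" where
  "V_x V x t i = (\<chi> k. partial k (\<lambda>z. V z t i) x)"

definition V_xx :: "(real^'d \<Rightarrow> real \<Rightarrow> int \<Rightarrow> real) \<Rightarrow> real^'d \<Rightarrow> real \<Rightarrow> int \<Rightarrow> real^'d^'d" where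
  "V_xx V x t i = (\<chi> l k. partial l (partial k (\<lambda>z. V z t i)) x)"

definition C21 :: "nat \<Rightarrow> (real^'d \<Rightarrow> real \<Rightarrow> int \<Rightarrow> real) \<Rightarrow> bool" where
  "C21 N V \<longleftrightarrow>
     (\<forall>i\<in>{1..int N}.
        (\<forall>x. \<forall>t\<ge>0.
           (\<lambda>s. V x s i) differentiable (at t within {0..}) \<and>
           (\<forall>k. has_partial k (\<lambda>z. V z t i) x) \<and>
           (\<forall>l k. has_partial l (partial k (\<lambda>z. V z t i)) x)) \<and>
        continuous_on (UNIV \<times> {0..}) (\<lambda>(x, t). V x t i) \<and>
        continuous_on (UNIV \<times> {0..}) (\<lambda>(x, t). V_t V x t i) \<and>
        continuous_on (UNIV \<times> {0..}) (\<lambda>(x, t). V_x V x t i) \<and>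
        continuous_on (UNIV \<times> {0..}) (\<lambda>(x, t). V_xx V x t i))"

definition L_op ::
    "nat \<Rightarrow> (int \<Rightarrow> int \<Rightarrow> real) \<Rightarrow>
     (real^'d \<Rightarrow> int \<Rightarrow> real^'d) \<Rightarrow>
     (real^'d \<Rightarrow> real^'d \<Rightarrow> real \<Rightarrow> int \<Rightarrow> real^'d) \<Rightarrow>
     (real^'d \<Rightarrow> real^'d \<Rightarrow> real \<Rightarrow> int \<Rightarrow> real^'m^'d) \<Rightarrow>
     (real^'d \<Rightarrow> real \<Rightarrow> int \<Rightarrow> real) \<Rightarrow>
     real^'d \<Rightarrow> real^'d \<Rightarrow> real \<Rightarrow> int \<Rightarrow> real" where
  "L_op N \<Gamma> D f g V x y t i =
     V_t V (x - D y i) t i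
     + V_x V (x - D y i) t i \<bullet> f x y t i
     + 1/2 * trace (transpose (g x y t i) ** V_xx V (x - D y i) t i ** g x y t i)
     + (\<Sum>j\<in>{1..int N}. \<Gamma> i j * V (x - D y i) t j)"

section \<open>Exponential stability\<close>

text \<open>The logarithm of a possibly infinite quantity, with \<open>log 0 = -\<infinity>\<close>.\<close>

definition elog :: "ennreal \<Rightarrow> ereal" where
  "elog a = (if a = 0 then -\<infinity> else if a = \<infinity> then \<infinity> else ereal (ln (enn2real a)))"

definition moment_exp_stable :: "'w measure \<Rightarrow> real \<Rightarrow> (real \<Rightarrow> 'w \<Rightarrow> real^'d) \<Rightarrow> bool" where
  "moment_exp_stable M p X \<longleftrightarrow>
     Limsup at_top (\<lambda>t. elog (\<integral>\<^sup>+\<omega>. ennreal (norm (X t \<omega>) powr p) \<partial>M) / ereal t) < 0"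

definition as_exp_stable :: "'w measure \<Rightarrow> (real \<Rightarrow> 'w \<Rightarrow> real^'d) \<Rightarrow> bool" where
  "as_exp_stable M X \<longleftrightarrow>
     (\<exists>\<kappa>>0. AE \<omega> in M.
        Limsup at_top (\<lambda>t. elog (ennreal (norm (X t \<omega>))) / ereal t) \<le> ereal (- \<kappa>))"

end

theory Submission
  imports Defs "HOL-Real_Asymp.Real_Asymp"
begin

text \<open>Ito's formula is applied to \<open>theta(Q) Phi(exp(lam t) V(Z,t,r))\<close>, where \<open>Z(t) = X(t) - D(X(t-tau),r(t))\<close>, \<open>Phi\<close> is a
 concave truncation at height \<open>R\<close>, and the cutoff \<open>theta\<close> at level \<open>K\<close> of \<open>Q = integral of |g|^2 + |f|\<close> takes the
 place of localising stopping times.  By concavity the bound on \<open>LV\<close> shows that the drift is at most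
 \<open>exp(lam t) gamma + psi Phi\<close>.  Letting \<open>K\<close> tend to infinity, applying Gronwall's inequality and letting \<open>R\<close>
 tend to infinity, one finds that \<open>exp(lam t - Psi(t)) V(Z,t,r)\<close> plus the tail of the integral of \<open>exp(lam t) gamma\<close>
 is a supermartingale, where \<open>Psi\<close> is the integral of \<open>psi\<close>.  Hence \<open>exp(lam t) |Z|^p\<close> is bounded in mean and, by the maximal inequality,
 along almost every path.  As \<open>D\<close> is a contraction, the decay passes to \<open>X\<close> by iteration over delay intervals.

 Ito's formula itself is first proved for simple integrands, from a Taylor expansion over short time steps whose
 mean error is \<open>o(h)\<close>, and then extended by approximation along an almost surely convergent subsequence.\<close>

section \<open>Increments of Brownian motion\<close>

text \<open>\<open>Z\<close> is almost surely continuous although \<open>X\<close> may jump with the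
  chain, so the expansion treats \<open>Z\<close> as a diffusion and the chain only as a switch of
  the last argument. Both may move in one time step; this mixed effect is \<open>o(h)\<close> in
  mean because a truncated function has a uniform modulus of the form
  \<open>eps + K * deviation\<close>, which can be averaged term by term. The truncations are chosen
  for their signs: the decreasing cutoff has a nonpositive derivative in \<open>Q\<close>, the cap
  adds a nonpositive second-derivative term and lies below its tangents at the jumps, and
  \<open>cap1 R v * v \<le> cap R v\<close> closes the Gronwall inequality in the capped quantity.
  The speed of \<open>Q\<close> has integral at most \<open>K\<close> over the times with
  \<open>Q < K\<close>, so drift integrals are bounded by a constant and dominated convergence
  applies. All identities are tested against events \<open>A\<close> of the past. This is
  conditional expectation in integrated form; it yields a supermartingale and not only a moment
  bound. The delay recursion passes on only rates below \<open>- ln \<beta> / \<tau>\<close>, so the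
  final rates may be smaller than those of \<open>Z\<close>.\<close>

lemma has_bochner_integral_lborel_prod_vec:
 fixes f :: "'n::finite => real => real"
 assumes "!!k. integrable lborel (f k)"
 shows "has_bochner_integral lborel (\<lambda>x::real^'n. \<Prod>k\<in>UNIV. f k (x $ k))
     (\<Prod>k\<in>UNIV. integral\<^sup>L lborel (f k))"
proof -
 interpret product_sigma_finite "\<lambda>_::real^'n. lborel :: real measure" ..
 \<comment> \<open>\<open>lborel\<close> on vectors is an image of the product measure indexed by
   \<open>Basis\<close>. Since \<open>axis_index\<close> inverts the map from \<open>k\<close> to
   \<open>axis k 1\<close>, a product over coordinates becomes a product over \<open>Basis\<close>,
   to which Fubini for finite products applies.\<close>
 define g where "g b = f (axis_index b)" for b :: "real^'n"
 have [measurable]: "f k \<in> borel_measurable borel" for k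
  using borel_measurable_integrable[OF assms[of k]] by simp
 have [measurable]: "g b \<in> borel_measurable borel" for b
  unfolding g_def by simp
 have B: "(Basis :: (real^'n) set) = (\<lambda>k. axis k 1) ` UNIV"
  by (auto simp: Basis_vec_def)
 have inj: "inj (\<lambda>k::'n. axis k (1::real))"
  by (auto simp: inj_on_def axis_eq_axis)
 have idx: "axis_index (axis k (1::real)) = k" for k :: 'n
  by (simp add: axis_eq_axis axis_index_def)
 have sel: "(\<Sum>b\<in>(Basis::(real^'n) set). y b *\<^sub>R b) $ k = y (axis k 1)" for y k
 proof -
  have "(\<Sum>b\<in>(Basis::(real^'n) set). y b *\<^sub>R b) $ k = (\<Sum>b\<in>(Basis::(real^'n) set). y b *\<^sub>R b) \<bullet> axis k 1"
   by (simp add: inner_axis)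
  also have "... = y (axis k 1)"
   by (subst inner_sum_left_Basis) (auto simp: B)
  finally show ?thesis .
 qed
 have prd: "(\<Prod>k\<in>UNIV. f k ((\<Sum>b\<in>(Basis::(real^'n) set). y b *\<^sub>R b) $ k)) = (\<Prod>b\<in>Basis. g b (y b))" for y
 proof -
  have "(\<Prod>b\<in>Basis. g b (y b)) = (\<Prod>k\<in>UNIV. f k (y (axis k 1)))"
   unfolding B by (subst prod.reindex[OF inj]) (simp add: g_def idx)
  then show ?thesis by (simp only: sel)
 qed
 have ig: "integrable lborel (g b)" for b by (simp add: g_def assms)
 have "integrable lborel (\<lambda>x::real^'n. \<Prod>k\<in>UNIV. f k (x $ k))"
  by (subst lborel_eq, subst integrable_distr_eq)
   (auto simp: prd simp del: sum_component vector_scaleR_component intro!: product_integrable_prod ig)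
 moreover have "integral\<^sup>L lborel (\<lambda>x::real^'n. \<Prod>k\<in>UNIV. f k (x $ k)) = (\<Prod>k\<in>UNIV. integral\<^sup>L lborel (f k))"
 proof -
  have "integral\<^sup>L lborel (\<lambda>x::real^'n. \<Prod>k\<in>UNIV. f k (x $ k)) = (\<Prod>b\<in>Basis. integral\<^sup>L lborel (g b))"
   by (subst lborel_eq, subst integral_distr)
    (auto simp: prd product_integral_prod ig simp del: sum_component vector_scaleR_component)
  also have "... = (\<Prod>k\<in>UNIV. integral\<^sup>L lborel (f k))"
   unfolding B by (subst prod.reindex[OF inj]) (simp add: g_def idx)
  finally show ?thesis .
 qed
 ultimately show ?thesis by (simp add: has_bochner_integral_iff)
qed

lemma has_bochner_integral_normal_vec:
 fixes Y :: "'w => real^'m" and g :: "'m => real => real"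
 assumes D: "distributed M lborel Y (\<lambda>x. ennreal (\<Prod>k\<in>UNIV. normal_density 0 s (x $ k)))"
  and int: "!!k. integrable lborel (\<lambda>x. normal_density 0 s x * g k x)"
  and [measurable]: "!!k. g k \<in> borel_measurable borel"
 shows "has_bochner_integral M (\<lambda>w. \<Prod>k\<in>UNIV. g k (Y w $ k))
     (\<Prod>k\<in>UNIV. (LINT x|lborel. normal_density 0 s x * g k x))"
proof -
 have *: "(\<Prod>k\<in>UNIV. normal_density 0 s (x $ k)) * (\<Prod>k\<in>UNIV. g k (x $ k)) =
  (\<Prod>k\<in>UNIV. normal_density 0 s (x $ k) * g k (x $ k))" for x :: "real^'m"
  by (simp add: prod.distrib)
 note I = has_bochner_integral_lborel_prod_vec[of "\<lambda>k x. normal_density 0 s x * g k x", OF int]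
 have nn: "0 \<le> (\<Prod>k\<in>UNIV. normal_density 0 s (x $ k))" for x :: "real^'m"
  by (intro prod_nonneg) auto
 have m: "(\<lambda>x::real^'m. \<Prod>k\<in>UNIV. g k (x $ k)) \<in> borel_measurable lborel" by measurable
 have "integrable M (\<lambda>w. \<Prod>k\<in>UNIV. g k (Y w $ k))"
  using distributed_integrable[OF D m nn] I unfolding * by (simp add: has_bochner_integral_iff)
 moreover have "(LINT w|M. (\<Prod>k\<in>UNIV. g k (Y w $ k))) = (\<Prod>k\<in>UNIV. (LINT x|lborel. normal_density 0 s x * g k x))"
  using distributed_integral[OF D m nn] I unfolding * by (simp add: has_bochner_integral_iff)
 ultimately show ?thesis by (simp add: has_bochner_integral_iff)
qed

text \<open>Each integrand is a product over the coordinates with factor 1 at those not involved, so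
  every moment splits into one-dimensional Gaussian moments. The fourth moment of order
  \<open>h^2\<close> is what later turns remainders in \<open>K\<close> into
  \<open>O(h^2)\<close>.\<close>

lemma normal_vec_moments:
 fixes Y :: "'w => real^'m"
 assumes D: "distributed M lborel Y (\<lambda>x. ennreal (\<Prod>k\<in>UNIV. normal_density 0 (sqrt h) (x $ k)))"
  and h: "h > 0"
 shows "has_bochner_integral M (\<lambda>w. Y w $ a) 0"
  and "has_bochner_integral M (\<lambda>w. Y w $ a * Y w $ b) (if a = b then h else 0)"
  and "has_bochner_integral M (\<lambda>w. (Y w $ a) ^ 4) (3 * h^2)"
proof -
 let ?n = "normal_density 0 (sqrt h)"
 have s: "0 < sqrt h" using h by simp
 have m0: "has_bochner_integral lborel ?n 1"
  using normal_moment_even[OF s, of 0 0] by simp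
 have m1: "has_bochner_integral lborel (\<lambda>x. ?n x * x) 0"
  using normal_moment_odd[OF s, of 0 0] by simp
 have m2: "has_bochner_integral lborel (\<lambda>x. ?n x * (x * x)) h"
  using normal_moment_even[OF s, of 0 1] h by (simp add: power2_eq_square)
 have m4: "has_bochner_integral lborel (\<lambda>x. ?n x * x ^ 4) (3 * h^2)"
  using normal_moment_even[OF s, of 0 2] h
  by (simp add: fact_numeral power2_eq_square field_simps)
 note m = m0 m1 m2 m4
 note mi = m[unfolded has_bochner_integral_iff]
 have p1: "(\<Prod>k\<in>UNIV. if k = a then F k else (1::real)) = F a" for F and a :: 'm
  by (simp add: prod.delta)
 have p2: "(\<Prod>k\<in>UNIV. if k = a then F k else if k = b then G k else (1::real)) = F a * G b"
  if "a \<noteq> b" for F G and a b :: 'm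
 proof -
  have "(if k = a then F k else if k = b then G k else (1::real)) =
   (if k = a then F k else 1) * (if k = b then G k else 1)" for k using that by auto
  then show ?thesis by (simp add: prod.distrib prod.delta)
 qed
 have "has_bochner_integral M (\<lambda>w. \<Prod>k\<in>UNIV. (if k = a then \<lambda>x. x else (\<lambda>x. 1)) (Y w $ k))
  (\<Prod>k\<in>UNIV. (LINT x|lborel. ?n x * (if k = a then \<lambda>x. x else (\<lambda>x. 1)) x))"
  by (rule has_bochner_integral_normal_vec[OF D]) (use mi in auto)
 moreover have "(\<Prod>k\<in>UNIV. (if k = a then \<lambda>x. x else (\<lambda>x. 1)) (Y w $ k)) = Y w $ a" for w
  using p1[of a "\<lambda>k. Y w $ k"] by (simp add: if_distrib[of "\<lambda>f. f _"] cong: if_cong)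
 moreover have "(\<Prod>k\<in>UNIV. (LINT x|lborel. ?n x * (if k = a then \<lambda>x. x else (\<lambda>x. 1)) x))
  = (\<Prod>k\<in>UNIV. if k = a then 0 else 1)"
  by (rule prod.cong) (use mi in auto)
 ultimately show "has_bochner_integral M (\<lambda>w. Y w $ a) 0"
  using p1[of a "\<lambda>_. 0"] by simp
 show "has_bochner_integral M (\<lambda>w. (Y w $ a) ^ 4) (3 * h^2)"
 proof -
  have "has_bochner_integral M (\<lambda>w. \<Prod>k\<in>UNIV. (if k = a then \<lambda>x. x ^ 4 else (\<lambda>x. 1)) (Y w $ k))
   (\<Prod>k\<in>UNIV. (LINT x|lborel. ?n x * (if k = a then \<lambda>x. x ^ 4 else (\<lambda>x. 1)) x))"
   by (rule has_bochner_integral_normal_vec[OF D]) (use mi in auto)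
  moreover have "(\<Prod>k\<in>UNIV. (if k = a then \<lambda>x. x ^ 4 else (\<lambda>x. 1)) (Y w $ k)) = (Y w $ a) ^ 4" for w
   using p1[of a "\<lambda>k. (Y w $ k) ^ 4"] by (simp add: if_distrib[of "\<lambda>f. f _"] cong: if_cong)
  moreover have "(\<Prod>k\<in>UNIV. (LINT x|lborel. ?n x * (if k = a then \<lambda>x. x ^ 4 else (\<lambda>x. 1)) x))
   = (\<Prod>k\<in>UNIV. if k = a then 3 * h^2 else 1)"
   by (rule prod.cong) (use mi in auto)
  ultimately show ?thesis using p1[of a "\<lambda>_. 3 * h^2"] by simp
 qed
 show "has_bochner_integral M (\<lambda>w. Y w $ a * Y w $ b) (if a = b then h else 0)"
 proof (cases "a = b")
  case True
  have "has_bochner_integral M (\<lambda>w. \<Prod>k\<in>UNIV. (if k = a then \<lambda>x. x * x else (\<lambda>x. 1)) (Y w $ k))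
   (\<Prod>k\<in>UNIV. (LINT x|lborel. ?n x * (if k = a then \<lambda>x. x * x else (\<lambda>x. 1)) x))"
   by (rule has_bochner_integral_normal_vec[OF D]) (use mi in auto)
  moreover have "(\<Prod>k\<in>UNIV. (if k = a then \<lambda>x. x * x else (\<lambda>x. 1)) (Y w $ k)) = Y w $ a * Y w $ a" for w
   using p1[of a "\<lambda>k. Y w $ k * Y w $ k"] by (simp add: if_distrib[of "\<lambda>f. f _"] cong: if_cong)
  moreover have "(\<Prod>k\<in>UNIV. (LINT x|lborel. ?n x * (if k = a then \<lambda>x. x * x else (\<lambda>x. 1)) x))
   = (\<Prod>k\<in>UNIV. if k = a then h else 1)"
   by (rule prod.cong) (use mi in auto)
  ultimately show ?thesis using True p1[of a "\<lambda>_. h"] by simp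
 next
  case False
  have "has_bochner_integral M (\<lambda>w. \<Prod>k\<in>UNIV. (if k = a then \<lambda>x. x else if k = b then \<lambda>x. x else (\<lambda>x. 1)) (Y w $ k))
   (\<Prod>k\<in>UNIV. (LINT x|lborel. ?n x * (if k = a then \<lambda>x. x else if k = b then \<lambda>x. x else (\<lambda>x. 1)) x))"
   by (rule has_bochner_integral_normal_vec[OF D]) (use mi in auto)
  moreover have "(\<Prod>k\<in>UNIV. (if k = a then \<lambda>x. x else if k = b then \<lambda>x. x else (\<lambda>x. 1)) (Y w $ k)) = Y w $ a * Y w $ b" for w
   using p2[OF False, of "\<lambda>k. Y w $ k" "\<lambda>k. Y w $ k"] by (simp add: if_distrib[of "\<lambda>f. f _"] cong: if_cong)
  moreover have "(\<Prod>k\<in>UNIV. (LINT x|lborel. ?n x * (if k = a then \<lambda>x. x else if k = b then \<lambda>x. x else (\<lambda>x. 1)) x))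
   = (\<Prod>k\<in>UNIV. if k = a then 0 else if k = b then 0 else 1)"
   by (rule prod.cong) (use mi in auto)
  ultimately show ?thesis using False p2[OF False, of "\<lambda>_. 0" "\<lambda>_. 0"] by simp
 qed
qed

lemma norm_pow4_le_sum:
 fixes x :: "real^'m"
 shows "norm x ^ 4 \<le> real CARD('m) * (\<Sum>k\<in>UNIV. (x $ k) ^ 4)"
proof -
 have "norm x ^ 4 = ((norm x)^2)^2" by simp
 also have "(norm x)^2 = (\<Sum>k\<in>UNIV. (x $ k)^2)"
  by (simp add: norm_vec_def L2_set_def sum_nonneg)
 also have "(\<Sum>k\<in>UNIV. (x $ k)^2)^2 \<le> (\<Sum>k\<in>(UNIV::'m set). 1^2) * (\<Sum>k\<in>UNIV. ((x $ k)^2)^2)"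
  using Cauchy_Schwarz_ineq_sum[of "\<lambda>_. 1" "\<lambda>k. (x $ k)^2" "UNIV::'m set"] by simp
 finally show ?thesis by simp
qed

locale filtered_prob = prob_space M for M :: "'w measure" +
 fixes F :: "real => 'w measure"
 assumes filt: "complete_filtration M F"
begin

lemma subalg: "t \<ge> 0 ==> subalgebra M (F t)"
 using filt by (auto simp: complete_filtration_def)

lemma space_F: "t \<ge> 0 ==> space (F t) = space M"
 using subalg by (auto simp: subalgebra_def)

lemma sets_F_mono: "0 \<le> s ==> s \<le> t ==> sets (F s) \<subseteq> sets (F t)"
 using filt by (auto simp: complete_filtration_def)

lemma sets_F_M: "0 \<le> t ==> sets (F t) \<subseteq> sets M"
 using subalg by (auto simp: subalgebra_def)

lemma measurable_F_M: "0 \<le> t ==> f \<in> measurable (F t) N ==> f \<in> measurable M N"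
 using measurable_from_subalg[OF subalg] by blast

lemma measurable_F_mono:
 assumes "0 \<le> s" "s \<le> t" "f \<in> measurable (F s) N"
 shows "f \<in> measurable (F t) N"
proof -
 have "subalgebra (F t) (F s)"
  using assms sets_F_mono space_F by (auto simp: subalgebra_def)
 then show ?thesis using measurable_from_subalg assms by blast
qed

lemma null_F: "A \<in> null_sets M ==> B \<subseteq> A ==> 0 \<le> t ==> B \<in> sets (F t)"
 using filt sets_F_mono[of 0 t] unfolding complete_filtration_def by blast

lemma sigma_finite_F: "0 \<le> t ==> sigma_finite_subalgebra M (F t)"
 by (intro finite_measure_subalgebra_is_sigma_finite finite_measure_subalgebra.intro
   finite_measure_subalgebra_axioms.intro subalg finite_measure_axioms)

end

locale brownian_space = filtered_prob M F for M :: "'w measure" and F +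
 fixes B :: "real => 'w => real^'m"
 assumes bm: "brownian_motion M F B"
begin

lemma B_meas: "t \<ge> 0 ==> B t \<in> borel_measurable (F t)"
 using bm by (auto simp: brownian_motion_def)

lemma B_meas_M: "t \<ge> 0 ==> B t \<in> borel_measurable M"
 using B_meas measurable_F_M by blast

lemma increment_moments:
 assumes "0 \<le> s" "s < t"
 shows "has_bochner_integral M (\<lambda>w. (B t w - B s w) $ a) 0"
  and "has_bochner_integral M (\<lambda>w. (B t w - B s w) $ a * (B t w - B s w) $ b) (if a = b then t - s else 0)"
  and "has_bochner_integral M (\<lambda>w. ((B t w - B s w) $ a) ^ 4) (3 * (t - s)^2)"
proof -
 have "distributed M lborel (\<lambda>w. B t w - B s w)
     (\<lambda>x. ennreal (\<Prod>k\<in>UNIV. normal_density 0 (sqrt (t - s)) (x $ k)))"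
  using bm assms by (auto simp: brownian_motion_def)
 from normal_vec_moments[OF this] assms
 show "has_bochner_integral M (\<lambda>w. (B t w - B s w) $ a) 0"
  and "has_bochner_integral M (\<lambda>w. (B t w - B s w) $ a * (B t w - B s w) $ b) (if a = b then t - s else 0)"
  and "has_bochner_integral M (\<lambda>w. ((B t w - B s w) $ a) ^ 4) (3 * (t - s)^2)"
  by auto
qed

text \<open>\<open>brownian_motion\<close> states independence of two sigma-algebras;
  \<open>Y\<close> and the function of the increment generate smaller ones, so the variables are
  independent and the expectation factorises.\<close>

lemma increment_indep:
 fixes Y :: "'w => real" and g :: "real^'m => real"
 assumes st: "0 \<le> s" "s < t"
  and Y: "Y \<in> borel_measurable (F s)" "integrable M Y"
  and g: "g \<in> borel_measurable borel" "integrable M (\<lambda>w. g (B t w - B s w))"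
 shows "has_bochner_integral M (\<lambda>w. Y w * g (B t w - B s w))
     ((LINT w|M. Y w) * (LINT w|M. g (B t w - B s w)))"
proof -
 let ?D = "\<lambda>w. B t w - B s w"
 have ind: "indep_set (sets (F s)) (sets (vimage_algebra (space M) ?D borel))"
  using bm st by (auto simp: brownian_motion_def)
 have YM[measurable]: "Y \<in> borel_measurable M" using Y st measurable_F_M by auto
 have [measurable]: "B t \<in> borel_measurable M" "B s \<in> borel_measurable M"
  using B_meas_M st by auto
 have "indep_var borel Y borel (\<lambda>w. g (?D w))"
 proof (subst indep_var_eq, intro conjI)
  show "random_variable borel Y" by simp
  show "random_variable borel (\<lambda>w. g (?D w))" using g(1) by measurable
  have 1: "sigma_sets (space M) {Y -` A \<inter> space M |A. A \<in> sets borel} \<subseteq> sets (F s)"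
  proof (rule sets.sigma_sets_subset[of _ "F s", unfolded space_F[OF st(1)]], safe)
   fix A :: "real set" assume "A \<in> sets borel"
   then show "Y -` A \<inter> space M \<in> sets (F s)"
    using measurable_sets[OF Y(1), of A] space_F[OF st(1)] by simp
  qed
  let ?V = "vimage_algebra (space M) ?D borel"
  have "?D \<in> measurable ?V borel" by (rule measurable_vimage_algebra1) simp
  then have gV: "(\<lambda>w. g (?D w)) \<in> measurable ?V borel" using g(1) by measurable
  have 2: "sigma_sets (space M) {(\<lambda>w. g (?D w)) -` A \<inter> space M |A. A \<in> sets borel} \<subseteq> sets ?V"
  proof (rule sets.sigma_sets_subset[of _ ?V, unfolded space_vimage_algebra], safe)
   fix A :: "real set" assume "A \<in> sets borel"
   then show "(\<lambda>w. g (?D w)) -` A \<inter> space M \<in> sets ?V"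
    using measurable_sets[OF gV, of A] by simp
  qed
  show "indep_set (sigma_sets (space M) {Y -` A \<inter> space M |A. A \<in> sets borel})
   (sigma_sets (space M) {(\<lambda>w. g (?D w)) -` A \<inter> space M |A. A \<in> sets borel})"
   using ind unfolding indep_set_def
   by (rule indep_sets_mono_sets) (use 1 2 in \<open>auto split: bool.split\<close>)
 qed
 from indep_var_integrable[OF this Y(2) g(2)] indep_var_lebesgue_integral[OF this Y(2) g(2)]
 show ?thesis by (simp add: has_bochner_integral_iff)
qed

lemma increment_norm4:
 assumes "0 \<le> s" "s < t"
 shows "integrable M (\<lambda>w. norm (B t w - B s w) ^ 4)"
  and "(LINT w|M. norm (B t w - B s w) ^ 4) \<le> 3 * (real CARD('m))^2 * (t - s)^2"
proof -
 have [measurable]: "B t \<in> borel_measurable M" "B s \<in> borel_measurable M"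
  using B_meas_M assms by auto
 have I: "has_bochner_integral M (\<lambda>w. real CARD('m) * (\<Sum>k\<in>UNIV. ((B t w - B s w) $ k) ^ 4))
   (real CARD('m) * (\<Sum>k\<in>(UNIV::'m set). (3 * (t - s)^2)))"
  by (intro has_bochner_integral_mult_right has_bochner_integral_sum increment_moments(3) assms)
 show int: "integrable M (\<lambda>w. norm (B t w - B s w) ^ 4)"
  by (rule Bochner_Integration.integrable_bound[OF integrable.intros[OF I]])
   (use norm_pow4_le_sum in \<open>auto intro!: AE_I2 order.trans[OF norm_pow4_le_sum]\<close>)
 have "(LINT w|M. norm (B t w - B s w) ^ 4) \<le> (LINT w|M. real CARD('m) * (\<Sum>k\<in>UNIV. ((B t w - B s w) $ k) ^ 4))"
  by (intro integral_mono int integrable.intros[OF I] norm_pow4_le_sum)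
 also have "... = real CARD('m) * (\<Sum>k\<in>(UNIV::'m set). (3 * (t - s)^2))"
  using I by (rule has_bochner_integral_integral_eq)
 finally show "(LINT w|M. norm (B t w - B s w) ^ 4) \<le> 3 * (real CARD('m))^2 * (t - s)^2"
  by (simp add: power2_eq_square)
qed

end

section \<open>The Markov chain over a short time step\<close>

lemma (in prob_space) abs_expectation_le:
 fixes Y :: "'a => real"
 assumes "!!w. w \<in> space M ==> \<bar>Y w\<bar> \<le> c"
 shows "\<bar>LINT w|M. Y w\<bar> \<le> c"
proof (cases "integrable M Y")
 case True
 have "\<bar>LINT w|M. Y w\<bar> \<le> (LINT w|M. \<bar>Y w\<bar>)" by (rule integral_abs_bound)
 also have "... \<le> (LINT w|M. c)"
  by (rule integral_mono) (use True assms in auto)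
 finally have "\<bar>LINT w|M. Y w\<bar> \<le> (LINT w|M. c)" .
 then show ?thesis by (simp add: prob_space)
next
 \<comment> \<open>A non-integrable function has integral 0 by convention, and \<open>c\<close> is
   nonnegative because the space has a point.\<close>
 case False
 obtain w where "w \<in> space M" using not_empty by blast
 from assms[OF this] have "0 \<le> c" by linarith
 with False show ?thesis by (simp add: not_integrable_integral_eq)
qed

locale markov_space = filtered_prob M F for M :: "'w measure" and F +
 fixes N :: nat and \<Gamma> :: "int => int => real" and r :: "real => 'w => int"
 assumes gen: "generator N \<Gamma>" and mc: "markov_chain M F N \<Gamma> r"
begin

abbreviation S :: "int set" where "S \<equiv> {1..int N}"

definition G_bound :: real where "G_bound = (\<Sum>i\<in>S. \<Sum>j\<in>S. \<bar>\<Gamma> i j\<bar>)"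

lemma G_bound_nonneg: "0 \<le> G_bound"
 unfolding G_bound_def by (intro sum_nonneg) auto

lemma row_bound: "i \<in> S ==> (\<Sum>j\<in>S. \<bar>\<Gamma> i j\<bar>) \<le> G_bound"
 unfolding G_bound_def
 by (rule member_le_sum[of i S "\<lambda>i. \<Sum>j\<in>S. \<bar>\<Gamma> i j\<bar>"]) (auto intro: sum_nonneg)

lemma row_sum_bound:
 assumes "i \<in> S" "!!j. j \<in> S ==> \<bar>y j\<bar> \<le> c"
 shows "\<bar>\<Sum>j\<in>S. \<Gamma> i j * y j\<bar> \<le> G_bound * c"
proof -
 have "0 \<le> c" using assms(2)[OF assms(1)] by linarith
 have "\<bar>\<Sum>j\<in>S. \<Gamma> i j * y j\<bar> \<le> (\<Sum>j\<in>S. \<bar>\<Gamma> i j\<bar> * c)"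
  by (rule order.trans[OF sum_abs]) (auto simp: abs_mult intro!: sum_mono mult_left_mono assms)
 also have "... \<le> G_bound * c"
  unfolding sum_distrib_right[symmetric] using row_bound[OF assms(1)] \<open>0 \<le> c\<close> by (rule mult_right_mono)
 finally show ?thesis .
qed

lemma row_sum_diff:
 assumes "i \<in> S"
 shows "(\<Sum>j\<in>S. \<Gamma> i j * y j) = (\<Sum>j\<in>S. \<Gamma> i j * (y j - y i))"
proof -
 have "(\<Sum>j\<in>S. \<Gamma> i j) = \<Gamma> i i + (\<Sum>j\<in>S - {i}. \<Gamma> i j)"
  using assms by (subst sum.remove[of S i]) auto
 then have "(\<Sum>j\<in>S. \<Gamma> i j) = 0"
  using gen assms by (simp add: generator_def)
 then show ?thesis
  by (simp add: right_diff_distrib sum_subtractf sum_distrib_right[symmetric])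
qed

lemma r_meas_F: "0 \<le> t ==> r t \<in> measurable (F t) (count_space UNIV)"
 using mc by (auto simp: markov_chain_def)

lemma r_meas: "0 \<le> t ==> r t \<in> measurable M (count_space UNIV)"
 using r_meas_F measurable_F_M by blast

lemma r_in_S: "w \<in> space M ==> 0 \<le> t ==> r t w \<in> S"
 using mc by (auto simp: markov_chain_def)

lemma measurable_at_r:
 assumes "0 \<le> v" "!!i. i \<in> S ==> Y i \<in> borel_measurable (F v)"
 shows "(\<lambda>w. Y (r v w) w :: real) \<in> borel_measurable (F v)"
proof -
 have "(\<lambda>w. Y (r v w) w) \<in> borel_measurable (F v) \<longleftrightarrow>
  (\<lambda>w. \<Sum>i\<in>S. indicator {i} (r v w) * Y i w) \<in> borel_measurable (F v)"
 proof (rule measurable_cong)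
  fix w assume "w \<in> space (F v)"
  then have "r v w \<in> S" using assms space_F r_in_S by auto
  then show "Y (r v w) w = (\<Sum>i\<in>S. indicator {i} (r v w) * Y i w)"
   by (simp add: indicator_def sum.delta' if_distrib[of "\<lambda>x. x * _"] cong: if_cong)
 qed
 also have "..."
 proof (intro borel_measurable_sum borel_measurable_times assms)
  fix i
  show "(\<lambda>w. indicator {i} (r v w) :: real) \<in> borel_measurable (F v)"
   by (rule measurable_compose[OF r_meas_F[OF assms(1)]]) simp
 qed
 finally show ?thesis .
qed

text \<open>Conditioning on \<open>F v\<close> replaces the indicator of a state at time
  \<open>v + h\<close> by the transition probability \<open>p h\<close>, whose expansion in
  \<open>h\<close> is given. The weights \<open>Y i\<close> may be random as long as they are known
  at time \<open>v\<close>. The constant is uniform in \<open>v\<close> because \<open>p\<close>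
  does not depend on it, and the error has a form that can be summed over small steps.\<close>

lemma markov_step:
 assumes "eps > 0"
 shows "\<exists>K\<ge>0. \<forall>v\<ge>0. \<forall>h>0. \<forall>Y C. (\<forall>i\<in>S. Y i \<in> borel_measurable (F v)) -->
  (\<forall>i\<in>S. \<forall>w\<in>space M. \<bar>Y i w\<bar> \<le> C) -->
  \<bar>(LINT w|M. Y (r (v + h) w) w - Y (r v w) w)
   - h * (LINT w|M. (\<Sum>j\<in>S. \<Gamma> (r v w) j * Y j w))\<bar> \<le> C * (eps * h + K * h^2)"
proof -
 obtain p :: "real => int => int => real" where
  P1: "\<forall>t\<ge>0. \<forall>\<delta>\<ge>0. \<forall>j\<in>S. AE w in M.
     real_cond_exp M (F t) (indicator {w'\<in>space M. r (t + \<delta>) w' = j}) w = p \<delta> (r t w) j" and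
  P2: "\<forall>i\<in>S. \<forall>j\<in>S. i \<noteq> j -->
     (\<lambda>\<delta>. p \<delta> i j - \<Gamma> i j * \<delta>) \<in> o[at_right 0](\<lambda>\<delta>. \<delta>)"
  using mc unfolding markov_chain_def by (elim conjE exE) (rule that)
 note p1 = P1[rule_format] and p2 = P2[rule_format]
 \<comment> \<open>The sum has \<open>N\<close> terms and each difference of weights is at most
   \<open>2 * C\<close>; the added 1 only keeps the denominator positive.\<close>
 define eta where "eta = eps / (2 * real N + 1)"
 have eta: "eta > 0" "2 * real N * eta \<le> eps"
  using assms by (auto simp: eta_def field_simps)
 have "\<forall>\<^sub>F d in at_right 0. \<forall>x\<in>S \<times> S. fst x \<noteq> snd x --> \<bar>p d (fst x) (snd x) - \<Gamma> (fst x) (snd x) * d\<bar> \<le> eta * \<bar>d\<bar>"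
 proof (intro eventually_ball_finite ballI)
  fix x assume x: "x \<in> S \<times> S"
  show "\<forall>\<^sub>F d in at_right 0. fst x \<noteq> snd x --> \<bar>p d (fst x) (snd x) - \<Gamma> (fst x) (snd x) * d\<bar> \<le> eta * \<bar>d\<bar>"
   using landau_o.smallD[OF p2[of "fst x" "snd x"] eta(1)] x by (cases "fst x = snd x") auto
 qed auto
 then obtain d0 where d0: "d0 > 0"
  "!!d i j. 0 < d ==> d < d0 ==> i \<in> S ==> j \<in> S ==> i \<noteq> j ==> \<bar>p d i j - \<Gamma> i j * d\<bar> \<le> eta * d"
  unfolding eventually_at_right_field by fastforce
 \<comment> \<open>For steps \<open>h\<close> at least \<open>d0\<close> nothing is known about
   \<open>p\<close>; the crude bounds \<open>2 * C\<close> and \<open>h * G_bound * C\<close> are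
   then absorbed, since 1 is at most \<open>h^2 / d0^2\<close> and \<open>h\<close> at most
   \<open>h^2 / d0\<close>.\<close>
 define K where "K = 2 / d0^2 + G_bound / d0"
 have K: "K \<ge> 0" using d0 G_bound_nonneg by (auto simp: K_def)
 show ?thesis
 proof (intro exI[of _ K] conjI K allI impI)
  fix v h :: real and Y :: "int => 'w => real" and C :: real
  assume v: "v \<ge> 0" and h: "h > 0"
   and Ym: "\<forall>i\<in>S. Y i \<in> borel_measurable (F v)"
   and YC: "\<forall>i\<in>S. \<forall>w\<in>space M. \<bar>Y i w\<bar> \<le> C"
  obtain w0 where w0: "w0 \<in> space M" using not_empty by blast
  have C: "C \<ge> 0" using YC r_in_S[OF w0 v] w0 by (meson abs_ge_zero order.trans)
  have vh: "v + h \<ge> 0" using v h by auto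
  have [measurable]: "!!i. i \<in> S ==> Y i \<in> borel_measurable M"
   using Ym v measurable_F_M by blast
  have [measurable]: "r v \<in> measurable M (count_space UNIV)" "r (v + h) \<in> measurable M (count_space UNIV)"
   using r_meas v vh by auto
  have Ysum: "Y (r u w) w = (\<Sum>j\<in>S. Y j w * indicator {j} (r u w))" if "w \<in> space M" "0 \<le> u" for u w
   using r_in_S[OF that] by (simp add: indicator_def sum.delta' if_distrib[of "\<lambda>x. _ * x"] cong: if_cong)
  have YrF: "(\<lambda>w. Y (r v w) w) \<in> borel_measurable (F v)"
   by (rule measurable_at_r[of v Y]) (use v Ym in auto)
  then have [measurable]: "(\<lambda>w. Y (r v w) w) \<in> borel_measurable M" using measurable_F_M v by blast
  have gamF: "(\<lambda>w. (\<Sum>j\<in>S. \<Gamma> (r v w) j * Y j w)) \<in> borel_measurable (F v)"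
   by (rule measurable_at_r[of v "\<lambda>i w. \<Sum>j\<in>S. \<Gamma> i j * Y j w"])
    (use v Ym in \<open>auto intro!: borel_measurable_sum borel_measurable_times\<close>)
  then have [measurable]: "(\<lambda>w. (\<Sum>j\<in>S. \<Gamma> (r v w) j * Y j w)) \<in> borel_measurable M"
   using measurable_F_M v by blast
  have gam: "\<bar>\<Sum>j\<in>S. \<Gamma> (r v w) j * Y j w\<bar> \<le> G_bound * C" if "w \<in> space M" for w
   by (rule row_sum_bound[OF r_in_S[OF that v]]) (rule YC[rule_format, OF _ that])
  have YrC: "\<bar>Y (r u w) w\<bar> \<le> C" if "w \<in> space M" "0 \<le> u" for w u
   using YC[rule_format, OF r_in_S[OF that] that(1)] .
  let ?L = "(LINT w|M. Y (r (v + h) w) w - Y (r v w) w) - h * (LINT w|M. (\<Sum>j\<in>S. \<Gamma> (r v w) j * Y j w))"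
  have iY: "integrable M (\<lambda>w. \<Sum>j\<in>S. \<Gamma> (r v w) j * Y j w)"
  proof (rule integrable_const_bound[where B = "G_bound * C"])
   show "AE w in M. norm (\<Sum>j\<in>S. \<Gamma> (r v w) j * Y j w) \<le> G_bound * C"
    using gam by (intro AE_I2) (simp only: real_norm_def)
  qed measurable
  show "\<bar>?L\<bar> \<le> C * (eps * h + K * h^2)"
  proof (cases "h < d0")
   case False
   then have "1 \<le> h / d0" using d0 by auto
   then have hd: "1 \<le> h^2 / d0^2" "h \<le> h^2 / d0"
    using h d0 power_mono[of 1 "h / d0" 2] by (auto simp: power_divide power2_eq_square field_simps)
   have "\<bar>LINT w|M. Y (r (v + h) w) w - Y (r v w) w\<bar> \<le> 2 * C"
   proof (rule abs_expectation_le)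
    fix w assume "w \<in> space M"
    from YrC[OF this v] YrC[OF this vh]
    show "\<bar>Y (r (v + h) w) w - Y (r v w) w\<bar> \<le> 2 * C" by linarith
   qed
   moreover have "\<bar>LINT w|M. (\<Sum>j\<in>S. \<Gamma> (r v w) j * Y j w)\<bar> \<le> G_bound * C"
    by (rule abs_expectation_le[OF gam])
   then have "\<bar>h * (LINT w|M. (\<Sum>j\<in>S. \<Gamma> (r v w) j * Y j w))\<bar> \<le> h * (G_bound * C)"
    unfolding abs_mult using h by (simp add: mult_left_mono)
   ultimately have "\<bar>?L\<bar> \<le> 2 * C + h * (G_bound * C)" by linarith
   also have "... \<le> 2 * C * (h^2 / d0^2) + (h^2 / d0) * (G_bound * C)"
    using mult_left_mono[OF hd(1), of "2 * C"] mult_right_mono[OF hd(2), of "G_bound * C"] C G_bound_nonneg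
    by simp
   also have "... = C * (K * h^2)" by (simp add: K_def field_simps)
   also have "... \<le> C * (eps * h + K * h^2)" using C assms h by (intro mult_left_mono) auto
   finally show ?thesis .
  next
   case True
   have Z: "(LINT w|M. (Y j w - Y (r v w) w) * indicator {j} (r (v + h) w)) =
     (LINT w|M. (Y j w - Y (r v w) w) * p h (r v w) j)" (is "?a = ?b") 
    and Zi: "integrable M (\<lambda>w. (Y j w - Y (r v w) w) * p h (r v w) j)"
    and Zj: "integrable M (\<lambda>w. (Y j w - Y (r v w) w) * indicator {j} (r (v + h) w))"
    if j: "j \<in> S" for j
   proof -
    have [measurable]: "Y j \<in> borel_measurable M" using j by simp
    have [measurable]: "(\<lambda>w. p h (r v w) j) \<in> borel_measurable M"
     by (rule measurable_compose[of _ _ "count_space UNIV" "\<lambda>i. p h i j"]) auto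
    let ?f = "\<lambda>w. Y j w - Y (r v w) w" and ?g = "indicator {w'\<in>space M. r (v + h) w' = j} :: 'w => real"
    have fm: "?f \<in> borel_measurable (F v)"
     by (rule borel_measurable_diff[OF Ym[rule_format, OF j] YrF])
    have gm: "?g \<in> borel_measurable M" by measurable
    have ig: "integrable M (\<lambda>w. ?f w * ?g w)"
    proof (rule integrable_const_bound[where B = "2 * C"])
     have "\<bar>?f w * ?g w\<bar> \<le> 2 * C" if "w \<in> space M" for w
      using YC[rule_format, OF j that] YrC[OF that v] C by (auto simp: indicator_def)
     then show "AE w in M. norm (?f w * ?g w) \<le> 2 * C"
      by (intro AE_I2) (simp only: real_norm_def)
    qed measurable
    note ce = sigma_finite_subalgebra.real_cond_exp_intg[OF sigma_finite_F[OF v] ig fm gm]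
    have AE: "AE w in M. ?f w * real_cond_exp M (F v) ?g w = ?f w * p h (r v w) j"
     using p1[of v h j] v h j by auto
    show "integrable M (\<lambda>w. (Y j w - Y (r v w) w) * p h (r v w) j)"
     using ce(1) AE by (subst integrable_cong_AE[symmetric, OF _ _ AE]) auto
    have gg: "?f w * indicator {j} (r (v + h) w) = ?f w * ?g w" if "w \<in> space M" for w
     using that by (auto simp: indicator_def)
    show "integrable M (\<lambda>w. (Y j w - Y (r v w) w) * indicator {j} (r (v + h) w))"
     using ig gg by (subst Bochner_Integration.integrable_cong[OF refl gg]) auto
    have "?a = (LINT w|M. ?f w * ?g w)"
     using gg by (intro Bochner_Integration.integral_cong) auto
    also have "... = (LINT w|M. ?f w * real_cond_exp M (F v) ?g w)" using ce(2) by simp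
    also have "... = ?b" by (rule integral_cong_AE[OF _ _ AE]) auto
    finally show "?a = ?b" .
   qed
   have "(LINT w|M. Y (r (v + h) w) w - Y (r v w) w)
     = (LINT w|M. (\<Sum>j\<in>S. (Y j w - Y (r v w) w) * indicator {j} (r (v + h) w)))"
    using r_in_S[OF _ vh]
    by (intro Bochner_Integration.integral_cong)
     (auto simp: indicator_def sum.delta' if_distrib[of "\<lambda>x. _ * x"] cong: if_cong)
   also have "... = (\<Sum>j\<in>S. (LINT w|M. (Y j w - Y (r v w) w) * indicator {j} (r (v + h) w)))"
    using Zj by (rule Bochner_Integration.integral_sum)
   also have "... = (\<Sum>j\<in>S. (LINT w|M. (Y j w - Y (r v w) w) * p h (r v w) j))"
    using Z by simp
   also have "... = (LINT w|M. (\<Sum>j\<in>S. (Y j w - Y (r v w) w) * p h (r v w) j))"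
    using Zi by (rule Bochner_Integration.integral_sum[symmetric])
   finally have "?L = (LINT w|M. (\<Sum>j\<in>S. (Y j w - Y (r v w) w) * p h (r v w) j)
     - h * (\<Sum>j\<in>S. \<Gamma> (r v w) j * Y j w))"
    using Zi iY by (subst Bochner_Integration.integral_diff) auto
   moreover have "\<bar>\<integral>w. (\<Sum>j\<in>S. (Y j w - Y (r v w) w) * p h (r v w) j)
     - h * (\<Sum>j\<in>S. \<Gamma> (r v w) j * Y j w) \<partial>M\<bar> \<le> C * (eps * h)"
   proof (rule abs_expectation_le)
    fix w assume w: "w \<in> space M"
    let ?i = "r v w"
    have i: "?i \<in> S" using r_in_S w v by auto
    \<comment> \<open>Rows of \<Gamma> sum to zero, so the second sum may be centred at the current
      state as the first one is. The term of the current state vanishes, and only the off-diagonal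
      rates remain, for which \<open>markov_chain\<close> states the expansion.\<close>
    have "(\<Sum>j\<in>S. (Y j w - Y ?i w) * p h ?i j) - h * (\<Sum>j\<in>S. \<Gamma> ?i j * Y j w) =
      (\<Sum>j\<in>S. (Y j w - Y ?i w) * (p h ?i j - \<Gamma> ?i j * h))"
     unfolding row_sum_diff[OF i, of "\<lambda>j. Y j w"] sum_distrib_left sum_subtractf[symmetric]
     by (intro sum.cong) (auto simp: algebra_simps)
    moreover have "\<bar>\<Sum>j\<in>S. (Y j w - Y ?i w) * (p h ?i j - \<Gamma> ?i j * h)\<bar> \<le> (\<Sum>j\<in>S. (2 * C) * (eta * h))"
    proof (rule order.trans[OF sum_abs], rule sum_mono)
     fix j assume j: "j \<in> S"
     show "\<bar>(Y j w - Y ?i w) * (p h ?i j - \<Gamma> ?i j * h)\<bar> \<le> (2 * C) * (eta * h)"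
     proof (cases "j = ?i")
      case True
      then show ?thesis using C eta h by simp
     next
      case False
      have "\<bar>Y j w - Y ?i w\<bar> \<le> 2 * C"
       using YC j i w by (smt (verit))
      moreover have "\<bar>p h ?i j - \<Gamma> ?i j * h\<bar> \<le> eta * h"
       using d0(2)[OF h True i j] False by auto
      ultimately show ?thesis unfolding abs_mult using C by (intro mult_mono) auto
     qed
    qed
    moreover have "(\<Sum>j\<in>S. (2 * C) * (eta * h)) \<le> C * (eps * h)"
    proof -
     have "(\<Sum>j\<in>S. (2 * C) * (eta * h)) = C * ((2 * real N * eta) * h)" by simp
     also have "... \<le> C * (eps * h)" using eta C h by (intro mult_left_mono mult_right_mono) auto
     finally show ?thesis .
    qed
    ultimately show "\<bar>(\<Sum>j\<in>S. (Y j w - Y ?i w) * p h ?i j) - h * (\<Sum>j\<in>S. \<Gamma> ?i j * Y j w)\<bar> \<le> C * (eps * h)"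
     by linarith
   qed
   ultimately have "\<bar>?L\<bar> \<le> C * (eps * h)" by simp
   also have "... \<le> C * (eps * h + K * h^2)" using C K by (intro mult_left_mono) auto
   finally show ?thesis .
  qed
 qed
qed

text \<open>\<open>markov_step\<close> is applied to the indicator that a state differs from
  \<open>r v\<close>: it is 0 at time \<open>v\<close> and at time \<open>v + h\<close> it marks a
  change. For \<open>h\<close> at least 1 the bound by 1 is enough.\<close>

lemma jump_prob:
 "\<exists>K\<ge>0. \<forall>v\<ge>0. \<forall>h\<ge>0. measure M {w\<in>space M. r (v + h) w \<noteq> r v w} \<le> K * h"
proof -
 obtain K where K: "K \<ge> 0" and st: "\<forall>v\<ge>0. \<forall>h>0. \<forall>Y C. (\<forall>i\<in>S. Y i \<in> borel_measurable (F v)) -->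
  (\<forall>i\<in>S. \<forall>w\<in>space M. \<bar>Y i w\<bar> \<le> C) -->
  \<bar>(LINT w|M. Y (r (v + h) w) w - Y (r v w) w)
   - h * (LINT w|M. (\<Sum>j\<in>S. \<Gamma> (r v w) j * Y j w))\<bar> \<le> C * (1 * h + K * h^2)"
  using markov_step[OF zero_less_one] by (elim exE conjE) (rule that)
 show ?thesis
 proof (intro exI[of _ "G_bound + 1 + K"] conjI allI impI)
  show "0 \<le> G_bound + 1 + K" using G_bound_nonneg K by auto
  fix v h :: real assume v: "v \<ge> 0" and h: "h \<ge> 0"
  let ?P = "measure M {w\<in>space M. r (v + h) w \<noteq> r v w}"
  consider "h = 0" | "h \<ge> 1" | "0 < h" "h < 1" using h by linarith
  then show "?P \<le> (G_bound + 1 + K) * h"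
  proof cases
   case 2
   have "?P \<le> 1" by simp
   also have "1 \<le> (G_bound + 1 + K) * h"
    using mult_mono[of 1 "G_bound + 1 + K" 1 h] 2 G_bound_nonneg K by simp
   finally show ?thesis .
  next
   case 3
   define Y :: "int => 'w => real" where "Y j w = (if r v w = j then 0 else 1)" for j w
   have [measurable]: "r v \<in> measurable M (count_space UNIV)" "r (v + h) \<in> measurable M (count_space UNIV)"
    using r_meas v h by auto
   have Ym: "\<forall>i\<in>S. Y i \<in> borel_measurable (F v)"
   proof
    fix i assume "i \<in> S"
    show "Y i \<in> borel_measurable (F v)"
     unfolding Y_def by (rule measurable_compose[OF r_meas_F[OF v]]) simp
   qed
   have Yb: "\<forall>i\<in>S. \<forall>w\<in>space M. \<bar>Y i w\<bar> \<le> 1" by (auto simp: Y_def)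
   have "(LINT w|M. Y (r (v + h) w) w - Y (r v w) w) = (LINT w|M. indicator {w\<in>space M. r (v + h) w \<noteq> r v w} w)"
    by (intro Bochner_Integration.integral_cong) (auto simp: Y_def indicator_def)
   also have "... = ?P" by (subst Bochner_Integration.integral_indicator) (auto intro!: arg_cong[of _ _ "measure M"])
   finally have eP: "(LINT w|M. Y (r (v + h) w) w - Y (r v w) w) = ?P" .
   have "\<bar>(LINT w|M. Y (r (v + h) w) w - Y (r v w) w)
     - h * (LINT w|M. (\<Sum>j\<in>S. \<Gamma> (r v w) j * Y j w))\<bar> \<le> 1 * (1 * h + K * h^2)"
    by (rule st[rule_format, OF v 3(1)]) (use Ym Yb in blast)+
   then have P: "?P \<le> h * (LINT w|M. (\<Sum>j\<in>S. \<Gamma> (r v w) j * Y j w)) + (h + K * h^2)"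
    unfolding eP by (simp add: abs_le_iff)
   have "(LINT w|M. (\<Sum>j\<in>S. \<Gamma> (r v w) j * Y j w)) \<le> (LINT w|M. G_bound)"
   proof (rule integral_mono')
    fix w assume "w \<in> space M"
    note row_sum_bound[OF r_in_S[OF this v], of "\<lambda>j. Y j w", OF Yb[rule_format, OF _ this]]
    then show "(\<Sum>j\<in>S. \<Gamma> (r v w) j * Y j w) \<le> G_bound" by linarith
   qed (use G_bound_nonneg in auto)
   then have "h * (LINT w|M. (\<Sum>j\<in>S. \<Gamma> (r v w) j * Y j w)) \<le> h * G_bound"
    using 3 by (intro mult_left_mono) (auto simp: prob_space)
   moreover have "K * h^2 \<le> K * h" using 3 K by (intro mult_left_mono) (auto simp: power2_eq_square)
   ultimately show ?thesis using P by (simp add: algebra_simps)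
  qed auto
 qed
qed

end

section \<open>Test functions\<close>

definition quad_trace :: "real^'d^'d => real^'m^'d => real" where
 "quad_trace A G = trace (transpose G ** A ** G)"

lemma quad_trace_sum:
 "quad_trace A G = (\<Sum>k\<in>UNIV. \<Sum>i\<in>UNIV. \<Sum>j\<in>UNIV. G $ i $ k * A $ i $ j * G $ j $ k)"
proof -
 have "quad_trace A G = (\<Sum>k\<in>UNIV. \<Sum>j\<in>UNIV. \<Sum>i\<in>UNIV. G $ i $ k * A $ i $ j * G $ j $ k)"
  unfolding quad_trace_def trace_def by (simp add: matrix_matrix_mult_def transpose_def sum_distrib_right)
 also have "... = (\<Sum>k\<in>UNIV. \<Sum>i\<in>UNIV. \<Sum>j\<in>UNIV. G $ i $ k * A $ i $ j * G $ j $ k)"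
  by (intro sum.cong refl sum.swap)
 finally show ?thesis .
qed

lemma matrix_entry_le_norm: "\<bar>(A :: real^'n^'k) $ i $ j\<bar> \<le> norm A"
proof -
 have "\<bar>A $ i $ j\<bar> \<le> norm (A $ i)" using norm_bound_component_le_cart component_le_norm_cart by blast
 also have "... \<le> norm A" by (rule Finite_Cartesian_Product.norm_nth_le)
 finally show ?thesis .
qed

lemma quad_trace_le:
 fixes A :: "real^'d^'d" and G :: "real^'m^'d"
 shows "\<bar>quad_trace A G\<bar> \<le> real CARD('m) * (real CARD('d))^2 * norm A * (norm G)^2"
proof -
 have "\<bar>quad_trace A G\<bar> \<le> (\<Sum>k\<in>(UNIV::'m set). \<Sum>i\<in>(UNIV::'d set). \<Sum>j\<in>(UNIV::'d set). norm G * norm A * norm G)"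
  unfolding quad_trace_sum
  by (rule order.trans[OF sum_abs], intro sum_mono, rule order.trans[OF sum_abs], intro sum_mono,
    rule order.trans[OF sum_abs], intro sum_mono)
   (auto simp: abs_mult intro!: mult_mono matrix_entry_le_norm)
 then show ?thesis by (simp add: power2_eq_square mult_ac)
qed

lemma abs_bilinear_diff_le:
 fixes a u v g h :: real
 assumes "\<bar>a\<bar> \<le> A" "\<bar>u\<bar> \<le> n" "\<bar>v\<bar> \<le> n" "\<bar>g\<bar> \<le> m" "\<bar>h\<bar> \<le> m"
 shows "\<bar>a * (u * v + u * h + g * v)\<bar> \<le> A * (n * (n + 2 * m))"
proof -
 have 1: "\<bar>u * v\<bar> \<le> n * n" "\<bar>u * h\<bar> \<le> n * m" "\<bar>g * v\<bar> \<le> m * n"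
  unfolding abs_mult by (intro mult_mono assms abs_ge_zero order.trans[OF abs_ge_zero assms(2)] order.trans[OF abs_ge_zero assms(4)])+
 have "\<bar>u * v + u * h + g * v\<bar> \<le> \<bar>u * v\<bar> + \<bar>u * h\<bar> + \<bar>g * v\<bar>" by (rule order.trans[OF abs_triangle_ineq add_right_mono[OF abs_triangle_ineq]])
 also have "... \<le> n * n + n * m + m * n" by (intro add_mono 1)
 also have "... = n * (n + 2 * m)" by (simp add: algebra_simps)
 finally have 2: "\<bar>u * v + u * h + g * v\<bar> \<le> n * (n + 2 * m)" .
 show ?thesis unfolding abs_mult[of a]
  by (intro mult_mono assms 2 abs_ge_zero order.trans[OF abs_ge_zero assms(1)])
qed

text \<open>The bound involves only \<open>G - H\<close> and \<open>H\<close>, so that it is small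
  in time integral as soon as \<open>G\<close> approximates a square-integrable \<open>H\<close> in
  L2, with no bound on \<open>G\<close> itself.\<close>

lemma quad_trace_diff_le:
 fixes A :: "real^'d^'d" and G H :: "real^'m^'d"
 shows "\<bar>quad_trace A G - quad_trace A H\<bar>
  \<le> real CARD('m) * (real CARD('d))^2 * norm A * (norm (G - H) * (norm (G - H) + 2 * norm H))"
proof -
 have "\<bar>G $ i $ k * A $ i $ j * G $ j $ k - H $ i $ k * A $ i $ j * H $ j $ k\<bar>
   \<le> norm A * (norm (G - H) * (norm (G - H) + 2 * norm H))" for i j k
 proof -
  have "G $ i $ k * A $ i $ j * G $ j $ k - H $ i $ k * A $ i $ j * H $ j $ k =
   A $ i $ j * ((G - H) $ i $ k * (G - H) $ j $ k + (G - H) $ i $ k * H $ j $ k + H $ i $ k * (G - H) $ j $ k)"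
   by (simp add: algebra_simps)
  then show ?thesis
   using abs_bilinear_diff_le[OF matrix_entry_le_norm[of A i j] matrix_entry_le_norm[of "G - H" i k]
    matrix_entry_le_norm[of "G - H" j k] matrix_entry_le_norm[of H i k] matrix_entry_le_norm[of H j k]]
   by (simp only:)
 qed
 note * = this
 have "\<bar>quad_trace A G - quad_trace A H\<bar> \<le>
  (\<Sum>k\<in>(UNIV::'m set). \<Sum>i\<in>(UNIV::'d set). \<Sum>j\<in>(UNIV::'d set). norm A * (norm (G - H) * (norm (G - H) + 2 * norm H)))"
  unfolding quad_trace_sum sum_subtractf[symmetric]
  by (rule order.trans[OF sum_abs], intro sum_mono, rule order.trans[OF sum_abs], intro sum_mono,
    rule order.trans[OF sum_abs], intro sum_mono) (rule *)
 then show ?thesis by (simp add: power2_eq_square mult_ac)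
qed

lemma quad_trace_diff_left: "quad_trace (A - A') G = quad_trace A G - quad_trace A' G"
 unfolding quad_trace_sum
 by (simp add: left_diff_distrib right_diff_distrib sum_subtractf)

lemma inner_matrix_quad:
 fixes A :: "real^'d^'d" and G :: "real^'m^'d"
 shows "(G *v x) \<bullet> (A *v (G *v x)) = (\<Sum>a\<in>UNIV. \<Sum>b\<in>UNIV. (transpose G ** A ** G) $ a $ b * (x $ a * x $ b))"
proof -
 have "x \<bullet> (transpose G *v y) = (G *v x) \<bullet> y" for y
  by (metis dot_lmul_matrix inner_commute transpose_matrix_vector)
 then have "(G *v x) \<bullet> (A *v (G *v x)) = x \<bullet> ((transpose G ** A ** G) *v x)"
  by (simp only: matrix_vector_mul_assoc[symmetric])
 then show ?thesis
  by (simp add: inner_vec_def matrix_vector_mult_def sum_distrib_left mult_ac)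
qed

lemma norm_matrix_vector_le:
 fixes A :: "real^'n^'k"
 shows "norm (A *v x) \<le> norm A * norm x"
proof -
 have "norm (A *v x) \<le> L2_set (\<lambda>i. norm (A $ i) * norm x) UNIV"
  unfolding norm_vec_def[of "A *v x"]
 proof (rule L2_set_mono)
  fix i
  have "(A *v x) $ i = A $ i \<bullet> x" by (simp add: matrix_vector_mult_def inner_vec_def)
  then show "norm ((A *v x) $ i) \<le> norm (A $ i) * norm x"
   using Cauchy_Schwarz_ineq2[of "A $ i" x] by simp
 qed simp
 also have "... = norm A * norm x"
  by (simp add: norm_vec_def[of A] L2_set_left_distrib)
 finally show ?thesis .
qed

text \<open>Diffusive scaling: over a time step \<open>h\<close> the squared increment of
  \<open>z\<close> and the plain increments of \<open>q\<close> and \<open>t\<close> all have mean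
  of order \<open>h\<close>.\<close>

abbreviation "deviation z' q' t' z q t \<equiv> (norm (z' - z))^2 + \<bar>q' - q\<bar> + \<bar>t' - t :: real\<bar>"

text \<open>If all three increments are below a third of the threshold of uniform continuity,
  \<open>eps\<close> suffices. Otherwise one of them is not, and \<open>K\<close> is chosen so that
  \<open>K * deviation\<close> exceeds twice the bound on \<open>f\<close>. In contrast to an
  epsilon-delta statement, this form of the modulus survives taking expectations.\<close>

lemma uniform_modulus:
 fixes f :: "'a::real_normed_vector => real => real => 'b::real_normed_vector"
 assumes uc: "uniformly_continuous_on (UNIV \<times> {0..} \<times> {0..T}) (\<lambda>(z, q, t). f z q t)"
  and bd: "!!z q t. 0 \<le> q ==> t \<in> {0..T} ==> norm (f z q t) \<le> C"
  and "eps > 0"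
 shows "\<exists>K\<ge>0. \<forall>z z' q q' t t'. 0 \<le> q --> 0 \<le> q' --> t \<in> {0..T} --> t' \<in> {0..T} -->
  norm (f z' q' t' - f z q t) \<le> eps + K * deviation z' q' t' z q t"
proof -
 obtain \<delta> where \<delta>: "\<delta> > 0" and D: "!!x x'. x \<in> UNIV \<times> {0..} \<times> {0..T} ==> x' \<in> UNIV \<times> {0..} \<times> {0..T} ==>
   dist x' x < \<delta> ==> dist ((\<lambda>(z, q, t). f z q t) x') ((\<lambda>(z, q, t). f z q t) x) < eps"
  using uniformly_continuous_onE[OF uc \<open>eps > 0\<close>] by blast
 define K where "K = 2 * \<bar>C\<bar> * (9 / \<delta>^2 + 3 / \<delta>)"
 have K: "K \<ge> 0" using \<delta> by (simp add: K_def)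
 show ?thesis
 proof (intro exI[of _ K] conjI K allI impI)
  fix z z' :: 'a and q q' t t' :: real
  assume q: "0 \<le> q" "0 \<le> q'" and t: "t \<in> {0..T}" "t' \<in> {0..T}"
  let ?D = "(norm (z' - z))^2 + \<bar>q' - q\<bar> + \<bar>t' - t\<bar>"
  show "norm (f z' q' t' - f z q t) \<le> eps + K * ?D"
  proof (cases "norm (z' - z) < \<delta> / 3 \<and> \<bar>q' - q\<bar> < \<delta> / 3 \<and> \<bar>t' - t\<bar> < \<delta> / 3")
   case True
   have "dist (z', q', t') (z, q, t) \<le> dist z' z + (dist q' q + dist t' t)"
    unfolding dist_Pair_Pair
    by (rule order.trans[OF sqrt_sum_squares_le_sum]) (auto intro!: sqrt_sum_squares_le_sum)
   also have "... < \<delta>" using True by (simp add: dist_norm)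
   finally have "norm (f z' q' t' - f z q t) < eps"
    using D[of "(z, q, t)" "(z', q', t')"] q t by (simp add: dist_norm)
   moreover have "0 \<le> K * ?D" using K by (intro mult_nonneg_nonneg) auto
   ultimately show ?thesis by linarith
  next
   case False
   have "1 \<le> (9 / \<delta>^2 + 3 / \<delta>) * ?D"
   proof -
    have gen: "1 \<le> (a + b) * (x + y + p)"
     if "0 \<le> a" "0 \<le> b" "0 \<le> x" "0 \<le> y" "0 \<le> p" "1 \<le> a * x \<or> 1 \<le> b * y \<or> 1 \<le> b * p" for a b x y p :: real
    proof -
     have "a * x \<le> (a + b) * (x + y + p)" "b * y \<le> (a + b) * (x + y + p)" "b * p \<le> (a + b) * (x + y + p)"
      by (rule mult_mono; use that in linarith)+
     then show ?thesis using that(6) by (meson order.trans)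
    qed
    have l: "1 \<le> 3 / \<delta> * x" if "\<not> x < \<delta> / 3" for x using that \<delta> by (simp add: field_simps)
    have l2: "1 \<le> 9 / \<delta>^2 * x^2" if "\<not> x < \<delta> / 3" for x
    proof -
     have "1^2 \<le> (3 / \<delta> * x)^2" using l[OF that] by (intro power_mono) auto
     then show ?thesis by (simp add: power_mult_distrib power_divide)
    qed
    have "1 \<le> 9 / \<delta>^2 * (norm (z' - z))^2 \<or> 1 \<le> 3 / \<delta> * \<bar>q' - q\<bar> \<or> 1 \<le> 3 / \<delta> * \<bar>t' - t\<bar>"
     using False l[of "\<bar>q' - q\<bar>"] l[of "\<bar>t' - t\<bar>"] l2[of "norm (z' - z)"] by argo
    then show ?thesis using \<delta> by (intro gen) simp_all
   qed
   then have "2 * \<bar>C\<bar> * 1 \<le> 2 * \<bar>C\<bar> * ((9 / \<delta>^2 + 3 / \<delta>) * ?D)"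
    by (intro mult_left_mono) auto
   moreover have "norm (f z' q' t' - f z q t) \<le> 2 * \<bar>C\<bar>"
    using bd[OF q(1) t(1), of z] bd[OF q(2) t(2), of z'] norm_triangle_ineq4[of "f z' q' t'" "f z q t"] by linarith
   ultimately show ?thesis using \<open>eps > 0\<close> by (simp add: K_def mult.assoc)
  qed
 qed
qed

definition modulus_bound :: "real => int set => ('a::real_normed_vector => real => real => int => 'b::real_normed_vector) => real => real => bool" where
 "modulus_bound T S f eps K \<longleftrightarrow> (\<forall>i\<in>S. \<forall>z z' q q' t t'. 0 \<le> q --> 0 \<le> q' --> t \<in> {0..T} --> t' \<in> {0..T} -->
  norm (f z' q' t' i - f z q t i) \<le> eps + K * deviation z' q' t' z q t)"

lemma modulus_bound_mono:
 fixes f :: "'a::real_normed_vector => real => real => int => 'b::real_normed_vector"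
 assumes f: "modulus_bound T S f eps K" and K: "K \<le> K'"
 shows "modulus_bound T S f eps K'"
 unfolding modulus_bound_def
proof (intro ballI allI impI)
 fix i and z z' :: 'a and q q' t t' :: real assume "i \<in> S" "0 \<le> q" "0 \<le> q'" "t \<in> {0..T}" "t' \<in> {0..T}"
 with f have "norm (f z' q' t' i - f z q t i) \<le> eps + K * deviation z' q' t' z q t" by (simp add: modulus_bound_def)
 moreover have "K * deviation z' q' t' z q t \<le> K' * deviation z' q' t' z q t" using K by (intro mult_right_mono) auto
 ultimately show "norm (f z' q' t' i - f z q t i) \<le> eps + K' * deviation z' q' t' z q t" by linarith
qed

lemma modulus_bound_exists:
 fixes f :: "'a::real_normed_vector => real => real => int => 'b::real_normed_vector"
 assumes "finite S" "eps > 0"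
  and uc: "!!i. i \<in> S ==> uniformly_continuous_on (UNIV \<times> {0..} \<times> {0..T}) (\<lambda>(z, q, t). f z q t i)"
  and bd: "!!i z q t. i \<in> S ==> 0 \<le> q ==> t \<in> {0..T} ==> norm (f z q t i) \<le> C"
 shows "\<exists>K\<ge>0. modulus_bound T S f eps K"
proof -
 have "\<exists>K\<ge>0. modulus_bound T {i} f eps K" if i: "i \<in> S" for i
 proof -
  have "\<exists>K\<ge>0. \<forall>z z' q q' t t'. 0 \<le> q --> 0 \<le> q' --> t \<in> {0..T} --> t' \<in> {0..T} -->
    norm (f z' q' t' i - f z q t i) \<le> eps + K * deviation z' q' t' z q t"
   by (rule uniform_modulus[where f = "\<lambda>z q t. f z q t i" and C = C]) (use uc bd i \<open>eps > 0\<close> in auto)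
  then show ?thesis by (simp add: modulus_bound_def)
 qed
 then obtain K where K: "!!i. i \<in> S ==> 0 \<le> K i" "!!i. i \<in> S ==> modulus_bound T {i} f eps (K i)" by metis
 have "modulus_bound T {i} f eps (sum K S)" if "i \<in> S" for i
 proof -
  have "K i \<le> sum K S" by (rule member_le_sum) (use that K(1) \<open>finite S\<close> in auto)
  then show ?thesis by (rule modulus_bound_mono[OF K(2)[OF that]])
 qed
 then have "modulus_bound T S f eps (sum K S)" by (simp add: modulus_bound_def)
 then show ?thesis using sum_nonneg[of S K] K(1) by blast
qed

lemma mvt_within:
 fixes f :: "real => real"
 assumes "a < b" and d: "!!x. x \<in> {a..b} ==> (f has_real_derivative f' x) (at x within {a..b})"
 shows "\<exists>c. a < c \<and> c < b \<and> f b - f a = (b - a) * f' c"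
proof -
 have "\<exists>c\<in>{a<..<b}. f b - f a = (\<lambda>y. f' c * y) (b - a)"
  by (rule mvt_simple[OF \<open>a < b\<close>]) (use d in \<open>simp add: has_field_derivative_def\<close>)
 then show ?thesis by (auto simp: mult.commute)
qed

lemma taylor2:
 fixes f :: "real => real"
 assumes "a < b" and d: "!!x. (f has_real_derivative f' x) (at x)"
  and dd: "!!x. (f' has_real_derivative f'' x) (at x)"
 shows "\<exists>c. a < c \<and> c < b \<and> f b = f a + f' a * (b - a) + f'' c / 2 * (b - a)^2"
proof -
 let ?D = "\<lambda>m. if m = 0 then f else if m = Suc 0 then f' else f''"
 have "\<exists>t. a < t \<and> t < b \<and> f b = (\<Sum>m<2. ?D m a / fact m * (b - a) ^ m) + ?D 2 t / fact 2 * (b - a) ^ 2"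
  by (rule Taylor_up[of 2 ?D f a b a]) (use assms in \<open>auto simp: less_2_cases_iff\<close>)
 then show ?thesis by (auto simp: numeral_2_eq_2)
qed

text \<open>The arguments of a test function are \<open>Z(t)\<close>, a nonnegative nondecreasing process \<open>Q(t)\<close> used
 for localisation in place of stopping times, the time and the state of the chain.\<close>

locale test_function =
 fixes T :: real and S :: "int set" and C :: real
  and phi :: "real^'d => real => real => int => real"
  and phiz :: "real^'d => real => real => int => real^'d"
  and phizz :: "real^'d => real => real => int => real^'d^'d"
  and phiq phit :: "real^'d => real => real => int => real"
 assumes T: "T \<ge> 0" and finS: "finite S" and C_nonneg: "C \<ge> 0"
  and bounds: "!!z q t i. i \<in> S ==> 0 \<le> q ==> t \<in> {0..T} ==>
    \<bar>phi z q t i\<bar> \<le> C \<and> norm (phiz z q t i) \<le> C \<and> norm (phizz z q t i) \<le> C \<and>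
    \<bar>phiq z q t i\<bar> \<le> C \<and> \<bar>phit z q t i\<bar> \<le> C"
  and uc: "!!i. i \<in> S ==> uniformly_continuous_on (UNIV \<times> {0..} \<times> {0..T}) (\<lambda>(z, q, t). phi z q t i)"
   "!!i. i \<in> S ==> uniformly_continuous_on (UNIV \<times> {0..} \<times> {0..T}) (\<lambda>(z, q, t). phiz z q t i)"
   "!!i. i \<in> S ==> uniformly_continuous_on (UNIV \<times> {0..} \<times> {0..T}) (\<lambda>(z, q, t). phizz z q t i)"
   "!!i. i \<in> S ==> uniformly_continuous_on (UNIV \<times> {0..} \<times> {0..T}) (\<lambda>(z, q, t). phiq z q t i)"
   "!!i. i \<in> S ==> uniformly_continuous_on (UNIV \<times> {0..} \<times> {0..T}) (\<lambda>(z, q, t). phit z q t i)"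
  and deriv_z: "!!i z q t x s. i \<in> S ==> 0 \<le> q ==> t \<in> {0..T} ==>
    ((\<lambda>s. phi (z + s *\<^sub>R x) q t i) has_real_derivative phiz (z + s *\<^sub>R x) q t i \<bullet> x) (at s)"
  and deriv_zz: "!!i z q t x s. i \<in> S ==> 0 \<le> q ==> t \<in> {0..T} ==>
    ((\<lambda>s. phiz (z + s *\<^sub>R x) q t i \<bullet> x) has_real_derivative x \<bullet> (phizz (z + s *\<^sub>R x) q t i *v x)) (at s)"
  and deriv_q: "!!i z q t. i \<in> S ==> 0 \<le> q ==> t \<in> {0..T} ==>
    ((\<lambda>q. phi z q t i) has_real_derivative phiq z q t i) (at q within {0..})"
  and deriv_t: "!!i z q t. i \<in> S ==> 0 \<le> q ==> t \<in> {0..T} ==>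
    ((\<lambda>t. phi z q t i) has_real_derivative phit z q t i) (at t within {0..})"
begin

lemma
 assumes "i \<in> S" "0 \<le> q" "t \<in> {0..T}"
 shows phi_bound: "\<bar>phi z q t i\<bar> \<le> C" and phiz_bound: "norm (phiz z q t i) \<le> C"
  and phizz_bound: "norm (phizz z q t i) \<le> C" and phiq_bound: "\<bar>phiq z q t i\<bar> \<le> C"
  and phit_bound: "\<bar>phit z q t i\<bar> \<le> C"
 using bounds[OF assms, of z] by auto

definition modulus :: "real => real => bool" where
 "modulus eps K \<longleftrightarrow> modulus_bound T S phi eps K \<and> modulus_bound T S phiz eps K \<and> modulus_bound T S phizz eps K
  \<and> modulus_bound T S phiq eps K \<and> modulus_bound T S phit eps K"

lemma modulus_exists:
 assumes "eps > 0"
 shows "\<exists>K\<ge>0. modulus eps K"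
proof -
 obtain K1 where K1: "K1 \<ge> 0" "modulus_bound T S phi eps K1"
  using modulus_bound_exists[where f = phi, OF finS assms uc(1) phi_bound[folded real_norm_def]] by auto
 obtain K2 where K2: "K2 \<ge> 0" "modulus_bound T S phiz eps K2"
  using modulus_bound_exists[where f = phiz, OF finS assms uc(2) phiz_bound] by auto
 obtain K3 where K3: "K3 \<ge> 0" "modulus_bound T S phizz eps K3"
  using modulus_bound_exists[where f = phizz, OF finS assms uc(3) phizz_bound] by auto
 obtain K4 where K4: "K4 \<ge> 0" "modulus_bound T S phiq eps K4"
  using modulus_bound_exists[where f = phiq, OF finS assms uc(4) phiq_bound[folded real_norm_def]] by auto
 obtain K5 where K5: "K5 \<ge> 0" "modulus_bound T S phit eps K5"
  using modulus_bound_exists[where f = phit, OF finS assms uc(5) phit_bound[folded real_norm_def]] by auto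
 note nn = K1(1) K2(1) K3(1) K4(1) K5(1)
 have "modulus eps (K1 + K2 + K3 + K4 + K5)"
  unfolding modulus_def
  by (intro conjI modulus_bound_mono[OF K1(2)] modulus_bound_mono[OF K2(2)] modulus_bound_mono[OF K3(2)]
    modulus_bound_mono[OF K4(2)] modulus_bound_mono[OF K5(2)]) (use nn in linarith)+
 then show ?thesis using nn by (intro exI[of _ "K1 + K2 + K3 + K4 + K5"]) auto
qed

lemma modulusD:
 assumes "modulus eps K" "i \<in> S" "0 \<le> q" "0 \<le> q'" "t \<in> {0..T}" "t' \<in> {0..T}"
 shows "\<bar>phi z' q' t' i - phi z q t i\<bar> \<le> eps + K * deviation z' q' t' z q t"
  "norm (phiz z' q' t' i - phiz z q t i) \<le> eps + K * deviation z' q' t' z q t"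
  "norm (phizz z' q' t' i - phizz z q t i) \<le> eps + K * deviation z' q' t' z q t"
  "\<bar>phiq z' q' t' i - phiq z q t i\<bar> \<le> eps + K * deviation z' q' t' z q t"
  "\<bar>phit z' q' t' i - phit z q t i\<bar> \<le> eps + K * deviation z' q' t' z q t"
 using assms by (simp_all add: modulus_def modulus_bound_def)

abbreviation "taylor_rest i z x d q \<kappa> t h \<equiv> phi (z + x + d) (q + \<kappa>) (t + h) i - phi z q t i
 - (phiz z q t i \<bullet> (x + d) + 1/2 * (x \<bullet> (phizz z q t i *v x)) + phiq z q t i * \<kappa> + phit z q t i * h)"
abbreviation "taylor_bound eps K x d \<kappa> h \<equiv> (h + \<kappa> + norm d) * (eps + K * (2 * (norm x)^2 + 2 * (norm d)^2 + \<kappa> + h)) + (norm x)^2 * (eps + K * (norm x)^2)"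

text \<open>The increment is decomposed in the order \<open>t\<close>, \<open>q\<close>,
  \<open>d\<close>, \<open>x\<close>. Here \<open>x\<close> is the martingale part, of size
  \<open>sqrt h\<close>, and needs the second-order expansion; drift \<open>d\<close>,
  \<open>\<kappa>\<close> and \<open>h\<close> are of order \<open>h\<close>, so the mean value
  theorem is enough for them. Each error is a step size times the modulus at an intermediate
  point.\<close>

lemma taylor:
 assumes M: "modulus eps K" and K: "0 \<le> K"
  and i: "i \<in> S" and nn: "0 \<le> q" "0 \<le> \<kappa>" "0 \<le> t" "0 \<le> h" and tT: "t + h \<le> T"
 shows "\<bar>taylor_rest i z x d q \<kappa> t h\<bar> \<le> taylor_bound eps K x d \<kappa> h"
proof -
 have tt: "t \<in> {0..T}" and qk: "0 \<le> q + \<kappa>" using nn tT by auto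
 define R where "R = eps + K * (2 * (norm x)^2 + 2 * (norm d)^2 + \<kappa> + h)"
 have R: "eps + K * D \<le> R" if "D \<le> 2 * (norm x)^2 + 2 * (norm d)^2 + \<kappa> + h" for D
  unfolding R_def using mult_left_mono[OF that K] by linarith
 have sq: "(norm (x + s *\<^sub>R d))^2 \<le> 2 * (norm x)^2 + 2 * (norm d)^2" if "0 \<le> s" "s \<le> 1" for s
 proof -
  have "norm (s *\<^sub>R d) \<le> norm d" using that by (simp add: mult_left_le_one_le)
  then have "norm (x + s *\<^sub>R d) \<le> norm x + norm d"
   using norm_triangle_ineq[of x "s *\<^sub>R d"] by linarith
  then have "(norm (x + s *\<^sub>R d))^2 \<le> (norm x + norm d)^2" by (intro power_mono) auto
  also have "... \<le> 2 * (norm x)^2 + 2 * (norm d)^2"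
   using sum_squares_bound[of "norm x" "norm d"] by (simp add: power2_sum)
  finally show ?thesis .
 qed
 have scaled: "\<bar>k * u - v * k\<bar> \<le> k * R" if "0 \<le> k" "\<bar>u - v\<bar> \<le> R" for k u v
 proof -
  have "\<bar>k * u - v * k\<bar> = k * \<bar>u - v\<bar>"
   using that(1) by (simp add: abs_mult_pos' right_diff_distrib mult.commute[of v])
  then show ?thesis using mult_left_mono[OF that(2,1)] by simp
 qed
 have A: "\<bar>phi (z + x + d) (q + \<kappa>) (t + h) i - phi (z + x + d) (q + \<kappa>) t i - phit z q t i * h\<bar> \<le> h * R"
 proof (cases "h = 0")
  case False
  then have "t < t + h" using nn by auto
  have "\<exists>c. t < c \<and> c < t + h \<and> phi (z + x + d) (q + \<kappa>) (t + h) i - phi (z + x + d) (q + \<kappa>) t i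
    = (t + h - t) * phit (z + x + d) (q + \<kappa>) c i"
  proof (rule mvt_within[OF \<open>t < t + h\<close>])
   fix c assume "c \<in> {t..t + h}"
   then show "((\<lambda>c. phi (z + x + d) (q + \<kappa>) c i) has_real_derivative phit (z + x + d) (q + \<kappa>) c i) (at c within {t..t + h})"
    using nn tT by (intro DERIV_subset[OF deriv_t[OF i qk]]) auto
  qed
  then obtain c where c: "t < c" "c < t + h" and
   e: "phi (z + x + d) (q + \<kappa>) (t + h) i - phi (z + x + d) (q + \<kappa>) t i = h * phit (z + x + d) (q + \<kappa>) c i"
   by auto
  have cT: "c \<in> {0..T}" using c nn tT by auto
  have "\<bar>phit (z + x + d) (q + \<kappa>) c i - phit z q t i\<bar> \<le> R"
   by (rule order.trans[OF modulusD(5)[OF M i nn(1) qk tt cT] R]) (use sq[of 1] c nn in \<open>simp add: algebra_simps\<close>)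
  then show ?thesis unfolding e by (rule scaled[OF nn(4)])
 qed simp
 have B: "\<bar>phi (z + x + d) (q + \<kappa>) t i - phi (z + x + d) q t i - phiq z q t i * \<kappa>\<bar> \<le> \<kappa> * R"
 proof (cases "\<kappa> = 0")
  case False
  then have "q < q + \<kappa>" using nn by auto
  have "\<exists>c. q < c \<and> c < q + \<kappa> \<and> phi (z + x + d) (q + \<kappa>) t i - phi (z + x + d) q t i
    = (q + \<kappa> - q) * phiq (z + x + d) c t i"
  proof (rule mvt_within[OF \<open>q < q + \<kappa>\<close>])
   fix c assume c: "c \<in> {q..q + \<kappa>}"
   have "0 \<le> c" using c nn by auto
   show "((\<lambda>c. phi (z + x + d) c t i) has_real_derivative phiq (z + x + d) c t i) (at c within {q..q + \<kappa>})"
    by (rule DERIV_subset[OF deriv_q[OF i \<open>0 \<le> c\<close> tt]]) (use nn in auto)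
  qed
  then obtain c where c: "q < c" "c < q + \<kappa>" and
   e: "phi (z + x + d) (q + \<kappa>) t i - phi (z + x + d) q t i = \<kappa> * phiq (z + x + d) c t i"
   by auto
  have c0: "0 \<le> c" using c nn by auto
  have "\<bar>phiq (z + x + d) c t i - phiq z q t i\<bar> \<le> R"
   by (rule order.trans[OF modulusD(4)[OF M i nn(1) c0 tt tt] R]) (use sq[of 1] c nn in \<open>simp add: algebra_simps\<close>)
  then show ?thesis unfolding e by (rule scaled[OF nn(2)])
 qed simp
 have Cc: "\<bar>phi (z + x + d) q t i - phi (z + x) q t i - phiz z q t i \<bullet> d\<bar> \<le> norm d * R"
 proof -
  have "\<exists>c. 0 < c \<and> c < 1 \<and> phi (z + x + 1 *\<^sub>R d) q t i - phi (z + x + 0 *\<^sub>R d) q t i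
    = (1 - 0) * (phiz (z + x + c *\<^sub>R d) q t i \<bullet> d)"
   by (rule mvt_within[OF zero_less_one]) (rule DERIV_subset[OF deriv_z[OF i nn(1) tt]], simp)
  then obtain c where c: "0 < c" "c < 1" and
   e: "phi (z + x + d) q t i - phi (z + x) q t i = phiz (z + x + c *\<^sub>R d) q t i \<bullet> d" by auto
  have "norm (phiz (z + x + c *\<^sub>R d) q t i - phiz z q t i) \<le> R"
   by (rule order.trans[OF modulusD(2)[OF M i nn(1) nn(1) tt tt] R]) (use sq[of c] c nn in \<open>simp add: algebra_simps\<close>)
  then have "norm (phiz (z + x + c *\<^sub>R d) q t i - phiz z q t i) * norm d \<le> R * norm d"
   by (rule mult_right_mono) simp
  moreover have "\<bar>(phiz (z + x + c *\<^sub>R d) q t i - phiz z q t i) \<bullet> d\<bar>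
    \<le> norm (phiz (z + x + c *\<^sub>R d) q t i - phiz z q t i) * norm d"
   by (rule Cauchy_Schwarz_ineq2)
  ultimately show ?thesis unfolding e by (simp add: inner_diff_left mult.commute)
 qed
 have Dd: "\<bar>phi (z + x) q t i - phi z q t i - (phiz z q t i \<bullet> x + 1/2 * (x \<bullet> (phizz z q t i *v x)))\<bar>
   \<le> (norm x)^2 * (eps + K * (norm x)^2)"
 proof -
  obtain c where c: "0 < c" "c < 1" and
   e: "phi (z + 1 *\<^sub>R x) q t i = phi (z + 0 *\<^sub>R x) q t i + (phiz (z + 0 *\<^sub>R x) q t i \<bullet> x) * (1 - 0)
     + (x \<bullet> (phizz (z + c *\<^sub>R x) q t i *v x)) / 2 * (1 - 0)^2"
   using taylor2[OF zero_less_one deriv_z[OF i nn(1) tt] deriv_zz[OF i nn(1) tt]] by blast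
  have "norm (phizz (z + c *\<^sub>R x) q t i - phizz z q t i)
    \<le> eps + K * deviation (z + c *\<^sub>R x) q t z q t"
   by (rule modulusD(3)[OF M i nn(1) nn(1) tt tt])
  also have "... \<le> eps + K * (norm x)^2"
  proof -
   have "norm (c *\<^sub>R x) \<le> norm x" using c by (simp add: mult_left_le_one_le)
   then have "(norm (c *\<^sub>R x))^2 \<le> (norm x)^2" by (intro power_mono) auto
   then have "K * (norm (c *\<^sub>R x))^2 \<le> K * (norm x)^2" using K by (rule mult_left_mono)
   then show ?thesis by simp
  qed
  finally have b: "norm (phizz (z + c *\<^sub>R x) q t i - phizz z q t i) \<le> eps + K * (norm x)^2" .
  let ?E = "phizz (z + c *\<^sub>R x) q t i - phizz z q t i"
  have "\<bar>x \<bullet> (?E *v x)\<bar> \<le> norm x * norm (?E *v x)" by (rule Cauchy_Schwarz_ineq2)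
  also have "... \<le> norm x * (norm ?E * norm x)"
   by (intro mult_left_mono norm_matrix_vector_le norm_ge_zero)
  also have "... = (norm x)^2 * norm ?E" by (simp add: power2_eq_square)
  also have "... \<le> (norm x)^2 * (eps + K * (norm x)^2)" using b by (rule mult_left_mono) simp
  finally have *: "\<bar>x \<bullet> (?E *v x)\<bar> \<le> (norm x)^2 * (eps + K * (norm x)^2)" .
  have "phi (z + x) q t i - phi z q t i - (phiz z q t i \<bullet> x + 1/2 * (x \<bullet> (phizz z q t i *v x))) = 1/2 * (x \<bullet> (?E *v x))"
   using e by (simp add: matrix_vector_mult_diff_rdistrib inner_diff_right)
  then show ?thesis using * by (simp add: abs_mult)
 qed
 have split: "\<bar>P - Q - (e1 + f1 + e2 + e3)\<bar> \<le> a1 + a2 + a3 + a4"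
  if "\<bar>P - P1 - e3\<bar> \<le> a1" "\<bar>P1 - P2 - e2\<bar> \<le> a2" "\<bar>P2 - P3 - f2\<bar> \<le> a3" "\<bar>P3 - Q - (f3 + f1)\<bar> \<le> a4" "e1 = f2 + f3"
  for P Q P1 P2 P3 e1 e2 e3 f1 f2 f3 a1 a2 a3 a4 :: real
  using that by linarith
 have "\<bar>taylor_rest i z x d q \<kappa> t h\<bar> \<le> h * R + \<kappa> * R + norm d * R + (norm x)^2 * (eps + K * (norm x)^2)"
  by (rule split[OF A B Cc Dd]) (simp add: inner_add_right)
 then show ?thesis unfolding R_def[symmetric] by (simp only: distrib_right)
qed

end

section \<open>Measurability\<close>

text \<open>Processes are known to be adapted only on \<open>[0, T]\<close>. Composing the time
  argument with \<open>clip T\<close> states joint measurability on the whole line without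
  restricting the space.\<close>

definition clip :: "real => real => real" where "clip T s = min T (max 0 s)"

lemma clip_in: "0 \<le> T ==> clip T s \<in> {0..T}"
 by (auto simp: clip_def)

lemma clip_eq: "s \<in> {0..T} ==> clip T s = s"
 by (auto simp: clip_def)

lemma clip_meas[measurable]: "clip T \<in> borel_measurable borel"
 unfolding clip_def[abs_def] by measurable

lemma borel_measurable_vec_nth':
 fixes A :: "'x => ('b::{real_normed_vector, second_countable_topology})^'n"
 assumes "A \<in> borel_measurable N"
 shows "(\<lambda>x. A x $ i) \<in> borel_measurable N"
 by (rule measurable_compose[OF assms], rule borel_measurable_continuous_onI) (intro continuous_intros)

lemma quad_trace_measurable:
 fixes A :: "'x => real^'d^'d" and G :: "'x => real^'m^'d"
 assumes "A \<in> borel_measurable N" "G \<in> borel_measurable N"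
 shows "(\<lambda>x. quad_trace (A x) (G x)) \<in> borel_measurable N"
 unfolding quad_trace_sum
 by (intro borel_measurable_sum borel_measurable_times borel_measurable_vec_nth' assms)

lemma uc_measurable:
 fixes f :: "'a::{real_normed_vector, second_countable_topology} => real => real => 'b::real_normed_vector"
 assumes uc: "uniformly_continuous_on (UNIV \<times> {0..} \<times> {0..T}) (\<lambda>(z, q, t). f z q t)"
  and m: "Z \<in> borel_measurable N" "Q \<in> borel_measurable N" "\<theta> \<in> borel_measurable N"
  and r: "!!x. x \<in> space N ==> 0 \<le> Q x" "!!x. x \<in> space N ==> \<theta> x \<in> {0..T}"
 shows "(\<lambda>x. f (Z x) (Q x) (\<theta> x)) \<in> borel_measurable N"
proof -
 have "(\<lambda>(z, q, t). f z q t) \<in> borel_measurable (restrict_space borel (UNIV \<times> {0..} \<times> {0..T}))"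
  by (rule borel_measurable_continuous_on_restrict[OF uniformly_continuous_imp_continuous[OF uc]])
 moreover have "(\<lambda>x. (Z x, Q x, \<theta> x)) \<in> measurable N (restrict_space borel (UNIV \<times> {0..} \<times> {0..T}))"
  by (rule measurable_restrict_space2) (use r m in \<open>auto intro!: borel_measurable_Pair\<close>)
 ultimately have "(\<lambda>x. (\<lambda>(z, q, t). f z q t) (Z x, Q x, \<theta> x)) \<in> borel_measurable N"
  by (rule measurable_compose[rotated])
 then show ?thesis by simp
qed

lemma measurable_switch:
 fixes \<rho> :: "'x => int"
 assumes \<rho>: "\<rho> \<in> measurable N (count_space UNIV)" "!!x. x \<in> space N ==> \<rho> x \<in> S"
  and f: "!!i. i \<in> S ==> f i \<in> measurable N K"
 shows "(\<lambda>x. f (\<rho> x) x) \<in> measurable N K"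
proof (rule measurable_compose_countable'[where I = S])
 show "\<rho> \<in> measurable N (count_space S)"
  by (rule measurable_count_space_extend) (use \<rho> in auto)
qed (use f in auto)

text \<open>A right-continuous adapted process is progressively measurable: sample it at the next point of
 a grid of mesh \<open>1/n\<close>.\<close>

lemma (in filtered_prob) right_continuous_joint:
 fixes Y :: "real => 'w => 'b::{real_normed_vector, second_countable_topology}"
 assumes T: "0 \<le> T"
  and ad: "!!t. t \<in> {0..T} ==> Y t \<in> borel_measurable (F T)"
  and rc: "!!w t. w \<in> space M ==> t \<in> {0..T} ==> continuous (at_right t) (\<lambda>s. Y s w)"
 shows "(\<lambda>x. Y (clip T (fst x)) (snd x)) \<in> borel_measurable (borel \<Otimes>\<^sub>M F T)"
proof (rule borel_measurable_LIMSEQ_metric)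
 let ?g = "\<lambda>(n::nat) s. clip T (of_int (\<lfloor>real (Suc n) * clip T s\<rfloor> + 1) / real (Suc n))"
 show "(\<lambda>x. Y (?g n (fst x)) (snd x)) \<in> borel_measurable (borel \<Otimes>\<^sub>M F T)" for n
 proof (rule measurable_compose_countable[where f = "\<lambda>k x. Y (clip T (of_int (k + 1) / real (Suc n))) (snd x)"
    and g = "\<lambda>x. \<lfloor>real (Suc n) * clip T (fst x)\<rfloor>"])
  fix k :: int
  show "(\<lambda>x. Y (clip T (of_int (k + 1) / real (Suc n))) (snd x)) \<in> borel_measurable (borel \<Otimes>\<^sub>M F T)"
   by (rule measurable_compose[OF measurable_snd ad]) (rule clip_in[OF T])
 next
  show "(\<lambda>x. \<lfloor>real (Suc n) * clip T (fst x)\<rfloor>) \<in> borel \<Otimes>\<^sub>M F T \<rightarrow>\<^sub>M count_space UNIV"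
   by measurable
 qed
 fix x :: "real \<times> 'w" assume "x \<in> space (borel \<Otimes>\<^sub>M F T)"
 then have w: "snd x \<in> space M"
  by (simp add: space_pair_measure space_F[OF T] mem_Times_iff)
 define s where "s = clip T (fst x)"
 have s: "s \<in> {0..T}" unfolding s_def by (rule clip_in[OF T])
 show "(\<lambda>n. Y (?g n (fst x)) (snd x)) \<longlonglongrightarrow> Y (clip T (fst x)) (snd x)"
 \<comment> \<open>At the right end the clipped grid point is \<open>T\<close> itself, so no value
   after the horizon is used; before \<open>T\<close> the grid point is strictly later than
   \<open>s\<close> and eventually below \<open>T\<close>, so right continuity applies.\<close>
 proof (cases "s = T")
  case True
  have "?g n (fst x) = T" for n
  proof -
   have "real (Suc n) * T < of_int (\<lfloor>real (Suc n) * T\<rfloor> + 1)" by linarith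
   then have "T < of_int (\<lfloor>real (Suc n) * T\<rfloor> + 1) / real (Suc n)"
    by (subst pos_less_divide_eq) (simp_all add: mult.commute)
   then show ?thesis using True T unfolding s_def by (simp add: clip_def[of T "_ / _"])
  qed
  then show ?thesis using True by (simp add: s_def)
 next
  case False
  then have sT: "0 \<le> s" "s < T" using s by auto
  let ?h = "\<lambda>n. of_int (\<lfloor>real (Suc n) * s\<rfloor> + 1) / real (Suc n)"
  have gt: "s < ?h n" for n
  proof -
   have "real (Suc n) * s < of_int (\<lfloor>real (Suc n) * s\<rfloor> + 1)" by linarith
   then show ?thesis by (subst pos_less_divide_eq) (simp_all add: mult.commute)
  qed
  have le: "?h n \<le> s + 1 / real (Suc n)" for n
  proof -
   have "of_int (\<lfloor>real (Suc n) * s\<rfloor> + 1) \<le> real (Suc n) * s + 1" by linarith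
   then have "?h n \<le> (real (Suc n) * s + 1) / real (Suc n)" by (rule divide_right_mono) simp
   then show ?thesis by (simp add: add_divide_distrib)
  qed
  have "?h \<longlonglongrightarrow> s"
  proof (rule tendsto_sandwich[of "\<lambda>_. s" ?h sequentially "\<lambda>n. s + 1 / real (Suc n)"])
   show "(\<lambda>n. s + 1 / real (Suc n)) \<longlonglongrightarrow> s"
    using tendsto_add[OF tendsto_const[of s] LIMSEQ_inverse_real_of_nat] by (simp add: inverse_eq_divide)
  qed (use gt le in \<open>auto simp: less_imp_le\<close>)
  then have h: "filterlim ?h (at_right s) sequentially"
   unfolding filterlim_at
  proof (intro conjI always_eventually allI)
   show "?h n \<in> {s<..}" "?h n \<noteq> s" for n using gt[of n] by (simp only: greaterThan_iff, rule less_imp_neq[symmetric])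
  qed
  have "\<forall>\<^sub>F n in sequentially. ?h n < T"
   using order_tendstoD(2)[OF \<open>?h \<longlonglongrightarrow> s\<close> sT(2)] .
  then have ev: "\<forall>\<^sub>F n in sequentially. Y (?h n) (snd x) = Y (?g n (fst x)) (snd x)"
  proof eventually_elim
   case (elim n)
   then have "?h n \<in> {0..T}" using gt[of n] sT by auto
   then show ?case by (simp add: s_def[symmetric] clip_eq)
  qed
  have "((\<lambda>u. Y u (snd x)) \<longlongrightarrow> Y s (snd x)) (at_right s)"
   using rc[OF w s] by (simp add: continuous_within)
  from filterlim_compose[OF this h] show ?thesis
   unfolding s_def[symmetric] by (rule Lim_transform_eventually[OF _ ev[unfolded s_def[symmetric]]])
 qed
qed

text \<open>The sampling lemma is about normed spaces; the chain is embedded into the reals and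
  recovered by the floor function. Right continuity in a discrete space means being constant just
  after each time.\<close>

lemma (in markov_space) r_joint:
 assumes T: "0 \<le> T"
 shows "(\<lambda>x. r (clip T (fst x)) (snd x)) \<in> measurable (borel \<Otimes>\<^sub>M F T) (count_space UNIV)"
proof -
 have "(\<lambda>x. real_of_int (r (clip T (fst x)) (snd x))) \<in> borel_measurable (borel \<Otimes>\<^sub>M F T)"
 proof (rule right_continuous_joint[OF T, of "\<lambda>t w. real_of_int (r t w)"])
  fix t assume t: "t \<in> {0..T}"
  have "r t \<in> measurable (F T) (count_space UNIV)"
   by (rule measurable_F_mono[of t T]) (use t r_meas_F in auto)
  then show "(\<lambda>w. real_of_int (r t w)) \<in> borel_measurable (F T)"
   by (rule measurable_compose) simp
  fix w assume w: "w \<in> space M"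
  have "continuous (at_right t) (\<lambda>s. r s w)"
   using mc w t unfolding markov_chain_def by auto
  then show "continuous (at_right t) (\<lambda>s. real_of_int (r s w))"
   unfolding continuous_within tendsto_discrete
   by (intro tendsto_eventually) (auto elim: eventually_mono)
 qed
 then have "(\<lambda>x. \<lfloor>real_of_int (r (clip T (fst x)) (snd x))\<rfloor>) \<in> measurable (borel \<Otimes>\<^sub>M F T) (count_space UNIV)"
  by measurable
 then show ?thesis by simp
qed

section \<open>The generator of the switching diffusion\<close>

locale switching_test =
 brownian_space M F B + markov_space M F N \<Gamma> r + test_function T "{1..int N}" C phi phiz phizz phiq phit
 for M :: "'w measure" and F and B :: "real => 'w => real^'m" and N \<Gamma> r T C
  and phi :: "real^'d => real => real => int => real" and phiz phizz phiq phit
begin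

text \<open>This is the generator of the joint process of \<open>Z\<close>, \<open>Q\<close>, time
  and chain. The term with \<open>phiq\<close> reflects that \<open>Q\<close> grows at speed
  \<open>(norm G)^2 + norm b\<close>.\<close>

definition H :: "real^'d => real => real => int => real^'d => real^'m^'d => real" where
 "H z q t i b G = phiz z q t i \<bullet> b + 1/2 * quad_trace (phizz z q t i) G + phit z q t i
  + phiq z q t i * ((norm G)^2 + norm b) + (\<Sum>j\<in>S. \<Gamma> i j * phi z q t j)"

definition c0 :: real where "c0 = real CARD('m) * (real CARD('d))^2"

lemma c0_nonneg: "c0 \<ge> 0" by (simp add: c0_def)

definition Hc :: "real => real" where
 "Hc L = L + c0 * L^2 + 1 + (L^2 + L) + G_bound"

lemma Hc_nonneg: "L \<ge> 0 ==> Hc L \<ge> 0"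
 unfolding Hc_def using c0_nonneg G_bound_nonneg by (intro add_nonneg_nonneg mult_nonneg_nonneg) auto

text \<open>\<open>H\<close> is linear in the derivatives of the test function, so a single estimate
  serves both for \<open>H\<close> itself and for its difference at two states.\<close>

lemma combine_bound:
 fixes D L :: real
 assumes "norm u \<le> D" "norm A \<le> D" "\<bar>t\<bar> \<le> D" "\<bar>q\<bar> \<le> D" "\<bar>s\<bar> \<le> G_bound * D"
  and "norm b \<le> L" "norm G \<le> L"
 shows "\<bar>u \<bullet> b + 1/2 * quad_trace (A :: real^'d^'d) (G :: real^'m^'d) + t + q * ((norm G)^2 + norm b) + s\<bar> \<le> Hc L * D"
proof -
 have D: "0 \<le> D" using assms(1) norm_ge_zero order.trans by blast
 have L: "0 \<le> L" using assms(6) norm_ge_zero order.trans by blast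
 have G2: "(norm G)^2 \<le> L^2" using assms(7) by (intro power_mono) auto
 have 1: "\<bar>u \<bullet> b\<bar> \<le> D * L"
  by (rule order.trans[OF Cauchy_Schwarz_ineq2], rule mult_mono) (use assms D in auto)
 have "\<bar>quad_trace A G\<bar> \<le> c0 * norm A * (norm G)^2" unfolding c0_def by (rule quad_trace_le)
 also have "... \<le> c0 * D * L^2"
  by (intro mult_mono assms G2 c0_nonneg mult_nonneg_nonneg D) auto
 finally have 2: "\<bar>1/2 * quad_trace A G\<bar> \<le> c0 * D * L^2" by (simp add: abs_mult)
 have 3: "\<bar>q * ((norm G)^2 + norm b)\<bar> \<le> D * (L^2 + L)"
  unfolding abs_mult by (rule mult_mono) (use assms G2 D in auto)
 have "\<bar>u \<bullet> b + 1/2 * quad_trace A G + t + q * ((norm G)^2 + norm b) + s\<bar>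
  \<le> \<bar>u \<bullet> b\<bar> + \<bar>1/2 * quad_trace A G\<bar> + \<bar>t\<bar> + \<bar>q * ((norm G)^2 + norm b)\<bar> + \<bar>s\<bar>" by linarith
 also have "... \<le> D * L + c0 * D * L^2 + D + D * (L^2 + L) + G_bound * D"
  by (intro add_mono 1 2 3 assms)
 also have "... = Hc L * D" by (simp add: Hc_def algebra_simps)
 finally show ?thesis .
qed

lemma H_bound:
 assumes "i \<in> S" "0 \<le> q" "t \<in> {0..T}" "norm b \<le> L" "norm G \<le> L"
 shows "\<bar>H z q t i b G\<bar> \<le> Hc L * C"
 unfolding H_def
 by (rule combine_bound)
  (use assms phi_bound phiz_bound phizz_bound phiq_bound phit_bound in \<open>auto intro!: row_sum_bound\<close>)

lemma H_diff_bound: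
 assumes i: "i \<in> S"
  and D: "norm (phiz z' q' t' i - phiz z q t i) \<le> D" "norm (phizz z' q' t' i - phizz z q t i) \<le> D"
   "\<bar>phiq z' q' t' i - phiq z q t i\<bar> \<le> D" "\<bar>phit z' q' t' i - phit z q t i\<bar> \<le> D"
   "!!j. j \<in> S ==> \<bar>phi z' q' t' j - phi z q t j\<bar> \<le> D"
  and "norm b \<le> L" "norm G \<le> L"
 shows "\<bar>H z' q' t' i b G - H z q t i b G\<bar> \<le> Hc L * D"
proof -
 have "H z' q' t' i b G - H z q t i b G =
  (phiz z' q' t' i - phiz z q t i) \<bullet> b + 1/2 * quad_trace (phizz z' q' t' i - phizz z q t i) G
   + (phit z' q' t' i - phit z q t i) + (phiq z' q' t' i - phiq z q t i) * ((norm G)^2 + norm b)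
   + (\<Sum>j\<in>S. \<Gamma> i j * (phi z' q' t' j - phi z q t j))"
  unfolding H_def quad_trace_diff_left right_diff_distrib sum_subtractf inner_diff_left left_diff_distrib
  by simp
 also have "\<bar>...\<bar> \<le> Hc L * D"
  by (rule combine_bound) (use assms in \<open>auto intro!: row_sum_bound\<close>)
 finally show ?thesis .
qed

lemma test_measurable:
 assumes m: "Z \<in> borel_measurable K" "Q \<in> borel_measurable K" "\<theta> \<in> borel_measurable K"
  and r: "!!x. x \<in> space K ==> 0 \<le> Q x" "!!x. x \<in> space K ==> \<theta> x \<in> {0..T}"
  and \<rho>: "\<rho> \<in> measurable K (count_space UNIV)" "!!x. x \<in> space K ==> \<rho> x \<in> S"
 shows "(\<lambda>x. phi (Z x) (Q x) (\<theta> x) (\<rho> x)) \<in> borel_measurable K"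
  and "(\<lambda>x. phiz (Z x) (Q x) (\<theta> x) (\<rho> x)) \<in> borel_measurable K"
  and "(\<lambda>x. phizz (Z x) (Q x) (\<theta> x) (\<rho> x)) \<in> borel_measurable K"
  and "(\<lambda>x. phiq (Z x) (Q x) (\<theta> x) (\<rho> x)) \<in> borel_measurable K"
  and "(\<lambda>x. phit (Z x) (Q x) (\<theta> x) (\<rho> x)) \<in> borel_measurable K"
proof -
 show "(\<lambda>x. phi (Z x) (Q x) (\<theta> x) (\<rho> x)) \<in> borel_measurable K"
  by (rule measurable_switch[OF \<rho>, where f = "\<lambda>i x. phi (Z x) (Q x) (\<theta> x) i"]) (assumption, rule uc_measurable[OF uc(1) m r])
 show "(\<lambda>x. phiz (Z x) (Q x) (\<theta> x) (\<rho> x)) \<in> borel_measurable K"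
  by (rule measurable_switch[OF \<rho>, where f = "\<lambda>i x. phiz (Z x) (Q x) (\<theta> x) i"]) (assumption, rule uc_measurable[OF uc(2) m r])
 show "(\<lambda>x. phizz (Z x) (Q x) (\<theta> x) (\<rho> x)) \<in> borel_measurable K"
  by (rule measurable_switch[OF \<rho>, where f = "\<lambda>i x. phizz (Z x) (Q x) (\<theta> x) i"]) (assumption, rule uc_measurable[OF uc(3) m r])
 show "(\<lambda>x. phiq (Z x) (Q x) (\<theta> x) (\<rho> x)) \<in> borel_measurable K"
  by (rule measurable_switch[OF \<rho>, where f = "\<lambda>i x. phiq (Z x) (Q x) (\<theta> x) i"]) (assumption, rule uc_measurable[OF uc(4) m r])
 show "(\<lambda>x. phit (Z x) (Q x) (\<theta> x) (\<rho> x)) \<in> borel_measurable K"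
  by (rule measurable_switch[OF \<rho>, where f = "\<lambda>i x. phit (Z x) (Q x) (\<theta> x) i"]) (assumption, rule uc_measurable[OF uc(5) m r])
qed

lemma H_measurable:
 assumes m: "Z \<in> borel_measurable K" "Q \<in> borel_measurable K" "\<theta> \<in> borel_measurable K"
  and r: "!!x. x \<in> space K ==> 0 \<le> Q x" "!!x. x \<in> space K ==> \<theta> x \<in> {0..T}"
  and \<rho>: "\<rho> \<in> measurable K (count_space UNIV)" "!!x. x \<in> space K ==> \<rho> x \<in> S"
  and bG: "b \<in> borel_measurable K" "G \<in> borel_measurable K"
 shows "(\<lambda>x. H (Z x) (Q x) (\<theta> x) (\<rho> x) (b x) (G x)) \<in> borel_measurable K"
proof -
 have 1: "(\<lambda>x. \<Sum>j\<in>S. \<Gamma> (\<rho> x) j * phi (Z x) (Q x) (\<theta> x) j) \<in> borel_measurable K"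
  by (rule measurable_switch[OF \<rho>, where f = "\<lambda>i x. \<Sum>j\<in>S. \<Gamma> i j * phi (Z x) (Q x) (\<theta> x) j"])
   (assumption, intro borel_measurable_sum borel_measurable_times borel_measurable_const uc_measurable[OF uc(1) m r])
 show ?thesis
  unfolding H_def
  by (intro borel_measurable_add borel_measurable_times borel_measurable_inner 1 quad_trace_measurable
    test_measurable m r \<rho> bG borel_measurable_const borel_measurable_power borel_measurable_norm
    measurable_compose[OF bG(1) borel_measurable_norm] measurable_compose[OF bG(2) borel_measurable_norm])
qed

end

text \<open>A time interval on which the integrand is one matrix \<open>eta\<close>, known at its
  left end \<open>a\<close>. The event \<open>A\<close> of \<open>F a\<close> is the test set: the
  formula to be shown is an identity of conditional expectations given \<open>F a\<close>,
  integrated over \<open>A\<close>.\<close>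

locale ito_cell = switching_test M F B N \<Gamma> r T C phi phiz phizz phiq phit
 for M :: "'w measure" and F and B :: "real => 'w => real^'m" and N \<Gamma> r T C
  and phi :: "real^'d => real => real => int => real" and phiz phizz phiq phit +
 fixes a c L :: real and eta :: "'w => real^'m^'d" and b Z :: "real => 'w => real^'d"
  and Q :: "real => 'w => real" and A :: "'w set"
 assumes ac: "0 \<le> a" "a \<le> c" "c \<le> T" and L: "0 \<le> L"
  and A: "A \<in> sets (F a)"
  and eta_meas: "eta \<in> borel_measurable (F a)"
  and eta_bound: "!!w. w \<in> space M ==> norm (eta w) \<le> L"
  and b_joint: "(\<lambda>x. b (fst x) (snd x)) \<in> borel_measurable (borel \<Otimes>\<^sub>M M)"
  and b_bound: "!!w u. w \<in> space M ==> norm (b u w) \<le> L"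
  and Z_joint: "(\<lambda>x. Z (fst x) (snd x)) \<in> borel_measurable (borel \<Otimes>\<^sub>M M)"
  and Q_joint: "(\<lambda>x. Q (fst x) (snd x)) \<in> borel_measurable (borel \<Otimes>\<^sub>M M)"
  and Z_ad: "!!v. v \<in> {a..c} ==> Z v \<in> borel_measurable (F v)"
  and Q_ad: "!!v. v \<in> {a..c} ==> Q v \<in> borel_measurable (F v)"
  and Q_nonneg: "!!v w. v \<in> {a..c} ==> w \<in> space M ==> 0 \<le> Q v w"
  and Z_incr: "!!w v v'. w \<in> space M ==> a \<le> v ==> v \<le> v' ==> v' \<le> c ==>
    Z v' w = Z v w + (LINT u:{v..v'}|lborel. b u w) + eta w *v (B v' w - B v w)"
  and Q_incr: "!!w v v'. w \<in> space M ==> a \<le> v ==> v \<le> v' ==> v' \<le> c ==>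
    Q v' w = Q v w + (LINT u:{v..v'}|lborel. (norm (eta w))^2 + norm (b u w))"
begin

abbreviation "phis v w \<equiv> phi (Z v w) (Q v w) v (r v w)"
abbreviation "phisz v w \<equiv> phiz (Z v w) (Q v w) v (r v w)"
abbreviation "phiszz v w \<equiv> phizz (Z v w) (Q v w) v (r v w)"
abbreviation "sw v w \<equiv> \<Sum>j\<in>S. \<Gamma> (r v w) j * phi (Z v w) (Q v w) v j"
text \<open>The compensated parts of the expansion over a step: gradient term, Hessian term minus
  its mean, and change of the chain minus its rate. Integrated over \<open>A\<close>, the first two
  give 0 and the third gives \<open>o(h)\<close>.\<close>

abbreviation "mart1 v y w \<equiv> phisz v w \<bullet> (eta w *v (B y w - B v w))"
abbreviation "mart2 v y w \<equiv> (eta w *v (B y w - B v w)) \<bullet> (phiszz v w *v (eta w *v (B y w - B v w))) - (y - v) * quad_trace (phiszz v w) (eta w)"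
abbreviation "mart3 v y w \<equiv> phi (Z v w) (Q v w) v (r y w) - phis v w - (y - v) * (sw v w)"

lemma in_T: "v \<in> {a..c} ==> v \<in> {0..T}" "v \<in> {a..c} ==> 0 \<le> v"
 using ac by auto

lemma eta_ad: "v \<in> {a..c} ==> eta \<in> borel_measurable (F v)"
 using measurable_F_mono[OF ac(1) _ eta_meas] by auto

lemma A_ad: "v \<in> {a..c} ==> A \<in> sets (F v)"
 using sets_F_mono[OF ac(1)] A by auto

lemma A_events: "A \<in> events"
 using sets_F_M[OF ac(1)] A by auto

lemma b_section: "w \<in> space M ==> (\<lambda>u. b u w) \<in> borel_measurable borel"
 using measurable_compose[OF measurable_Pair2' b_joint, of w] by simp

lemma b_int: "w \<in> space M ==> set_integrable lborel {v..y} (\<lambda>u. b u w)"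
 unfolding set_integrable_def
 by (rule integrableI_bounded_set_indicator[where B = L])
  (use b_section b_bound in \<open>auto simp: emeasure_lborel_Icc_eq\<close>)

lemma set_integral_norm_le:
 fixes g :: "real => 'b::{banach, second_countable_topology}"
 assumes "v \<le> y" "!!u. u \<in> {v..y} ==> norm (g u) \<le> K" "0 \<le> K"
 shows "norm (LINT u:{v..y}|lborel. g u) \<le> K * (y - v)"
proof -
 have "norm (LINT u:{v..y}|lborel. g u) \<le> (LINT u|lborel. norm (indicator {v..y} u *\<^sub>R g u))"
  unfolding set_lebesgue_integral_def by (rule integral_norm_bound)
 also have "... \<le> (LINT u|lborel. indicator {v..y} u * K)"
 proof (rule integral_mono')
  show "integrable lborel (\<lambda>u. indicator {v..y} u * K)"
   by (intro integrable_mult_left integrable_real_indicator) (auto simp: emeasure_lborel_Icc_eq)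
 qed (use assms in \<open>auto simp: indicator_def\<close>)
 also have "... = K * (y - v)" using assms(1) by simp
 finally show ?thesis .
qed

lemma drift_le:
 assumes "w \<in> space M" "v \<le> y"
 shows "norm (LINT u:{v..y}|lborel. b u w) \<le> L * (y - v)"
 by (rule set_integral_norm_le) (use assms b_bound L in auto)

lemma speed_bounds:
 assumes w: "w \<in> space M" and "v \<le> y"
 shows "0 \<le> (LINT u:{v..y}|lborel. (norm (eta w))^2 + norm (b u w))"
  and "(LINT u:{v..y}|lborel. (norm (eta w))^2 + norm (b u w)) \<le> (L^2 + L) * (y - v)"
proof -
 show "0 \<le> (LINT u:{v..y}|lborel. (norm (eta w))^2 + norm (b u w))"
  unfolding set_lebesgue_integral_def by (rule Bochner_Integration.integral_nonneg) auto
 have "norm (LINT u:{v..y}|lborel. (norm (eta w))^2 + norm (b u w)) \<le> (L^2 + L) * (y - v)"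
 proof (rule set_integral_norm_le)
  fix u
  have "(norm (eta w))^2 \<le> L^2" using eta_bound[OF w] by (intro power_mono) auto
  then show "norm ((norm (eta w))^2 + norm (b u w)) \<le> L^2 + L"
   using b_bound[OF w, of u] by simp
 qed (use L assms in auto)
 then show "(LINT u:{v..y}|lborel. (norm (eta w))^2 + norm (b u w)) \<le> (L^2 + L) * (y - v)"
  by simp
qed

lemma state_measurable:
 assumes v: "v \<in> {a..c}"
 shows "(\<lambda>w. phis v w) \<in> borel_measurable (F v)"
  and "(\<lambda>w. phisz v w) \<in> borel_measurable (F v)"
  and "(\<lambda>w. phiszz v w) \<in> borel_measurable (F v)"
  and "i \<in> S ==> (\<lambda>w. phi (Z v w) (Q v w) v i) \<in> borel_measurable (F v)"
proof -
 have sp: "w \<in> space (F v) ==> w \<in> space M" for w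
  using space_F[OF in_T(2)[OF v]] by simp
 have m: "Z v \<in> borel_measurable (F v)" "Q v \<in> borel_measurable (F v)" "(\<lambda>_. v) \<in> borel_measurable (F v)"
  "!!x. x \<in> space (F v) ==> 0 \<le> Q v x" "!!x. x \<in> space (F v) ==> v \<in> {0..T}"
  using Z_ad Q_ad Q_nonneg sp in_T v by auto
 have rr: "r v \<in> measurable (F v) (count_space UNIV)" "!!x. x \<in> space (F v) ==> r v x \<in> S"
  using r_meas_F[OF in_T(2)[OF v]] r_in_S[OF sp in_T(2)[OF v]] by blast+
 note t = test_measurable[OF m(1-3) m(4) m(5) rr]
 show "(\<lambda>w. phis v w) \<in> borel_measurable (F v)"
  and "(\<lambda>w. phisz v w) \<in> borel_measurable (F v)"
  and "(\<lambda>w. phiszz v w) \<in> borel_measurable (F v)"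
  by (rule t; assumption)+
 show "(\<lambda>w. phi (Z v w) (Q v w) v i) \<in> borel_measurable (F v)" if "i \<in> S"
  by (rule uc_measurable[OF uc(1)[OF that] m(1-3)]) (use m in auto)
qed

lemma state_bounds:
 assumes v: "v \<in> {a..c}" and w: "w \<in> space M"
 shows "0 \<le> y ==> \<bar>phi (Z v w) (Q v w) v (r y w)\<bar> \<le> C"
  and "norm (phisz v w) \<le> C"
  and "norm (phiszz v w) \<le> C"
proof -
 note * = Q_nonneg[OF v w] in_T(1)[OF v]
 show "\<bar>phi (Z v w) (Q v w) v (r y w)\<bar> \<le> C" if "0 \<le> y"
  by (rule phi_bound[OF r_in_S[OF w that] *])
 show "norm (phisz v w) \<le> C" "norm (phiszz v w) \<le> C"
  by (rule phiz_bound[OF r_in_S[OF w in_T(2)[OF v]] *] phizz_bound[OF r_in_S[OF w in_T(2)[OF v]] *])+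
qed

lemma bounded_F_integrable:
 assumes "0 \<le> v" "Y \<in> borel_measurable (F v)" "!!w. w \<in> space M ==> \<bar>Y w\<bar> \<le> K"
 shows "integrable M (Y :: 'w => real)"
proof (rule integrable_const_bound[where B = K])
 show "AE w in M. norm (Y w) \<le> K" using assms(3) by (intro AE_I2) (simp only: real_norm_def)
qed (rule measurable_F_M[OF assms(1,2)])

text \<open>The term is a sum over the components of the Brownian increment with bounded
  coefficients known at time \<open>v\<close>; each increment has mean 0 and is independent of its
  coefficient.\<close>

lemma first_order_term:
 assumes v: "v \<in> {a..c}" and y: "y \<in> {a..c}" "v < y"
 shows "has_bochner_integral M (\<lambda>w. indicator A w *
   (mart1 v y w)) 0"
proof -
 let ?f = "\<lambda>w. phisz v w" and ?D = "\<lambda>w. B y w - B v w"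
 define Y where "Y k w = indicator A w * (\<Sum>i\<in>UNIV. ?f w $ i * eta w $ i $ k)" for k w
 have v0: "0 \<le> v" using in_T v by auto
 have YF: "Y k \<in> borel_measurable (F v)" for k
  unfolding Y_def
  by (intro borel_measurable_times borel_measurable_sum borel_measurable_indicator A_ad v
    borel_measurable_vec_nth' state_measurable eta_ad)
 have Yb: "\<bar>Y k w\<bar> \<le> real CARD('d) * (C * L)" if "w \<in> space M" for k w
 proof -
  have "\<bar>\<Sum>i\<in>UNIV. ?f w $ i * eta w $ i $ k\<bar> \<le> (\<Sum>i\<in>(UNIV::'d set). C * L)"
  proof (rule order.trans[OF sum_abs], rule sum_mono)
   fix i
   have "\<bar>?f w $ i\<bar> \<le> C" using component_le_norm_cart[of "?f w" i] state_bounds(2)[OF v that] by linarith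
   moreover have "\<bar>eta w $ i $ k\<bar> \<le> L" using matrix_entry_le_norm[of "eta w" i k] eta_bound[OF that] by linarith
   ultimately show "\<bar>?f w $ i * eta w $ i $ k\<bar> \<le> C * L"
    unfolding abs_mult using C_nonneg by (intro mult_mono) auto
  qed
  then show ?thesis using C_nonneg L by (auto simp: Y_def indicator_def)
 qed
 have Yi: "integrable M (Y k)" for k by (rule bounded_F_integrable[OF v0 YF Yb])
 have "has_bochner_integral M (\<lambda>w. Y k w * ?D w $ k) 0" for k
  using increment_indep[OF v0 y(2) YF Yi, of "\<lambda>x. x $ k" k] increment_moments(1)[OF v0 y(2), of k]
  by (auto simp: has_bochner_integral_iff borel_measurable_vec_nth')
 then have "has_bochner_integral M (\<lambda>w. \<Sum>k\<in>UNIV. Y k w * ?D w $ k) (\<Sum>k\<in>(UNIV::'m set). 0)"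
  by (rule has_bochner_integral_sum)
 moreover have "(\<Sum>k\<in>UNIV. Y k w * ?D w $ k) = indicator A w * (?f w \<bullet> (eta w *v ?D w))" for w
 proof -
  have "?f w \<bullet> (eta w *v ?D w) = (?f w v* eta w) \<bullet> ?D w" by (rule dot_lmul_matrix[symmetric])
  also have "... = (\<Sum>k\<in>UNIV. (\<Sum>i\<in>UNIV. ?f w $ i * eta w $ i $ k) * ?D w $ k)"
   unfolding inner_vec_def by (simp add: vector_matrix_mult_def mult.commute)
  finally show ?thesis unfolding Y_def mult.assoc[of "indicator A w"] sum_distrib_left[symmetric] by simp
 qed
 ultimately show ?thesis by simp
qed

text \<open>As a quadratic form in the increment, the coefficients are the entries of
  \<open>transpose eta ** phizz ** eta\<close>, known at time \<open>v\<close>. Products of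
  components have mean \<open>y - v\<close> on the diagonal and 0 off it, which leaves the
  trace.\<close>

lemma second_order_term:
 assumes v: "v \<in> {a..c}" and y: "y \<in> {a..c}" "v < y"
 shows "has_bochner_integral M (\<lambda>w. indicator A w *
   (mart2 v y w)) 0"
proof -
 let ?f = "\<lambda>w. phiszz v w" and ?D = "\<lambda>w. B y w - B v w"
 let ?N = "\<lambda>w. transpose (eta w) ** ?f w ** eta w"
 define Y where "Y k l w = indicator A w * ?N w $ k $ l" for k l w
 have Ye: "Y k l w = indicator A w * (\<Sum>j\<in>UNIV. \<Sum>i\<in>UNIV. eta w $ i $ k * ?f w $ i $ j * eta w $ j $ l)" for k l w
  unfolding Y_def by (simp add: matrix_matrix_mult_def transpose_def sum_distrib_right)
 have v0: "0 \<le> v" using in_T v by auto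
 have YF: "Y k l \<in> borel_measurable (F v)" for k l
  unfolding Ye
  by (intro borel_measurable_times borel_measurable_sum borel_measurable_indicator A_ad v
    borel_measurable_vec_nth' state_measurable eta_ad)
 have Yb: "\<bar>Y k l w\<bar> \<le> real CARD('d) * (real CARD('d) * (L * C * L))" if "w \<in> space M" for k l w
 proof -
  have "\<bar>\<Sum>j\<in>UNIV. \<Sum>i\<in>UNIV. eta w $ i $ k * ?f w $ i $ j * eta w $ j $ l\<bar> \<le> (\<Sum>j\<in>(UNIV::'d set). \<Sum>i\<in>(UNIV::'d set). L * C * L)"
  proof (rule order.trans[OF sum_abs], rule sum_mono, rule order.trans[OF sum_abs], rule sum_mono)
   fix i j
   have "\<bar>?f w $ i $ j\<bar> \<le> C" using matrix_entry_le_norm[of "?f w" i j] state_bounds(3)[OF v that] by linarith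
   moreover have "\<bar>eta w $ i $ k\<bar> \<le> L" for i k using matrix_entry_le_norm[of "eta w" i k] eta_bound[OF that] by linarith
   ultimately show "\<bar>eta w $ i $ k * ?f w $ i $ j * eta w $ j $ l\<bar> \<le> L * C * L"
    unfolding abs_mult using C_nonneg L by (intro mult_mono) auto
  qed
  then show ?thesis using C_nonneg L by (auto simp: Ye indicator_def)
 qed
 have Yi: "integrable M (Y k l)" for k l by (rule bounded_F_integrable[OF v0 YF Yb])
 have "has_bochner_integral M (\<lambda>w. Y k l w * (?D w $ k * ?D w $ l) - (if k = l then y - v else 0) * Y k l w) 0" for k l
 proof -
  have "has_bochner_integral M (\<lambda>w. Y k l w * (?D w $ k * ?D w $ l)) (expectation (Y k l) * (if k = l then y - v else 0))"
   using increment_indep[OF v0 y(2) YF Yi, of "\<lambda>x. x $ k * x $ l"] increment_moments(2)[OF v0 y(2), of k l]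
   by (auto simp: has_bochner_integral_iff borel_measurable_vec_nth' borel_measurable_times)
  then show ?thesis using Yi by (auto simp: has_bochner_integral_iff)
 qed
 then have "has_bochner_integral M (\<lambda>w. \<Sum>k\<in>UNIV. \<Sum>l\<in>UNIV. (Y k l w * (?D w $ k * ?D w $ l) - (if k = l then y - v else 0) * Y k l w))
  (\<Sum>k\<in>(UNIV::'m set). \<Sum>l\<in>(UNIV::'m set). 0)"
  by (intro has_bochner_integral_sum)
 moreover have "(\<Sum>k\<in>UNIV. \<Sum>l\<in>UNIV. (Y k l w * (?D w $ k * ?D w $ l) - (if k = l then y - v else 0) * Y k l w))
  = indicator A w * ((eta w *v ?D w) \<bullet> (?f w *v (eta w *v ?D w)) - (y - v) * quad_trace (?f w) (eta w))" for w
 proof -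
  have "(\<Sum>k\<in>UNIV. \<Sum>l\<in>UNIV. Y k l w * (?D w $ k * ?D w $ l)) = indicator A w * ((eta w *v ?D w) \<bullet> (?f w *v (eta w *v ?D w)))"
   unfolding inner_matrix_quad Y_def by (simp only: sum_distrib_left mult.assoc)
  moreover have "(\<Sum>k\<in>UNIV. \<Sum>l\<in>UNIV. (if k = l then y - v else 0) * Y k l w) = indicator A w * ((y - v) * quad_trace (?f w) (eta w))"
  proof -
   have "(\<Sum>k\<in>UNIV. \<Sum>l\<in>UNIV. (if k = l then y - v else 0) * Y k l w) = (\<Sum>k\<in>UNIV. (y - v) * Y k k w)"
    by (simp add: if_distrib[of "\<lambda>x. x * _"] sum.delta cong: if_cong)
   then show ?thesis
    unfolding Y_def quad_trace_def trace_def by (simp add: sum_distrib_left mult.left_commute)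
  qed
  ultimately show ?thesis by (simp add: sum_subtractf right_diff_distrib)
 qed
 ultimately show ?thesis by simp
qed

end

lemma set_integral_Icc_split:
 fixes g :: "real => 'b::{banach, second_countable_topology}"
 assumes "a \<le> v" "v \<le> l" "set_integrable lborel {a..l} g"
 shows "(LINT u:{a..l}|lborel. g u) = (LINT u:{a..v}|lborel. g u) + (LINT u:{v..l}|lborel. g u)"
proof -
 have "{a..l} = {a..v} \<union> {v..l}" using assms by auto
 moreover have "AE x in lborel. \<not> (x \<in> {a..v} \<and> x \<in> {v..l})"
  using AE_lborel_singleton[of v] by eventually_elim auto
 moreover have "set_integrable lborel {a..v} g" "set_integrable lborel {v..l} g"
  using assms by (auto intro: set_integrable_subset)
 ultimately show ?thesis by (simp add: set_integral_Un_AE)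
qed

text \<open>Increments that are uniformly \<open>o(l - v)\<close> force derivative 0. This takes the
  place of summing the step errors over a partition and refining it.\<close>

lemma constant_of_small_increments:
 fixes G :: "real => real"
 assumes "a \<le> c"
  and inc: "!!eps. eps > 0 ==> \<exists>K\<ge>0. \<forall>v l. a \<le> v --> v < l --> l \<le> c --> \<bar>G l - G v\<bar> \<le> eps * (l - v) + K * (l - v)^2"
 shows "G c = G a"
proof -
 have "(G has_field_derivative 0) (at x within {a..c})" if x: "x \<in> {a..c}" for x
  unfolding has_field_derivative_iff Lim_within
 proof (intro allI impI)
  fix e :: real assume e: "e > 0"
  obtain K where K: "K \<ge> 0" "\<forall>v l. a \<le> v --> v < l --> l \<le> c --> \<bar>G l - G v\<bar> \<le> (e / 2) * (l - v) + K * (l - v)^2"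
   using inc[of "e / 2"] e by auto
  have G: "\<bar>G y - G x\<bar> \<le> (e / 2) * \<bar>y - x\<bar> + K * \<bar>y - x\<bar>^2" if "y \<in> {a..c}" "y \<noteq> x" for y
  proof (cases "x < y")
   case True
   then show ?thesis using K(2)[rule_format, of x y] x that by auto
  next
   case False
   then have "\<bar>G x - G y\<bar> \<le> (e / 2) * (x - y) + K * (x - y)^2"
    using K(2)[rule_format, of y x] x that by auto
   then show ?thesis using False by (simp add: abs_minus_commute power2_commute)
  qed
  show "\<exists>d>0. \<forall>y\<in>{a..c}. 0 < dist y x \<and> dist y x < d --> dist ((G y - G x) / (y - x)) 0 < e"
  \<comment> \<open>Below this distance the quadratic error contributes less than
    \<open>e / 2\<close> to the quotient; the other half comes from the choice of \<open>eps\<close>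
    above.\<close>
  proof (intro exI[of _ "e / (2 * (K + 1))"] conjI ballI impI)
   show "0 < e / (2 * (K + 1))" using e K by auto
   fix y assume y: "y \<in> {a..c}" and d: "0 < dist y x \<and> dist y x < e / (2 * (K + 1))"
   define t where "t = \<bar>y - x\<bar>"
   have t: "t > 0" "t < e / (2 * (K + 1))" using d by (auto simp: t_def dist_norm)
   have "K * t \<le> (K + 1) * t" using t by simp
   also have "... < (K + 1) * (e / (2 * (K + 1)))" using t K by (intro mult_strict_left_mono) auto
   also have "... = e / 2"
   proof -
    have "K + 1 \<noteq> 0" using K(1) by simp
    then show ?thesis by (simp add: field_simps)
   qed
   finally have kt: "K * t < e / 2" .
   have "y \<noteq> x" using t(1) by (auto simp: t_def)
   have "\<bar>G y - G x\<bar> \<le> (e / 2 + K * t) * t"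
    using G[OF y \<open>y \<noteq> x\<close>] by (simp add: t_def[symmetric] power2_eq_square algebra_simps)
   also have "... < e * t" using kt t by (intro mult_strict_right_mono) auto
   finally have "\<bar>G y - G x\<bar> / t < e" using t by (simp add: divide_less_eq)
   then show "dist ((G y - G x) / (y - x)) 0 < e" by (simp add: t_def abs_divide)
  qed
 qed
 then obtain k where "!!x. x \<in> {a..c} ==> G x = k"
  using has_field_derivative_zero_constant[of "{a..c}" G] by auto
 then show ?thesis using assms(1) by auto
qed

section \<open>Pathwise expansion over one time step\<close>

context ito_cell
begin

definition Phi :: "real => 'w => real" where
 "Phi v w = phis v w"

definition HH :: "real => 'w => real" where
 "HH u w = H (Z u w) (Q u w) u (r u w) (b u w) (eta w)"

text \<open>The state is frozen at the start \<open>v\<close> of the step while the drift is that of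
  time \<open>u\<close>. With frozen derivatives the integral of \<open>H0\<close> is exactly the
  drift part of the Taylor expansion.\<close>

definition H0 :: "real => real => 'w => real" where
 "H0 v u w = H (Z v w) (Q v w) v (r v w) (b u w) (eta w)"

definition J :: "real => real => 'w => real" where
 "J v l w = (if r l w = r v w then 0 else 1)"

definition nB :: "real => real => 'w => real" where
 "nB v l w = norm (B l w - B v w)"

text \<open>Large enough for both estimates of \<open>step_sizes\<close>: the first needs
  \<open>1 + L^2 + 2 * L\<close>, the second \<open>1 + L^2 + L + 2 * L^2 * T\<close>, where a step
  is at most \<open>T\<close>.\<close>

definition c1 :: real where "c1 = 1 + L^2 + 2 * L + 2 * L^2 * T"

lemma c1: "c1 \<ge> 1" "c1 \<ge> 0"
 using L T by (auto simp: c1_def)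

lemma step_sizes:
 assumes w: "w \<in> space M" and v: "a \<le> v" "v \<le> l" "l \<le> c"
 defines "d \<equiv> (LINT u:{v..l}|lborel. b u w)" and "\<kappa> \<equiv> (LINT u:{v..l}|lborel. (norm (eta w))^2 + norm (b u w))"
 shows "0 \<le> \<kappa>" "(l - v) + \<kappa> + norm d \<le> c1 * (l - v)" "2 * (norm d)^2 + \<kappa> + (l - v) \<le> c1 * (l - v)"
  "norm (eta w *v (B l w - B v w)) \<le> L * nB v l w"
proof -
 have d: "norm d \<le> L * (l - v)" unfolding d_def by (rule drift_le) (use assms in auto)
 show k: "0 \<le> \<kappa>" unfolding \<kappa>_def by (rule speed_bounds) (use assms in auto)
 have k2: "\<kappa> \<le> (L^2 + L) * (l - v)" unfolding \<kappa>_def by (rule speed_bounds) (use assms in auto)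
 have h: "0 \<le> l - v" "l - v \<le> T" using v ac by auto
 have p: "0 \<le> (2 * L^2 * T) * (l - v)" "0 \<le> (2 * L) * (l - v)" using L T h by (auto intro!: mult_nonneg_nonneg)
 show "(l - v) + \<kappa> + norm d \<le> c1 * (l - v)"
  using d k2 p by (simp add: c1_def algebra_simps)
 have "(norm d)^2 \<le> (L * (l - v))^2" using d by (intro power_mono) auto
 also have "... = (L^2 * (l - v)) * (l - v)" by (simp add: power2_eq_square)
 also have "... \<le> (L^2 * T) * (l - v)" using h by (intro mult_right_mono mult_left_mono) auto
 finally have "2 * (norm d)^2 \<le> (2 * L^2 * T) * (l - v)" by simp
 then show "2 * (norm d)^2 + \<kappa> + (l - v) \<le> c1 * (l - v)"
  using k2 p by (simp add: c1_def algebra_simps)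
 have "norm (eta w *v (B l w - B v w)) \<le> norm (eta w) * norm (B l w - B v w)" by (rule norm_matrix_vector_le)
 also have "... \<le> L * nB v l w" unfolding nB_def by (intro mult_right_mono eta_bound w) auto
 finally show "norm (eta w *v (B l w - B v w)) \<le> L * nB v l w" .
qed

lemma state_distance:
 assumes w: "w \<in> space M" and v: "a \<le> v" "v \<le> l" "l \<le> c"
 shows "(norm (Z l w - Z v w))^2 + \<bar>Q l w - Q v w\<bar> + \<bar>l - v\<bar> \<le> 2 * L^2 * (nB v l w)^2 + c1 * (l - v)"
proof -
 let ?d = "LINT u:{v..l}|lborel. b u w" and ?\<kappa> = "LINT u:{v..l}|lborel. (norm (eta w))^2 + norm (b u w)"
 let ?x = "eta w *v (B l w - B v w)"
 note s = step_sizes[OF assms]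
 have Z: "Z l w - Z v w = ?d + ?x" using Z_incr[OF assms] by (simp add: algebra_simps)
 have Qe: "\<bar>Q l w - Q v w\<bar> = ?\<kappa>" using Q_incr[OF assms] s(1) by simp
 have "(norm (?d + ?x))^2 \<le> (norm ?d + norm ?x)^2" by (intro power_mono norm_triangle_ineq) auto
 also have "... \<le> 2 * (norm ?d)^2 + 2 * (norm ?x)^2"
  using sum_squares_bound[of "norm ?d" "norm ?x"] by (simp add: power2_sum)
 finally have 1: "(norm (?d + ?x))^2 \<le> 2 * (norm ?d)^2 + 2 * (norm ?x)^2" .
 have "(norm ?x)^2 \<le> (L * nB v l w)^2" using s(4) by (intro power_mono) auto
 then have 2: "2 * (norm ?x)^2 \<le> 2 * L^2 * (nB v l w)^2" by (simp add: power_mult_distrib)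
 have 3: "\<bar>l - v\<bar> = l - v" using v by simp
 show ?thesis unfolding Z Qe 3 using 1 2 s(3) by linarith
qed

text \<open>For a frozen state \<open>H\<close> is affine in \<open>b\<close> and in the speed of
  \<open>Q\<close>, so integration in time produces precisely the increments called \<open>d\<close>
  and \<open>\<kappa>\<close> in \<open>taylor\<close>.\<close>

lemma H0_integral:
 assumes w: "w \<in> space M" and v: "v \<le> l"
 shows "(LINT u:{v..l}|lborel. H0 v u w) =
  phisz v w \<bullet> (LINT u:{v..l}|lborel. b u w)
  + (l - v) * (1/2 * quad_trace (phiszz v w) (eta w))
  + phit (Z v w) (Q v w) v (r v w) * (l - v)
  + phiq (Z v w) (Q v w) v (r v w) * (LINT u:{v..l}|lborel. (norm (eta w))^2 + norm (b u w))
  + (l - v) * (sw v w)"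
proof -
 let ?I = "{v..l}"
 let ?p = "phisz v w" and ?q = "phiq (Z v w) (Q v w) v (r v w)"
 define k where "k = 1/2 * quad_trace (phiszz v w) (eta w) + phit (Z v w) (Q v w) v (r v w)
   + (sw v w)"
 have bi: "integrable lborel (\<lambda>u. indicator ?I u *\<^sub>R b u w)" using b_int[OF w] by (simp add: set_integrable_def)
 have i1: "set_integrable lborel ?I (\<lambda>u. ?p \<bullet> b u w)"
  using integrable_inner_right[OF bi, of ?p] by (simp add: set_integrable_def)
 have ik: "set_integrable lborel ?I (\<lambda>u. k :: real)" for k
  by (auto simp: set_integrable_def emeasure_lborel_Icc_eq intro!: integrable_mult_left integrable_real_indicator)
 have "set_integrable lborel ?I (\<lambda>u. norm (b u w))"
  using integrable_norm[OF bi] by (simp add: set_integrable_def)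
 then have i3: "set_integrable lborel ?I (\<lambda>u. (norm (eta w))^2 + norm (b u w))"
  by (intro set_integral_add ik)
 then have i2: "set_integrable lborel ?I (\<lambda>u. ?q * ((norm (eta w))^2 + norm (b u w)))"
  by simp
 have "H0 v u w = ?p \<bullet> b u w + (k + ?q * ((norm (eta w))^2 + norm (b u w)))" for u
  unfolding H0_def H_def k_def by simp
 then have "(LINT u:?I|lborel. H0 v u w) = (LINT u:?I|lborel. ?p \<bullet> b u w + (k + ?q * ((norm (eta w))^2 + norm (b u w))))"
  by simp
 also have "... = (LINT u:?I|lborel. ?p \<bullet> b u w) + ((LINT u:?I|lborel. k) + (LINT u:?I|lborel. ?q * ((norm (eta w))^2 + norm (b u w))))"
  using i1 i2 ik by (simp add: set_integral_add)
 also have "(LINT u:?I|lborel. ?p \<bullet> b u w) = ?p \<bullet> (LINT u:?I|lborel. b u w)"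
  using integral_inner_right[of ?p lborel "\<lambda>u. indicator ?I u *\<^sub>R b u w"] bi by (simp add: set_lebesgue_integral_def)
 also have "(LINT u:?I|lborel. k) = k * (l - v)" using v by (simp add: set_lebesgue_integral_def)
 also have "(LINT u:?I|lborel. ?q * ((norm (eta w))^2 + norm (b u w))) = ?q * (LINT u:?I|lborel. (norm (eta w))^2 + norm (b u w))"
  by simp
 finally show ?thesis by (simp add: k_def algebra_simps)
qed

end

context ito_cell
begin

text \<open>Ito's formula up to an error of order \<open>o(h)\<close> in mean: the first-order, second-order and jump terms
 are kept, all else is dominated by powers of the increments of \<open>B\<close>.\<close>

lemma path_step:
 assumes "eps > 0"
 obtains K where "K \<ge> 0"
  "!!w v y. w \<in> space M ==> a \<le> v ==> v < y ==> y \<le> c ==>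
   \<bar>Phi y w - Phi v w - (LINT u:{v..y}|lborel. H0 v u w)
    - (mart1 v y w
     + 1/2 * (mart2 v y w)
     + (mart3 v y w))\<bar>
   \<le> eps * ((y - v) + (nB v y w)^2 + J v y w) + K * ((y - v)^2 + (nB v y w)^4 + (y - v) * J v y w)"
proof -
 \<comment> \<open>The denominator collects the weights of \<open>eps1\<close> in the remainders
   \<open>R1\<close> and \<open>R2\<close>: \<open>c1\<close> on \<open>h\<close>,
   \<open>L^2\<close> on \<open>n^2\<close> and 3 on \<open>j\<close>.\<close>
 define eps1 where "eps1 = eps / (c1 + L^2 + 3)"
 have den: "c1 + L^2 + 3 > 0" using c1 zero_le_power2[of L] by linarith
 have e1: "eps1 > 0" "eps1 * (c1 + L^2 + 3) = eps" using assms den by (auto simp: eps1_def)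
 obtain K1 where K1: "K1 \<ge> 0" and K1m: "modulus eps1 K1" using modulus_exists[OF e1(1)] by blast
 note taylor' = taylor[OF K1m K1] and modulus' = modulusD(1)[OF K1m]
 define k where "k = 4 * K1 * L^2"
 have k0: "k \<ge> 0" using K1 by (simp add: k_def)
 define K where "K = K1 * (2 * c1 * L^2 + c1^2 + L^4) + k^2 / (4 * eps1) + 2 * K1 * c1"
 have K: "K \<ge> 0" unfolding K_def using K1 K1 c1 e1 by (intro add_nonneg_nonneg mult_nonneg_nonneg) auto
 show ?thesis
 proof (rule that[OF K])
  fix w v y assume w: "w \<in> space M" and vw: "a \<le> v" "v < y" "y \<le> c"
  have vw': "v \<le> y" "v \<in> {a..c}" "y \<in> {a..c}" using vw by auto
  define h where "h = y - v"
  define n where "n = nB v y w"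
  define j where "j = J v y w"
  define d where "d = (LINT u:{v..y}|lborel. b u w)"
  define \<kappa> where "\<kappa> = (LINT u:{v..y}|lborel. (norm (eta w))^2 + norm (b u w))"
  define x where "x = eta w *v (B y w - B v w)"
  define z where "z = Z v w"
  define q where "q = Q v w"
  define i where "i = r v w"
  define i' where "i' = r y w"
  have h: "0 \<le> h" "0 \<le> n" "j = 0 \<or> j = 1" using vw by (auto simp: h_def n_def nB_def j_def J_def)
  have w_eq: "y = v + h" by (simp add: h_def)
  have Zw: "Z y w = z + x + d" using Z_incr[OF w vw(1) vw'(1) vw(3)] by (simp add: z_def x_def d_def algebra_simps)
  have Qw: "Q y w = q + \<kappa>" using Q_incr[OF w vw(1) vw'(1) vw(3)] by (simp add: q_def \<kappa>_def)
  have i: "i \<in> S" "i' \<in> S" unfolding i_def i'_def using r_in_S[OF w] in_T vw' by auto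
  have q0: "0 \<le> q" "0 \<le> q + \<kappa>" using Q_nonneg[OF vw'(2) w] Q_nonneg[OF vw'(3) w] Qw by (auto simp: q_def)
  have t: "v \<in> {0..T}" "y \<in> {0..T}" "0 \<le> v" "v + h \<le> T" using in_T vw' by (auto simp: h_def)
  note ss = step_sizes[OF w vw(1) vw'(1) vw(3), folded d_def \<kappa>_def x_def h_def n_def]
  have x2: "(norm x)^2 \<le> L^2 * n^2" using power_mono[OF ss(4), of 2] by (simp add: power_mult_distrib)
  have R1: "\<bar>taylor_rest i z x d q \<kappa> v h\<bar>
   \<le> eps1 * (c1 * h + L^2 * n^2) + K1 * (2 * c1 * L^2 + c1^2 + L^4) * (h^2 + n^4)"
  proof -
   have "taylor_bound eps1 K1 x d \<kappa> h
    \<le> (c1 * h) * (eps1 + K1 * (2 * (L^2 * n^2) + c1 * h)) + (L^2 * n^2) * (eps1 + K1 * (L^2 * n^2))"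
   proof (rule add_mono)
    have "2 * (norm x)^2 + 2 * (norm d)^2 + \<kappa> + h \<le> 2 * (L^2 * n^2) + c1 * h" using x2 ss(3) by linarith
    then have e: "eps1 + K1 * (2 * (norm x)^2 + 2 * (norm d)^2 + \<kappa> + h) \<le> eps1 + K1 * (2 * (L^2 * n^2) + c1 * h)"
     by (intro add_left_mono mult_left_mono K1)
    show "(h + \<kappa> + norm d) * (eps1 + K1 * (2 * (norm x)^2 + 2 * (norm d)^2 + \<kappa> + h))
      \<le> (c1 * h) * (eps1 + K1 * (2 * (L^2 * n^2) + c1 * h))"
     by (rule mult_mono[OF ss(2) e]) (use e1 K1 ss(1) h c1 in auto)
    show "(norm x)^2 * (eps1 + K1 * (norm x)^2) \<le> (L^2 * n^2) * (eps1 + K1 * (L^2 * n^2))"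
     by (rule mult_mono[OF x2 add_left_mono[OF mult_left_mono[OF x2 K1]]]) (use e1 K1 in auto)
   qed
   also have "... = eps1 * (c1 * h + L^2 * n^2) + K1 * (2 * c1 * L^2 * (h * n^2) + c1^2 * h^2 + L^4 * n^4)"
    by (simp add: algebra_simps power2_eq_square power4_eq_xxxx)
   also have "... \<le> eps1 * (c1 * h + L^2 * n^2) + K1 * (2 * c1 * L^2 * (h^2 + n^4) + c1^2 * (h^2 + n^4) + L^4 * (h^2 + n^4))"
   proof (intro add_mono mult_left_mono order_refl)
    have "0 \<le> (h - n^2)^2" "0 \<le> h^2" "0 \<le> n^4" by auto
    then have "2 * (h * n^2) \<le> h^2 + n^4" by (simp add: power2_diff)
    moreover have "0 \<le> h * n^2" using h by simp
    ultimately show "h * n^2 \<le> h^2 + n^4" by linarith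
   qed (use K1 c1 e1 in auto)
   also have "... = eps1 * (c1 * h + L^2 * n^2) + K1 * (2 * c1 * L^2 + c1^2 + L^4) * (h^2 + n^4)"
    by (simp add: algebra_simps)
   finally show ?thesis
    using taylor'[OF i(1) q0(1) ss(1) t(3) h(1) t(4), of z x d] by linarith
  qed
  \<comment> \<open>The mixed effect of chain and diffusion: the increment in the other arguments is
    compared for the old and the new state. It vanishes unless the state changes, and then both
    increments are small by the modulus.\<close>
  have R2: "\<bar>(phi (z + x + d) (q + \<kappa>) y i' - phi z q v i') - (phi (z + x + d) (q + \<kappa>) y i - phi z q v i)\<bar>
   \<le> 3 * eps1 * j + k^2 / (4 * eps1) * n^4 + 2 * K1 * c1 * (h * j)"
  proof (cases "i' = i")
   case True
   have "0 \<le> 3 * eps1 * j + k^2 / (4 * eps1) * n^4 + 2 * K1 * c1 * (h * j)"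
    using e1 K1 c1 h by (intro add_nonneg_nonneg mult_nonneg_nonneg) auto
   then show ?thesis using True by simp
  next
   case False
   then have j1: "j = 1" by (simp add: j_def J_def i_def i'_def)
   have D: "\<bar>phi (z + x + d) (q + \<kappa>) y l - phi z q v l\<bar> \<le> eps1 + K1 * (2 * L^2 * n^2 + c1 * h)" if l: "l \<in> S" for l
   proof -
    have "K1 * ((norm (z + x + d - z))^2 + \<bar>q + \<kappa> - q\<bar> + \<bar>y - v\<bar>) \<le> K1 * (2 * L^2 * n^2 + c1 * h)"
     using state_distance[OF w vw(1) vw'(1) vw(3)] unfolding Zw Qw z_def[symmetric] q_def[symmetric] h_def[symmetric] n_def[symmetric]
     by (rule mult_left_mono) (rule K1)
    then show ?thesis using modulus'[OF l q0 t(1,2), of "z + x + d" z] by linarith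
   qed
   have "\<bar>(phi (z + x + d) (q + \<kappa>) y i' - phi z q v i') - (phi (z + x + d) (q + \<kappa>) y i - phi z q v i)\<bar>
     \<le> 2 * (eps1 + K1 * (2 * L^2 * n^2 + c1 * h))"
   proof -
    have gen: "\<bar>s - t\<bar> \<le> 2 * e" if "\<bar>s\<bar> \<le> e" "\<bar>t\<bar> \<le> e" for s t e :: real using that by linarith
    show ?thesis by (rule gen[OF D[OF i(2)] D[OF i(1)]])
   qed
   also have "... = 2 * eps1 + k * n^2 + 2 * K1 * c1 * h" by (simp add: k_def algebra_simps)
   \<comment> \<open>The product of \<open>n^2\<close> with the jump indicator is split by the
     arithmetic-geometric mean, so that only means of the indicator and of \<open>n^4\<close> are
     required and no joint law of chain and Brownian motion.\<close>
   also have "k * n^2 \<le> eps1 + k^2 / (4 * eps1) * n^4"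
   proof -
    have "0 \<le> (eps1 - k * n^2 / 2)^2" by simp
    then have "eps1 * (k * n^2) \<le> eps1 * eps1 + k^2 * n^4 / 4"
     by (simp add: power2_diff power2_eq_square power4_eq_xxxx algebra_simps)
    then have "k * n^2 \<le> (eps1 * eps1 + k^2 * n^4 / 4) / eps1"
     using e1(1) by (subst pos_le_divide_eq) (simp_all add: mult.commute)
    also have "... = eps1 + k^2 / (4 * eps1) * n^4" using e1(1) by (simp add: field_simps)
    finally show ?thesis .
   qed
   finally show ?thesis using j1 by simp
  qed
  have H0: "(LINT u:{v..y}|lborel. H0 v u w) = phiz z q v i \<bullet> d + h * (1/2 * quad_trace (phizz z q v i) (eta w))
    + phit z q v i * h + phiq z q v i * \<kappa> + h * (\<Sum>j\<in>S. \<Gamma> i j * phi z q v j)"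
   using H0_integral[OF w vw'(1)] unfolding z_def q_def i_def h_def d_def \<kappa>_def .
  have Ph: "Phi y w = phi (z + x + d) (q + \<kappa>) y i'" "Phi v w = phi z q v i"
   unfolding Phi_def Zw Qw by (simp_all add: i_def i'_def z_def q_def)
  have comb: "\<bar>P' - P0 - (e1 + h * (1/2 * tr) + e2 + e3 + h * sm) - (f1 + 1/2 * (qd - h * tr) + (P1 - P0 - h * sm))\<bar> \<le> x1 + x2"
   if "\<bar>P2 - P0 - (f + 1/2 * qd + e3 + e2)\<bar> \<le> x1" "\<bar>(P' - P1) - (P2 - P0)\<bar> \<le> x2" "f = f1 + e1"
   for P' P0 P1 P2 e1 tr e2 e3 sm f1 qd f x1 x2 :: real
   using that by (simp add: right_diff_distrib)
  have "\<bar>Phi y w - Phi v w - (LINT u:{v..y}|lborel. H0 v u w)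
    - (phiz z q v i \<bullet> x + 1/2 * (x \<bullet> (phizz z q v i *v x) - h * quad_trace (phizz z q v i) (eta w))
     + (phi z q v i' - phi z q v i - h * (\<Sum>j\<in>S. \<Gamma> i j * phi z q v j)))\<bar>
   \<le> (eps1 * (c1 * h + L^2 * n^2) + K1 * (2 * c1 * L^2 + c1^2 + L^4) * (h^2 + n^4))
    + (3 * eps1 * j + k^2 / (4 * eps1) * n^4 + 2 * K1 * c1 * (h * j))"
   unfolding H0 Ph by (rule comb[OF R1[folded w_eq] R2]) (simp add: inner_add_right)
  also have "... \<le> eps * (h + n^2 + j) + K * (h^2 + n^4 + h * j)"
  proof -
   have "eps1 * (c1 * h + L^2 * n^2) + 3 * eps1 * j = eps1 * (c1 * h + L^2 * n^2 + 3 * j)" by (simp add: algebra_simps)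
   also have "... \<le> eps1 * ((c1 + L^2 + 3) * (h + n^2 + j))"
   proof (rule mult_left_mono)
    have "0 \<le> c1 * (n^2 + j) + L^2 * (h + j) + 3 * (h + n^2)" using c1 h by (intro add_nonneg_nonneg mult_nonneg_nonneg) auto
    then show "c1 * h + L^2 * n^2 + 3 * j \<le> (c1 + L^2 + 3) * (h + n^2 + j)" by (simp add: algebra_simps)
   qed (use e1 in auto)
   also have "... = eps * (h + n^2 + j)" unfolding mult.assoc[symmetric] e1(2) ..
   finally have E: "eps1 * (c1 * h + L^2 * n^2) + 3 * eps1 * j \<le> eps * (h + n^2 + j)" .
   define k1 k2 k3 where "k1 = K1 * (2 * c1 * L^2 + c1^2 + L^4)" and "k2 = k^2 / (4 * eps1)" and "k3 = 2 * K1 * c1"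
   have kk: "0 \<le> k1" "0 \<le> k2" "0 \<le> k3" unfolding k1_def k2_def k3_def using K1 K1 c1 e1 by (auto intro!: mult_nonneg_nonneg add_nonneg_nonneg)
   have "0 \<le> k1 * (h * j) + k2 * (h^2 + h * j) + k3 * (h^2 + n^4)" using kk h by (intro add_nonneg_nonneg mult_nonneg_nonneg) auto
   then have "k1 * (h^2 + n^4) + k2 * n^4 + k3 * (h * j) \<le> (k1 + k2 + k3) * (h^2 + n^4 + h * j)"
    by (simp add: algebra_simps)
   then show ?thesis using E unfolding K_def k1_def[symmetric] k2_def[symmetric] k3_def[symmetric] by linarith
  qed
  finally show "\<bar>Phi y w - Phi v w - (LINT u:{v..y}|lborel. H0 v u w)
    - (mart1 v y w
     + 1/2 * (mart2 v y w)
     + (mart3 v y w))\<bar>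
   \<le> eps * ((y - v) + (nB v y w)^2 + J v y w) + K * ((y - v)^2 + (nB v y w)^4 + (y - v) * J v y w)"
   unfolding z_def q_def i_def i'_def x_def n_def h_def j_def .
 qed
qed

end

lemma (in prob_space) abs_expectation_mono:
 fixes Y R :: "'a => real"
 assumes "integrable M R" "!!w. w \<in> space M ==> \<bar>Y w\<bar> \<le> R w"
 shows "\<bar>LINT w|M. Y w\<bar> \<le> (LINT w|M. R w)"
proof -
 have "\<bar>LINT w|M. Y w\<bar> \<le> (LINT w|M. \<bar>Y w\<bar>)" by (rule integral_abs_bound)
 also have "... \<le> (LINT w|M. R w)"
 proof (rule integral_mono'[OF assms])
  show "0 \<le> R w" if "w \<in> space M" for w using assms(2)[OF that] by linarith
 qed
 finally show ?thesis .
qed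

lemma (in prob_space) expectation_time_integral:
 fixes g :: "real => 'a => real"
 assumes gm: "(\<lambda>x. g (fst x) (snd x)) \<in> borel_measurable (borel \<Otimes>\<^sub>M M)"
  and bd: "!!u w. u \<in> {v..y} ==> w \<in> space M ==> \<bar>g u w\<bar> \<le> K"
 shows "integrable M (\<lambda>w. LINT u:{v..y}|lborel. g u w)"
  and "(LINT w|M. (LINT u:{v..y}|lborel. g u w)) = (LINT u:{v..y}|lborel. (LINT w|M. g u w))"
proof -
 interpret P: pair_sigma_finite lborel M ..
 let ?f = "\<lambda>u w. indicator {v..y} u *\<^sub>R g u w"
 have [measurable]: "(\<lambda>x. g (fst x) (snd x)) \<in> borel_measurable (lborel \<Otimes>\<^sub>M M)"
  using gm by (simp add: measurable_cong_sets[OF sets_pair_measure_cong[OF sets_lborel refl] refl])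
 have int: "integrable (lborel \<Otimes>\<^sub>M M) (case_prod ?f)"
 proof (rule integrableI_bounded_set[where A = "{v..y} \<times> space M" and B = K])
  show "{v..y} \<times> space M \<in> sets (lborel \<Otimes>\<^sub>M M)" by auto
  show "case_prod ?f \<in> borel_measurable (lborel \<Otimes>\<^sub>M M)" unfolding case_prod_beta' by measurable
  show "emeasure (lborel \<Otimes>\<^sub>M M) ({v..y} \<times> space M) < \<infinity>"
   by (subst emeasure_pair_measure_Times) (auto simp: emeasure_lborel_Icc_eq emeasure_space_1 ennreal_mult_less_top)
  show "AE x in lborel \<Otimes>\<^sub>M M. x \<in> {v..y} \<times> space M --> norm (case_prod ?f x) \<le> K"
   using bd by (intro AE_I2) (auto simp: case_prod_beta')
  show "AE x in lborel \<Otimes>\<^sub>M M. x \<notin> {v..y} \<times> space M --> case_prod ?f x = 0"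
   by (intro AE_I2) (auto simp: case_prod_beta' space_pair_measure indicator_def)
 qed
 show "integrable M (\<lambda>w. LINT u:{v..y}|lborel. g u w)"
  unfolding set_lebesgue_integral_def by (rule P.integrable_snd[OF int])
 show "(LINT w|M. (LINT u:{v..y}|lborel. g u w)) = (LINT u:{v..y}|lborel. (LINT w|M. g u w))"
  unfolding set_lebesgue_integral_def by (subst P.Fubini_integral[OF int]) simp
qed

lemma (in filtered_prob) joint_F_M:
 assumes "0 \<le> t" "f \<in> measurable (borel \<Otimes>\<^sub>M F t) K"
 shows "f \<in> measurable (borel \<Otimes>\<^sub>M M) K"
proof (rule measurable_compose[of "\<lambda>x. x"])
 have "(\<lambda>x. x) \<in> measurable M (F t)"
  using subalg[OF assms(1)] by (intro measurableI) (auto simp: subalgebra_def)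
 then have "(\<lambda>x. (fst x, snd x)) \<in> measurable (borel \<Otimes>\<^sub>M M) (borel \<Otimes>\<^sub>M F t)"
  by (intro measurable_Pair measurable_fst measurable_compose[OF measurable_snd])
 then show "(\<lambda>x. x) \<in> measurable (borel \<Otimes>\<^sub>M M) (borel \<Otimes>\<^sub>M F t)" by simp
qed (rule assms)

section \<open>Moments of the step errors and measurability of the drift\<close>

context ito_cell
begin

lemma nB_moments:
 assumes "a \<le> v" "v \<le> y" "y \<le> c"
 shows "integrable M (\<lambda>w. (nB v y w)^2)" "(LINT w|M. (nB v y w)^2) \<le> real CARD('m) * (y - v)"
  and "integrable M (\<lambda>w. (nB v y w)^4)" "(LINT w|M. (nB v y w)^4) \<le> 3 * (real CARD('m))^2 * (y - v)^2"
proof -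
 have "integrable M (\<lambda>w. (nB v y w)^2) \<and> (LINT w|M. (nB v y w)^2) \<le> real CARD('m) * (y - v)
  \<and> integrable M (\<lambda>w. (nB v y w)^4) \<and> (LINT w|M. (nB v y w)^4) \<le> 3 * (real CARD('m))^2 * (y - v)^2"
 proof (cases "v = y")
  case False
  then have vw: "0 \<le> v" "v < y" using assms ac by auto
  have "has_bochner_integral M (\<lambda>w. (B y w - B v w) $ k * (B y w - B v w) $ k) (y - v)" for k
   using increment_moments(2)[OF vw, of k k] by (simp only: simp_thms if_True)
  then have "has_bochner_integral M (\<lambda>w. \<Sum>k\<in>UNIV. (B y w - B v w) $ k * (B y w - B v w) $ k) (\<Sum>k\<in>(UNIV::'m set). y - v)"
   by (rule has_bochner_integral_sum)
  moreover have "(\<Sum>k\<in>UNIV. (B y w - B v w) $ k * (B y w - B v w) $ k) = (nB v y w)^2" for w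
   unfolding nB_def power2_norm_eq_inner inner_vec_def by simp
  ultimately show ?thesis
   using increment_norm4[OF vw] unfolding nB_def by (auto simp: has_bochner_integral_iff)
 qed (simp add: nB_def)
 then show "integrable M (\<lambda>w. (nB v y w)^2)" "(LINT w|M. (nB v y w)^2) \<le> real CARD('m) * (y - v)"
  "integrable M (\<lambda>w. (nB v y w)^4)" "(LINT w|M. (nB v y w)^4) \<le> 3 * (real CARD('m))^2 * (y - v)^2"
  by auto
qed

lemma J_moment:
 "\<exists>K\<ge>0. \<forall>v y. a \<le> v --> v \<le> y --> y \<le> c --> integrable M (J v y) \<and> (LINT w|M. J v y w) \<le> K * (y - v)"
proof -
 obtain K where K: "K \<ge> 0" "\<forall>v\<ge>0. \<forall>h\<ge>0. measure M {w\<in>space M. r (v + h) w \<noteq> r v w} \<le> K * h"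
  using jump_prob by blast
 show ?thesis
 proof (intro exI[of _ K] conjI K(1) allI impI)
  fix v y assume vw: "a \<le> v" "v \<le> y" "y \<le> c"
  have v0: "0 \<le> v" "0 \<le> y" using vw ac by auto
  have [measurable]: "r v \<in> measurable M (count_space UNIV)" "r y \<in> measurable M (count_space UNIV)"
   using r_meas v0 by auto
  have e: "J v y w = indicator {w\<in>space M. r y w \<noteq> r v w} w" if "w \<in> space M" for w
   using that by (auto simp: J_def indicator_def)
  have s: "{w\<in>space M. r y w \<noteq> r v w} \<in> events" by measurable
  have "has_bochner_integral M (\<lambda>w. indicator {w\<in>space M. r y w \<noteq> r v w} w :: real) (prob {w\<in>space M. r y w \<noteq> r v w})"
   by (rule has_bochner_integral_real_indicator[OF s]) (simp add: less_top[symmetric])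
  then have "has_bochner_integral M (J v y) (prob {w\<in>space M. r y w \<noteq> r v w})"
   by (subst has_bochner_integral_cong[OF refl e refl])
  then show "integrable M (J v y)" "(LINT w|M. J v y w) \<le> K * (y - v)"
   using K(2)[rule_format, of v "y - v"] v0 vw by (auto simp: has_bochner_integral_iff)
 qed
qed

definition kl :: "real => real" where "kl u = max a (min c u)"

lemma kl: "kl u \<in> {a..c}" "u \<in> {a..c} ==> kl u = u"
 using ac by (auto simp: kl_def)

lemma kl_joint: "(\<lambda>x. (kl (fst x), snd x)) \<in> measurable (borel \<Otimes>\<^sub>M M) (borel \<Otimes>\<^sub>M M)"
 unfolding kl_def by measurable

lemma r_kl_joint: "(\<lambda>x. r (kl (fst x)) (snd x)) \<in> measurable (borel \<Otimes>\<^sub>M M) (count_space UNIV)"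
proof -
 have "(\<lambda>x. r (clip T (fst x)) (snd x)) \<in> measurable (borel \<Otimes>\<^sub>M M) (count_space UNIV)"
  by (rule joint_F_M[OF T r_joint[OF T]])
 from measurable_compose[OF kl_joint this]
 show ?thesis by (simp add: clip_eq[OF in_T(1)[OF kl(1)]])
qed

lemma eta_joint: "(\<lambda>x. eta (snd x)) \<in> borel_measurable (borel \<Otimes>\<^sub>M M)"
 by (rule measurable_compose[OF measurable_snd measurable_F_M[OF ac(1) eta_meas]])

lemma space_joint: "x \<in> space (borel \<Otimes>\<^sub>M M) ==> snd x \<in> space M"
 by (auto simp: space_pair_measure)

lemma HH_joint: "(\<lambda>x. HH (kl (fst x)) (snd x)) \<in> borel_measurable (borel \<Otimes>\<^sub>M M)"
 unfolding HH_def
proof (rule H_measurable)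
 show "(\<lambda>x. Z (kl (fst x)) (snd x)) \<in> borel_measurable (borel \<Otimes>\<^sub>M M)"
  "(\<lambda>x. Q (kl (fst x)) (snd x)) \<in> borel_measurable (borel \<Otimes>\<^sub>M M)"
  "(\<lambda>x. b (kl (fst x)) (snd x)) \<in> borel_measurable (borel \<Otimes>\<^sub>M M)"
  using measurable_compose[OF kl_joint Z_joint] measurable_compose[OF kl_joint Q_joint]
   measurable_compose[OF kl_joint b_joint] by simp_all
 show "(\<lambda>x. kl (fst x)) \<in> borel_measurable (borel \<Otimes>\<^sub>M M)" unfolding kl_def by measurable
 fix x assume "x \<in> space (borel \<Otimes>\<^sub>M M :: (real \<times> 'w) measure)"
 then have x: "snd x \<in> space M" by (rule space_joint)
 show "0 \<le> Q (kl (fst x)) (snd x)" by (rule Q_nonneg[OF kl(1) x])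
 show "kl (fst x) \<in> {0..T}" by (rule in_T(1)[OF kl(1)])
 show "r (kl (fst x)) (snd x) \<in> S" by (rule r_in_S[OF x in_T(2)[OF kl(1)]])
qed (rule r_kl_joint eta_joint)+

lemma H0_joint:
 assumes v: "v \<in> {a..c}"
 shows "(\<lambda>x. H0 v (fst x) (snd x)) \<in> borel_measurable (borel \<Otimes>\<^sub>M M)"
 unfolding H0_def
proof (rule H_measurable)
 have v0: "0 \<le> v" using in_T v by auto
 show "(\<lambda>x. Z v (snd x)) \<in> borel_measurable (borel \<Otimes>\<^sub>M M)" "(\<lambda>x. Q v (snd x)) \<in> borel_measurable (borel \<Otimes>\<^sub>M M)"
  "(\<lambda>x. r v (snd x)) \<in> measurable (borel \<Otimes>\<^sub>M M) (count_space UNIV)"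
  by (rule measurable_compose[OF measurable_snd measurable_F_M[OF v0]], rule Z_ad[OF v] Q_ad[OF v] r_meas_F[OF v0])+
 show "(\<lambda>x::real \<times> 'w. v) \<in> borel_measurable (borel \<Otimes>\<^sub>M M)" by simp
 fix x assume "x \<in> space (borel \<Otimes>\<^sub>M M :: (real \<times> 'w) measure)"
 then have x: "snd x \<in> space M" by (rule space_joint)
 show "0 \<le> Q v (snd x)" by (rule Q_nonneg[OF v x])
 show "v \<in> {0..T}" by (rule in_T(1)[OF v])
 show "r v (snd x) \<in> S" by (rule r_in_S[OF x v0])
qed (rule b_joint eta_joint)+

lemma HH_bound: "u \<in> {a..c} ==> w \<in> space M ==> \<bar>HH u w\<bar> \<le> Hc L * C"
 unfolding HH_def by (rule H_bound[OF r_in_S[OF _ in_T(2)] Q_nonneg in_T(1) b_bound eta_bound])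

lemma H0_bound: "v \<in> {a..c} ==> w \<in> space M ==> \<bar>H0 v u w\<bar> \<le> Hc L * C"
 unfolding H0_def by (rule H_bound[OF r_in_S[OF _ in_T(2)] Q_nonneg in_T(1) b_bound eta_bound])

lemma HH_kl_section:
 assumes w: "w \<in> space M"
 shows "set_integrable lborel {v..y} (\<lambda>u. HH (kl u) w)"
proof -
 have "(\<lambda>u. HH (kl u) w) \<in> borel_measurable borel"
  using measurable_compose[OF measurable_Pair2'[OF w] HH_joint] by simp
 moreover have "\<bar>HH (kl u) w\<bar> \<le> Hc L * C" for u by (rule HH_bound[OF kl(1) w])
 ultimately show ?thesis unfolding set_integrable_def
  by (intro integrableI_bounded_set_indicator[where B = "Hc L * C"]) (auto simp: emeasure_lborel_Icc_eq)
qed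

lemma HH_kl_eq:
 assumes "a \<le> v" "y \<le> c"
 shows "(LINT u:{v..y}|lborel. HH (kl u) w) = (LINT u:{v..y}|lborel. HH u w)"
 by (rule set_lebesgue_integral_cong) (use assms kl(2) in auto)

lemma HH_integral_measurable:
 "integrable M (\<lambda>w. LINT u:{v..y}|lborel. HH (kl u) w)"
 by (rule expectation_time_integral(1)[OF HH_joint]) (rule HH_bound[OF kl(1)])

lemma H0_integral_measurable:
 "v \<in> {a..c} ==> integrable M (\<lambda>w. LINT u:{v..y}|lborel. H0 v u w)"
 by (rule expectation_time_integral(1)[OF H0_joint H0_bound])

end

section \<open>Freezing error and jump term\<close>

context ito_cell
begin

lemma freeze:
 assumes "eps > 0"
 shows "\<exists>K\<ge>0. \<forall>v y. a \<le> v --> v < y --> y \<le> c -->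
  \<bar>LINT w|M. indicator A w * ((LINT u:{v..y}|lborel. H0 v u w) - (LINT u:{v..y}|lborel. HH u w))\<bar>
   \<le> eps * (y - v) + K * (y - v)^2"
proof -
 have HcL: "0 \<le> Hc L" by (rule Hc_nonneg[OF L])
 define eps1 where "eps1 = eps / (Hc L + 1)"
 have e1: "eps1 > 0" "Hc L * eps1 \<le> eps" using assms HcL by (auto simp: eps1_def field_simps)
 obtain K2 where K2: "K2 \<ge> 0" and md: "modulus eps1 K2" using modulus_exists[OF e1(1)] by blast
 obtain Kj where Kj: "Kj \<ge> 0" and Jm: "!!v y. a \<le> v ==> v \<le> y ==> y \<le> c ==> integrable M (J v y) \<and> (LINT w|M. J v y w) \<le> Kj * (y - v)"
  using J_moment by blast
 define K where "K = Hc L * K2 * (2 * L^2 * real CARD('m) + c1) + 2 * (Hc L * C) * Kj"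
 have K: "K \<ge> 0" unfolding K_def using HcL K2 c1 C_nonneg Kj by (intro add_nonneg_nonneg mult_nonneg_nonneg) auto
 show ?thesis
 proof (intro exI[of _ K] conjI K allI impI)
  fix v y assume vw: "a \<le> v" "v < y" "y \<le> c"
  have vI: "v \<in> {a..c}" using vw by auto
  define D where "D u w = indicator A w * (H0 v u w - HH (kl u) w)" for u w
  have DJ: "(\<lambda>x. D (fst x) (snd x)) \<in> borel_measurable (borel \<Otimes>\<^sub>M M)"
   unfolding D_def
   by (intro borel_measurable_times borel_measurable_diff H0_joint[OF vI] HH_joint
     measurable_compose[OF measurable_snd] borel_measurable_indicator A_events)
  have Db: "\<bar>D u w\<bar> \<le> 2 * (Hc L * C)" if "w \<in> space M" for u w
   using H0_bound[OF vI that, of u] HH_bound[OF kl(1) that, of u] by (auto simp: D_def indicator_def)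
  have path: "\<bar>H0 v u w - HH u w\<bar> \<le> Hc L * (eps1 + K2 * (2 * L^2 * (nB v u w)^2 + c1 * (u - v))) + 2 * (Hc L * C) * J v u w"
   if u: "u \<in> {v..y}" and w: "w \<in> space M" for u w
  proof (cases "r u w = r v w")
   case True
   have uI: "u \<in> {a..c}" using u vw by auto
   have u': "a \<le> v" "v \<le> u" "u \<le> c" using u vw by auto
   let ?D = "(norm (Z u w - Z v w))^2 + \<bar>Q u w - Q v w\<bar> + \<bar>u - v\<bar>"
   have rS: "r v w \<in> S" by (rule r_in_S[OF w in_T(2)[OF vI]])
   note q = Q_nonneg[OF vI w] Q_nonneg[OF uI w] in_T(1)[OF vI] in_T(1)[OF uI]
   note m = modulusD[OF md _ q, where z' = "Z u w" and z = "Z v w"]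
   have "\<bar>HH u w - H0 v u w\<bar> \<le> Hc L * (eps1 + K2 * ?D)"
    unfolding HH_def H0_def True
    by (rule H_diff_bound[OF rS]) (use m[OF rS] m b_bound[OF w] eta_bound[OF w] in blast)+
   also have "... \<le> Hc L * (eps1 + K2 * (2 * L^2 * (nB v u w)^2 + c1 * (u - v)))"
    by (intro mult_left_mono add_left_mono state_distance[OF w u'] K2 HcL)
   finally show ?thesis using True by (simp add: J_def abs_minus_commute)
  next
   case False
   then have J1: "J v u w = 1" by (simp add: J_def)
   have uI: "u \<in> {a..c}" using u vw by auto
   have "\<bar>H0 v u w - HH u w\<bar> \<le> 2 * (Hc L * C)"
    using H0_bound[OF vI w, of u] HH_bound[OF uI w] by linarith
   moreover have "0 \<le> Hc L * (eps1 + K2 * (2 * L^2 * (nB v u w)^2 + c1 * (u - v)))"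
    using HcL K2 c1 e1 u by (intro add_nonneg_nonneg mult_nonneg_nonneg) auto
   ultimately show ?thesis unfolding J1 by linarith
  qed
  have Du: "\<bar>LINT w|M. D u w\<bar> \<le> eps + K * (y - v)" if u: "u \<in> {v..y}" for u
  proof -
   have u': "a \<le> v" "v \<le> u" "u \<le> c" and uI: "u \<in> {a..c}" using u vw by auto
   note Jm' = Jm[OF u'] and nm = nB_moments[OF u']
   let ?R = "\<lambda>w. Hc L * (eps1 + K2 * (2 * L^2 * (nB v u w)^2 + c1 * (u - v))) + 2 * (Hc L * C) * J v u w"
   have i: "integrable M (\<lambda>w. eps1 + K2 * (2 * L^2 * (nB v u w)^2 + c1 * (u - v)))"
    using nm(1) by (intro Bochner_Integration.integrable_add integrable_mult_right) auto
   have ri: "integrable M ?R"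
    using i nm(1) Jm' by (intro Bochner_Integration.integrable_add integrable_mult_right) auto
   have "\<bar>LINT w|M. D u w\<bar> \<le> (LINT w|M. ?R w)"
   proof (rule abs_expectation_mono[OF ri])
    fix w assume w: "w \<in> space M"
    have "\<bar>D u w\<bar> \<le> \<bar>H0 v u w - HH u w\<bar>" using kl(2)[OF uI] by (auto simp: D_def indicator_def)
    then show "\<bar>D u w\<bar> \<le> ?R w" using path[OF u w] by linarith
   qed
   also have "... = (LINT w|M. Hc L * (eps1 + K2 * (2 * L^2 * (nB v u w)^2 + c1 * (u - v)))) + (LINT w|M. 2 * (Hc L * C) * J v u w)"
    using i nm(1) Jm' by (intro Bochner_Integration.integral_add integrable_mult_right) auto
   also have "(LINT w|M. 2 * (Hc L * C) * J v u w) = 2 * (Hc L * C) * (LINT w|M. J v u w)" by simp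
   also have "(LINT w|M. Hc L * (eps1 + K2 * (2 * L^2 * (nB v u w)^2 + c1 * (u - v))))
     = Hc L * (eps1 + K2 * (2 * L^2 * (LINT w|M. (nB v u w)^2) + c1 * (u - v)))"
    using nm(1) by (simp add: prob_space)
   also have "Hc L * (eps1 + K2 * (2 * L^2 * (LINT w|M. (nB v u w)^2) + c1 * (u - v))) + 2 * (Hc L * C) * (LINT w|M. J v u w)
     \<le> Hc L * (eps1 + K2 * (2 * L^2 * (real CARD('m) * (y - v)) + c1 * (y - v))) + 2 * (Hc L * C) * (Kj * (y - v))"
   proof (intro add_mono mult_left_mono order_refl)
    show "expectation (\<lambda>w. (nB v u w)^2) \<le> real CARD('m) * (y - v)"
     using u by (intro order.trans[OF nm(2)] mult_left_mono) auto
    show "expectation (J v u) \<le> Kj * (y - v)"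
     using u Kj by (intro order.trans[OF conjunct2[OF Jm']] mult_left_mono) auto
   qed (use u HcL K2 c1 C_nonneg in auto)
   also have "... = Hc L * eps1 + K * (y - v)" by (simp add: K_def algebra_simps)
   finally show ?thesis using e1(2) by linarith
  qed
  have i0: "set_integrable lborel {v..y} (\<lambda>u. H0 v u w)" if w: "w \<in> space M" for w
  proof -
   have "(\<lambda>u. H0 v u w) \<in> borel_measurable borel"
    using measurable_compose[OF measurable_Pair2'[OF w] H0_joint[OF vI]] by simp
   then show ?thesis unfolding set_integrable_def using H0_bound[OF vI w]
    by (intro integrableI_bounded_set_indicator[where B = "Hc L * C"]) (auto simp: emeasure_lborel_Icc_eq)
  qed
  have "(LINT w|M. indicator A w * ((LINT u:{v..y}|lborel. H0 v u w) - (LINT u:{v..y}|lborel. HH u w)))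
   = (LINT w|M. (LINT u:{v..y}|lborel. D u w))"
  proof (rule Bochner_Integration.integral_cong[OF refl])
   fix w assume w: "w \<in> space M"
   have "(LINT u:{v..y}|lborel. D u w) = indicator A w * (LINT u:{v..y}|lborel. H0 v u w - HH (kl u) w)"
    unfolding D_def by simp
   also have "(LINT u:{v..y}|lborel. H0 v u w - HH (kl u) w) = (LINT u:{v..y}|lborel. H0 v u w) - (LINT u:{v..y}|lborel. HH (kl u) w)"
    by (rule set_integral_diff(2)[OF i0[OF w] HH_kl_section[OF w]])
   finally show "indicator A w * ((LINT u:{v..y}|lborel. H0 v u w) - (LINT u:{v..y}|lborel. HH u w)) = (LINT u:{v..y}|lborel. D u w)"
    using HH_kl_eq[OF vw(1,3)] by simp
  qed
  also have "... = (LINT u:{v..y}|lborel. (LINT w|M. D u w))"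
   by (rule expectation_time_integral(2)[OF DJ Db])
  also have "\<bar>...\<bar> \<le> (eps + K * (y - v)) * (y - v)"
   using set_integral_norm_le[of v y "\<lambda>u. \<integral>w. D u w \<partial>M" "eps + K * (y - v)"] Du assms K vw by simp
  also have "... = eps * (y - v) + K * (y - v)^2" by (simp add: power2_eq_square algebra_simps)
  finally show "\<bar>LINT w|M. indicator A w * ((LINT u:{v..y}|lborel. H0 v u w) - (LINT u:{v..y}|lborel. HH u w))\<bar>
   \<le> eps * (y - v) + K * (y - v)^2" .
 qed
qed

text \<open>\<open>markov_step\<close> with the test function, frozen at time \<open>v\<close> and
  restricted to \<open>A\<close>, as random weights of the states.\<close>

lemma jump_term:
 assumes "eps > 0"
 shows "\<exists>K\<ge>0. \<forall>v y. a \<le> v --> v < y --> y \<le> c -->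
  \<bar>LINT w|M. indicator A w * (mart3 v y w)\<bar>
   \<le> eps * (y - v) + K * (y - v)^2"
proof -
 define eps1 where "eps1 = eps / (C + 1)"
 have e1: "eps1 > 0" "C * eps1 \<le> eps" using assms C_nonneg by (auto simp: eps1_def field_simps)
 obtain K where K: "K \<ge> 0" and st: "\<forall>v\<ge>0. \<forall>h>0. \<forall>Y C. (\<forall>i\<in>S. Y i \<in> borel_measurable (F v)) -->
  (\<forall>i\<in>S. \<forall>w\<in>space M. \<bar>Y i w\<bar> \<le> C) -->
  \<bar>(LINT w|M. Y (r (v + h) w) w - Y (r v w) w)
   - h * (LINT w|M. (\<Sum>j\<in>S. \<Gamma> (r v w) j * Y j w))\<bar> \<le> C * (eps1 * h + K * h^2)"
  using markov_step[OF e1(1)] by (elim exE conjE) (rule that)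
 show ?thesis
 proof (intro exI[of _ "C * K"] conjI allI impI)
  show "0 \<le> C * K" using K C_nonneg by simp
  fix v y assume vw: "a \<le> v" "v < y" "y \<le> c"
  have vI: "v \<in> {a..c}" and v0: "0 \<le> v" "0 \<le> y" and h0: "y - v > 0" using vw ac by auto
  define Y where "Y i w = indicator A w * phi (Z v w) (Q v w) v i" for i w
  have YF: "\<forall>i\<in>S. Y i \<in> borel_measurable (F v)"
   unfolding Y_def by (intro ballI borel_measurable_times borel_measurable_indicator A_ad[OF vI] state_measurable(4)[OF vI])
  have YC: "\<forall>i\<in>S. \<forall>w\<in>space M. \<bar>Y i w\<bar> \<le> C"
  proof (intro ballI)
   fix i w assume i: "i \<in> S" and w: "w \<in> space M"
   show "\<bar>Y i w\<bar> \<le> C"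
    using phi_bound[OF i Q_nonneg[OF vI w] in_T(1)[OF vI], of "Z v w"] C_nonneg by (simp add: Y_def indicator_def)
  qed
  have bd: "\<bar>(LINT w|M. Y (r (v + (y - v)) w) w - Y (r v w) w)
   - (y - v) * (LINT w|M. (\<Sum>j\<in>S. \<Gamma> (r v w) j * Y j w))\<bar> \<le> C * (eps1 * (y - v) + K * (y - v)^2)"
   by (rule st[rule_format, OF v0(1) h0]) (use YF YC in blast)+
  have m: "(\<lambda>w. Y (r y w) w) \<in> borel_measurable M" if "0 \<le> y" for y
  proof (rule measurable_switch[where S = S])
   show "r y \<in> measurable M (count_space UNIV)" by (rule r_meas[OF that])
   show "r y w \<in> S" if "w \<in> space M" for w by (rule r_in_S[OF that \<open>0 \<le> y\<close>])
   show "Y i \<in> borel_measurable M" if "i \<in> S" for i by (rule measurable_F_M[OF v0(1)]) (use YF that in blast)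
  qed
  have iY: "integrable M (\<lambda>w. Y (r y w) w)" if "0 \<le> y" for y
  proof (rule integrable_const_bound[where B = C, OF _ m[OF that]])
   show "AE w in M. norm (Y (r y w) w) \<le> C"
    using YC r_in_S[OF _ that] by (intro AE_I2) (simp only: real_norm_def)
  qed
  have gm: "(\<lambda>w. \<Sum>j\<in>S. \<Gamma> (r v w) j * Y j w) \<in> borel_measurable M"
  proof (rule measurable_switch[where S = S and f = "\<lambda>i w. \<Sum>j\<in>S. \<Gamma> i j * Y j w"])
   show "r v \<in> measurable M (count_space UNIV)" by (rule r_meas[OF v0(1)])
   show "r v w \<in> S" if "w \<in> space M" for w by (rule r_in_S[OF that v0(1)])
   have "Y j \<in> borel_measurable M" if "j \<in> S" for j by (rule measurable_F_M[OF v0(1)]) (use YF that in blast)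
   then show "(\<lambda>w. \<Sum>j\<in>S. \<Gamma> i j * Y j w) \<in> borel_measurable M" for i
    by (intro borel_measurable_sum borel_measurable_times borel_measurable_const)
  qed
  have iG: "integrable M (\<lambda>w. \<Sum>j\<in>S. \<Gamma> (r v w) j * Y j w)"
  proof (rule integrable_const_bound[where B = "G_bound * C", OF _ gm])
   have "\<bar>\<Sum>j\<in>S. \<Gamma> (r v w) j * Y j w\<bar> \<le> G_bound * C" if w: "w \<in> space M" for w
    by (rule row_sum_bound[OF r_in_S[OF w v0(1)]]) (use YC w in blast)
   then show "AE w in M. norm (\<Sum>j\<in>S. \<Gamma> (r v w) j * Y j w) \<le> G_bound * C"
    by (intro AE_I2) (simp only: real_norm_def)
  qed
  have "(LINT w|M. indicator A w * (mart3 v y w))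
   = (LINT w|M. (Y (r y w) w - Y (r v w) w) - (y - v) * (\<Sum>j\<in>S. \<Gamma> (r v w) j * Y j w))"
   by (rule Bochner_Integration.integral_cong) (auto simp: Y_def indicator_def)
  also have "... = (LINT w|M. Y (r (v + (y - v)) w) w - Y (r v w) w)
   - (y - v) * (LINT w|M. (\<Sum>j\<in>S. \<Gamma> (r v w) j * Y j w))"
   using iY[OF v0(1)] iY[OF v0(2)] iG by (subst Bochner_Integration.integral_diff) auto
  also have "\<bar>...\<bar> \<le> C * (eps1 * (y - v) + K * (y - v)^2)" by (rule bd)
  also have "... = (C * eps1) * (y - v) + C * K * (y - v)^2" by (simp add: algebra_simps)
  also have "... \<le> eps * (y - v) + C * K * (y - v)^2" using e1(2) h0 by (intro add_right_mono mult_right_mono) auto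
  finally show "\<bar>LINT w|M. indicator A w * (mart3 v y w)\<bar>
   \<le> eps * (y - v) + C * K * (y - v)^2" .
 qed
qed

end

section \<open>Ito's formula in expectation on one cell\<close>

context ito_cell
begin

lemma integrable_indicator_A: "integrable M f ==> integrable M (\<lambda>w. indicator A w * (f w :: real))"
 using integrable_mult_indicator[OF A_events, of f] by simp

lemma Phi_integrable:
 assumes v: "v \<in> {a..c}"
 shows "integrable M (Phi v)"
 unfolding Phi_def
 by (rule bounded_F_integrable[OF in_T(2)[OF v] state_measurable(1)[OF v]])
  (rule state_bounds(1)[OF v _ in_T(2)[OF v]])

lemma jump_integrable:
 assumes v: "v \<in> {a..c}" and y: "y \<in> {a..c}"
 shows "integrable M (\<lambda>w. phi (Z v w) (Q v w) v (r y w) - phis v w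
       - (y - v) * (sw v w))"
proof -
 note v0 = in_T(2)[OF v] and w0 = in_T(2)[OF y]
 have m: "(\<lambda>w. phi (Z v w) (Q v w) v j) \<in> borel_measurable M" if "j \<in> S" for j
  by (rule measurable_F_M[OF v0 state_measurable(4)[OF v that]])
 have i1: "integrable M (\<lambda>w. phi (Z v w) (Q v w) v (r y w))" if w0: "0 \<le> y" for y
 proof (rule integrable_const_bound[where B = C])
  show "AE w in M. norm (phi (Z v w) (Q v w) v (r y w)) \<le> C"
   using state_bounds(1)[OF v _ w0] by (intro AE_I2) (simp only: real_norm_def)
  show "(\<lambda>w. phi (Z v w) (Q v w) v (r y w)) \<in> borel_measurable M"
   by (rule measurable_switch[OF r_meas[OF w0] r_in_S[OF _ w0], where f = "\<lambda>j w. phi (Z v w) (Q v w) v j"])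
    (assumption, rule m)
 qed
 have i2: "integrable M (\<lambda>w. \<Sum>j\<in>S. \<Gamma> (r v w) j * phi (Z v w) (Q v w) v j)"
 proof (rule integrable_const_bound[where B = "G_bound * C"])
  have "\<bar>\<Sum>j\<in>S. \<Gamma> (r v w) j * phi (Z v w) (Q v w) v j\<bar> \<le> G_bound * C" if w: "w \<in> space M" for w
   by (rule row_sum_bound[OF r_in_S[OF w v0]]) (rule phi_bound[OF _ Q_nonneg[OF v w] in_T(1)[OF v]])
  then show "AE w in M. norm (sw v w) \<le> G_bound * C"
   by (intro AE_I2) (simp only: real_norm_def)
  show "(\<lambda>w. \<Sum>j\<in>S. \<Gamma> (r v w) j * phi (Z v w) (Q v w) v j) \<in> borel_measurable M"
   by (rule measurable_switch[OF r_meas[OF v0] r_in_S[OF _ v0], where f = "\<lambda>i w. \<Sum>j\<in>S. \<Gamma> i j * phi (Z v w) (Q v w) v j"])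
    (assumption, intro borel_measurable_sum borel_measurable_times borel_measurable_const m)
 qed
 show ?thesis using i1[OF v0] i1[OF w0] i2 by auto
qed

text \<open>On \<open>A\<close> the gradient and Hessian terms have integral 0, and
  \<open>jump_term\<close> and \<open>freeze\<close> are \<open>o(h)\<close>. The pathwise remainder
  of \<open>path_step\<close> has mean of the form \<open>eps * h + K * h^2\<close>, since the mean
  of \<open>n^2\<close> and the chance of a changed state are \<open>O(h)\<close> and the mean of
  \<open>n^4\<close> is \<open>O(h^2)\<close>.\<close>

lemma one_step:
 assumes "eps > 0"
 shows "\<exists>K\<ge>0. \<forall>v y. a \<le> v --> v < y --> y \<le> c -->
  \<bar>LINT w|M. indicator A w * (Phi y w - Phi v w - (LINT u:{v..y}|lborel. HH u w))\<bar> \<le> eps * (y - v) + K * (y - v)^2"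
proof -
 obtain Kj where Kj: "Kj \<ge> 0" and Jm: "!!v y. a \<le> v ==> v \<le> y ==> y \<le> c ==> integrable M (J v y) \<and> (LINT w|M. J v y w) \<le> Kj * (y - v)"
  using J_moment by blast
 let ?m = "real CARD('m)"
 \<comment> \<open>The pathwise remainder uses \<open>1 + ?m + Kj\<close>, for the means of
   \<open>h\<close>, \<open>n^2\<close> and the jump indicator; \<open>jump_term\<close> and
   \<open>freeze\<close> each use one more.\<close>
 define eps1 where "eps1 = eps / (3 + ?m + Kj)"
 have den: "0 < 3 + ?m + Kj" using Kj by (simp add: add_pos_nonneg)
 have e1: "eps1 > 0" "eps1 * (3 + ?m + Kj) = eps" using assms den by (auto simp: eps1_def)
 obtain K1 where K1: "K1 \<ge> 0" and ps: "!!w v y. w \<in> space M ==> a \<le> v ==> v < y ==> y \<le> c ==>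
   \<bar>Phi y w - Phi v w - (LINT u:{v..y}|lborel. H0 v u w)
    - (mart1 v y w
     + 1/2 * (mart2 v y w)
     + (mart3 v y w))\<bar>
   \<le> eps1 * ((y - v) + (nB v y w)^2 + J v y w) + K1 * ((y - v)^2 + (nB v y w)^4 + (y - v) * J v y w)"
  by (rule path_step[OF e1(1)]) (rule that)
 obtain K2 where K2: "K2 \<ge> 0" and fr: "\<forall>v y. a \<le> v --> v < y --> y \<le> c -->
  \<bar>LINT w|M. indicator A w * ((LINT u:{v..y}|lborel. H0 v u w) - (LINT u:{v..y}|lborel. HH u w))\<bar>
   \<le> eps1 * (y - v) + K2 * (y - v)^2"
  using freeze[OF e1(1)] by (elim exE conjE) (rule that)
 obtain K3 where K3: "K3 \<ge> 0" and jt: "\<forall>v y. a \<le> v --> v < y --> y \<le> c -->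
  \<bar>LINT w|M. indicator A w * (mart3 v y w)\<bar>
   \<le> eps1 * (y - v) + K3 * (y - v)^2"
  using jump_term[OF e1(1)] by (elim exE conjE) (rule that)
 define K where "K = K1 * (1 + 3 * ?m^2 + Kj) + K2 + K3"
 have K: "K \<ge> 0" unfolding K_def using K1 K2 K3 Kj by (intro add_nonneg_nonneg mult_nonneg_nonneg) auto
 show ?thesis
 proof (intro exI[of _ K] conjI K allI impI)
  fix v y assume vw: "a \<le> v" "v < y" "y \<le> c"
  define h where "h = y - v"
  have h: "h > 0" using vw by (simp add: h_def)
  have vI: "v \<in> {a..c}" "y \<in> {a..c}" and vw': "v \<le> y" using vw by auto
  define Y1 where "Y1 w = mart1 v y w" for w
  define Y2 where "Y2 w = (eta w *v (B y w - B v w)) \<bullet> (phiszz v w *v (eta w *v (B y w - B v w)))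
       - (y - v) * quad_trace (phiszz v w) (eta w)" for w
  define Y3 where "Y3 w = phi (Z v w) (Q v w) v (r y w) - phis v w
       - (y - v) * (sw v w)" for w
  define Y4 where "Y4 w = (LINT u:{v..y}|lborel. H0 v u w) - (LINT u:{v..y}|lborel. HH u w)" for w
  define X where "X w = Phi y w - Phi v w - (LINT u:{v..y}|lborel. HH u w)" for w
  have iHH: "integrable M (\<lambda>w. LINT u:{v..y}|lborel. HH u w)"
   using HH_integral_measurable[of v y] unfolding HH_kl_eq[OF vw(1,3)] .
  have iX: "integrable M (\<lambda>w. indicator A w * X w)"
   unfolding X_def using Phi_integrable vI iHH by (intro integrable_indicator_A Bochner_Integration.integrable_diff)
  have i1: "has_bochner_integral M (\<lambda>w. indicator A w * Y1 w) 0"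
   unfolding Y1_def by (rule first_order_term[OF vI vw(2)])
  have i2: "has_bochner_integral M (\<lambda>w. indicator A w * Y2 w) 0"
   unfolding Y2_def by (rule second_order_term[OF vI vw(2)])
  have i3: "integrable M (\<lambda>w. indicator A w * Y3 w)"
   unfolding Y3_def by (rule integrable_indicator_A[OF jump_integrable[OF vI]])
  have i4: "integrable M (\<lambda>w. indicator A w * Y4 w)"
   unfolding Y4_def using H0_integral_measurable[OF vI(1)] iHH by (intro integrable_indicator_A Bochner_Integration.integrable_diff)
  define R where "R w = indicator A w * X w - (indicator A w * Y1 w + 1/2 * (indicator A w * Y2 w) + indicator A w * Y3 w + indicator A w * Y4 w)" for w
  have "(LINT w|M. R w) = (LINT w|M. indicator A w * X w) - ((LINT w|M. indicator A w * Y3 w) + (LINT w|M. indicator A w * Y4 w))"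
   unfolding R_def using iX i1 i2 i3 i4 by (simp add: has_bochner_integral_iff)
  then have eX: "(LINT w|M. indicator A w * X w) = (LINT w|M. R w) + (LINT w|M. indicator A w * Y3 w) + (LINT w|M. indicator A w * Y4 w)"
   by simp
  have b3: "\<bar>LINT w|M. indicator A w * Y3 w\<bar> \<le> eps1 * h + K3 * h^2"
   using jt[rule_format, OF vw] unfolding Y3_def h_def .
  have b4: "\<bar>LINT w|M. indicator A w * Y4 w\<bar> \<le> eps1 * h + K2 * h^2"
   using fr[rule_format, OF vw] unfolding Y4_def h_def .
  note nm = nB_moments[OF vw(1) vw' vw(3), folded h_def] and Jm' = Jm[OF vw(1) vw' vw(3), folded h_def]
  let ?W = "\<lambda>w. eps1 * (h + (nB v y w)^2 + J v y w) + K1 * (h^2 + (nB v y w)^4 + h * J v y w)"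
  have iW: "integrable M ?W"
   using nm Jm' by (intro Bochner_Integration.integrable_add integrable_mult_right) auto
  have "\<bar>LINT w|M. R w\<bar> \<le> (LINT w|M. ?W w)"
  proof (rule abs_expectation_mono[OF iW])
   fix w assume w: "w \<in> space M"
   have p: "\<bar>Phi y w - Phi v w - (LINT u:{v..y}|lborel. H0 v u w) - (Y1 w + 1/2 * Y2 w + Y3 w)\<bar> \<le> ?W w"
    using ps[OF w vw] unfolding Y1_def Y2_def Y3_def h_def .
   have "\<bar>R w\<bar> \<le> \<bar>Phi y w - Phi v w - (LINT u:{v..y}|lborel. H0 v u w) - (Y1 w + 1/2 * Y2 w + Y3 w)\<bar>"
   proof (cases "w \<in> A")
    case True
    then have "R w = Phi y w - Phi v w - (LINT u:{v..y}|lborel. H0 v u w) - (Y1 w + 1/2 * Y2 w + Y3 w)"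
     by (simp add: R_def X_def Y4_def)
    then show ?thesis by simp
   qed (simp add: R_def)
   then show "\<bar>R w\<bar> \<le> ?W w" using p by (rule order.trans)
  qed
  also have "(LINT w|M. ?W w) = eps1 * (h + (LINT w|M. (nB v y w)^2) + (LINT w|M. J v y w)) + K1 * (h^2 + (LINT w|M. (nB v y w)^4) + h * (LINT w|M. J v y w))"
   using nm(1,3) conjunct1[OF Jm'] by (simp add: prob_space)
  also have "... \<le> eps1 * (h + ?m * h + Kj * h) + K1 * (h^2 + 3 * ?m^2 * h^2 + h * (Kj * h))"
   using nm conjunct2[OF Jm'] e1 K1 h by (intro add_mono mult_left_mono) auto
  finally have bR: "\<bar>LINT w|M. R w\<bar> \<le> eps1 * (h + ?m * h + Kj * h) + K1 * (h^2 + 3 * ?m^2 * h^2 + h * (Kj * h))" .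
  have "\<bar>LINT w|M. indicator A w * X w\<bar> \<le> (eps1 * (h + ?m * h + Kj * h) + K1 * (h^2 + 3 * ?m^2 * h^2 + h * (Kj * h)))
    + (eps1 * h + K3 * h^2) + (eps1 * h + K2 * h^2)"
   unfolding eX by (intro order.trans[OF abs_triangle_ineq] add_mono bR b3 b4)
  also have "... = (eps1 * (3 + ?m + Kj)) * h + K * h^2"
   by (simp add: K_def algebra_simps power2_eq_square)
  finally show "\<bar>LINT w|M. indicator A w * (Phi y w - Phi v w - (LINT u:{v..y}|lborel. HH u w))\<bar> \<le> eps * (y - v) + K * (y - v)^2"
   unfolding e1(2) X_def h_def .
 qed
qed

text \<open>The integral over \<open>A\<close> of \<open>Phi v\<close> minus the accumulated drift
  is a function of \<open>v\<close> whose increments are governed by \<open>one_step\<close>; by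
  \<open>constant_of_small_increments\<close> it is constant.\<close>

theorem cell_ito:
 "(LINT w|M. indicator A w * (Phi c w - Phi a w)) = (LINT w|M. indicator A w * (LINT u:{a..c}|lborel. HH u w))"
proof -
 define G where "G v = (LINT w|M. indicator A w * (Phi v w - (LINT u:{a..v}|lborel. HH (kl u) w)))" for v
 have iG: "integrable M (\<lambda>w. indicator A w * (Phi v w - (LINT u:{a..v}|lborel. HH (kl u) w)))" if "v \<in> {a..c}" for v
  by (intro integrable_indicator_A Bochner_Integration.integrable_diff Phi_integrable[OF that] HH_integral_measurable)
 have diff: "G y - G v = (LINT w|M. indicator A w * (Phi y w - Phi v w - (LINT u:{v..y}|lborel. HH u w)))"
  if vw: "a \<le> v" "v < y" "y \<le> c" for v y
 proof -
  have vI: "v \<in> {a..c}" "y \<in> {a..c}" using vw by auto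
  have "G y - G v = (LINT w|M. indicator A w * (Phi y w - (LINT u:{a..y}|lborel. HH (kl u) w))
   - indicator A w * (Phi v w - (LINT u:{a..v}|lborel. HH (kl u) w)))"
   unfolding G_def by (rule Bochner_Integration.integral_diff[OF iG[OF vI(2)] iG[OF vI(1)], symmetric])
  also have "... = (LINT w|M. indicator A w * (Phi y w - Phi v w - (LINT u:{v..y}|lborel. HH u w)))"
  proof (rule Bochner_Integration.integral_cong[OF refl])
   fix w assume w: "w \<in> space M"
   have "(LINT u:{a..y}|lborel. HH (kl u) w) = (LINT u:{a..v}|lborel. HH (kl u) w) + (LINT u:{v..y}|lborel. HH (kl u) w)"
    by (rule set_integral_Icc_split) (use vw HH_kl_section[OF w] in auto)
   then show "indicator A w * (Phi y w - (LINT u:{a..y}|lborel. HH (kl u) w))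
    - indicator A w * (Phi v w - (LINT u:{a..v}|lborel. HH (kl u) w))
    = indicator A w * (Phi y w - Phi v w - (LINT u:{v..y}|lborel. HH u w))"
    unfolding HH_kl_eq[OF vw(1,3), symmetric] by (simp add: algebra_simps)
  qed
  finally show ?thesis .
 qed
 have "G c = G a"
 proof (rule constant_of_small_increments[OF ac(2)])
  fix eps :: real assume e: "eps > 0"
  show "\<exists>K\<ge>0. \<forall>v y. a \<le> v --> v < y --> y \<le> c --> \<bar>G y - G v\<bar> \<le> eps * (y - v) + K * (y - v)^2"
   using one_step[OF e] by (simp add: diff cong: imp_cong)
 qed
 moreover have "G a = (LINT w|M. indicator A w * Phi a w)"
 proof -
  have "(LINT u:{a..a}|lborel. HH (kl u) w) = 0" for w
  proof -
   have "AE u in lborel. indicator {a..a} u *\<^sub>R HH (kl u) w = 0"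
    using AE_lborel_singleton[of a] by eventually_elim auto
   then show ?thesis unfolding set_lebesgue_integral_def by (rule integral_eq_zero_AE)
  qed
  then show ?thesis unfolding G_def by simp
 qed
 moreover have "G c = (LINT w|M. indicator A w * Phi c w) - (LINT w|M. indicator A w * (LINT u:{a..c}|lborel. HH u w))"
 proof -
  have e: "(LINT u:{a..c}|lborel. HH (kl u) w) = (LINT u:{a..c}|lborel. HH u w)" for w
   by (rule HH_kl_eq) auto
  have cI: "c \<in> {a..c}" using ac by auto
  have i: "integrable M (\<lambda>w. LINT u:{a..c}|lborel. HH u w)"
   using HH_integral_measurable[of a c] unfolding e .
  show ?thesis unfolding G_def e right_diff_distrib
   by (rule Bochner_Integration.integral_diff[OF integrable_indicator_A[OF Phi_integrable[OF cI]] integrable_indicator_A[OF i]])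
 qed
 moreover have "(LINT w|M. indicator A w * (Phi c w - Phi a w)) = (LINT w|M. indicator A w * Phi c w) - (LINT w|M. indicator A w * Phi a w)"
 proof -
  have cI: "c \<in> {a..c}" "a \<in> {a..c}" using ac by auto
  show ?thesis unfolding right_diff_distrib
   by (rule Bochner_Integration.integral_diff[OF integrable_indicator_A[OF Phi_integrable[OF cI(1)]] integrable_indicator_A[OF Phi_integrable[OF cI(2)]]])
 qed
 ultimately show ?thesis by simp
qed

end

section \<open>Simple integrands\<close>

lemma matrix_vector_sum_left:
 "(\<Sum>k\<in>I. f k) *v (x :: real^'n) = (\<Sum>k\<in>I. f k *v x)"
 by (induction I rule: infinite_finite_induct) (auto simp: matrix_vector_mult_add_rdistrib)

context filtered_prob
begin

text \<open>Progressive measurability at the single horizon \<open>v\<close>, phrased with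
  \<open>clip\<close> so that the time variable ranges over the whole line.\<close>

definition prog :: "real => (real => 'w => 'b::topological_space) => bool" where
 "prog v f \<longleftrightarrow> (\<lambda>x. f (clip v (fst x)) (snd x)) \<in> borel_measurable (borel \<Otimes>\<^sub>M F v)"

lemma prog_integral:
 fixes f :: "real => 'w => 'b::{banach, second_countable_topology}"
 assumes "prog v f"
 shows "(\<lambda>w. LINT s:{0..v}|lborel. f s w) \<in> borel_measurable (F v)"
proof -
 have "(\<lambda>x. f (clip v (fst x)) (snd x)) \<in> borel_measurable (lborel \<Otimes>\<^sub>M F v)"
  using assms by (simp add: prog_def measurable_cong_sets[OF sets_pair_measure_cong[OF sets_lborel refl] refl])
 from measurable_compose[OF measurable_pair_swap' this]
 have [measurable]: "(\<lambda>x. f (clip v (snd x)) (fst x)) \<in> borel_measurable (F v \<Otimes>\<^sub>M lborel)"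
  by (simp add: case_prod_beta')
 have "(\<lambda>w. LINT s|lborel. indicator {0..v} s *\<^sub>R f (clip v s) w) \<in> borel_measurable (F v)"
  by (rule sigma_finite_measure.borel_measurable_lebesgue_integral[OF sigma_finite_lborel])
   (simp add: case_prod_beta', measurable)
 also have "(\<lambda>w. LINT s|lborel. indicator {0..v} s *\<^sub>R f (clip v s) w) = (\<lambda>w. LINT s:{0..v}|lborel. f s w)"
  unfolding set_lebesgue_integral_def
  by (intro ext Bochner_Integration.integral_cong) (auto simp: clip_eq indicator_def)
 finally show ?thesis .
qed

lemma prog_section:
 assumes "prog v f" "w \<in> space M" "0 \<le> v"
 shows "(\<lambda>s. f (clip v s) w) \<in> borel_measurable borel"
proof -
 have "w \<in> space (F v)" using assms space_F by simp
 from measurable_compose[OF measurable_Pair2'[OF this] assms(1)[unfolded prog_def]] show ?thesis by simp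
qed

lemma prog_set_integrable:
 fixes f :: "real => 'w => 'b::{banach, second_countable_topology}"
 assumes p: "prog T f" and w: "w \<in> space M" and T: "0 \<le> T" and b: "!!s. norm (f s w) \<le> L"
  and sub: "{v..y} \<subseteq> {0..T}"
 shows "set_integrable lborel {v..y} (\<lambda>s. f s w)"
proof -
 have "set_integrable lborel {v..y} (\<lambda>s. f (clip T s) w)"
  unfolding set_integrable_def
  by (rule integrableI_bounded_set_indicator[where B = L])
   (use prog_section[OF p w T] b in \<open>auto simp: emeasure_lborel_Icc_eq\<close>)
 moreover have "set_integrable lborel {v..y} (\<lambda>s. f (clip T s) w) = set_integrable lborel {v..y} (\<lambda>s. f s w)"
  by (rule set_integrable_cong) (use sub clip_eq in auto)
 ultimately show ?thesis by simp
qed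

end

lemma set_integral_norm_le':
 fixes g :: "real => 'b::{banach, second_countable_topology}"
 assumes "v \<le> y" "!!u. u \<in> {v..y} ==> norm (g u) \<le> K" "0 \<le> K"
 shows "norm (LINT u:{v..y}|lborel. g u) \<le> K * (y - v)"
proof -
 have "norm (LINT u:{v..y}|lborel. g u) \<le> (LINT u|lborel. norm (indicator {v..y} u *\<^sub>R g u))"
  unfolding set_lebesgue_integral_def by (rule integral_norm_bound)
 also have "... \<le> (LINT u|lborel. indicator {v..y} u * K)"
 proof (rule integral_mono')
  show "integrable lborel (\<lambda>u. indicator {v..y} u * K)"
   by (intro integrable_mult_left integrable_real_indicator) (auto simp: emeasure_lborel_Icc_eq)
 qed (use assms in \<open>auto simp: indicator_def\<close>)
 also have "... = K * (y - v)" using assms(1) by simp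
 finally show ?thesis .
qed

lemma integral_lipschitz:
 fixes g :: "real => 'b::{banach, second_countable_topology}"
 assumes i: "set_integrable lborel {0..T} g" and b: "!!u. norm (g u) \<le> K" and K: "0 \<le> K"
  and vw: "v \<in> {0..T}" "y \<in> {0..T}"
 shows "norm ((LINT u:{0..v}|lborel. g u) - (LINT u:{0..y}|lborel. g u)) \<le> K * \<bar>v - y\<bar>"
proof -
 have *: "norm ((LINT u:{0..y}|lborel. g u) - (LINT u:{0..v}|lborel. g u)) \<le> K * \<bar>y - v\<bar>"
  if "v \<le> y" "v \<in> {0..T}" "y \<in> {0..T}" for v y
 proof -
  have "(LINT u:{0..y}|lborel. g u) = (LINT u:{0..v}|lborel. g u) + (LINT u:{v..y}|lborel. g u)"
   by (rule set_integral_Icc_split) (use that in \<open>auto intro: set_integrable_subset[OF i]\<close>)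
  then show ?thesis using set_integral_norm_le'[of v y g K] that b K by simp
 qed
 show ?thesis
 proof (cases "v \<le> y")
  case True
  then show ?thesis using *[OF True vw] by (simp add: norm_minus_commute abs_minus_commute)
 next
  case False
  then show ?thesis using *[of y v] vw by simp
 qed
qed

lemma continuous_on_integral:
 fixes g :: "real => 'b::{banach, second_countable_topology}"
 assumes "set_integrable lborel {0..T} g" "!!u. norm (g u) \<le> K" "0 \<le> K"
 shows "continuous_on {0..T} (\<lambda>v. LINT u:{0..v}|lborel. g u)"
proof (rule lipschitz_on_continuous_on)
 show "K-lipschitz_on {0..T} (\<lambda>v. LINT u:{0..v}|lborel. g u)"
  using integral_lipschitz[OF assms] assms(3) by (intro lipschitz_onI) (auto simp: dist_norm)
qed

lemma continuous_clip:
 assumes "continuous_on {0..T} f" "0 \<le> T"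
 shows "continuous (at_right t) (\<lambda>s. f (clip T s))"
proof -
 have "continuous_on UNIV (clip T)" unfolding clip_def[abs_def] by (intro continuous_intros)
 then have "continuous_on UNIV (\<lambda>s. f (clip T s))"
  by (rule continuous_on_compose2[OF assms(1)]) (use clip_in[OF assms(2)] in auto)
 then show ?thesis by (auto simp: continuous_on_eq_continuous_at intro: continuous_at_imp_continuous_at_within)
qed

lemma clip_clip: "0 \<le> T ==> clip T (clip T s) = clip T s"
 by (rule clip_eq[OF clip_in])

lemma (in filtered_prob) prog_continuous:
 fixes Y :: "real => 'w => 'b::{real_normed_vector, second_countable_topology}"
 assumes T: "0 \<le> T"
  and ad: "!!t. t \<in> {0..T} ==> Y t \<in> borel_measurable (F t)"
  and co: "!!w. w \<in> space M ==> continuous_on {0..T} (\<lambda>s. Y s w)"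
 shows "prog T Y"
proof -
 have "(\<lambda>x. Y (clip T (clip T (fst x))) (snd x)) \<in> borel_measurable (borel \<Otimes>\<^sub>M F T)"
 proof (rule right_continuous_joint[OF T, of "\<lambda>s. Y (clip T s)"])
  fix t assume "t \<in> {0..T}"
  show "Y (clip T t) \<in> borel_measurable (F T)"
   using clip_in[OF T, of t] by (intro measurable_F_mono[OF _ _ ad]) auto
  fix w assume "w \<in> space M"
  show "continuous (at_right t) (\<lambda>s. Y (clip T s) w)"
   by (rule continuous_clip[OF co T]) fact
 qed
 then show ?thesis by (simp add: prog_def clip_clip[OF T])
qed

text \<open>For a simple integrand and a bounded drift, \<open>Z\<close> and \<open>Q\<close> are
  explicit. Continuity is required of every Brownian path, since then \<open>Z\<close> is continuous
  everywhere and therefore progressively measurable.\<close>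

locale simple_ito = switching_test M F B N \<Gamma> r T C phi phiz phizz phiq phit
 for M :: "'w measure" and F and B :: "real => 'w => real^'m" and N \<Gamma> r T C
  and phi :: "real^'d => real => real => int => real" and phiz phizz phiq phit +
 fixes n :: nat and u :: "nat => real" and eta :: "nat => 'w => real^'m^'d"
  and b :: "real => 'w => real^'d" and L :: real and Z0 :: "'w => real^'d"
 assumes B_cont: "!!w. w \<in> space M ==> continuous_on {0..} (\<lambda>t. B t w)"
  and u0: "0 \<le> u 0" and u_Suc: "!!k. k < n ==> u k \<le> u (Suc k)"
  and eta_meas: "!!k. k < n ==> eta k \<in> borel_measurable (F (u k))"
  and eta_bound: "!!k w. k < n ==> w \<in> space M ==> norm (eta k w) \<le> L"
  and b_prog: "!!v. v \<in> {0..T} ==> prog v b"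
  and b_bound: "!!s w. w \<in> space M ==> norm (b s w) \<le> L"
  and Z0_meas: "Z0 \<in> borel_measurable (F 0)"
begin

definition G :: "real => 'w => real^'m^'d" where "G s w = simple_val n u eta s w"

definition Z :: "real => 'w => real^'d" where
 "Z v w = Z0 w + (LINT s:{0..v}|lborel. b s w) + simple_integral B n u eta v w"

definition Q :: "real => 'w => real" where
 "Q v w = (LINT s:{0..v}|lborel. (norm (G s w))^2 + norm (b s w))"

text \<open>The integrand is a sum of \<open>n\<close> terms of norm at most \<open>L\<close>; the
  additional \<open>L\<close> makes the same constant cover the drift.\<close>

definition Lc :: real where "Lc = real n * L + L"

lemma L_nonneg: "0 \<le> L"
proof -
 obtain w where "w \<in> space M" using not_empty by blast
 from b_bound[OF this, of 0] show ?thesis using norm_ge_zero order.trans by blast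
qed

lemma u_nonneg: "k \<le> n ==> 0 \<le> u k"
proof (induction k)
 case 0 show ?case by (rule u0)
next
 case (Suc k) then show ?case using u_Suc[of k] by auto
qed

lemma Lc: "0 \<le> Lc" "L \<le> Lc"
 using L_nonneg by (auto simp: Lc_def)

lemma G_bound_Lc: "w \<in> space M ==> norm (G s w) \<le> real n * L"
proof -
 assume w: "w \<in> space M"
 have "norm (G s w) \<le> (\<Sum>k<n. L)"
  unfolding G_def simple_val_def
  by (rule order.trans[OF norm_sum], rule sum_mono) (use eta_bound[OF _ w] L_nonneg in \<open>auto simp: indicator_def\<close>)
 then show ?thesis by simp
qed

lemma G_le_Lc: "w \<in> space M ==> norm (G s w) \<le> Lc"
 using G_bound_Lc[of w s] L_nonneg by (simp add: Lc_def)

lemma b_le_Lc: "w \<in> space M ==> norm (b s w) \<le> Lc"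
 using b_bound[of w s] Lc by simp

lemma G_prog: "0 \<le> v ==> prog v G"
 unfolding prog_def G_def simple_val_def
proof (rule borel_measurable_sum)
 fix k assume k: "k \<in> {..<n}" and v: "0 \<le> v"
 show "(\<lambda>x. indicator {u k<..u (Suc k)} (clip v (fst x)) *\<^sub>R eta k (snd x)) \<in> borel_measurable (borel \<Otimes>\<^sub>M F v)"
 proof (cases "u k < v")
  case True
  have "eta k \<in> borel_measurable (F v)"
   using u_nonneg[of k] k True by (intro measurable_F_mono[OF _ _ eta_meas]) auto
  then have [measurable]: "(\<lambda>x. eta k (snd x)) \<in> borel_measurable (borel \<Otimes>\<^sub>M F v)" by (rule measurable_compose[OF measurable_snd])
  show ?thesis by measurable
 next
  case False
  have "clip v s \<le> u k" for s using False clip_in[OF v, of s] by auto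
  then have "indicator {u k<..u (Suc k)} (clip v s) = (0::real)" for s by (simp add: not_less)
  then show ?thesis by simp
 qed
qed

definition sp :: "real => 'w => real" where "sp s w = (norm (G s w))^2 + norm (b s w)"

lemma Q_sp: "Q v w = (LINT s:{0..v}|lborel. sp s w)"
 by (simp add: Q_def sp_def)

lemma sp_prog: "v \<in> {0..T} ==> prog v sp"
 using G_prog[of v] b_prog[of v] unfolding prog_def sp_def
 by (intro borel_measurable_add borel_measurable_power measurable_compose[OF _ borel_measurable_norm]) auto

lemma sp_bound: "w \<in> space M ==> norm (sp s w) \<le> Lc^2 + Lc"
proof -
 assume w: "w \<in> space M"
 have "(norm (G s w))^2 \<le> Lc^2" using G_le_Lc[OF w] by (intro power_mono) auto
 then show ?thesis using b_le_Lc[OF w, of s] by (simp add: sp_def)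
qed

lemma TT: "T \<in> {0..T}" using T by simp

lemma b_set_integrable: "w \<in> space M ==> {v..y} \<subseteq> {0..T} ==> set_integrable lborel {v..y} (\<lambda>s. b s w)"
 by (rule prog_set_integrable[OF b_prog[OF TT] _ T b_bound])

lemma sp_set_integrable: "w \<in> space M ==> {v..y} \<subseteq> {0..T} ==> set_integrable lborel {v..y} (\<lambda>s. sp s w)"
 by (rule prog_set_integrable[OF sp_prog[OF TT] _ T sp_bound])

lemma simple_integral_meas:
 assumes v: "0 \<le> v"
 shows "simple_integral B n u eta v \<in> borel_measurable (F v)"
 unfolding simple_integral_def[abs_def]
proof (rule borel_measurable_sum)
 fix k assume k: "k \<in> {..<n}"
 show "(\<lambda>w. eta k w *v (B (min v (u (Suc k))) w - B (min v (u k)) w)) \<in> borel_measurable (F v)"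
 proof (cases "u k \<le> v")
  case True
  have "eta k \<in> borel_measurable (F v)"
   using u_nonneg[of k] k True by (intro measurable_F_mono[OF _ _ eta_meas]) auto
  moreover have "B (min v y) \<in> borel_measurable (F v)" if "0 \<le> y" for y
   by (rule measurable_F_mono[OF _ _ B_meas]) (use v that in auto)
  ultimately have m1: "(\<lambda>w. (eta k w, B (min v (u (Suc k))) w - B (min v (u k)) w)) \<in> borel_measurable (F v)"
   using u_nonneg[of k] u_nonneg[of "Suc k"] k by (intro borel_measurable_Pair borel_measurable_diff) auto
  have m2: "(\<lambda>p. (fst p :: real^'m^'d) *v snd p) \<in> borel_measurable borel"
   unfolding matrix_vector_mult_def by (rule borel_measurable_continuous_onI) (intro continuous_intros)
  show ?thesis using measurable_compose[OF m1 m2] by simp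
 next
  case False
  then have "min v (u (Suc k)) = v" "min v (u k) = v" using u_Suc[of k] k by auto
  then show ?thesis by simp
 qed
qed

lemma simple_integral_cont:
 assumes w: "w \<in> space M"
 shows "continuous_on {0..} (\<lambda>v. simple_integral B n u eta v w)"
 unfolding simple_integral_def
proof (rule continuous_on_sum)
 fix k assume k: "k \<in> {..<n}"
 have B: "continuous_on {0..} (\<lambda>v. B (min v y) w)" if "0 \<le> y" for y
  by (rule continuous_on_compose2[OF B_cont[OF w]]) (use that in \<open>auto intro!: continuous_intros\<close>)
 show "continuous_on {0..} (\<lambda>v. eta k w *v (B (min v (u (Suc k))) w - B (min v (u k)) w))"
  using u_nonneg[of k] u_nonneg[of "Suc k"] k unfolding matrix_vector_mult_def
  by (intro continuous_intros B) auto
qed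

lemma Z_meas: "v \<in> {0..T} ==> Z v \<in> borel_measurable (F v)"
 unfolding Z_def[abs_def]
 by (intro borel_measurable_add prog_integral b_prog simple_integral_meas measurable_F_mono[OF _ _ Z0_meas]) auto

lemma Q_meas: "v \<in> {0..T} ==> Q v \<in> borel_measurable (F v)"
 unfolding Q_sp[abs_def] by (rule prog_integral[OF sp_prog])

lemma Q_nonneg: "0 \<le> Q v w"
 unfolding Q_def set_lebesgue_integral_def by (rule Bochner_Integration.integral_nonneg) auto

lemma Z_cont: "w \<in> space M ==> continuous_on {0..T} (\<lambda>v. Z v w)"
 unfolding Z_def
 by (intro continuous_intros continuous_on_integral[OF b_set_integrable b_bound L_nonneg]
   continuous_on_subset[OF simple_integral_cont]) auto

lemma Q_cont: "w \<in> space M ==> continuous_on {0..T} (\<lambda>v. Q v w)"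
 unfolding Q_sp
 by (rule continuous_on_integral[OF sp_set_integrable sp_bound]) (use Lc in auto)

lemma Z_prog: "prog T Z" by (rule prog_continuous[OF T Z_meas Z_cont])

lemma Q_prog: "prog T Q" by (rule prog_continuous[OF T Q_meas Q_cont])

definition Phi :: "real => 'w => real" where
 "Phi v w = phi (Z v w) (Q v w) v (r v w)"

definition HH :: "real => 'w => real" where
 "HH v w = H (Z v w) (Q v w) v (r v w) (b v w) (G v w)"

lemma HH_joint: "(\<lambda>x. HH (clip T (fst x)) (snd x)) \<in> borel_measurable (borel \<Otimes>\<^sub>M M)"
 unfolding HH_def
proof (rule H_measurable)
 show "(\<lambda>x. Z (clip T (fst x)) (snd x)) \<in> borel_measurable (borel \<Otimes>\<^sub>M M)"
  by (rule joint_F_M[OF T Z_prog[unfolded prog_def]])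
 show "(\<lambda>x. Q (clip T (fst x)) (snd x)) \<in> borel_measurable (borel \<Otimes>\<^sub>M M)"
  by (rule joint_F_M[OF T Q_prog[unfolded prog_def]])
 show "(\<lambda>x. b (clip T (fst x)) (snd x)) \<in> borel_measurable (borel \<Otimes>\<^sub>M M)"
  by (rule joint_F_M[OF T b_prog[OF TT, unfolded prog_def]])
 show "(\<lambda>x. G (clip T (fst x)) (snd x)) \<in> borel_measurable (borel \<Otimes>\<^sub>M M)"
  by (rule joint_F_M[OF T G_prog[OF T, unfolded prog_def]])
 show "(\<lambda>x. r (clip T (fst x)) (snd x)) \<in> measurable (borel \<Otimes>\<^sub>M M) (count_space UNIV)"
  by (rule joint_F_M[OF T r_joint[OF T]])
 show "(\<lambda>x::real \<times> 'w. clip T (fst x)) \<in> borel_measurable (borel \<Otimes>\<^sub>M M)" by measurable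
 fix x assume "x \<in> space (borel \<Otimes>\<^sub>M M :: (real \<times> 'w) measure)"
 then have x: "snd x \<in> space M" by (auto simp: space_pair_measure)
 show "0 \<le> Q (clip T (fst x)) (snd x)" by (rule Q_nonneg)
 show c: "clip T (fst x) \<in> {0..T}" by (rule clip_in[OF T])
 show "r (clip T (fst x)) (snd x) \<in> S" by (rule r_in_S[OF x]) (use c in auto)
qed

lemma HH_bound: "w \<in> space M ==> v \<in> {0..T} ==> \<bar>HH v w\<bar> \<le> Hc Lc * C"
 unfolding HH_def by (rule H_bound[OF r_in_S Q_nonneg _ b_le_Lc G_le_Lc]) auto

lemma HH_clip_bound: "w \<in> space M ==> \<bar>HH (clip T v) w\<bar> \<le> Hc Lc * C"
 by (rule HH_bound[OF _ clip_in[OF T]])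

lemma HH_clip_eq:
 "{v..y} \<subseteq> {0..T} ==> (LINT s:{v..y}|lborel. HH (clip T s) w) = (LINT s:{v..y}|lborel. HH s w)"
 by (rule set_lebesgue_integral_cong) (use clip_eq in auto)

lemma HH_set_integrable:
 assumes w: "w \<in> space M" and sub: "{v..y} \<subseteq> {0..T}"
 shows "set_integrable lborel {v..y} (\<lambda>s. HH s w)"
proof -
 have "(\<lambda>s. HH (clip T s) w) \<in> borel_measurable borel"
  using measurable_compose[OF measurable_Pair2'[OF w] HH_joint] by simp
 then have "set_integrable lborel {v..y} (\<lambda>s. HH (clip T s) w)"
  unfolding set_integrable_def using HH_clip_bound[OF w]
  by (intro integrableI_bounded_set_indicator[where B = "Hc Lc * C"]) (auto simp: emeasure_lborel_Icc_eq)
 moreover have "set_integrable lborel {v..y} (\<lambda>s. HH (clip T s) w) = set_integrable lborel {v..y} (\<lambda>s. HH s w)"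
  by (rule set_integrable_cong) (use sub clip_eq in auto)
 ultimately show ?thesis by simp
qed

lemma HH_integral_integrable:
 assumes "{v..y} \<subseteq> {0..T}"
 shows "integrable M (\<lambda>w. LINT s:{v..y}|lborel. HH s w)"
 using expectation_time_integral(1)[OF HH_joint HH_clip_bound, of v y] unfolding HH_clip_eq[OF assms] by simp

lemma Phi_integrable:
 assumes v: "v \<in> {0..T}"
 shows "integrable M (Phi v)"
proof (rule integrable_const_bound[where B = C])
 have v0: "0 \<le> v" using v by auto
 show "AE w in M. norm (Phi v w) \<le> C"
  unfolding Phi_def using phi_bound[OF r_in_S[OF _ v0] Q_nonneg v] by (intro AE_I2) (simp only: real_norm_def)
 show "Phi v \<in> borel_measurable M"
  unfolding Phi_def[abs_def]
  by (rule test_measurable(1)[OF measurable_F_M[OF v0 Z_meas[OF v]] measurable_F_M[OF v0 Q_meas[OF v]] _ Q_nonneg _ r_meas[OF v0] r_in_S[OF _ v0]])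
   (use v in auto)
qed

end

section \<open>Gluing the cells of a simple integrand\<close>

context simple_ito
begin

text \<open>Steps are open on the left and closed on the right, so on a cell from \<open>s\<close>
  to \<open>t\<close> without interior grid points the integrand has on all of \<open>(s, t]\<close>
  its value at the right end.\<close>

definition etac :: "real => 'w => real^'m^'d" where "etac t w = G t w"

lemma cell_value:
 assumes no: "!!k. k \<le> n ==> \<not> (s < u k \<and> u k < t)" and v: "s < v" "v \<le> t"
 shows "G v w = etac t w"
 unfolding G_def etac_def simple_val_def
proof (rule sum.cong[OF refl])
 fix k assume k: "k \<in> {..<n}"
 then have "u k < v \<and> v \<le> u (Suc k) \<longleftrightarrow> u k < t \<and> t \<le> u (Suc k)"
  using no[of k] no[of "Suc k"] v u_Suc[of k] by auto
 then show "indicator {u k<..u (Suc k)} v *\<^sub>R eta k w = indicator {u k<..u (Suc k)} t *\<^sub>R eta k w"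
  by (simp add: indicator_def)
qed

text \<open>Although it is the value at the right end, it is known at time \<open>s\<close>: a step
  that is active at \<open>t\<close> began at a grid point below \<open>t\<close>, hence not after
  \<open>s\<close>.\<close>

lemma cell_meas:
 assumes no: "!!k. k \<le> n ==> \<not> (s < u k \<and> u k < t)" and s: "0 \<le> s" "s < t"
 shows "etac t \<in> borel_measurable (F s)"
 unfolding etac_def[abs_def] G_def simple_val_def
proof (rule borel_measurable_sum)
 fix k assume k: "k \<in> {..<n}"
 show "(\<lambda>w. indicator {u k<..u (Suc k)} t *\<^sub>R eta k w) \<in> borel_measurable (F s)"
 proof (cases "u k < t")
  case True
  then have "u k \<le> s" using no[of k] k by auto
  then have "eta k \<in> borel_measurable (F s)"
   using u_nonneg[of k] k by (intro measurable_F_mono[OF _ _ eta_meas]) auto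
  then show ?thesis by simp
 qed simp
qed

lemma cell_integral:
 assumes no: "!!k. k \<le> n ==> \<not> (s < u k \<and> u k < t)" and s: "s < t" and v: "s \<le> v" "v \<le> t"
 shows "simple_integral B n u eta v w - simple_integral B n u eta s w = etac t w *v (B v w - B s w)"
proof -
 have "etac t w *v (B v w - B s w) = (\<Sum>k<n. (indicator {u k<..u (Suc k)} t *\<^sub>R eta k w) *v (B v w - B s w))"
  unfolding etac_def G_def simple_val_def by (rule matrix_vector_sum_left)
 also have "... = (\<Sum>k<n. eta k w *v (B (min v (u (Suc k))) w - B (min v (u k)) w)
   - eta k w *v (B (min s (u (Suc k))) w - B (min s (u k)) w))"
 proof (rule sum.cong[OF refl])
  fix k assume k: "k \<in> {..<n}"
  consider "u k \<le> s" "t \<le> u (Suc k)" | "t \<le> u k" "t \<le> u (Suc k)" | "u k \<le> s" "u (Suc k) \<le> s"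
   using no[of k] no[of "Suc k"] u_Suc[of k] k s by fastforce
  then show "(indicator {u k<..u (Suc k)} t *\<^sub>R eta k w) *v (B v w - B s w)
   = eta k w *v (B (min v (u (Suc k))) w - B (min v (u k)) w)
    - eta k w *v (B (min s (u (Suc k))) w - B (min s (u k)) w)"
  proof cases
   case 1
   then have "min v (u (Suc k)) = v" "min v (u k) = u k" "min s (u (Suc k)) = s" "min s (u k) = u k" using v s by auto
   then show ?thesis using 1 s by (simp add: matrix_vector_mult_diff_distrib[symmetric])
  next
   case 2
   then have "min v (u (Suc k)) = v" "min v (u k) = v" "min s (u (Suc k)) = s" "min s (u k) = s" using v s by auto
   then show ?thesis using 2 by simp
  next
   case 3
   then have "min v (u (Suc k)) = u (Suc k)" "min v (u k) = u k" "min s (u (Suc k)) = u (Suc k)" "min s (u k) = u k" using v s by auto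
   then show ?thesis using 3 s by simp
  qed
 qed
 also have "... = simple_integral B n u eta v w - simple_integral B n u eta s w"
  unfolding simple_integral_def by (rule sum_subtractf)
 finally show ?thesis ..
qed

text \<open>An instance of \<open>ito_cell\<close> with times clipped to \<open>[0, T]\<close>. At
  the left end \<open>s\<close> the integrand may differ from the matrix of the cell, which does not
  affect integrals over time.\<close>

lemma ito_one_cell:
 assumes no: "!!k. k \<le> n ==> \<not> (s < u k \<and> u k < t)" and s: "0 \<le> s" "s < t" "t \<le> T"
  and A: "A \<in> sets (F s)"
 shows "(LINT w|M. indicator A w * (Phi t w - Phi s w)) = (LINT w|M. indicator A w * (LINT v:{s..t}|lborel. HH v w))"
proof -
 have sT: "v \<in> {0..T}" if "v \<in> {s..t}" for v using that s by auto
 let ?b = "\<lambda>v. b (clip T v)" and ?Z = "\<lambda>v. Z (clip T v)" and ?Q = "\<lambda>v. Q (clip T v)"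
 interpret c: ito_cell M F B N \<Gamma> r T C phi phiz phizz phiq phit s t Lc "etac t" ?b ?Z ?Q A
 proof
  show "0 \<le> s" "s \<le> t" "t \<le> T" "0 \<le> Lc" "A \<in> sets (F s)" using s Lc A by auto
  show "etac t \<in> borel_measurable (F s)" by (rule cell_meas[OF no s(1,2)])
  show "norm (etac t w) \<le> Lc" if "w \<in> space M" for w unfolding etac_def by (rule G_le_Lc[OF that])
  show "(\<lambda>x. b (clip T (fst x)) (snd x)) \<in> borel_measurable (borel \<Otimes>\<^sub>M M)"
   by (rule joint_F_M[OF T b_prog[OF TT, unfolded prog_def]])
  show "norm (b (clip T v) w) \<le> Lc" if "w \<in> space M" for w v by (rule b_le_Lc[OF that])
  show "(\<lambda>x. Z (clip T (fst x)) (snd x)) \<in> borel_measurable (borel \<Otimes>\<^sub>M M)"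
   by (rule joint_F_M[OF T Z_prog[unfolded prog_def]])
  show "(\<lambda>x. Q (clip T (fst x)) (snd x)) \<in> borel_measurable (borel \<Otimes>\<^sub>M M)"
   by (rule joint_F_M[OF T Q_prog[unfolded prog_def]])
  show "Z (clip T v) \<in> borel_measurable (F v)" "Q (clip T v) \<in> borel_measurable (F v)" if "v \<in> {s..t}" for v
   unfolding clip_eq[OF sT[OF that]] using Z_meas[OF sT[OF that]] Q_meas[OF sT[OF that]] by auto
  show "0 \<le> Q (clip T v) w" for v w by (rule Q_nonneg)
  fix w v v' assume w: "w \<in> space M" and v: "s \<le> v" "v \<le> v'" "v' \<le> t"
  have vT: "v \<in> {0..T}" "v' \<in> {0..T}" "{0..v'} \<subseteq> {0..T}" "{v..v'} \<subseteq> {0..T}" and v0: "0 \<le> v" using v s by auto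
  have eb: "(LINT l:{v..v'}|lborel. b (clip T l) w) = (LINT l:{v..v'}|lborel. b l w)"
   by (rule set_lebesgue_integral_cong) (use vT clip_eq in auto)
  show "Z (clip T v') w = Z (clip T v) w + (LINT l:{v..v'}|lborel. b (clip T l) w) + etac t w *v (B v' w - B v w)"
  proof -
   have "(LINT l:{0..v'}|lborel. b l w) = (LINT l:{0..v}|lborel. b l w) + (LINT l:{v..v'}|lborel. b l w)"
    by (rule set_integral_Icc_split[OF v0 v(2) b_set_integrable[OF w vT(3)]])
   moreover have "simple_integral B n u eta v' w - simple_integral B n u eta v w = etac t w *v (B v' w - B v w)"
   proof -
    have "simple_integral B n u eta v' w - simple_integral B n u eta s w = etac t w *v (B v' w - B s w)"
     "simple_integral B n u eta v w - simple_integral B n u eta s w = etac t w *v (B v w - B s w)"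
     using v by (auto intro!: cell_integral[OF no s(2)])
    moreover have "etac t w *v (B v' w - B v w) = etac t w *v (B v' w - B s w) - etac t w *v (B v w - B s w)"
     by (simp add: matrix_vector_mult_diff_distrib)
    moreover have "y - z = y - x - (z - x)" for x y z :: "real^'d" by simp
    ultimately show ?thesis by metis
   qed
   ultimately show ?thesis unfolding clip_eq[OF vT(1)] clip_eq[OF vT(2)] eb Z_def
    by (simp add: algebra_simps)
  qed
  show "Q (clip T v') w = Q (clip T v) w + (LINT l:{v..v'}|lborel. (norm (etac t w))^2 + norm (b (clip T l) w))"
  proof -
   have e: "sp l w = (norm (etac t w))^2 + norm (b (clip T l) w)" if "l \<in> {v..v'}" "l \<noteq> v" for l
   proof -
    have "l \<in> {0..T}" "s < l" "l \<le> t" using that vT v by auto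
    then show ?thesis unfolding sp_def using cell_value[OF no, of l w] clip_eq by simp
   qed
   have "(LINT l:{v..v'}|lborel. sp l w) = (LINT l:{v..v'}|lborel. (norm (etac t w))^2 + norm (b (clip T l) w))"
    unfolding set_lebesgue_integral_def
   proof (rule integral_cong_AE)
    show "AE l in lborel. indicator {v..v'} l *\<^sub>R sp l w = indicator {v..v'} l *\<^sub>R ((norm (etac t w))^2 + norm (b (clip T l) w))"
     using AE_lborel_singleton[of v] by eventually_elim (use e in \<open>auto simp: indicator_def\<close>)
    show "(\<lambda>l. indicator {v..v'} l *\<^sub>R sp l w) \<in> borel_measurable lborel"
     using sp_set_integrable[OF w vT(4)] by (simp add: set_integrable_def)
    have "(\<lambda>l. b (clip T l) w) \<in> borel_measurable borel" by (rule prog_section[OF b_prog[OF TT] w T])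
    then show "(\<lambda>l. indicator {v..v'} l *\<^sub>R ((norm (etac t w))^2 + norm (b (clip T l) w))) \<in> borel_measurable lborel"
     by measurable
   qed
   moreover have "(LINT l:{0..v'}|lborel. sp l w) = (LINT l:{0..v}|lborel. sp l w) + (LINT l:{v..v'}|lborel. sp l w)"
    by (rule set_integral_Icc_split[OF v0 v(2) sp_set_integrable[OF w vT(3)]])
   ultimately show ?thesis unfolding clip_eq[OF vT(1)] clip_eq[OF vT(2)] Q_sp by simp
  qed
 qed
 have st: "clip T s = s" "clip T t = t" using s by (auto intro!: clip_eq)
 have P: "c.Phi s w = Phi s w" "c.Phi t w = Phi t w" for w
  unfolding c.Phi_def Phi_def st by auto
 have "(LINT w|M. indicator A w * (LINT v:{s..t}|lborel. c.HH v w)) = (LINT w|M. indicator A w * (LINT v:{s..t}|lborel. HH v w))"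
 proof (rule Bochner_Integration.integral_cong[OF refl])
  fix w assume w: "w \<in> space M"
  have sub: "{s..t} \<subseteq> {0..T}" using s by auto
  have e: "c.HH v w = HH v w" if "v \<in> {s..t}" "v \<noteq> s" for v
  proof -
   have "s < v" "v \<le> t" using that by auto
   then show ?thesis unfolding c.HH_def HH_def clip_eq[OF sT[OF that(1)]] using cell_value[OF no, of v w] by simp
  qed
  have "(LINT v:{s..t}|lborel. c.HH (c.kl v) w) = (LINT v:{s..t}|lborel. HH v w)"
   unfolding set_lebesgue_integral_def
  proof (rule integral_cong_AE)
   show "AE l in lborel. indicator {s..t} l *\<^sub>R c.HH (c.kl l) w = indicator {s..t} l *\<^sub>R HH l w"
    using AE_lborel_singleton[of s] by eventually_elim (use e c.kl(2) in \<open>auto simp: indicator_def\<close>)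
   show "(\<lambda>l. indicator {s..t} l *\<^sub>R HH l w) \<in> borel_measurable lborel"
    using HH_set_integrable[OF w sub] by (simp add: set_integrable_def)
   show "(\<lambda>l. indicator {s..t} l *\<^sub>R c.HH (c.kl l) w) \<in> borel_measurable lborel"
    using c.HH_kl_section[OF w, of s t] by (simp add: set_integrable_def)
  qed
  then show "indicator A w * (LINT v:{s..t}|lborel. c.HH v w) = indicator A w * (LINT v:{s..t}|lborel. HH v w)"
   using c.HH_kl_eq[of s t w] by simp
 qed
 then show ?thesis using c.cell_ito unfolding P by simp
qed

text \<open>Induction on the number of grid points strictly between \<open>s\<close> and
  \<open>t\<close>. Splitting at one of them removes it from both halves, and \<open>A\<close> also
  belongs to the later sigma-algebra, so both halves are instances of the claim.\<close>

theorem ito_simple: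
 assumes "0 \<le> s" "s \<le> t" "t \<le> T" "A \<in> sets (F s)"
 shows "(LINT w|M. indicator A w * (Phi t w - Phi s w)) = (LINT w|M. indicator A w * (LINT v:{s..t}|lborel. HH v w))"
 using assms
proof (induction "card {k. k \<le> n \<and> s < u k \<and> u k < t}" arbitrary: s t A rule: less_induct)
 case less
 have fin: "finite {k. k \<le> n \<and> P k}" for P by (rule finite_subset[of _ "{..n}"]) auto
 consider "s = t" | "s < t" "!!k. k \<le> n ==> \<not> (s < u k \<and> u k < t)" | k where "k \<le> n" "s < u k" "u k < t"
  using less.prems(2) by fastforce
 then show ?case
 proof cases
  case 1
  have "(LINT v:{t..t}|lborel. HH v w) = 0" for w
  proof -
   have "AE v in lborel. indicator {t..t} v *\<^sub>R HH v w = 0"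
    using AE_lborel_singleton[of t] by eventually_elim auto
   then show ?thesis unfolding set_lebesgue_integral_def by (rule integral_eq_zero_AE)
  qed
  then show ?thesis using 1 by simp
 next
  case 2
  then show ?thesis using less.prems by (intro ito_one_cell) auto
 next
  case 3
  let ?m = "u k"
  have AM: "A \<in> events" using less.prems(4) sets_F_M[OF less.prems(1)] by auto
  have m: "s \<le> ?m" "?m \<le> t" "0 \<le> ?m" "?m \<le> T" using 3 less.prems by auto
  have "card {j. j \<le> n \<and> s < u j \<and> u j < ?m} < card {j. j \<le> n \<and> s < u j \<and> u j < t}"
   using 3 by (intro psubset_card_mono fin) auto
  then have e1: "(LINT w|M. indicator A w * (Phi ?m w - Phi s w)) = (LINT w|M. indicator A w * (LINT v:{s..?m}|lborel. HH v w))"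
   by (rule less.hyps) (use less.prems m in auto)
  have "card {j. j \<le> n \<and> ?m < u j \<and> u j < t} < card {j. j \<le> n \<and> s < u j \<and> u j < t}"
   using 3 by (intro psubset_card_mono fin) auto
  then have e2: "(LINT w|M. indicator A w * (Phi t w - Phi ?m w)) = (LINT w|M. indicator A w * (LINT v:{?m..t}|lborel. HH v w))"
   by (rule less.hyps) (use less.prems m sets_F_mono[OF less.prems(1) m(1)] in auto)
  have iA: "integrable M f ==> integrable M (\<lambda>w. indicator A w * (f w :: real))" for f
   using integrable_mult_indicator[OF AM, of f] by simp
  have I: "v \<in> {0..T} ==> l \<in> {0..T} ==> integrable M (\<lambda>w. indicator A w * (Phi v w - Phi l w))" for v l
   by (intro iA Bochner_Integration.integrable_diff Phi_integrable)
  have J: "{v..l} \<subseteq> {0..T} ==> integrable M (\<lambda>w. indicator A w * (LINT x:{v..l}|lborel. HH x w))" for v l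
   by (intro iA HH_integral_integrable)
  have "(LINT w|M. indicator A w * (Phi t w - Phi s w)) =
    (LINT w|M. indicator A w * (Phi ?m w - Phi s w) + indicator A w * (Phi t w - Phi ?m w))"
   by (intro Bochner_Integration.integral_cong) (auto simp: algebra_simps)
  also have "... = (LINT w|M. indicator A w * (LINT v:{s..?m}|lborel. HH v w)) + (LINT w|M. indicator A w * (LINT v:{?m..t}|lborel. HH v w))"
   unfolding e1[symmetric] e2[symmetric] by (rule Bochner_Integration.integral_add) (use I m less.prems in auto)
  also have "... = (LINT w|M. indicator A w * (LINT v:{s..?m}|lborel. HH v w) + indicator A w * (LINT v:{?m..t}|lborel. HH v w))"
   by (rule Bochner_Integration.integral_add[symmetric]) (use J m less.prems in auto)
  also have "... = (LINT w|M. indicator A w * (LINT v:{s..t}|lborel. HH v w))"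
  proof (rule Bochner_Integration.integral_cong[OF refl])
   fix w assume w: "w \<in> space M"
   have "(LINT v:{s..t}|lborel. HH v w) = (LINT v:{s..?m}|lborel. HH v w) + (LINT v:{?m..t}|lborel. HH v w)"
    by (rule set_integral_Icc_split[OF m(1,2)]) (use HH_set_integrable[OF w] less.prems in auto)
   then show "indicator A w * (LINT v:{s..?m}|lborel. HH v w) + indicator A w * (LINT v:{?m..t}|lborel. HH v w)
     = indicator A w * (LINT v:{s..t}|lborel. HH v w)" by (simp add: distrib_left)
  qed
  finally show ?thesis .
 qed
qed

end

section \<open>Passage to the limit\<close>

context switching_test
begin

definition C1 :: real where "C1 = 2 * C + c0 * C + G_bound * C"

lemma C1_nonneg: "0 \<le> C1"
 unfolding C1_def using C_nonneg c0_nonneg G_bound_nonneg by auto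

text \<open>Growth is linear in the speed of \<open>Q\<close>, with a constant independent of any
  bound on the coefficients. This estimate remains valid for the limit process and couples the drift
  to the variable in which the cutoff acts.\<close>

lemma H_growth:
 assumes i: "i \<in> S" and q: "0 \<le> q" and t: "t \<in> {0..T}"
 shows "\<bar>H z q t i b G\<bar> \<le> C1 * (1 + (norm G)^2 + norm b)"
proof -
 have 1: "\<bar>phiz z q t i \<bullet> b\<bar> \<le> C * norm b"
  by (rule order.trans[OF Cauchy_Schwarz_ineq2]) (intro mult_right_mono phiz_bound assms norm_ge_zero)
 have "\<bar>quad_trace (phizz z q t i) G\<bar> \<le> c0 * norm (phizz z q t i) * (norm G)^2" unfolding c0_def by (rule quad_trace_le)
 also have "... \<le> c0 * C * (norm G)^2" by (intro mult_right_mono mult_left_mono phizz_bound assms c0_nonneg) auto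
 finally have 2: "\<bar>1/2 * quad_trace (phizz z q t i) G\<bar> \<le> c0 * C * (norm G)^2" by (simp add: abs_mult)
 have 3: "\<bar>phiq z q t i * ((norm G)^2 + norm b)\<bar> \<le> C * ((norm G)^2 + norm b)"
  unfolding abs_mult using phiq_bound[OF assms] by (simp add: mult_right_mono)
 have 4: "\<bar>\<Sum>j\<in>S. \<Gamma> i j * phi z q t j\<bar> \<le> G_bound * C"
  by (rule row_sum_bound[OF i]) (rule phi_bound[OF _ q t])
 have "\<bar>H z q t i b G\<bar> \<le> \<bar>phiz z q t i \<bullet> b\<bar> + \<bar>1/2 * quad_trace (phizz z q t i) G\<bar> + \<bar>phit z q t i\<bar>
  + \<bar>phiq z q t i * ((norm G)^2 + norm b)\<bar> + \<bar>\<Sum>j\<in>S. \<Gamma> i j * phi z q t j\<bar>"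
  unfolding H_def by linarith
 also have "... \<le> C * norm b + c0 * C * (norm G)^2 + C + C * ((norm G)^2 + norm b) + G_bound * C"
  by (intro add_mono 1 2 3 4 phit_bound assms)
 also have "... \<le> C1 * (1 + (norm G)^2 + norm b)"
 proof -
  have "0 \<le> C + C * (norm G)^2 + c0 * C + c0 * C * norm b + G_bound * C * (norm G)^2 + G_bound * C * norm b"
   using C_nonneg c0_nonneg G_bound_nonneg by (intro add_nonneg_nonneg mult_nonneg_nonneg) auto
  then show ?thesis unfolding C1_def by (simp add: algebra_simps)
 qed
 finally show ?thesis .
qed

lemma norm_square_diff:
 fixes x y :: "'x::real_normed_vector"
 shows "\<bar>(norm x)^2 - (norm y)^2\<bar> \<le> norm (x - y) * (norm (x - y) + 2 * norm y)"
proof -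
 have 1: "\<bar>norm x - norm y\<bar> \<le> norm (x - y)" by (rule norm_triangle_ineq3)
 have 2: "norm x + norm y \<le> norm (x - y) + 2 * norm y" using norm_triangle_ineq[of "x - y" y] by simp
 have "(norm x)^2 - (norm y)^2 = (norm x - norm y) * (norm x + norm y)"
  by (simp add: power2_eq_square algebra_simps)
 then have "\<bar>(norm x)^2 - (norm y)^2\<bar> = \<bar>norm x - norm y\<bar> * (norm x + norm y)" by (simp add: abs_mult)
 also have "... \<le> norm (x - y) * (norm (x - y) + 2 * norm y)" by (intro mult_mono 1 2) auto
 finally show ?thesis .
qed

lemma H_arg_diff:
 assumes i: "i \<in> S" and q: "0 \<le> q" and t: "t \<in> {0..T}"
 shows "\<bar>H z q t i b' G' - H z q t i b G\<bar> \<le> C1 * (norm (b' - b) + norm (G' - G) * (norm (G' - G) + 2 * norm G))"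
proof -
 let ?w = "norm (G' - G) * (norm (G' - G) + 2 * norm G)"
 have l: "0 \<le> ?w" by simp
 have 1: "\<bar>phiz z q t i \<bullet> (b' - b)\<bar> \<le> C * norm (b' - b)"
  by (rule order.trans[OF Cauchy_Schwarz_ineq2]) (intro mult_right_mono phiz_bound assms norm_ge_zero)
 have "\<bar>quad_trace (phizz z q t i) G' - quad_trace (phizz z q t i) G\<bar> \<le> c0 * norm (phizz z q t i) * ?w"
  unfolding c0_def by (rule quad_trace_diff_le)
 also have "... \<le> c0 * C * ?w" by (intro mult_right_mono mult_left_mono phizz_bound assms c0_nonneg) auto
 finally have 2: "\<bar>1/2 * (quad_trace (phizz z q t i) G' - quad_trace (phizz z q t i) G)\<bar> \<le> c0 * C * ?w" by (simp add: abs_mult)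
 have "\<bar>((norm G')^2 + norm b') - ((norm G)^2 + norm b)\<bar> \<le> ?w + norm (b' - b)"
  using norm_square_diff[of G' G] norm_triangle_ineq3[of b' b] by linarith
 then have 3: "\<bar>phiq z q t i * (((norm G')^2 + norm b') - ((norm G)^2 + norm b))\<bar> \<le> C * (?w + norm (b' - b))"
  unfolding abs_mult by (intro mult_mono phiq_bound assms) (use C_nonneg in auto)
 have "H z q t i b' G' - H z q t i b G = phiz z q t i \<bullet> (b' - b) + 1/2 * (quad_trace (phizz z q t i) G' - quad_trace (phizz z q t i) G)
  + phiq z q t i * (((norm G')^2 + norm b') - ((norm G)^2 + norm b))"
  unfolding H_def inner_diff_right right_diff_distrib by simp
 also have "\<bar>...\<bar> \<le> C * norm (b' - b) + c0 * C * ?w + C * (?w + norm (b' - b))"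
  by (intro order.trans[OF abs_triangle_ineq] add_mono 1 2 3)
 also have "... \<le> C1 * (norm (b' - b) + ?w)"
 proof -
  have "0 \<le> c0 * C * norm (b' - b) + C * ?w + G_bound * C * (norm (b' - b) + ?w)"
   using C_nonneg c0_nonneg G_bound_nonneg l by (intro add_nonneg_nonneg mult_nonneg_nonneg) auto
  then show ?thesis unfolding C1_def distrib_left distrib_right by linarith
 qed
 finally show ?thesis .
qed

lemma uc_tendsto:
 fixes f :: "real^'d => real => real => 'x::real_normed_vector"
 assumes uc: "uniformly_continuous_on (UNIV \<times> {0..} \<times> {0..T}) (\<lambda>(z, q, t). f z q t)"
  and t: "t \<in> {0..T}" and z: "zs \<longlonglongrightarrow> z" and q: "qs \<longlonglongrightarrow> q" and nn: "!!j. 0 \<le> qs j" "0 \<le> q"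
 shows "(\<lambda>j::nat. f (zs j) (qs j) t) \<longlonglongrightarrow> f z q t"
proof -
 have "(\<lambda>j. (\<lambda>(z, q, t). f z q t) (zs j, qs j, t)) \<longlonglongrightarrow> (\<lambda>(z, q, t). f z q t) (z, q, t)"
  by (rule continuous_on_tendsto_compose[OF uniformly_continuous_imp_continuous[OF uc]])
   (use t nn in \<open>auto intro!: tendsto_intros z q\<close>)
 then show ?thesis by simp
qed

lemma H_tendsto:
 assumes i: "i \<in> S" and t: "t \<in> {0..T}" and z: "zs \<longlonglongrightarrow> z" and q: "qs \<longlonglongrightarrow> q" and nn: "!!j. 0 \<le> qs j" "0 \<le> q"
 shows "(\<lambda>j::nat. H (zs j) (qs j) t i b G) \<longlonglongrightarrow> H z q t i b G"
proof -
 note U = uc_tendsto[OF _ t z q nn]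
 have "(\<lambda>j. quad_trace (phizz (zs j) (qs j) t i) G) \<longlonglongrightarrow> quad_trace (phizz z q t i) G"
  unfolding quad_trace_sum by (intro tendsto_intros U[OF uc(3)[OF i]])
 then show ?thesis
  unfolding H_def by (intro tendsto_intros U[OF uc(1)] U[OF uc(2)[OF i]] U[OF uc(4)[OF i]] U[OF uc(5)[OF i]])
qed

end

text \<open>Let \<open>c\<close> be the supremum of the times with \<open>Q < K\<close>. By
  continuity \<open>Q c\<close> is at most \<open>K\<close>, all such times lie in
  \<open>[0, c]\<close>, and the integral of \<open>g\<close> there is \<open>Q c\<close>. This is
  the deterministic bound that stopping at level \<open>K\<close> would provide.\<close>

lemma sublevel_integral_le:
 fixes g Q :: "real => real"
 assumes g: "set_integrable lborel {0..T} g" and nn: "!!u. 0 \<le> g u" and T: "0 \<le> T" and K: "0 \<le> K"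
  and Q: "!!v. Q v = (LINT u:{0..v}|lborel. g u)" and cont: "continuous_on {0..T} Q"
 shows "(LINT u:{0..T}|lborel. indicator {u. Q u < K} u * g u) \<le> K"
proof (cases "\<exists>u\<in>{0..T}. Q u < K")
 case False
 then have "(LINT u:{0..T}|lborel. indicator {u. Q u < K} u * g u) = (LINT u:{0..T}|lborel. 0)"
  by (intro set_lebesgue_integral_cong) auto
 then show ?thesis using K by simp
next
 case True
 let ?A = "{u\<in>{0..T}. Q u < K}"
 define c where "c = Sup ?A"
 have ne: "?A \<noteq> {}" and bd: "bdd_above ?A" using True by (auto intro: bdd_aboveI[of _ T])
 have cl: "closed {u\<in>{0..T}. Q u \<le> K}"
  using continuous_on_closed_Collect_le[OF cont continuous_on_const[of "{0..T}" K]] by simp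
 have "c \<in> closure ?A" unfolding c_def by (rule closure_contains_Sup[OF ne bd])
 also have "closure ?A \<subseteq> {u\<in>{0..T}. Q u \<le> K}" by (rule closure_minimal[OF _ cl]) auto
 finally have c: "c \<in> {0..T}" "Q c \<le> K" by auto
 have le: "u \<le> c" if "u \<in> {0..T}" "Q u < K" for u
  unfolding c_def by (rule cSup_upper[OF _ bd]) (use that in auto)
 have "(LINT u:{0..T}|lborel. indicator {u. Q u < K} u * g u) \<le> (LINT u:{0..c}|lborel. g u)"
  unfolding set_lebesgue_integral_def
 proof (rule integral_mono')
  show "integrable lborel (\<lambda>u. indicator {0..c} u *\<^sub>R g u)"
   using set_integrable_subset[OF g, of "{0..c}"] c by (auto simp: set_integrable_def)
 qed (use nn le in \<open>auto simp: indicator_def\<close>)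
 also have "... \<le> K" using c Q by simp
 finally show ?thesis .
qed

lemma truncation_tendsto:
 fixes b :: "real => 'x::{banach, second_countable_topology}"
 assumes b: "set_integrable lborel I b" and m: "(\<lambda>u. indicator I u *\<^sub>R b u) \<in> borel_measurable lborel"
 shows "(\<lambda>j::nat. LINT u:I|lborel. norm ((if norm (b u) \<le> real j then b u else 0) - b u)) \<longlonglongrightarrow> 0"
proof -
 let ?g = "\<lambda>j u. indicator I u *\<^sub>R norm ((if norm (b u) \<le> real j then b u else 0) - b u)"
 have eq: "?g j u = (if norm (indicator I u *\<^sub>R b u) \<le> real j then 0 else norm (indicator I u *\<^sub>R b u))" for j u
  by (auto simp: indicator_def)
 have "(\<lambda>j. LINT u|lborel. ?g j u) \<longlonglongrightarrow> (LINT u|(lborel :: real measure). (0::real))"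
 proof (rule integral_dominated_convergence[where f = "\<lambda>_. 0" and s = ?g and w = "\<lambda>u. norm (indicator I u *\<^sub>R b u)"])
  show "?g j \<in> borel_measurable lborel" for j unfolding eq using m by measurable
  show "integrable lborel (\<lambda>u. norm (indicator I u *\<^sub>R b u))"
   using b unfolding set_integrable_def by (rule integrable_norm)
  show "AE u in lborel. norm (?g j u) \<le> norm (indicator I u *\<^sub>R b u)" for j
   by (intro AE_I2) (auto simp: indicator_def)
  show "AE u in lborel. (\<lambda>j. ?g j u) \<longlonglongrightarrow> 0"
  proof (intro AE_I2 tendsto_eventually)
   fix u
   obtain j0 :: nat where "norm (b u) \<le> real j0" using real_arch_simple by blast
   then show "\<forall>\<^sub>F j in sequentially. ?g j u = 0"
    by (intro eventually_sequentiallyI[of j0]) auto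
  qed
 qed auto
 then show ?thesis by (simp add: set_lebesgue_integral_def)
qed

text \<open>Convergence in probability becomes convergence of the truncated means, which can be
  added for several sequences and integrated over time. Truncation at 1 also makes the values
  finite.\<close>

lemma null_in_prob_expectation:
 assumes "prob_space M" and Y: "null_in_prob M Y"
 shows "(\<lambda>n. \<integral>w. enn2real (min 1 (Y n w)) \<partial>M) \<longlonglongrightarrow> 0"
proof -
 interpret prob_space M by fact
 have [measurable]: "Y n \<in> borel_measurable M" for n using Y by (simp add: null_in_prob_def)
 have b1: "0 \<le> enn2real (min 1 (Y n w))" "enn2real (min 1 (Y n w)) \<le> 1" for n w
  by (auto intro: enn2real_leI)
 have i1: "integrable M (\<lambda>w. enn2real (min 1 (Y n w)))" for n
  by (rule integrable_const_bound[where B = 1]) (use b1 in auto)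
 show ?thesis
 proof (rule LIMSEQ_I)
  fix e :: real assume e: "e > 0"
  define eps where "eps = e / 2"
  have "(\<lambda>n. measure M {w\<in>space M. Y n w > ennreal eps}) \<longlonglongrightarrow> 0"
   using Y e by (auto simp: null_in_prob_def eps_def)
  from LIMSEQ_D[OF this, of "e / 2"] e obtain n0 where n0: "!!n. n \<ge> n0 ==> measure M {w\<in>space M. Y n w > ennreal eps} < e / 2"
   by auto
  show "\<exists>n0. \<forall>n\<ge>n0. norm ((LINT w|M. enn2real (min 1 (Y n w))) - 0) < e"
  proof (intro exI[of _ n0] allI impI)
   fix n assume n: "n \<ge> n0"
   let ?E = "{w\<in>space M. Y n w > ennreal eps}"
   have "(LINT w|M. enn2real (min 1 (Y n w))) \<le> (LINT w|M. eps + indicator ?E w)"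
   proof (rule integral_mono[OF i1])
    show "integrable M (\<lambda>w. eps + indicator ?E w)"
     by (intro Bochner_Integration.integrable_add integrable_real_indicator) (auto simp: less_top[symmetric])
    fix w assume w: "w \<in> space M"
    show "enn2real (min 1 (Y n w)) \<le> eps + indicator ?E w"
    proof (cases "Y n w > ennreal eps")
     case True
     then show ?thesis using b1[of n w] w e by (simp add: eps_def)
    next
     case False
     then have "enn2real (min 1 (Y n w)) \<le> eps" using e by (intro enn2real_leI) (auto simp: eps_def min_le_iff_disj)
     moreover have "0 \<le> (indicator ?E w :: real)" by simp
     ultimately show ?thesis by linarith
    qed
   qed
   also have "... = eps + measure M ?E"
   proof -
    have "has_bochner_integral M (\<lambda>w. indicator ?E w :: real) (measure M ?E)"
     by (rule has_bochner_integral_real_indicator) (auto simp: less_top[symmetric])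
    then show ?thesis
     by (subst Bochner_Integration.integral_add) (auto simp: has_bochner_integral_iff prob_space)
   qed
   also have "... < e" using n0[OF n] by (simp add: eps_def)
   finally show "norm ((LINT w|M. enn2real (min 1 (Y n w))) - 0) < e"
    using Bochner_Integration.integral_nonneg[of M "\<lambda>w. enn2real (min 1 (Y n w))"] b1(1) by simp
  qed
 qed
qed

text \<open>The upper limit of integration also varies; it is moved into an indicator, which is
  jointly measurable in both time variables.\<close>

lemma (in filtered_prob) prog_integral_joint:
 fixes f :: "real => 'w => 'b::{banach, second_countable_topology}"
 assumes T: "0 \<le> T" and f: "prog T f"
 shows "prog T (\<lambda>v w. LINT s:{0..v}|lborel. f s w)"
proof -
 have "(\<lambda>p. (snd p, snd (fst p))) \<in> measurable ((borel \<Otimes>\<^sub>M F T) \<Otimes>\<^sub>M (lborel :: real measure)) (borel \<Otimes>\<^sub>M F T)"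
  by measurable
 from measurable_compose[OF this f[unfolded prog_def]]
 have [measurable]: "(\<lambda>p. f (clip T (snd p)) (snd (fst p))) \<in> borel_measurable ((borel \<Otimes>\<^sub>M F T) \<Otimes>\<^sub>M (lborel :: real measure))"
  by simp
 have "(\<lambda>x. LINT s|lborel. indicator {0..clip T (fst x)} s *\<^sub>R f (clip T s) (snd x)) \<in> borel_measurable (borel \<Otimes>\<^sub>M F T)"
 proof (rule sigma_finite_measure.borel_measurable_lebesgue_integral[OF sigma_finite_lborel])
  have "(\<lambda>p. (if 0 \<le> snd p \<and> snd p \<le> clip T (fst (fst p)) then 1 else 0 :: real) *\<^sub>R f (clip T (snd p)) (snd (fst p)))
    \<in> borel_measurable ((borel \<Otimes>\<^sub>M F T) \<Otimes>\<^sub>M (lborel :: real measure))"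
   by measurable
  then show "(\<lambda>(x, s). indicator {0..clip T (fst x)} s *\<^sub>R f (clip T s) (snd x)) \<in> borel_measurable ((borel \<Otimes>\<^sub>M F T) \<Otimes>\<^sub>M (lborel :: real measure))"
   by (simp add: case_prod_beta' indicator_def)
 qed
 also have "(\<lambda>x. LINT s|lborel. indicator {0..clip T (fst x)} s *\<^sub>R f (clip T s) (snd x)) = (\<lambda>x. LINT s:{0..clip T (fst x)}|lborel. f s (snd x))"
  unfolding set_lebesgue_integral_def
 proof (intro ext Bochner_Integration.integral_cong refl)
  fix x :: "real \<times> 'w" and s :: real
  show "indicator {0..clip T (fst x)} s *\<^sub>R f (clip T s) (snd x) = indicator {0..clip T (fst x)} s *\<^sub>R f s (snd x)"
  proof (cases "s \<in> {0..clip T (fst x)}")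
   case True
   then have "s \<in> {0..T}" using clip_in[OF T, of "fst x"] by auto
   then show ?thesis by (simp add: clip_eq)
  qed simp
 qed
 finally show ?thesis by (simp add: prog_def)
qed

text \<open>The stochastic integral enters only through the simple processes that approximate it;
  its value is recovered as \<open>Zp\<close> minus the initial value minus the integrated drift,
  which is the content of \<open>approx_int\<close>.\<close>

locale ito_process = brownian_space M F B + markov_space M F N \<Gamma> r
 for M :: "'w measure" and F and B :: "real => 'w => real^'m" and N \<Gamma> r +
 fixes b :: "real => 'w => real^'d" and \<sigma> :: "real => 'w => real^'m^'d" and Zp :: "real => 'w => real^'d"
  and nn :: "nat => nat" and uu :: "nat => nat => real" and etaeta :: "nat => nat => 'w => real^'m^'d"
 assumes B_cont: "!!w. w \<in> space M ==> continuous_on {0..} (\<lambda>t. B t w)"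
  and b_prog: "!!v. 0 \<le> v ==> prog v b" and \<sigma>_prog: "!!v. 0 \<le> v ==> prog v \<sigma>" and Zp_prog: "!!v. 0 \<le> v ==> prog v Zp"
  and b_int: "AE w in M. \<forall>t\<ge>0. set_integrable lborel {0..t} (\<lambda>s. b s w)"
  and \<sigma>_int: "AE w in M. \<forall>t\<ge>0. (\<integral>\<^sup>+s\<in>{0..t}. ennreal ((norm (\<sigma> s w))^2) \<partial>lborel) < \<infinity>"
  and simple: "!!j. simple_process M F (nn j) (uu j) (etaeta j)"
  and approx_val: "!!v. 0 \<le> v ==> null_in_prob M (\<lambda>j w.
    \<integral>\<^sup>+s\<in>{0..v}. ennreal ((norm (simple_val (nn j) (uu j) (etaeta j) s w - \<sigma> s w))^2) \<partial>lborel)"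
  and approx_int: "!!v. 0 \<le> v ==> null_in_prob M (\<lambda>j w.
    ennreal (norm (simple_integral B (nn j) (uu j) (etaeta j) v w - (Zp v w - Zp 0 w - (LINT s:{0..v}|lborel. b s w)))))"
begin

text \<open>The suffix \<open>j\<close> marks the approximating process with truncated drift and simple integrand, the suffix
 \<open>p\<close> the process itself.\<close>

definition spd :: "real => 'w => real" where "spd s w = (norm (\<sigma> s w))^2 + norm (b s w)"
definition Qp :: "real => 'w => real" where "Qp v w = (LINT s:{0..v}|lborel. spd s w)"
definition bj :: "nat => real => 'w => real^'d" where "bj j s w = (if norm (b s w) \<le> real j then b s w else 0)"
definition Gj :: "nat => real => 'w => real^'m^'d" where "Gj j s w = simple_val (nn j) (uu j) (etaeta j) s w"
definition Sj :: "nat => real => 'w => real^'d" where "Sj j v w = simple_integral B (nn j) (uu j) (etaeta j) v w"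
definition Zj :: "nat => real => 'w => real^'d" where "Zj j v w = Zp 0 w + (LINT s:{0..v}|lborel. bj j s w) + Sj j v w"
definition Qj :: "nat => real => 'w => real" where "Qj j v w = (LINT s:{0..v}|lborel. (norm (Gj j s w))^2 + norm (bj j s w))"
definition Ip :: "real => 'w => real^'d" where "Ip v w = Zp v w - Zp 0 w - (LINT s:{0..v}|lborel. b s w)"

definition ej :: "real => nat => 'w => ennreal" where
 "ej T j w = (\<integral>\<^sup>+s\<in>{0..T}. ennreal ((norm (Gj j s w - \<sigma> s w))^2) \<partial>lborel)"
definition fe :: "real => nat => 'w => real" where "fe T j w = enn2real (min 1 (ej T j w))"
definition fd :: "nat => real => 'w => real" where "fd j v w = min 1 (norm (Sj j v w - Ip v w))"

lemma Zp_meas: "0 \<le> v ==> Zp v \<in> borel_measurable (F v)"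
proof -
 assume v: "0 \<le> v"
 have "(\<lambda>w. (v, w)) \<in> measurable (F v) (borel \<Otimes>\<^sub>M F v)" by measurable
 from measurable_compose[OF this Zp_prog[OF v, unfolded prog_def]] show ?thesis
  using v by (simp add: clip_eq)
qed

lemma bj_prog: "0 \<le> v ==> prog v (bj j)"
 using b_prog[of v] unfolding prog_def bj_def by measurable

lemma spd_prog: "0 \<le> v ==> prog v spd"
 using \<sigma>_prog[of v] b_prog[of v] unfolding prog_def spd_def
 by (intro borel_measurable_add borel_measurable_power measurable_compose[OF _ borel_measurable_norm]) auto

lemma Ip_prog: "0 \<le> T ==> prog T Ip"
proof -
 assume T: "0 \<le> T"
 have "(\<lambda>x. Zp 0 (snd x)) \<in> borel_measurable (borel \<Otimes>\<^sub>M F T)"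
  by (rule measurable_compose[OF measurable_snd measurable_F_mono[OF _ T Zp_meas]]) auto
 then show ?thesis
  using Zp_prog[OF T] prog_integral_joint[OF T b_prog[OF T]] unfolding prog_def Ip_def
  by (intro borel_measurable_diff)
qed

lemma fd_bounds: "0 \<le> fd j v w" "fd j v w \<le> 1" by (auto simp: fd_def)

lemma fe_bounds: "0 \<le> fe T j w" "fe T j w \<le> 1" by (auto simp: fe_def intro: enn2real_leI)

lemma fe_meas:
 assumes "0 \<le> T"
 shows "fe T j \<in> borel_measurable M"
proof -
 have [measurable]: "ej T j \<in> borel_measurable M"
  using approx_val[OF assms] unfolding null_in_prob_def ej_def[abs_def] Gj_def by blast
 show ?thesis unfolding fe_def[abs_def] by measurable
qed

lemma fe_limit: "0 \<le> T ==> (\<lambda>j. \<integral>w. fe T j w \<partial>M) \<longlonglongrightarrow> 0"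
 using null_in_prob_expectation[OF prob_space_axioms approx_val[of T]] unfolding fe_def ej_def Gj_def .

lemma enn2real_min1: "0 \<le> x ==> enn2real (min 1 (ennreal x)) = min 1 x"
proof -
 assume "0 \<le> x"
 have "min 1 (ennreal x) = ennreal (min 1 x)"
  by (cases "x \<le> 1") (auto simp: min_def ennreal_le_1)
 then show ?thesis using \<open>0 \<le> x\<close> by simp
qed

lemma fd_limit: "0 \<le> v ==> (\<lambda>j. \<integral>w. fd j v w \<partial>M) \<longlonglongrightarrow> 0"
 using null_in_prob_expectation[OF prob_space_axioms approx_int[of v]]
 unfolding fd_def Sj_def Ip_def by (simp only: enn2real_min1[OF norm_ge_zero])

lemma Sj_prog:
 assumes T: "0 \<le> T"
 shows "prog T (Sj j)"
proof (rule prog_continuous[OF T])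
 let ?n = "nn j" and ?u = "uu j" and ?eta = "etaeta j"
 have sp: "0 \<le> ?u 0" "!!k. k < ?n ==> ?u k \<le> ?u (Suc k)" "!!k. k < ?n ==> ?eta k \<in> borel_measurable (F (?u k))"
  using simple[of j] by (auto simp: simple_process_def)
 have u: "0 \<le> ?u k" if "k \<le> ?n" for k using that
 proof (induction k)
  case 0 show ?case by (rule sp(1))
 next
  case (Suc k) then show ?case using sp(2)[of k] by auto
 qed
 show "Sj j t \<in> borel_measurable (F t)" if "t \<in> {0..T}" for t
  unfolding Sj_def[abs_def] simple_integral_def
 proof (rule borel_measurable_sum)
  have t: "0 \<le> t" using that by auto
  fix k assume k: "k \<in> {..<?n}"
  show "(\<lambda>w. ?eta k w *v (B (min t (?u (Suc k))) w - B (min t (?u k)) w)) \<in> borel_measurable (F t)"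
  proof (cases "?u k \<le> t")
   case True
   have "?eta k \<in> borel_measurable (F t)"
    using u[of k] k True by (intro measurable_F_mono[OF _ _ sp(3)]) auto
   moreover have "B (min t y) \<in> borel_measurable (F t)" if "0 \<le> y" for y
    by (rule measurable_F_mono[OF _ _ B_meas]) (use t that in auto)
   ultimately have m1: "(\<lambda>w. (?eta k w, B (min t (?u (Suc k))) w - B (min t (?u k)) w)) \<in> borel_measurable (F t)"
    using u[of k] u[of "Suc k"] k by (intro borel_measurable_Pair borel_measurable_diff) auto
   have m2: "(\<lambda>p. (fst p :: real^'m^'d) *v snd p) \<in> borel_measurable borel"
    unfolding matrix_vector_mult_def by (rule borel_measurable_continuous_onI) (intro continuous_intros)
   show ?thesis using measurable_compose[OF m1 m2] by simp
  next
   case False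
   then have "min t (?u (Suc k)) = t" "min t (?u k) = t" using sp(2)[of k] k by auto
   then show ?thesis by simp
  qed
 qed
 fix w assume w: "w \<in> space M"
 show "continuous_on {0..T} (\<lambda>s. Sj j s w)"
  unfolding Sj_def simple_integral_def
 proof (rule continuous_on_sum)
  fix k assume k: "k \<in> {..<?n}"
  have B: "continuous_on {0..T} (\<lambda>v. B (min v y) w)" if "0 \<le> y" for y
   by (rule continuous_on_compose2[OF B_cont[OF w]]) (use that in \<open>auto intro!: continuous_intros\<close>)
  show "continuous_on {0..T} (\<lambda>v. ?eta k w *v (B (min v (?u (Suc k))) w - B (min v (?u k)) w))"
   using u[of k] u[of "Suc k"] k unfolding matrix_vector_mult_def
   by (intro continuous_intros B) auto
 qed
qed

lemma fd_joint:
 assumes T: "0 \<le> T"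
 shows "(\<lambda>x. fd j (clip T (fst x)) (snd x)) \<in> borel_measurable (borel \<Otimes>\<^sub>M M)"
 unfolding fd_def
 using joint_F_M[OF T Sj_prog[OF T, unfolded prog_def]] joint_F_M[OF T Ip_prog[OF T, unfolded prog_def]]
 by measurable

lemma fd_meas: "0 \<le> v ==> fd j v \<in> borel_measurable M"
proof -
 assume v: "0 \<le> v"
 have "(\<lambda>w. (v, w)) \<in> measurable M (borel \<Otimes>\<^sub>M M)" by measurable
 from measurable_compose[OF this fd_joint[OF v]] show ?thesis using v by (simp add: clip_eq)
qed

text \<open>Convergence in probability is given for each time separately, but a time integral along
  one path needs almost every time at once. The truncated errors tend to 0 in L1 of the product of
  \<open>M\<close> and \<open>[0, T]\<close>, so a subsequence converges almost everywhere there and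
  Fubini selects the paths. The error of the integrand and those at \<open>s\<close> and
  \<open>t\<close> are added to the same sum, to share the subsequence.\<close>

lemma subsequence:
 assumes T: "0 < T" and st: "0 \<le> s" "0 \<le> t"
 obtains \<rho> :: "nat => nat" where "strict_mono \<rho>"
  "AE w in M. (\<lambda>j. fe T (\<rho> j) w) \<longlonglongrightarrow> 0 \<and> (\<lambda>j. fd (\<rho> j) s w) \<longlonglongrightarrow> 0 \<and> (\<lambda>j. fd (\<rho> j) t w) \<longlonglongrightarrow> 0
   \<and> (AE u in lborel. u \<in> {0..T} --> (\<lambda>j. fd (\<rho> j) u w) \<longlonglongrightarrow> 0)"
proof -
 interpret P: pair_sigma_finite M "lborel :: real measure" ..
 have T0: "0 \<le> T" using T by simp
 let ?h = "\<lambda>j w u. fe T j w + fd j s w + fd j t w + fd j (clip T u) w"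
 let ?g = "\<lambda>j w u. indicator {0..T} u * ?h j w u"
 have hb: "0 \<le> ?h j w u" "?h j w u \<le> 4" for j w u
  using fe_bounds[of T j w] fd_bounds[of j s w] fd_bounds[of j t w] fd_bounds[of j "clip T u" w] by auto
 have fdj: "(\<lambda>p. fd j (clip T (snd p)) (fst p)) \<in> borel_measurable (M \<Otimes>\<^sub>M lborel)" for j
 proof -
  have "(\<lambda>p. (snd p, fst p)) \<in> measurable (M \<Otimes>\<^sub>M (lborel :: real measure)) (borel \<Otimes>\<^sub>M M)" by measurable
  from measurable_compose[OF this fd_joint[OF T0]] show ?thesis by simp
 qed
 have gm: "case_prod (?g j) \<in> borel_measurable (M \<Otimes>\<^sub>M lborel)" for j
  unfolding case_prod_beta'
  by (intro borel_measurable_times borel_measurable_add fdj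
    measurable_compose[OF measurable_fst fe_meas[OF T0]] measurable_compose[OF measurable_fst fd_meas] st
    measurable_compose[OF measurable_snd borel_measurable_indicator]) auto
 have gi: "integrable (M \<Otimes>\<^sub>M lborel) (case_prod (?g j))" for j
 proof (rule integrableI_bounded_set[where A = "space M \<times> {0..T}" and B = 4])
  show "space M \<times> {0..T} \<in> sets (M \<Otimes>\<^sub>M lborel)" by auto
  show "emeasure (M \<Otimes>\<^sub>M lborel) (space M \<times> {0..T}) < \<infinity>"
   by (subst lborel.emeasure_pair_measure_Times) (auto simp: emeasure_lborel_Icc_eq emeasure_space_1)
  show "AE x in M \<Otimes>\<^sub>M lborel. x \<in> space M \<times> {0..T} --> norm (case_prod (?g j) x) \<le> 4"
   using hb by (intro AE_I2) (auto simp: case_prod_beta' abs_of_nonneg)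
  show "AE x in M \<Otimes>\<^sub>M lborel. x \<notin> space M \<times> {0..T} --> case_prod (?g j) x = 0"
   by (intro AE_I2) (auto simp: case_prod_beta' space_pair_measure indicator_def)
 qed (rule gm)
 have ih: "integrable M (\<lambda>w. fe T j w)" "0 \<le> v ==> integrable M (\<lambda>w. fd j v w)" for j v
  using fe_meas[OF T0] fd_meas fe_bounds fd_bounds by (auto intro!: integrable_const_bound[where B = 1])
 have c0: "0 \<le> clip T u" for u using clip_in[OF T0, of u] by auto
 have lim: "(\<lambda>j. LINT u|lborel. (LINT w|M. ?g j w u)) \<longlonglongrightarrow> (LINT u|(lborel :: real measure). (0::real))"
 proof (rule integral_dominated_convergence[where w = "\<lambda>u. indicator {0..T} u * 4"])
  show "(\<lambda>u. \<integral>w. ?g j w u \<partial>M) \<in> borel_measurable lborel" for j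
   using P.integrable_snd[OF gi[of j]] by (rule borel_measurable_integrable)
  show "integrable lborel (\<lambda>u. indicator {0..T} u * (4::real))"
   by (intro integrable_mult_left integrable_real_indicator) (auto simp: emeasure_lborel_Icc_eq)
  show "AE u in lborel. norm (LINT w|M. ?g j w u) \<le> indicator {0..T} u * 4" for j
  proof (intro AE_I2)
   fix u
   have "\<bar>LINT w|M. ?g j w u\<bar> \<le> indicator {0..T} u * 4"
    by (rule abs_expectation_le) (use hb in \<open>auto simp: indicator_def abs_of_nonneg\<close>)
   then show "norm (LINT w|M. ?g j w u) \<le> indicator {0..T} u * 4" by simp
  qed
  show "AE u in lborel. (\<lambda>j. \<integral>w. ?g j w u \<partial>M) \<longlonglongrightarrow> 0"
  proof (intro AE_I2)
   fix u
   have "(LINT w|M. ?g j w u) = indicator {0..T} u * ((LINT w|M. fe T j w) + (LINT w|M. fd j s w) + (LINT w|M. fd j t w) + (LINT w|M. fd j (clip T u) w))" for j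
    using ih st c0 by simp
   moreover have "(\<lambda>j. indicator {0..T} u * ((LINT w|M. fe T j w) + (LINT w|M. fd j s w) + (LINT w|M. fd j t w) + (LINT w|M. fd j (clip T u) w)))
    \<longlonglongrightarrow> indicator {0..T} u * (0 + 0 + 0 + (0::real))"
    by (intro tendsto_intros fe_limit[OF T0] fd_limit st c0)
   ultimately show "(\<lambda>j. \<integral>w. ?g j w u \<partial>M) \<longlonglongrightarrow> 0"
    by (simp only: add_0_right mult_zero_right)
  qed
 qed simp
 have "(\<lambda>j. \<integral>x. norm (case_prod (?g j) x) \<partial>(M \<Otimes>\<^sub>M lborel)) \<longlonglongrightarrow> 0"
 proof -
  have "(\<integral>x. norm (case_prod (?g j) x) \<partial>(M \<Otimes>\<^sub>M lborel)) = (LINT u|lborel. (LINT w|M. ?g j w u))" for j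
  proof -
   have "(\<integral>x. norm (case_prod (?g j) x) \<partial>(M \<Otimes>\<^sub>M lborel)) = (\<integral>x. case_prod (?g j) x \<partial>(M \<Otimes>\<^sub>M lborel))"
    by (rule Bochner_Integration.integral_cong) (use hb in \<open>auto simp: case_prod_beta' indicator_def abs_of_nonneg\<close>)
   also have "... = (LINT u|lborel. (LINT w|M. ?g j w u))" by (rule P.integral_snd[OF gi, symmetric])
   finally show ?thesis .
  qed
  then show ?thesis using lim by simp
 qed
 from tendsto_L1_AE_subseq[OF gi this] obtain \<rho> :: "nat => nat" where \<rho>: "strict_mono \<rho>"
  and ae: "AE x in M \<Otimes>\<^sub>M lborel. (\<lambda>n. case_prod (?g (\<rho> n)) x) \<longlonglongrightarrow> 0" by blast
 have "AE w in M. AE u in lborel. (\<lambda>n. ?g (\<rho> n) w u) \<longlonglongrightarrow> 0"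
  using P.AE_pair[OF ae] by simp
 then have "AE w in M. (\<lambda>j. fe T (\<rho> j) w) \<longlonglongrightarrow> 0 \<and> (\<lambda>j. fd (\<rho> j) s w) \<longlonglongrightarrow> 0 \<and> (\<lambda>j. fd (\<rho> j) t w) \<longlonglongrightarrow> 0
   \<and> (AE u in lborel. u \<in> {0..T} --> (\<lambda>j. fd (\<rho> j) u w) \<longlonglongrightarrow> 0)"
 proof eventually_elim
  case (elim w)
  have sq: "(\<lambda>n. f n) \<longlonglongrightarrow> 0" if "(\<lambda>n. ?g (\<rho> n) w u) \<longlonglongrightarrow> 0" "u \<in> {0..T}" "!!n. 0 \<le> f n" "!!n. f n \<le> ?h (\<rho> n) w u"
   for f :: "nat => real" and u
   using that by (intro tendsto_sandwich[of "\<lambda>_. 0" f sequentially "\<lambda>n. ?g (\<rho> n) w u" 0]) auto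
  \<comment> \<open>Three summands do not depend on \<open>u\<close>; one time at which the sum
    converges is enough for them, and it exists because \<open>[0, T]\<close> has positive
    length.\<close>
  have "\<exists>u\<in>{0..T}. (\<lambda>n. ?g (\<rho> n) w u) \<longlonglongrightarrow> 0"
  proof (rule ccontr)
   assume no: "\<not> (\<exists>u\<in>{0..T}. (\<lambda>n. ?g (\<rho> n) w u) \<longlonglongrightarrow> 0)"
   have "AE u in lborel. u \<notin> {0..T}" using elim by eventually_elim (use no in blast)
   then have "emeasure lborel {0..T} = 0" by (subst (asm) AE_iff_measurable[of "{0..T}"]) auto
   then show False using T by simp
  qed
  then obtain u where u: "u \<in> {0..T}" "(\<lambda>n. ?g (\<rho> n) w u) \<longlonglongrightarrow> 0" by blast
  note nn = fe_bounds(1) fd_bounds(1)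
  have 1: "(\<lambda>j. fe T (\<rho> j) w) \<longlonglongrightarrow> 0" by (rule sq[OF u(2,1)]) (simp_all add: nn)
  have 2: "(\<lambda>j. fd (\<rho> j) s w) \<longlonglongrightarrow> 0" by (rule sq[OF u(2,1)]) (simp_all add: nn)
  have 3: "(\<lambda>j. fd (\<rho> j) t w) \<longlonglongrightarrow> 0" by (rule sq[OF u(2,1)]) (simp_all add: nn)
  have 4: "AE u in lborel. u \<in> {0..T} --> (\<lambda>j. fd (\<rho> j) u w) \<longlonglongrightarrow> 0"
   using elim
  proof eventually_elim
   case (elim u)
   show ?case
   proof
    assume uT: "u \<in> {0..T}"
    show "(\<lambda>j. fd (\<rho> j) u w) \<longlonglongrightarrow> 0"
     by (rule sq[OF elim uT]) (simp_all add: nn clip_eq[OF uT])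
   qed
  qed
  show ?case using 1 2 3 4 by blast
 qed
 with \<rho> show ?thesis by (rule that)
qed

end

context filtered_prob
begin

lemma prog_integral_Icc:
 fixes f :: "real => 'w => 'b::{banach, second_countable_topology}"
 assumes f: "prog T f" and sub: "{s..t} \<subseteq> {0..T}"
 shows "(\<lambda>w. LINT v:{s..t}|lborel. f v w) \<in> borel_measurable (F T)"
proof -
 have "(\<lambda>x. f (clip T (fst x)) (snd x)) \<in> borel_measurable (lborel \<Otimes>\<^sub>M F T)"
  using f by (simp add: prog_def measurable_cong_sets[OF sets_pair_measure_cong[OF sets_lborel refl] refl])
 from measurable_compose[OF measurable_pair_swap' this]
 have [measurable]: "(\<lambda>x. f (clip T (snd x)) (fst x)) \<in> borel_measurable (F T \<Otimes>\<^sub>M lborel)"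
  by (simp add: case_prod_beta')
 have "(\<lambda>w. LINT v|lborel. indicator {s..t} v *\<^sub>R f (clip T v) w) \<in> borel_measurable (F T)"
  by (rule sigma_finite_measure.borel_measurable_lebesgue_integral[OF sigma_finite_lborel])
   (simp add: case_prod_beta', measurable)
 also have "(\<lambda>w. LINT v|lborel. indicator {s..t} v *\<^sub>R f (clip T v) w) = (\<lambda>w. LINT v:{s..t}|lborel. f v w)"
  unfolding set_lebesgue_integral_def
 proof (intro ext Bochner_Integration.integral_cong refl)
  fix w and v :: real
  show "indicator {s..t} v *\<^sub>R f (clip T v) w = indicator {s..t} v *\<^sub>R f v w"
   using sub clip_eq[of v T] by (cases "v \<in> {s..t}") auto
 qed
 finally show ?thesis .
qed

lemma prog_set_measurable:
 fixes f :: "real => 'w => 'b::{banach, second_countable_topology}"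
 assumes f: "prog T f" and w: "w \<in> space M" and T: "0 \<le> T"
 shows "set_borel_measurable lborel {0..T} (\<lambda>v. f v w)"
proof -
 have "(\<lambda>v. indicator {0..T} v *\<^sub>R f (clip T v) w) \<in> borel_measurable lborel"
  using prog_section[OF f w T] by measurable
 also have "(\<lambda>v. indicator {0..T} v *\<^sub>R f (clip T v) w) = (\<lambda>v. indicator {0..T} v *\<^sub>R f v w)"
  by (auto simp: fun_eq_iff indicator_def clip_eq)
 finally show ?thesis by (simp add: set_borel_measurable_def)
qed

end

lemma (in switching_test) H_prog:
 assumes "prog T Z" "prog T Q" "!!v w. 0 \<le> Q v w" "prog T b" "prog T G"
 shows "prog T (\<lambda>v w. H (Z v w) (Q v w) v (r v w) (b v w) (G v w))"
 unfolding prog_def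
proof (rule H_measurable)
 show "(\<lambda>x. r (clip T (fst x)) (snd x)) \<in> borel \<Otimes>\<^sub>M F T \<rightarrow>\<^sub>M count_space UNIV"
  by (rule r_joint[OF T])
 show "(\<lambda>x::real \<times> 'w. clip T (fst x)) \<in> borel_measurable (borel \<Otimes>\<^sub>M F T)" by measurable
 fix x assume "x \<in> space (borel \<Otimes>\<^sub>M F T :: (real \<times> 'w) measure)"
 then have x: "snd x \<in> space M" using space_F[OF T] by (simp add: space_pair_measure mem_Times_iff)
 show c: "clip T (fst x) \<in> {0..T}" by (rule clip_in[OF T])
 show "r (clip T (fst x)) (snd x) \<in> S" by (rule r_in_S[OF x]) (use c in auto)
qed (use assms in \<open>simp_all add: prog_def\<close>)

text \<open>The support condition does the localisation: once \<open>Q\<close> has reached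
  \<open>K\<close>, the function and its derivatives are 0, so unbounded coefficients do no harm
  afterwards.\<close>

locale ito_limit = ito_process M F B N \<Gamma> r b \<sigma> Zp nn uu etaeta + switching_test M F B N \<Gamma> r T C phi phiz phizz phiq phit
 for M :: "'w measure" and F and B :: "real => 'w => real^'m" and N \<Gamma> r
  and b :: "real => 'w => real^'d" and \<sigma> Zp nn uu etaeta T C and phi :: "real^'d => real => real => int => real" and phiz phizz phiq phit +
 fixes K :: real
 assumes K: "0 \<le> K"
  and support: "!!z q t i. i \<in> S ==> K \<le> q ==> t \<in> {0..T} ==>
    phi z q t i = 0 \<and> phiz z q t i = 0 \<and> phizz z q t i = 0 \<and> phiq z q t i = 0 \<and> phit z q t i = 0"
begin

lemma H_support: "i \<in> S ==> K \<le> q ==> t \<in> {0..T} ==> H z q t i b' G = 0"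
 unfolding H_def using support by (simp add: quad_trace_sum)

definition Hj :: "nat => real => 'w => real" where
 "Hj j v w = H (Zj j v w) (Qj j v w) v (r v w) (bj j v w) (Gj j v w)"
definition Hp :: "real => 'w => real" where
 "Hp v w = H (Zp v w) (Qp v w) v (r v w) (b v w) (\<sigma> v w)"
definition Phij :: "nat => real => 'w => real" where
 "Phij j v w = phi (Zj j v w) (Qj j v w) v (r v w)"
definition Phip :: "real => 'w => real" where
 "Phip v w = phi (Zp v w) (Qp v w) v (r v w)"

text \<open>The approximation number \<open>j\<close> is an instance of \<open>simple_ito\<close>;
  the bound \<open>max (real j) C'\<close> covers the truncated drift as well as the values of the
  simple integrand.\<close>

lemma j_facts:
 shows j_ito: "!!s t A. 0 \<le> s ==> s \<le> t ==> t \<le> T ==> A \<in> sets (F s) ==>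
  (LINT w|M. indicator A w * (Phij j t w - Phij j s w)) = (LINT w|M. indicator A w * (LINT v:{s..t}|lborel. Hj j v w))"
  and j_Z: "prog T (Zj j)" and j_Q: "prog T (Qj j)" and j_G: "prog T (Gj j)" and j_Qnn: "!!v w. 0 \<le> Qj j v w"
  and j_Qcont: "!!w. w \<in> space M ==> continuous_on {0..T} (\<lambda>v. Qj j v w)"
  and j_speed: "!!w. w \<in> space M ==> set_integrable lborel {0..T} (\<lambda>s. (norm (Gj j s w))^2 + norm (bj j s w))"
  and j_Gbound: "\<exists>L. \<forall>w\<in>space M. \<forall>s. norm (Gj j s w) \<le> L"
  and j_Phi: "!!v. v \<in> {0..T} ==> Phij j v \<in> borel_measurable M"
  and j_Hint: "!!w v y. w \<in> space M ==> {v..y} \<subseteq> {0..T} ==> set_integrable lborel {v..y} (\<lambda>s. Hj j s w)"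
proof -
 obtain C' where C': "\<forall>k<nn j. \<forall>w\<in>space M. norm (etaeta j k w) \<le> C'"
  using simple[of j] by (auto simp: simple_process_def)
 interpret c: simple_ito M F B N \<Gamma> r T C phi phiz phizz phiq phit "nn j" "uu j" "etaeta j" "bj j" "max (real j) C'" "Zp 0"
 proof
  show "continuous_on {0..} (\<lambda>t. B t w)" if "w \<in> space M" for w by (rule B_cont[OF that])
  show "0 \<le> uu j 0" "!!k. k < nn j ==> uu j k \<le> uu j (Suc k)" "!!k. k < nn j ==> etaeta j k \<in> borel_measurable (F (uu j k))"
   using simple[of j] by (auto simp: simple_process_def)
  show "norm (etaeta j k w) \<le> max (real j) C'" if "k < nn j" "w \<in> space M" for k w
   using C' that by (meson le_max_iff_disj)
  show "prog v (bj j)" if "v \<in> {0..T}" for v by (rule bj_prog) (use that in auto)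
  show "norm (bj j s w) \<le> max (real j) C'" for s w by (simp add: bj_def le_max_iff_disj)
  show "Zp 0 \<in> borel_measurable (F 0)" by (rule Zp_meas) simp
 qed
 have e: "c.G = Gj j" "c.Z = Zj j" "c.Q = Qj j"
  by (auto simp: fun_eq_iff c.G_def Gj_def c.Z_def Zj_def Sj_def c.Q_def Qj_def)
 have e2: "c.Phi = Phij j" "c.HH = Hj j"
  by (auto simp: fun_eq_iff c.Phi_def Phij_def c.HH_def Hj_def e)
 have e3: "c.sp = (\<lambda>s w. (norm (Gj j s w))^2 + norm (bj j s w))" by (simp add: fun_eq_iff c.sp_def e)
 show "(LINT w|M. indicator A w * (Phij j t w - Phij j s w)) = (LINT w|M. indicator A w * (LINT v:{s..t}|lborel. Hj j v w))"
  if "0 \<le> s" "s \<le> t" "t \<le> T" "A \<in> sets (F s)" for s t A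
  using c.ito_simple[OF that] unfolding e2 .
 show "prog T (Zj j)" using c.Z_prog unfolding e .
 show "prog T (Qj j)" using c.Q_prog unfolding e .
 show "prog T (Gj j)" using c.G_prog[OF T] unfolding e .
 show "0 \<le> Qj j v w" for v w using c.Q_nonneg unfolding e .
 show "continuous_on {0..T} (\<lambda>v. Qj j v w)" if "w \<in> space M" for w using c.Q_cont[OF that] unfolding e .
 show "set_integrable lborel {0..T} (\<lambda>s. (norm (Gj j s w))^2 + norm (bj j s w))" if "w \<in> space M" for w
  using c.sp_set_integrable[OF that, of 0 T] unfolding e3 by simp
 show "\<exists>L. \<forall>w\<in>space M. \<forall>s. norm (Gj j s w) \<le> L" using c.G_le_Lc unfolding e by blast
 show "Phij j v \<in> borel_measurable M" if "v \<in> {0..T}" for v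
  using borel_measurable_integrable[OF c.Phi_integrable[OF that]] unfolding e2 .
 show "set_integrable lborel {v..y} (\<lambda>s. Hj j s w)" if "w \<in> space M" "{v..y} \<subseteq> {0..T}" for w v y
  using c.HH_set_integrable[OF that] unfolding e2 .
qed

text \<open>Where the approximating \<open>Q\<close> is below \<open>K\<close>,
  \<open>H_growth\<close> applies and the speed has integral at most \<open>K\<close> by
  \<open>sublevel_integral_le\<close>; elsewhere the drift is 0. The bound does not depend on
  \<open>j\<close>, so it dominates in the passage to the limit.\<close>

lemma Hj_integral_bound:
 assumes w: "w \<in> space M" and st: "{s..t} \<subseteq> {0..T}"
 shows "\<bar>LINT v:{s..t}|lborel. Hj j v w\<bar> \<le> C1 * (T + K)"
proof -
 let ?sp = "\<lambda>s. (norm (Gj j s w))^2 + norm (bj j s w)" and ?Q = "\<lambda>v. Qj j v w"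
 let ?A = "{u\<in>{0..T}. ?Q u < K}"
 have cl: "closed {u\<in>{0..T}. K \<le> ?Q u}"
  using continuous_on_closed_Collect_le[OF continuous_on_const j_Qcont[OF w], of K j] by simp
 have "?A = {0..T} - {u\<in>{0..T}. K \<le> ?Q u}" by auto
 then have A: "?A \<in> sets lborel" using cl by auto
 have spA: "set_integrable lborel ?A ?sp" by (rule set_integrable_subset[OF j_speed[OF w] A]) auto
 have eq: "indicator ?A v *\<^sub>R ?sp v = indicator {0..T} v *\<^sub>R (indicator {u. ?Q u < K} v * ?sp v)" for v
  by (auto simp: indicator_def)
 have int1: "integrable lborel (\<lambda>v. indicator {0..T} v *\<^sub>R (indicator {u. ?Q u < K} v * ?sp v))"
  using spA unfolding set_integrable_def eq .
 have sub: "(LINT v:{0..T}|lborel. indicator {u. ?Q u < K} v * ?sp v) \<le> K"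
  by (rule sublevel_integral_le[OF j_speed[OF w] _ T K _ j_Qcont[OF w]]) (auto simp: Qj_def)
 have one: "integrable lborel (\<lambda>v. indicator {0..T} v *\<^sub>R (1::real))"
  by (auto intro!: integrable_real_indicator simp: emeasure_lborel_Icc_eq)
 have "\<bar>LINT v:{s..t}|lborel. Hj j v w\<bar> \<le> (LINT v|lborel. \<bar>indicator {s..t} v *\<^sub>R Hj j v w\<bar>)"
  unfolding set_lebesgue_integral_def by (rule integral_abs_bound)
 also have "... \<le> (LINT v|lborel. C1 * (indicator {0..T} v *\<^sub>R 1 + indicator {0..T} v *\<^sub>R (indicator {u. ?Q u < K} v * ?sp v)))"
 proof (rule integral_mono')
  show "integrable lborel (\<lambda>v. C1 * (indicator {0..T} v *\<^sub>R 1 + indicator {0..T} v *\<^sub>R (indicator {u. ?Q u < K} v * ?sp v)))"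
   by (intro integrable_mult_right Bochner_Integration.integrable_add one int1)
  fix v
  show "0 \<le> C1 * (indicator {0..T} v *\<^sub>R 1 + indicator {0..T} v *\<^sub>R (indicator {u. ?Q u < K} v * ?sp v))"
   using C1_nonneg by (intro mult_nonneg_nonneg add_nonneg_nonneg) auto
  show "\<bar>indicator {s..t} v *\<^sub>R Hj j v w\<bar> \<le> C1 * (indicator {0..T} v *\<^sub>R 1 + indicator {0..T} v *\<^sub>R (indicator {u. ?Q u < K} v * ?sp v))"
  proof (cases "v \<in> {s..t}")
   case False
   have "0 \<le> C1 * (indicator {0..T} v *\<^sub>R 1 + indicator {0..T} v *\<^sub>R (indicator {u. ?Q u < K} v * ?sp v))"
    using C1_nonneg by (intro mult_nonneg_nonneg add_nonneg_nonneg) auto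
   then show ?thesis using False by simp
  next
   case True
   then have vT: "v \<in> {0..T}" using st by auto
   then have rS: "r v w \<in> S" by (intro r_in_S[OF w]) auto
   show ?thesis
   proof (cases "?Q v < K")
    case True
    then show ?thesis using H_growth[OF rS j_Qnn vT, where z = "Zj j v w" and b = "bj j v w" and G = "Gj j v w"] \<open>v \<in> {s..t}\<close> vT
     by (simp add: Hj_def add.assoc)
   next
    case False
    then have "Hj j v w = 0" unfolding Hj_def by (intro H_support[OF rS _ vT]) auto
    then show ?thesis using vT C1_nonneg False by simp
   qed
  qed
 qed
 also have "... = C1 * (T + (LINT v:{0..T}|lborel. indicator {u. ?Q u < K} v * ?sp v))"
  using one int1 T by (simp add: set_lebesgue_integral_def)
 also have "... \<le> C1 * (T + K)" using sub C1_nonneg by (intro mult_left_mono) auto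
 finally show ?thesis .
qed

end

lemma min_one_tendsto:
 fixes x :: "nat => real"
 assumes "(\<lambda>j. min 1 (x j)) \<longlonglongrightarrow> 0"
 shows "x \<longlonglongrightarrow> 0"
proof -
 have "\<forall>\<^sub>F j in sequentially. min 1 (x j) < 1" using order_tendstoD(2)[OF assms] by simp
 then have "\<forall>\<^sub>F j in sequentially. min 1 (x j) = x j" by eventually_elim (auto simp: min_def)
 with assms show ?thesis by (rule Lim_transform_eventually)
qed

section \<open>Convergence of the approximations along one path\<close>

context ito_limit
begin

text \<open>A common majorant: it bounds the change in the speed of \<open>Q\<close> and, up to the
  factor \<open>C1\<close>, the change of \<open>H\<close> when the coefficients are replaced by
  their approximations.\<close>

definition wj :: "nat => real => 'w => real" where
 "wj j v w = norm (bj j v w - b v w) + norm (Gj j v w - \<sigma> v w) * (norm (Gj j v w - \<sigma> v w) + 2 * norm (\<sigma> v w))"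

lemma wj_nonneg: "0 \<le> wj j v w" by (simp add: wj_def)

lemma Qp_nonneg: "0 \<le> Qp v w'"
 unfolding Qp_def set_lebesgue_integral_def by (rule Bochner_Integration.integral_nonneg) (auto simp: spd_def)

lemma norm_square_integrable:
 assumes w: "w \<in> space M" and \<sigma>i: "(\<integral>\<^sup>+v\<in>{0..T}. ennreal ((norm (\<sigma> v w))^2) \<partial>lborel) < \<infinity>"
 shows "set_integrable lborel {0..T} (\<lambda>v. (norm (\<sigma> v w))^2)"
proof -
 have "prog T (\<lambda>v w. (norm (\<sigma> v w))^2)"
  using \<sigma>_prog[OF T] unfolding prog_def by measurable
 from prog_set_measurable[OF this w T]
 have m: "(\<lambda>v. indicator {0..T} v *\<^sub>R (norm (\<sigma> v w))^2) \<in> borel_measurable lborel" by (simp add: set_borel_measurable_def)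
 have "(\<integral>\<^sup>+v. ennreal (indicator {0..T} v *\<^sub>R (norm (\<sigma> v w))^2) \<partial>lborel) < \<infinity>"
 proof -
  have "(\<integral>\<^sup>+v. ennreal (indicator {0..T} v *\<^sub>R (norm (\<sigma> v w))^2) \<partial>lborel) = (\<integral>\<^sup>+v\<in>{0..T}. ennreal ((norm (\<sigma> v w))^2) \<partial>lborel)"
   by (intro nn_integral_cong) (auto simp: indicator_def)
  then show ?thesis using \<sigma>i by simp
 qed
 then show ?thesis unfolding set_integrable_def by (intro integrableI_nonneg m) auto
qed

context
 fixes w :: 'w and \<rho> :: "nat => nat" and s t :: real
 assumes w: "w \<in> space M" and \<rho>: "strict_mono \<rho>"
  and bi: "set_integrable lborel {0..T} (\<lambda>v. b v w)"
  and \<sigma>i: "(\<integral>\<^sup>+v\<in>{0..T}. ennreal ((norm (\<sigma> v w))^2) \<partial>lborel) < \<infinity>"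
  and fe0: "(\<lambda>j. fe T (\<rho> j) w) \<longlonglongrightarrow> 0"
begin

lemmas \<sigma>2_integrable = norm_square_integrable[OF w \<sigma>i]

lemma diff2_integrable: "set_integrable lborel {0..T} (\<lambda>v. (norm (Gj j v w - \<sigma> v w))^2)"
proof -
 obtain L where L: "!!v. norm (Gj j v w) \<le> L" using j_Gbound w by blast
 have dom: "set_integrable lborel {0..T} (\<lambda>v. 2 * L^2 + 2 * (norm (\<sigma> v w))^2)"
  by (intro set_integral_add set_integrable_mult_right \<sigma>2_integrable)
   (auto simp: set_integrable_def emeasure_lborel_Icc_eq intro!: integrable_mult_left integrable_real_indicator)
 have "prog T (\<lambda>v w. (norm (Gj j v w - \<sigma> v w))^2)"
  using \<sigma>_prog[OF T] j_G[of j] unfolding prog_def by measurable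
 note m = prog_set_measurable[OF this w T]
 show ?thesis
 proof (rule set_integrable_bound[OF dom m], intro AE_I2 impI)
  fix v
  have "norm (Gj j v w - \<sigma> v w) \<le> norm (Gj j v w) + norm (\<sigma> v w)" by (rule norm_triangle_ineq4)
  also have "... \<le> L + norm (\<sigma> v w)" using L by simp
  finally have "(norm (Gj j v w - \<sigma> v w))^2 \<le> (L + norm (\<sigma> v w))^2" by (intro power_mono) auto
  also have "... \<le> 2 * L^2 + 2 * (norm (\<sigma> v w))^2"
   using sum_squares_bound[of L "norm (\<sigma> v w)"] by (simp add: power2_sum)
  finally show "norm ((norm (Gj j v w - \<sigma> v w))^2) \<le> norm (2 * L^2 + 2 * (norm (\<sigma> v w))^2)" by simp
 qed
qed

lemma diff2_tendsto: "(\<lambda>j. LINT v:{0..T}|lborel. (norm (Gj (\<rho> j) v w - \<sigma> v w))^2) \<longlonglongrightarrow> 0"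
proof -
 have eq: "enn2real (ej T j w) = (LINT v:{0..T}|lborel. (norm (Gj j v w - \<sigma> v w))^2)"
  and fin: "ej T j w < \<infinity>" for j
 proof -
  let ?f = "\<lambda>v. indicator {0..T} v *\<^sub>R (norm (Gj j v w - \<sigma> v w))^2"
  have i: "integrable lborel ?f" using diff2_integrable by (simp add: set_integrable_def)
  have "(\<integral>\<^sup>+v. ennreal (?f v) \<partial>lborel) = ennreal (LINT v|lborel. ?f v)"
   by (rule nn_integral_eq_integral[OF i]) auto
  moreover have "(\<integral>\<^sup>+v. ennreal (?f v) \<partial>lborel) = ej T j w"
   unfolding ej_def by (intro nn_integral_cong) (auto simp: indicator_def)
  moreover have "0 \<le> (LINT v|lborel. ?f v)" by (rule Bochner_Integration.integral_nonneg) auto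
  ultimately have *: "ej T j w = ennreal (LINT v|lborel. ?f v)" "0 \<le> (LINT v|lborel. ?f v)" by auto
  show "enn2real (ej T j w) = (LINT v:{0..T}|lborel. (norm (Gj j v w - \<sigma> v w))^2)"
   using * by (simp add: set_lebesgue_integral_def)
  show "ej T j w < \<infinity>" using * by simp
 qed
 have feq: "fe T j w = min 1 (enn2real (ej T j w))" for j
 proof -
  have "ej T j w = ennreal (enn2real (ej T j w))" using fin[of j] by simp
  then show ?thesis unfolding fe_def using enn2real_min1[of "enn2real (ej T j w)"] by simp
 qed
 have "(\<lambda>j. min 1 (enn2real (ej T (\<rho> j) w))) \<longlonglongrightarrow> 0" using fe0 by (simp only: feq)
 then have "(\<lambda>j. enn2real (ej T (\<rho> j) w)) \<longlonglongrightarrow> 0" by (rule min_one_tendsto)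
 then show ?thesis unfolding eq .
qed

lemma trunc_integrable: "set_integrable lborel {0..T} (\<lambda>v. norm (bj j v w - b v w))"
proof (rule set_integrable_bound[OF bi])
 have "prog T (\<lambda>v w. norm (bj j v w - b v w))"
  using b_prog[OF T] bj_prog[OF T, of j] unfolding prog_def by measurable
 then show "set_borel_measurable lborel {0..T} (\<lambda>v. norm (bj j v w - b v w))" by (rule prog_set_measurable[OF _ w T])
 show "AE v in lborel. v \<in> {0..T} --> norm (norm (bj j v w - b v w)) \<le> norm (b v w)"
  by (intro AE_I2 impI) (simp add: bj_def)
qed

lemma trunc_tendsto: "(\<lambda>j. LINT v:{0..T}|lborel. norm (bj (\<rho> j) v w - b v w)) \<longlonglongrightarrow> 0"
proof -
 have m: "(\<lambda>v. indicator {0..T} v *\<^sub>R b v w) \<in> borel_measurable lborel"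
  using bi unfolding set_integrable_def by (rule borel_measurable_integrable)
 show ?thesis
  using LIMSEQ_subseq_LIMSEQ[OF truncation_tendsto[OF bi m] \<rho>] unfolding bj_def comp_def .
qed

lemma wj_integrable: "set_integrable lborel {0..T} (\<lambda>v. wj j v w)"
proof -
 have dom: "set_integrable lborel {0..T} (\<lambda>v. norm (bj j v w - b v w) + (2 * (norm (Gj j v w - \<sigma> v w))^2 + (norm (\<sigma> v w))^2))"
  by (intro set_integral_add set_integrable_mult_right \<sigma>2_integrable diff2_integrable trunc_integrable)
 have "prog T (wj j)"
  using b_prog[OF T] bj_prog[OF T, of j] \<sigma>_prog[OF T] j_G[of j] unfolding prog_def wj_def by measurable
 note m = prog_set_measurable[OF this w T]
 show ?thesis
 proof (rule set_integrable_bound[OF dom m], intro AE_I2 impI)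
  fix v
  have "2 * norm (Gj j v w - \<sigma> v w) * norm (\<sigma> v w) \<le> (norm (Gj j v w - \<sigma> v w))^2 + (norm (\<sigma> v w))^2"
   by (rule sum_squares_bound)
  then have "wj j v w \<le> norm (bj j v w - b v w) + (2 * (norm (Gj j v w - \<sigma> v w))^2 + (norm (\<sigma> v w))^2)"
   by (simp add: wj_def power2_eq_square algebra_simps)
  then show "norm (wj j v w) \<le> norm (norm (bj j v w - b v w) + (2 * (norm (Gj j v w - \<sigma> v w))^2 + (norm (\<sigma> v w))^2))"
   using wj_nonneg[of j v w] by simp
 qed
qed

text \<open>The cross term with \<open>norm (\<sigma> v w)\<close> is split by Young's inequality
  with weight \<open>\<delta>\<close>, chosen so that \<open>\<delta>\<close> times the integral of
  \<open>(norm \<sigma>)^2\<close> stays below \<open>e / 2\<close>. For this fixed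
  \<open>\<delta>\<close> the remaining terms vanish by L2 convergence of the integrands and by
  truncation of the drift.\<close>

lemma wj_tendsto: "(\<lambda>j. LINT v:{0..T}|lborel. wj (\<rho> j) v w) \<longlonglongrightarrow> 0"
proof (rule LIMSEQ_I)
 fix e :: real assume e: "e > 0"
 let ?B = "\<lambda>j. LINT v:{0..T}|lborel. norm (bj (\<rho> j) v w - b v w)"
 let ?E = "\<lambda>j. LINT v:{0..T}|lborel. (norm (Gj (\<rho> j) v w - \<sigma> v w))^2"
 let ?S = "LINT v:{0..T}|lborel. (norm (\<sigma> v w))^2"
 have S: "0 \<le> ?S" unfolding set_lebesgue_integral_def by (rule Bochner_Integration.integral_nonneg) auto
 define \<delta> where "\<delta> = e / (2 * (?S + 1))"
 have \<delta>: "\<delta> > 0" "\<delta> * ?S < e / 2 + 0" 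
 proof -
  show "\<delta> > 0" using e S by (simp add: \<delta>_def)
  have "\<delta> * ?S < \<delta> * (?S + 1)" using \<open>\<delta> > 0\<close> by (intro mult_strict_left_mono) auto
  also have "... = e / 2"
  proof -
   have "?S + 1 \<noteq> 0" using S by linarith
   then show ?thesis by (simp add: \<delta>_def field_simps)
  qed
  finally show "\<delta> * ?S < e / 2 + 0" by simp
 qed
 have bound: "(LINT v:{0..T}|lborel. wj (\<rho> j) v w) \<le> ?B j + ((1 + 1 / \<delta>) * ?E j + \<delta> * ?S)" for j
 proof -
  let ?d = "\<lambda>v. norm (Gj (\<rho> j) v w - \<sigma> v w)"
  have "(LINT v:{0..T}|lborel. wj (\<rho> j) v w) \<le> (LINT v:{0..T}|lborel. norm (bj (\<rho> j) v w - b v w) + ((1 + 1 / \<delta>) * (?d v)^2 + \<delta> * (norm (\<sigma> v w))^2))"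
  proof (rule set_integral_mono)
   show "set_integrable lborel {0..T} (\<lambda>v. wj (\<rho> j) v w)" by (rule wj_integrable)
   show "set_integrable lborel {0..T} (\<lambda>v. norm (bj (\<rho> j) v w - b v w) + ((1 + 1 / \<delta>) * (?d v)^2 + \<delta> * (norm (\<sigma> v w))^2))"
    by (intro set_integral_add set_integrable_mult_right \<sigma>2_integrable diff2_integrable trunc_integrable)
   fix v
   have "0 \<le> (?d v - \<delta> * norm (\<sigma> v w))^2" by simp
   then have "2 * \<delta> * (?d v * norm (\<sigma> v w)) \<le> (?d v)^2 + \<delta>^2 * (norm (\<sigma> v w))^2"
    by (simp add: power2_diff power_mult_distrib algebra_simps)
   then have "(2 * \<delta> * (?d v * norm (\<sigma> v w))) / \<delta> \<le> ((?d v)^2 + \<delta>^2 * (norm (\<sigma> v w))^2) / \<delta>"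
    using \<delta>(1) by (intro divide_right_mono) auto
   then have "2 * (?d v * norm (\<sigma> v w)) \<le> 1 / \<delta> * (?d v)^2 + \<delta> * (norm (\<sigma> v w))^2"
    using \<delta>(1) by (simp add: add_divide_distrib power2_eq_square)
   then show "wj (\<rho> j) v w \<le> norm (bj (\<rho> j) v w - b v w) + ((1 + 1 / \<delta>) * (?d v)^2 + \<delta> * (norm (\<sigma> v w))^2)"
    by (simp add: wj_def algebra_simps power2_eq_square)
  qed
  also have "... = ?B j + ((1 + 1 / \<delta>) * ?E j + \<delta> * ?S)"
   using trunc_integrable[of "\<rho> j"] diff2_integrable[of "\<rho> j"] \<sigma>2_integrable
   by (simp add: set_integral_add set_integrable_mult_right)
  finally show ?thesis .
 qed
 have "(\<lambda>j. ?B j + ((1 + 1 / \<delta>) * ?E j + \<delta> * ?S)) \<longlonglongrightarrow> 0 + ((1 + 1 / \<delta>) * 0 + \<delta> * ?S)"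
  by (intro tendsto_intros trunc_tendsto diff2_tendsto)
 moreover have "0 + ((1 + 1 / \<delta>) * 0 + \<delta> * ?S) < e" using \<delta>(2) e by simp
 ultimately have "\<forall>\<^sub>F j in sequentially. ?B j + ((1 + 1 / \<delta>) * ?E j + \<delta> * ?S) < e" by (rule order_tendstoD(2))
 then obtain n0 where n0: "!!n. n \<ge> n0 ==> ?B n + ((1 + 1 / \<delta>) * ?E n + \<delta> * ?S) < e" by (auto simp: eventually_sequentially)
 show "\<exists>n0. \<forall>n\<ge>n0. norm ((LINT v:{0..T}|lborel. wj (\<rho> n) v w) - 0) < e"
 proof (intro exI[of _ n0] allI impI)
  fix n assume "n \<ge> n0"
  have "0 \<le> (LINT v:{0..T}|lborel. wj (\<rho> n) v w)"
   unfolding set_lebesgue_integral_def by (rule Bochner_Integration.integral_nonneg) (simp add: wj_nonneg)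
  then show "norm ((LINT v:{0..T}|lborel. wj (\<rho> n) v w) - 0) < e"
   using bound[of n] n0[OF \<open>n \<ge> n0\<close>] by simp
 qed
qed

lemma spd_integrable: "set_integrable lborel {0..T} (\<lambda>v. spd v w)"
 unfolding spd_def by (intro set_integral_add \<sigma>2_integrable set_integrable_norm[OF bi])

lemma Q_tendsto:
 assumes v: "v \<in> {0..T}"
 shows "(\<lambda>j. Qj (\<rho> j) v w) \<longlonglongrightarrow> Qp v w"
proof -
 have "norm (Qj j v w - Qp v w) \<le> (LINT u:{0..T}|lborel. wj j u w)" for j
 proof -
  have sub: "{0..v} \<subseteq> {0..T}" and m: "{0..v} \<in> sets lborel" using v by auto
  have "Qj j v w - Qp v w = (LINT u:{0..v}|lborel. ((norm (Gj j u w))^2 + norm (bj j u w)) - spd u w)"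
   unfolding Qj_def Qp_def
   by (rule set_integral_diff(2)[symmetric]) (intro set_integrable_subset[OF _ m sub] j_speed[OF w] spd_integrable)+
  also have "norm ... \<le> (LINT u|lborel. norm (indicator {0..v} u *\<^sub>R (((norm (Gj j u w))^2 + norm (bj j u w)) - spd u w)))"
   unfolding set_lebesgue_integral_def by (rule integral_norm_bound)
  also have "... \<le> (LINT u|lborel. indicator {0..T} u *\<^sub>R wj j u w)"
  proof (rule integral_mono')
   show "integrable lborel (\<lambda>u. indicator {0..T} u *\<^sub>R wj j u w)" using wj_integrable by (simp add: set_integrable_def)
   fix u
   show "0 \<le> indicator {0..T} u *\<^sub>R wj j u w" using wj_nonneg by simp
   have "\<bar>((norm (Gj j u w))^2 + norm (bj j u w)) - spd u w\<bar> \<le> wj j u w"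
    using norm_square_diff[of "Gj j u w" "\<sigma> u w"] norm_triangle_ineq3[of "bj j u w" "b u w"]
    unfolding spd_def wj_def by linarith
   then show "norm (indicator {0..v} u *\<^sub>R (((norm (Gj j u w))^2 + norm (bj j u w)) - spd u w)) \<le> indicator {0..T} u *\<^sub>R wj j u w"
    using v wj_nonneg by (auto simp: indicator_def)
  qed
  finally show ?thesis by (simp add: set_lebesgue_integral_def)
 qed
 then have "(\<lambda>j. Qj (\<rho> j) v w - Qp v w) \<longlonglongrightarrow> 0"
  by (intro Lim_null_comparison[OF _ wj_tendsto] always_eventually allI)
 then show ?thesis by (rule LIM_zero_cancel)
qed

lemma Z_tendsto:
 assumes v: "v \<in> {0..T}" and fd0: "(\<lambda>j. fd (\<rho> j) v w) \<longlonglongrightarrow> 0"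
 shows "(\<lambda>j. Zj (\<rho> j) v w) \<longlonglongrightarrow> Zp v w"
proof -
 have sub: "{0..v} \<subseteq> {0..T}" and m: "{0..v} \<in> sets lborel" using v by auto
 have bji: "set_integrable lborel {0..T} (\<lambda>v. bj j v w)" for j
 proof (rule set_integrable_bound[OF bi prog_set_measurable[OF bj_prog[OF T] w T]], intro AE_I2 impI)
  fix v show "norm (bj j v w) \<le> norm (b v w)" by (simp add: bj_def)
 qed
 have "norm ((LINT u:{0..v}|lborel. bj j u w) - (LINT u:{0..v}|lborel. b u w)) \<le> (LINT u:{0..T}|lborel. norm (bj j u w - b u w))" for j
 proof -
  have "(LINT u:{0..v}|lborel. bj j u w) - (LINT u:{0..v}|lborel. b u w) = (LINT u:{0..v}|lborel. bj j u w - b u w)"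
   by (rule set_integral_diff(2)[symmetric]) (intro set_integrable_subset[OF _ m sub] bji bi)+
  also have "norm ... \<le> (LINT u|lborel. norm (indicator {0..v} u *\<^sub>R (bj j u w - b u w)))"
   unfolding set_lebesgue_integral_def by (rule integral_norm_bound)
  also have "... \<le> (LINT u|lborel. indicator {0..T} u *\<^sub>R norm (bj j u w - b u w))"
  proof (rule integral_mono')
   show "integrable lborel (\<lambda>u. indicator {0..T} u *\<^sub>R norm (bj j u w - b u w))" using trunc_integrable by (simp add: set_integrable_def)
  qed (use v in \<open>auto simp: indicator_def\<close>)
  finally show ?thesis by (simp add: set_lebesgue_integral_def)
 qed
 then have 1: "(\<lambda>j. (LINT u:{0..v}|lborel. bj (\<rho> j) u w) - (LINT u:{0..v}|lborel. b u w)) \<longlonglongrightarrow> 0"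
  by (intro Lim_null_comparison[OF _ trunc_tendsto] always_eventually allI)
 have "(\<lambda>j. norm (Sj (\<rho> j) v w - Ip v w)) \<longlonglongrightarrow> 0"
  using fd0 unfolding fd_def by (rule min_one_tendsto)
 then have 2: "(\<lambda>j. Sj (\<rho> j) v w - Ip v w) \<longlonglongrightarrow> 0" by (simp add: tendsto_norm_zero_iff)
 have "Zj j v w - Zp v w = ((LINT u:{0..v}|lborel. bj j u w) - (LINT u:{0..v}|lborel. b u w)) + (Sj j v w - Ip v w)" for j
  unfolding Zj_def Ip_def by simp
 then have "(\<lambda>j. Zj (\<rho> j) v w - Zp v w) \<longlonglongrightarrow> 0 + 0" using tendsto_add[OF 1 2] by simp
 then have "(\<lambda>j. Zj (\<rho> j) v w - Zp v w) \<longlonglongrightarrow> 0" by simp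
 then show ?thesis by (rule LIM_zero_cancel)
qed

lemma Phi_tendsto:
 assumes v: "v \<in> {0..T}" and fd0: "(\<lambda>j. fd (\<rho> j) v w) \<longlonglongrightarrow> 0"
 shows "(\<lambda>j. Phij (\<rho> j) v w) \<longlonglongrightarrow> Phip v w"
proof -
 have rS: "r v w \<in> S" by (rule r_in_S[OF w]) (use v in auto)
 note Zt = Z_tendsto[OF v fd0] and Qt = Q_tendsto[OF v]
 show ?thesis unfolding Phij_def Phip_def
  by (rule uc_tendsto[where f = "\<lambda>z q t. phi z q t (r v w)" and zs = "\<lambda>j. Zj (\<rho> j) v w" and qs = "\<lambda>j. Qj (\<rho> j) v w",
     OF uc(1)[OF rS] v Zt Qt j_Qnn Qp_nonneg])
qed

text \<open>Two stages, with the intermediate expression \<open>?X\<close> using approximate states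
  and true coefficients. Exchanging the coefficients costs at most \<open>C1\<close> times the
  integral of \<open>wj\<close>; exchanging the states is dominated convergence with majorant
  \<open>C1 * (1 + spd v w)\<close>.\<close>

lemma H_integral_tendsto:
 assumes st: "{s..t} \<subseteq> {0..T}" and fd0: "AE v in lborel. v \<in> {0..T} --> (\<lambda>j. fd (\<rho> j) v w) \<longlonglongrightarrow> 0"
 shows "(\<lambda>j. LINT v:{s..t}|lborel. Hj (\<rho> j) v w) \<longlonglongrightarrow> (LINT v:{s..t}|lborel. Hp v w)"
proof -
 let ?X = "\<lambda>j v w. H (Zj j v w) (Qj j v w) v (r v w) (b v w) (\<sigma> v w)"
 have m: "{s..t} \<in> sets lborel" by simp
 have rS: "r v w \<in> S" if "v \<in> {0..T}" for v by (rule r_in_S[OF w]) (use that in auto)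
 have Qp_prog: "prog T Qp" unfolding Qp_def[abs_def] by (rule prog_integral_joint[OF T spd_prog[OF T]])
 have pX: "prog T (?X j)" for j
  by (rule H_prog[OF j_Z j_Q j_Qnn b_prog[OF T] \<sigma>_prog[OF T]])
 have pH: "prog T Hp" unfolding Hp_def[abs_def]
  by (rule H_prog[OF Zp_prog[OF T] Qp_prog Qp_nonneg b_prog[OF T] \<sigma>_prog[OF T]])
 have dom: "set_integrable lborel {0..T} (\<lambda>v. C1 * (1 + spd v w))"
  by (intro set_integral_add set_integrable_mult_right spd_integrable)
   (auto simp: set_integrable_def emeasure_lborel_Icc_eq intro!: integrable_real_indicator)
 have gX: "\<bar>?X j v w\<bar> \<le> C1 * (1 + spd v w)" if "v \<in> {0..T}" for j v
  using H_growth[OF rS[OF that] j_Qnn that] by (simp add: spd_def add.assoc)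
 have gH: "\<bar>Hp v w\<bar> \<le> C1 * (1 + spd v w)" if "v \<in> {0..T}" for v
  unfolding Hp_def using H_growth[OF rS[OF that] Qp_nonneg that] by (simp add: spd_def add.assoc)
 have nn: "0 \<le> C1 * (1 + spd v w)" for v using C1_nonneg by (simp add: spd_def)
 have Xi: "set_integrable lborel {0..T} (\<lambda>v. ?X j v w)" for j
  by (rule set_integrable_bound[OF dom prog_set_measurable[OF pX w T]], intro AE_I2 impI)
   (use gX nn in \<open>simp add: abs_of_nonneg\<close>)
 have "norm ((LINT v:{s..t}|lborel. Hj j v w) - (LINT v:{s..t}|lborel. ?X j v w)) \<le> C1 * (LINT u:{0..T}|lborel. wj j u w)" for j
 proof -
  have e: "(LINT v:{s..t}|lborel. Hj j v w) - (LINT v:{s..t}|lborel. ?X j v w) = (LINT v:{s..t}|lborel. Hj j v w - ?X j v w)"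
   by (rule set_integral_diff(2)[symmetric]) (intro j_Hint[OF w st] set_integrable_subset[OF Xi m st])+
  have "norm ((LINT v:{s..t}|lborel. Hj j v w) - (LINT v:{s..t}|lborel. ?X j v w)) \<le> (LINT v|lborel. norm (indicator {s..t} v *\<^sub>R (Hj j v w - ?X j v w)))"
   unfolding e unfolding set_lebesgue_integral_def by (rule integral_norm_bound)
  also have "... \<le> (LINT v|lborel. C1 * (indicator {0..T} v *\<^sub>R wj j v w))"
  proof (rule integral_mono')
   show "integrable lborel (\<lambda>v. C1 * (indicator {0..T} v *\<^sub>R wj j v w))"
    by (rule integrable_mult_right[OF wj_integrable[unfolded set_integrable_def]])
   fix v
   show nn1: "0 \<le> C1 * (indicator {0..T} v *\<^sub>R wj j v w)"
    by (intro mult_nonneg_nonneg scaleR_nonneg_nonneg C1_nonneg wj_nonneg) simp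
   show "norm (indicator {s..t} v *\<^sub>R (Hj j v w - ?X j v w)) \<le> C1 * (indicator {0..T} v *\<^sub>R wj j v w)"
   proof (cases "v \<in> {s..t}")
    case True
    then have vT: "v \<in> {0..T}" using st by auto
    have "norm (Hj j v w - ?X j v w) \<le> C1 * wj j v w"
     unfolding Hj_def wj_def real_norm_def by (rule H_arg_diff[OF rS[OF vT] j_Qnn vT])
    then show ?thesis using True vT by simp
   next
    case False
    then show ?thesis using nn1 by simp
   qed
  qed
  also have "... = C1 * (LINT u:{0..T}|lborel. wj j u w)" by (simp add: set_lebesgue_integral_def)
  finally show ?thesis .
 qed
 then have 1: "(\<lambda>j. (LINT v:{s..t}|lborel. Hj (\<rho> j) v w) - (LINT v:{s..t}|lborel. ?X (\<rho> j) v w)) \<longlonglongrightarrow> 0"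
  by (intro Lim_null_comparison[OF _ tendsto_mult_right_zero[OF wj_tendsto, of C1]] always_eventually allI)
 have 2: "(\<lambda>j. LINT v:{s..t}|lborel. ?X (\<rho> j) v w) \<longlonglongrightarrow> (LINT v:{s..t}|lborel. Hp v w)"
  unfolding set_lebesgue_integral_def
 proof (rule integral_dominated_convergence[where w = "\<lambda>v. indicator {0..T} v *\<^sub>R (C1 * (1 + spd v w))"])
  have Hi: "set_integrable lborel {0..T} (\<lambda>v. Hp v w)"
   by (rule set_integrable_bound[OF dom prog_set_measurable[OF pH w T]], intro AE_I2 impI)
    (use gH nn in \<open>simp add: abs_of_nonneg\<close>)
  show "(\<lambda>v. indicator {s..t} v *\<^sub>R Hp v w) \<in> borel_measurable lborel"
   using set_integrable_subset[OF Hi m st] unfolding set_integrable_def by (rule borel_measurable_integrable)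
  show "(\<lambda>v. indicator {s..t} v *\<^sub>R ?X (\<rho> j) v w) \<in> borel_measurable lborel" for j
   using set_integrable_subset[OF Xi m st] unfolding set_integrable_def by (rule borel_measurable_integrable)
  show "integrable lborel (\<lambda>v. indicator {0..T} v *\<^sub>R (C1 * (1 + spd v w)))" using dom by (simp add: set_integrable_def)
  show "AE v in lborel. (\<lambda>j. indicator {s..t} v *\<^sub>R ?X (\<rho> j) v w) \<longlonglongrightarrow> indicator {s..t} v *\<^sub>R Hp v w"
   using fd0
  proof eventually_elim
   case (elim v)
   show ?case
   proof (cases "v \<in> {s..t}")
    case True
    then have vT: "v \<in> {0..T}" using st by auto
    have Zt: "(\<lambda>j. Zj (\<rho> j) v w) \<longlonglongrightarrow> Zp v w" by (rule Z_tendsto[OF vT elim[rule_format, OF vT]])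
    have "(\<lambda>j. ?X (\<rho> j) v w) \<longlonglongrightarrow> Hp v w"
     unfolding Hp_def
     by (rule H_tendsto[where zs = "\<lambda>j. Zj (\<rho> j) v w" and qs = "\<lambda>j. Qj (\<rho> j) v w", OF rS[OF vT] vT Zt Q_tendsto[OF vT] j_Qnn Qp_nonneg])
    then show ?thesis by (intro tendsto_intros)
   qed simp
  qed
  show "AE v in lborel. norm (indicator {s..t} v *\<^sub>R ?X (\<rho> j) v w) \<le> indicator {0..T} v *\<^sub>R (C1 * (1 + spd v w))" for j
  proof (intro AE_I2)
   fix v
   show "norm (indicator {s..t} v *\<^sub>R ?X (\<rho> j) v w) \<le> indicator {0..T} v *\<^sub>R (C1 * (1 + spd v w))"
    using gX[of v "\<rho> j"] nn[of v] st by (cases "v \<in> {s..t}"; cases "v \<in> {0..T}") auto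
  qed
 qed
 show ?thesis using tendsto_add[OF 1 2] by simp
qed

end

end

section \<open>Ito's formula in expectation for a general integrand\<close>

context ito_limit
begin

lemma Qp_prog: "prog T Qp"
 unfolding Qp_def[abs_def] by (rule prog_integral_joint[OF T spd_prog[OF T]])

lemma Hp_prog: "prog T Hp"
 unfolding Hp_def[abs_def]
 by (rule H_prog[OF Zp_prog[OF T] Qp_prog Qp_nonneg b_prog[OF T] \<sigma>_prog[OF T]])

lemma Phip_meas:
 assumes v: "v \<in> {0..T}"
 shows "Phip v \<in> borel_measurable M"
proof -
 have v0: "0 \<le> v" using v by auto
 have Z: "Zp v \<in> borel_measurable M" by (rule measurable_F_M[OF v0 Zp_meas[OF v0]])
 have "Qp v \<in> borel_measurable (F T)"
  unfolding Qp_def[abs_def] by (rule prog_integral_Icc[OF spd_prog[OF T]]) (use v in auto)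
 then have Q: "Qp v \<in> borel_measurable M" by (rule measurable_F_M[OF T])
 show ?thesis
  unfolding Phip_def[abs_def]
  by (rule test_measurable(1)[where \<theta> = "\<lambda>_. v", OF Z Q _ _ _ r_meas[OF v0]]) (use Qp_nonneg r_in_S v in auto)
qed

lemma Phip_bound: "w \<in> space M ==> v \<in> {0..T} ==> \<bar>Phip v w\<bar> \<le> C"
 unfolding Phip_def by (rule phi_bound) (use Qp_nonneg r_in_S in auto)

lemma Phij_bound: "w \<in> space M ==> v \<in> {0..T} ==> \<bar>Phij j v w\<bar> \<le> C"
 unfolding Phij_def by (rule phi_bound) (use j_Qnn r_in_S in auto)

lemma Hp_integrable: "AE w in M. set_integrable lborel {0..T} (\<lambda>v. Hp v w)"
 using b_int \<sigma>_int AE_space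
proof eventually_elim
 case (elim w)
 have bi: "set_integrable lborel {0..T} (\<lambda>v. b v w)" and si: "(\<integral>\<^sup>+v\<in>{0..T}. ennreal ((norm (\<sigma> v w))^2) \<partial>lborel) < \<infinity>"
  using elim T by auto
 have w: "w \<in> space M" using elim by simp
 have dom: "set_integrable lborel {0..T} (\<lambda>v. C1 * (1 + spd v w))"
  unfolding spd_def
  by (intro set_integral_add set_integrable_mult_right norm_square_integrable[OF w si] set_integrable_norm[OF bi])
   (auto simp: set_integrable_def emeasure_lborel_Icc_eq intro!: integrable_real_indicator)
 show ?case
 proof (rule set_integrable_bound[OF dom prog_set_measurable[OF Hp_prog w T]], intro AE_I2 impI)
  fix v assume v: "v \<in> {0..T}"
  have "r v w \<in> S" by (rule r_in_S[OF w]) (use v in auto)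
  then have "\<bar>Hp v w\<bar> \<le> C1 * (1 + spd v w)"
   unfolding Hp_def using H_growth[OF _ Qp_nonneg v] by (simp add: spd_def add.assoc)
  then show "norm (Hp v w) \<le> norm (C1 * (1 + spd v w))" by simp
 qed
qed

text \<open>Both sides of \<open>j_ito\<close> converge along the subsequence by dominated
  convergence: test functions are bounded by \<open>C\<close> and drift integrals by
  \<open>C1 * (T + K)\<close>. The latter bound passes to the limit and is recorded because
  integrability of the drift integral depends on it.\<close>

theorem ito_formula:
 assumes st: "0 \<le> s" "s \<le> t" "t \<le> T" and A: "A \<in> sets (F s)"
 shows "(LINT w|M. indicator A w * (Phip t w - Phip s w)) = (LINT w|M. indicator A w * (LINT v:{s..t}|lborel. Hp v w))"
  and "AE w in M. \<bar>LINT v:{s..t}|lborel. Hp v w\<bar> \<le> C1 * (T + K)"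
proof -
 have AM: "A \<in> sets M" using A sets_F_M[OF st(1)] by auto
 have sub: "{s..t} \<subseteq> {0..T}" and sT: "s \<in> {0..T}" "t \<in> {0..T}" using st by auto
 have both: "(LINT w|M. indicator A w * (Phip t w - Phip s w)) = (LINT w|M. indicator A w * (LINT v:{s..t}|lborel. Hp v w))
  \<and> (AE w in M. \<bar>LINT v:{s..t}|lborel. Hp v w\<bar> \<le> C1 * (T + K))"
 \<comment> \<open>\<open>subsequence\<close> asks for positive \<open>T\<close>; for
   \<open>T = 0\<close> both sides are integrals of 0.\<close>
 proof (cases "T = 0")
  case True
  then have "s = t" "t = 0" using st by auto
  moreover have "0 \<le> C1 * (T + K)" using C1_nonneg T K by simp
  moreover have "(LINT v:{0..0}|lborel. Hp v w) = 0" for w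
   proof -
   have "AE v in lborel. v \<noteq> (0::real)" by (rule AE_lborel_singleton)
   then show ?thesis unfolding set_lebesgue_integral_def by (intro integral_eq_zero_AE) auto
  qed
  ultimately show ?thesis by simp
 next
  case False
  then have "0 < T" using T by simp
  obtain \<rho> where \<rho>: "strict_mono \<rho>" and ae: "AE w in M. (\<lambda>j. fe T (\<rho> j) w) \<longlonglongrightarrow> 0 \<and> (\<lambda>j. fd (\<rho> j) s w) \<longlonglongrightarrow> 0 \<and> (\<lambda>j. fd (\<rho> j) t w) \<longlonglongrightarrow> 0
    \<and> (AE u in lborel. u \<in> {0..T} --> (\<lambda>j. fd (\<rho> j) u w) \<longlonglongrightarrow> 0)"
   by (rule subsequence[OF \<open>0 < T\<close> st(1) order.trans[OF st(1,2)]])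
  have conv: "AE w in M. (\<lambda>j. Phij (\<rho> j) s w) \<longlonglongrightarrow> Phip s w \<and> (\<lambda>j. Phij (\<rho> j) t w) \<longlonglongrightarrow> Phip t w
    \<and> (\<lambda>j. LINT v:{s..t}|lborel. Hj (\<rho> j) v w) \<longlonglongrightarrow> (LINT v:{s..t}|lborel. Hp v w)"
   using ae b_int \<sigma>_int AE_space
  proof eventually_elim
   case (elim w)
   have bi: "set_integrable lborel {0..T} (\<lambda>v. b v w)" and si: "(\<integral>\<^sup>+v\<in>{0..T}. ennreal ((norm (\<sigma> v w))^2) \<partial>lborel) < \<infinity>"
    using elim T by auto
   have w: "w \<in> space M" and fe0: "(\<lambda>j. fe T (\<rho> j) w) \<longlonglongrightarrow> 0" and fd0: "(\<lambda>j. fd (\<rho> j) s w) \<longlonglongrightarrow> 0" "(\<lambda>j. fd (\<rho> j) t w) \<longlonglongrightarrow> 0"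
    and fdu: "AE u in lborel. u \<in> {0..T} --> (\<lambda>j. fd (\<rho> j) u w) \<longlonglongrightarrow> 0"
    using elim by auto
   show ?case
    by (intro conjI Phi_tendsto[OF w \<rho> bi si fe0] H_integral_tendsto[OF w \<rho> bi si fe0 sub fdu] sT fd0)
  qed
  have 1: "(\<lambda>j. \<integral>w. indicator A w * (Phij (\<rho> j) t w - Phij (\<rho> j) s w) \<partial>M) \<longlonglongrightarrow> (LINT w|M. indicator A w * (Phip t w - Phip s w))"
  proof (rule integral_dominated_convergence[where w = "\<lambda>_. 2 * C"])
   show "(\<lambda>w. indicator A w * (Phip t w - Phip s w)) \<in> borel_measurable M"
    by (intro borel_measurable_times borel_measurable_diff Phip_meas sT borel_measurable_indicator AM)
   show "(\<lambda>w. indicator A w * (Phij (\<rho> j) t w - Phij (\<rho> j) s w)) \<in> borel_measurable M" for j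
    by (intro borel_measurable_times borel_measurable_diff j_Phi sT borel_measurable_indicator AM)
   show "integrable M (\<lambda>_. 2 * C)" by simp
   show "AE w in M. (\<lambda>j. indicator A w * (Phij (\<rho> j) t w - Phij (\<rho> j) s w)) \<longlonglongrightarrow> indicator A w * (Phip t w - Phip s w)"
    using conv by eventually_elim (intro tendsto_intros, auto)
   show "AE w in M. norm (indicator A w * (Phij (\<rho> j) t w - Phij (\<rho> j) s w)) \<le> 2 * C" for j
   proof (rule AE_I2)
    fix w assume w: "w \<in> space M"
    have "\<bar>Phij (\<rho> j) t w - Phij (\<rho> j) s w\<bar> \<le> 2 * C"
     using Phij_bound[OF w sT(1), of "\<rho> j"] Phij_bound[OF w sT(2), of "\<rho> j"] by linarith
    then show "norm (indicator A w * (Phij (\<rho> j) t w - Phij (\<rho> j) s w)) \<le> 2 * C"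
     by (cases "w \<in> A") auto
   qed
  qed
  have bH: "norm (indicator A w * (LINT v:{s..t}|lborel. Hj (\<rho> j) v w)) \<le> C1 * (T + K)" if w: "w \<in> space M" for j w
   using Hj_integral_bound[OF w sub, of "\<rho> j"] by (cases "w \<in> A") auto
  have mH: "(\<lambda>w. LINT v:{s..t}|lborel. Hj j v w) \<in> borel_measurable M" for j
  proof -
   have "prog T (Hj j)" unfolding Hj_def[abs_def] by (rule H_prog[OF j_Z j_Q j_Qnn bj_prog[OF T] j_G])
   then show ?thesis by (intro measurable_F_M[OF T] prog_integral_Icc sub)
  qed
  have mHp: "(\<lambda>w. LINT v:{s..t}|lborel. Hp v w) \<in> borel_measurable M"
   by (intro measurable_F_M[OF T] prog_integral_Icc sub Hp_prog)
  have 2: "(\<lambda>j. \<integral>w. indicator A w * (LINT v:{s..t}|lborel. Hj (\<rho> j) v w) \<partial>M) \<longlonglongrightarrow> (LINT w|M. indicator A w * (LINT v:{s..t}|lborel. Hp v w))"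
  proof (rule integral_dominated_convergence[where w = "\<lambda>_. C1 * (T + K)"])
   show "(\<lambda>w. indicator A w * (LINT v:{s..t}|lborel. Hp v w)) \<in> borel_measurable M"
    by (intro borel_measurable_times mHp borel_measurable_indicator AM)
   show "(\<lambda>w. indicator A w * (LINT v:{s..t}|lborel. Hj (\<rho> j) v w)) \<in> borel_measurable M" for j
    by (intro borel_measurable_times mH borel_measurable_indicator AM)
   show "integrable M (\<lambda>_. C1 * (T + K))" by simp
   show "AE w in M. (\<lambda>j. indicator A w * (LINT v:{s..t}|lborel. Hj (\<rho> j) v w)) \<longlonglongrightarrow> indicator A w * (LINT v:{s..t}|lborel. Hp v w)"
    using conv by eventually_elim (intro tendsto_intros, auto)
   show "AE w in M. norm (indicator A w * (LINT v:{s..t}|lborel. Hj (\<rho> j) v w)) \<le> C1 * (T + K)" for j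
    using bH by (intro AE_I2)
  qed
  have e: "(LINT w|M. indicator A w * (Phij (\<rho> j) t w - Phij (\<rho> j) s w)) = (LINT w|M. indicator A w * (LINT v:{s..t}|lborel. Hj (\<rho> j) v w))" for j
   by (rule j_ito[OF st A])
  have "AE w in M. \<bar>LINT v:{s..t}|lborel. Hp v w\<bar> \<le> C1 * (T + K)"
   using conv AE_space
  proof eventually_elim
   case (elim w)
   then have "(\<lambda>j. \<bar>LINT v:{s..t}|lborel. Hj (\<rho> j) v w\<bar>) \<longlonglongrightarrow> \<bar>LINT v:{s..t}|lborel. Hp v w\<bar>"
    by (intro tendsto_rabs) auto
   then show ?case
    by (rule LIMSEQ_le_const2) (use Hj_integral_bound[OF _ sub] elim in auto)
  qed
  moreover have "(LINT w|M. indicator A w * (Phip t w - Phip s w)) = (LINT w|M. indicator A w * (LINT v:{s..t}|lborel. Hp v w))"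
   using 1 2 unfolding e by (rule LIMSEQ_unique)
  ultimately show ?thesis by blast
 qed
 then show "(LINT w|M. indicator A w * (Phip t w - Phip s w)) = (LINT w|M. indicator A w * (LINT v:{s..t}|lborel. Hp v w))"
  and "AE w in M. \<bar>LINT v:{s..t}|lborel. Hp v w\<bar> \<le> C1 * (T + K)" by blast+
qed

end

section \<open>Functions with continuous partial derivatives\<close>

text \<open>\<open>C21\<close> provides partial derivatives only. The increment is built up one
  coordinate at a time by the mean value theorem; the intermediate points stay within
  \<open>norm u\<close> of \<open>x\<close>, where the partials vary by at most
  \<open>e\<close>.\<close>

lemma increment_partials:
 fixes h :: "real^'d => real"
 assumes P: "!!k y. has_partial k h y" and "finite A"
  and e: "!!k y. norm (y - x) \<le> \<delta> ==> \<bar>partial k h y - partial k h x\<bar> \<le> e" and u: "norm u \<le> \<delta>"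
 shows "\<bar>h (x + (\<chi> k. if k \<in> A then u $ k else 0)) - h x - (\<Sum>k\<in>A. u $ k * partial k h x)\<bar> \<le> (\<Sum>k\<in>A. \<bar>u $ k\<bar> * e)"
 using \<open>finite A\<close>
proof induction
 case empty
 have "(\<chi> k. 0) = (0::real^'d)" by (simp add: vec_eq_iff)
 then show ?case by simp
next
 case (insert k A)
 let ?v = "\<lambda>A. (\<chi> k. if k \<in> A then u $ k else 0) :: real^'d"
 let ?y = "\<lambda>s. x + ?v A + s *\<^sub>R axis k 1"
 have v: "?v (insert k A) = ?v A + (u $ k) *\<^sub>R axis k 1"
  using insert(2) by (auto simp: vec_eq_iff axis_def)
 have d: "((\<lambda>s. h (?y s)) has_real_derivative partial k h (?y s)) (at s)" for s
 proof -
  have "(\<lambda>r. h (?y s + r *\<^sub>R axis k 1)) field_differentiable (at 0)" using P[of k "?y s"] by (simp add: has_partial_def)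
  then have "((\<lambda>r. h (?y s + r *\<^sub>R axis k 1)) has_real_derivative partial k h (?y s)) (at 0)"
   unfolding partial_def by (simp add: DERIV_deriv_iff_field_differentiable)
  then have "((\<lambda>r. h (?y (s + r))) has_real_derivative partial k h (?y s)) (at 0)"
   by (simp add: scaleR_add_left add.assoc)
  then have "((\<lambda>r. h (?y (r + s))) has_real_derivative partial k h (?y s)) (at 0)" by (simp only: add.commute)
  from DERIV_shift[of "\<lambda>s. h (?y s)" _ 0 s, THEN iffD2, OF this] show ?thesis by (simp only: add_0)
 qed
 obtain \<theta> where \<theta>: "\<bar>\<theta>\<bar> \<le> \<bar>u $ k\<bar>" "h (?y (u $ k)) - h (?y 0) = u $ k * partial k h (?y \<theta>)"
 proof (cases "u $ k" "0::real" rule: linorder_cases)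
  case less
  obtain z where "u $ k < z" "z < 0" "h (?y 0) - h (?y (u $ k)) = (0 - u $ k) * partial k h (?y z)"
   using MVT2[OF less d] by blast
  then show ?thesis by (intro that[of z]) (auto simp: algebra_simps)
 next
  case equal
  then show ?thesis by (intro that[of 0]) auto
 next
  case greater
  obtain z where "0 < z" "z < u $ k" "h (?y (u $ k)) - h (?y 0) = (u $ k - 0) * partial k h (?y z)"
   using MVT2[OF greater d] by blast
  then show ?thesis by (intro that[of z]) auto
 qed
 have "norm (?y \<theta> - x) \<le> norm u"
  by (rule norm_le_componentwise_cart) (use \<theta>(1) insert(2) in \<open>auto simp: axis_def\<close>)
 then have "\<bar>partial k h (?y \<theta>) - partial k h x\<bar> \<le> e" using u by (intro e) simp
 then have "\<bar>u $ k\<bar> * \<bar>partial k h (?y \<theta>) - partial k h x\<bar> \<le> \<bar>u $ k\<bar> * e" by (intro mult_left_mono) auto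
 then have "\<bar>u $ k * partial k h (?y \<theta>) - u $ k * partial k h x\<bar> \<le> \<bar>u $ k\<bar> * e"
  by (simp add: abs_mult[symmetric] right_diff_distrib)
 moreover have "h (x + ?v (insert k A)) - h (x + ?v A) = u $ k * partial k h (?y \<theta>)"
  using \<theta>(2) unfolding v by (simp add: add.assoc)
 ultimately show ?case using insert by simp
qed

lemma continuous_partials_imp_has_derivative:
 fixes h :: "real^'d => real"
 assumes P: "!!k y. has_partial k h y" and C: "!!k. continuous_on UNIV (partial k h)"
 shows "(h has_derivative (\<lambda>u. \<Sum>k\<in>UNIV. u $ k * partial k h x)) (at x)"
 unfolding has_derivative_at_alt
proof (intro conjI allI impI)
 show "bounded_linear (\<lambda>u. \<Sum>k\<in>UNIV. u $ k * partial k h x)"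
  by (intro bounded_linear_sum bounded_linear_mult_const bounded_linear_vec_nth)
 fix e :: real assume e: "0 < e"
 define e' where "e' = e / real CARD('d)"
 have e': "0 < e'" using e by (simp add: e'_def)
 have "\<exists>d>0. \<forall>y. norm (y - x) \<le> d --> \<bar>partial k h y - partial k h x\<bar> \<le> e'" for k
 proof -
  have "isCont (partial k h) x" using C[of k] by (simp add: continuous_on_eq_continuous_at)
  then obtain d where "d > 0" "!!y. dist y x < d ==> dist (partial k h y) (partial k h x) < e'"
   using e' unfolding continuous_at_eps_delta by blast
  then show ?thesis by (intro exI[of _ "d/2"]) (auto simp: dist_norm intro!: less_imp_le)
 qed
 then obtain d where d: "!!k. d k > 0" "!!k y. norm (y - x) \<le> d k ==> \<bar>partial k h y - partial k h x\<bar> \<le> e'"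
  by metis
 define \<delta> where "\<delta> = Min (range d)"
 have \<delta>: "\<delta> > 0" "!!k. \<delta> \<le> d k" unfolding \<delta>_def using d(1) by auto
 have "norm (h y - h x - (\<Sum>k\<in>UNIV. (y - x) $ k * partial k h x)) \<le> e * norm (y - x)" if y: "norm (y - x) < \<delta>" for y
 proof -
  let ?u = "y - x"
  have "\<bar>h (x + (\<chi> k. if k \<in> UNIV then ?u $ k else 0)) - h x - (\<Sum>k\<in>UNIV. ?u $ k * partial k h x)\<bar> \<le> (\<Sum>k\<in>UNIV. \<bar>?u $ k\<bar> * e')"
  proof (rule increment_partials[where \<delta> = \<delta>, OF P])
   show "norm ?u \<le> \<delta>" using y by simp
   show "\<bar>partial k h y' - partial k h x\<bar> \<le> e'" if "norm (y' - x) \<le> \<delta>" for k y'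
    by (rule d(2)[OF order.trans[OF that \<delta>(2)]])
  qed simp
  also have "... \<le> (\<Sum>k\<in>(UNIV::'d set). norm ?u * e')"
   using e' component_le_norm_cart[of ?u] by (intro sum_mono mult_right_mono) auto
  also have "... = e * norm ?u" by (simp add: e'_def)
  also have "(\<chi> k. if k \<in> UNIV then ?u $ k else 0) = ?u" by (simp add: vec_eq_iff)
  finally show ?thesis by simp
 qed
 then show "\<exists>d>0. \<forall>y. norm (y - x) < d --> norm (h y - h x - (\<Sum>k\<in>UNIV. (y - x) $ k * partial k h x)) \<le> e * norm (y - x)"
  using \<delta>(1) by blast
qed

lemma continuous_partials_directional:
 fixes h :: "real^'d => real"
 assumes P: "!!k y. has_partial k h y" and C: "!!k. continuous_on UNIV (partial k h)"
 shows "((\<lambda>s. h (z + s *\<^sub>R x)) has_real_derivative (\<Sum>k\<in>UNIV. x $ k * partial k h (z + s *\<^sub>R x))) (at s)"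
proof -
 have "((\<lambda>s. h (z + s *\<^sub>R x)) has_derivative (\<lambda>r. \<Sum>k\<in>UNIV. (r *\<^sub>R x) $ k * partial k h (z + s *\<^sub>R x))) (at s)"
  by (rule has_derivative_compose[OF _ continuous_partials_imp_has_derivative[OF P C], of "\<lambda>s. z + s *\<^sub>R x" "\<lambda>r. r *\<^sub>R x"])
   (auto intro!: derivative_eq_intros)
 then show ?thesis
  unfolding has_field_derivative_def
  by (rule has_derivative_eq_rhs) (auto simp: fun_eq_iff sum_distrib_left sum_distrib_right algebra_simps)
qed

section \<open>Truncated powers\<close>

text \<open>An exponent of at least 2 removes the kink at 0: the difference quotient there is at
  most \<open>\<bar>h\<bar> ^ Suc n\<close>.\<close>

lemma has_derivative_max_power:
 "((\<lambda>x::real. max 0 x ^ Suc (Suc n)) has_real_derivative real (Suc (Suc n)) * max 0 x ^ Suc n) (at x)"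
proof (cases x "0::real" rule: linorder_cases)
 case less
 have "((\<lambda>x::real. 0) has_real_derivative 0) (at x)" by simp
 then show ?thesis
  by (rule has_field_derivative_transform_within_open[where S = "{..<0}", THEN DERIV_cong]) (use less in auto)
next
 case greater
 have "((\<lambda>x::real. x ^ Suc (Suc n)) has_real_derivative real (Suc (Suc n)) * x ^ Suc n) (at x)"
  using DERIV_pow[of "Suc (Suc n)" x UNIV] by simp
 then have "((\<lambda>x::real. max 0 x ^ Suc (Suc n)) has_real_derivative real (Suc (Suc n)) * x ^ Suc n) (at x)"
  by (rule has_field_derivative_transform_within_open[where S = "{0<..}"]) (use greater in auto)
 then show ?thesis using greater by simp
next
 case equal
 have "(\<lambda>h::real. (max 0 (0 + h) ^ Suc (Suc n) - max 0 0 ^ Suc (Suc n)) / h) \<midarrow>0\<rightarrow> 0"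
 proof (rule Lim_null_comparison)
  show "\<forall>\<^sub>F h in at 0. norm ((max 0 (0 + h) ^ Suc (Suc n) - max 0 0 ^ Suc (Suc n)) / h) \<le> \<bar>h\<bar> ^ Suc n"
  proof (intro always_eventually allI)
   fix h :: real
   have "max 0 h ^ Suc (Suc n) \<le> \<bar>h\<bar> ^ Suc (Suc n)" by (intro power_mono) auto
   then have "max 0 h ^ Suc (Suc n) / \<bar>h\<bar> \<le> \<bar>h\<bar> ^ Suc (Suc n) / \<bar>h\<bar>" by (intro divide_right_mono) auto
   then show "norm ((max 0 (0 + h) ^ Suc (Suc n) - max 0 0 ^ Suc (Suc n)) / h) \<le> \<bar>h\<bar> ^ Suc n"
    by (cases "h = 0") (auto simp: abs_mult)
  qed
  show "(\<lambda>h::real. \<bar>h\<bar> ^ Suc n) \<midarrow>0\<rightarrow> 0"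
   by (rule tendsto_eq_intros | simp)+
 qed
 then show ?thesis using equal unfolding DERIV_def by simp
qed

text \<open>A concave truncation of the identity of class \<open>C^2\<close>, constant on \<open>[R, oo)\<close>, with its first two derivatives.
 The decreasing function \<open>cap1 K\<close> is also the cutoff in the localising variable \<open>q\<close>.\<close>

definition cap :: "real => real => real" where "cap R v = R / 3 * (1 - max 0 (1 - v / R) ^ 3)"
definition cap1 :: "real => real => real" where "cap1 R v = max 0 (1 - v / R) ^ 2"
definition cap2 :: "real => real => real" where "cap2 R v = - (2 / R) * max 0 (1 - v / R)"

lemma has_derivative_max_power_comp:
 fixes R v :: real
 assumes "R > 0"
 shows "((\<lambda>v. max 0 (1 - v / R) ^ Suc (Suc n)) has_real_derivative real (Suc (Suc n)) * max 0 (1 - v / R) ^ Suc n * (- (1 / R))) (at v)"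
proof -
 have "((\<lambda>v. 1 - v / R) has_real_derivative - (1 / R)) (at v)"
  using assms by (auto intro!: derivative_eq_intros)
 from DERIV_chain2[where f = "\<lambda>x. max 0 x ^ Suc (Suc n)", OF has_derivative_max_power this] show ?thesis .
qed

lemma cap_deriv:
 assumes "R > 0"
 shows "(cap R has_real_derivative cap1 R v) (at v)"
proof -
 have d: "((\<lambda>v. max 0 (1 - v / R) ^ 3) has_real_derivative 3 * max 0 (1 - v / R) ^ 2 * (- (1 / R))) (at v)"
  using has_derivative_max_power_comp[OF assms, of 1 v] by (simp add: numeral_eq_Suc)
 show ?thesis
  unfolding cap_def[abs_def] cap1_def
  by (rule DERIV_cong[OF DERIV_cmult[OF DERIV_diff[OF DERIV_const d]]]) (use assms in simp)
qed

lemma cap1_deriv: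
 assumes "R > 0"
 shows "(cap1 R has_real_derivative cap2 R v) (at v)"
proof -
 have d: "((\<lambda>v. max 0 (1 - v / R) ^ 2) has_real_derivative 2 * max 0 (1 - v / R) * (- (1 / R))) (at v)"
  using has_derivative_max_power_comp[OF assms, of 0 v] by (simp add: numeral_eq_Suc)
 show ?thesis unfolding cap1_def[abs_def] cap2_def by (rule DERIV_cong[OF d]) simp
qed

lemma cap_continuous:
 assumes "R > 0"
 shows "continuous_on A (cap R)" "continuous_on A (cap1 R)" "continuous_on A (cap2 R)"
 unfolding cap_def[abs_def] cap1_def[abs_def] cap2_def[abs_def]
 using assms by (intro continuous_intros; simp)+

lemma cap1_bounds: "R > 0 ==> 0 \<le> v ==> 0 \<le> cap1 R v \<and> cap1 R v \<le> 1"
 unfolding cap1_def by (auto intro!: power_le_one)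

lemma cap2_nonpos: "R > 0 ==> cap2 R v \<le> 0"
 unfolding cap2_def by (auto simp: divide_nonneg_pos mult_nonneg_nonneg)

lemma cap_large: "R > 0 ==> R \<le> v ==> cap R v = R / 3 \<and> cap1 R v = 0 \<and> cap2 R v = 0"
proof -
 assume "R > 0" "R \<le> v"
 then have "max 0 (1 - v / R) = 0" by (simp add: field_simps)
 then show ?thesis by (simp add: cap_def cap1_def cap2_def)
qed

lemma cap_bounds: "R > 0 ==> 0 \<le> v ==> 0 \<le> cap R v \<and> cap R v \<le> R / 3"
proof -
 assume R: "R > 0" "0 \<le> v"
 then have "max 0 (1 - v / R) ^ 3 \<le> 1" "0 \<le> max 0 (1 - v / R) ^ 3" by (auto intro!: power_le_one)
 then show ?thesis using R by (auto simp: cap_def field_simps)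
qed

lemma cap_eq_small: "R > 0 ==> v \<le> R ==> cap R v = v - v^2 / R + v ^ 3 / (3 * R^2)"
 by (simp add: cap_def field_simps power2_eq_square power3_eq_cube)

text \<open>Concavity, for arguments of either sign. With \<open>x\<close> and \<open>y\<close> the
  truncated values of \<open>1 - v / R\<close> and \<open>1 - b / R\<close>, it reduces to
  \<open>(x - y)^2 * (2 * x + y) \<ge> 0\<close>.\<close>

lemma cap_tangent: "R > 0 ==> cap R b \<le> cap R v + cap1 R v * (b - v)"
proof -
 assume R: "R > 0"
 define x y where "x = max 0 (1 - v / R)" and "y = max 0 (1 - b / R)"
 have nn: "0 \<le> x" "0 \<le> y" by (auto simp: x_def y_def)
 have "0 \<le> (x - y)^2 * (2 * x + y)" using nn by (intro mult_nonneg_nonneg) auto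
 then have 1: "3 * x^2 * (x - y) \<ge> x ^ 3 - y ^ 3" by (simp add: power2_eq_square power3_eq_cube algebra_simps)
 have "x^2 * (x - y) \<le> x^2 * ((b - v) / R)"
 proof (cases "1 - v / R \<le> 0")
  case True then show ?thesis by (simp add: x_def)
 next
  case False
  then have "x - y \<le> (b - v) / R" by (simp add: x_def y_def diff_divide_distrib)
  then show ?thesis by (intro mult_left_mono) auto
 qed
 with 1 have "x ^ 3 - y ^ 3 \<le> 3 * (x^2 * ((b - v) / R))" by linarith
 then have "R / 3 * (x ^ 3 - y ^ 3) \<le> R / 3 * (3 * (x^2 * ((b - v) / R)))" using R by (intro mult_left_mono) auto
 moreover have "R / 3 * (3 * (x^2 * ((b - v) / R))) = x^2 * (b - v)" using R by simp
 ultimately have "R / 3 * (x ^ 3 - y ^ 3) \<le> x^2 * (b - v)" by linarith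
 then show ?thesis unfolding cap_def cap1_def x_def[symmetric] y_def[symmetric] by (simp add: algebra_simps)
qed

lemma cap_0: "R > 0 ==> cap R 0 = 0" by (simp add: cap_def)

lemma cap_le: "R > 0 ==> cap R v \<le> v"
 using cap_tangent[of R v 0] by (simp add: cap_0 cap1_def)

text \<open>The tangent at \<open>v\<close> evaluated at 0, where the cap vanishes. It converts a
  bound on the drift in terms of \<open>V\<close> into one in terms of the capped function.\<close>

lemma cap1_mult_le: "R > 0 ==> cap1 R v * v \<le> cap R v"
 using cap_tangent[of R 0 v] by (simp add: cap_0)

lemma cap_tendsto:
 assumes "0 \<le> v"
 shows "(\<lambda>n. cap (real (Suc n)) v) \<longlonglongrightarrow> v"
proof -
 have "(\<lambda>n. v - v^2 / real (Suc n) + v ^ 3 / (3 * (real (Suc n))^2)) \<longlonglongrightarrow> v" by real_asymp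
 moreover have "\<forall>\<^sub>F n in sequentially. v - v^2 / real (Suc n) + v ^ 3 / (3 * (real (Suc n))^2) = cap (real (Suc n)) v"
  using eventually_ge_at_top[of "nat \<lceil>v\<rceil>"]
 proof eventually_elim
  case (elim n)
  have "v \<le> real (nat \<lceil>v\<rceil>)" by (rule real_nat_ceiling_ge)
  then have "v \<le> real (Suc n)" using elim by linarith
  then show ?case by (simp only: cap_eq_small of_nat_0_less_iff zero_less_Suc)
 qed
 ultimately show ?thesis by (rule Lim_transform_eventually)
qed

section \<open>Uniform continuity by clipping\<close>

text \<open>By \<open>far\<close> and \<open>late\<close>, \<open>f\<close> is unchanged when
  \<open>z\<close> is projected to the ball of radius \<open>\<rho>\<close> and \<open>q\<close> is
  cut at \<open>K\<close>. This map is 1-Lipschitz into a compact set, on which a continuous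
  function is bounded and uniformly continuous.\<close>

lemma uniformly_continuous_clip:
 fixes f :: "real^'d => real => real => 'x::real_normed_vector"
 assumes c: "continuous_on (UNIV \<times> {0..} \<times> {0..}) (\<lambda>(z, q, t). f z q t)"
  and K: "0 \<le> K" and T: "0 \<le> T" and \<rho>: "0 \<le> \<rho>"
  and far: "!!z z' q t. \<rho> \<le> norm z ==> \<rho> \<le> norm z' ==> 0 \<le> q ==> t \<in> {0..T} ==> f z q t = f z' q t"
  and late: "!!z q t. K \<le> q ==> t \<in> {0..T} ==> f z q t = f z K t"
 shows "uniformly_continuous_on (UNIV \<times> {0..} \<times> {0..T}) (\<lambda>(z, q, t). f z q t)"
  and "\<exists>C\<ge>0. \<forall>z q t. 0 \<le> q --> t \<in> {0..T} --> norm (f z q t) \<le> C"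
proof -
 let ?c = "closest_point (cball (0::real^'d) \<rho>)"
 let ?P = "\<lambda>(z :: real^'d, q, t). (?c z, min q K, t)"
 let ?B = "cball (0::real^'d) \<rho> \<times> {0..K} \<times> {0..T}"
 have B: "compact ?B" by (intro compact_Times compact_cball compact_Icc)
 have ne: "cball (0::real^'d) \<rho> \<noteq> {}" using \<rho> by simp
 have cB: "continuous_on ?B (\<lambda>(z, q, t). f z q t)" by (rule continuous_on_subset[OF c]) auto
 have cin: "?c z \<in> cball 0 \<rho>" for z by (rule closest_point_in_set) (use ne in auto)
 have Pin: "?P x \<in> ?B" if "x \<in> UNIV \<times> {0..} \<times> {0..T}" for x
  using that cin K by (auto simp: split_beta)
 have eq: "f z q t = f (?c z) (min q K) t" if "0 \<le> q" "t \<in> {0..T}" for z q t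
 proof -
  have "f z q t = f z (min q K) t" using late[of q t z] that by (cases "K \<le> q") (auto simp: min_def)
  also have "... = f (?c z) (min q K) t"
  proof (cases "norm z \<le> \<rho>")
   case True
   then show ?thesis by (simp add: closest_point_self)
  next
   case False
   let ?z = "(\<rho> / norm z) *\<^sub>R z"
   have z0: "norm z > 0" using False \<rho> by linarith
   \<comment> \<open>Comparison with the radial projection shows that the nearest point still has
     norm at least \<open>\<rho>\<close>, so that \<open>far\<close> relates it to
     \<open>z\<close>.\<close>
   have "dist z (?c z) \<le> dist z ?z"
    by (rule closest_point_le) (use z0 \<rho> in auto)
   also have "... = norm ((1 - \<rho> / norm z) *\<^sub>R z)" by (simp add: dist_norm scaleR_left_diff_distrib)
   also have "... = norm z - \<rho>" using z0 False by (simp add: field_simps abs_of_nonneg)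
   finally have "norm (?c z) \<ge> \<rho>" using norm_triangle_sub[of z "?c z"] by (simp add: dist_norm)
   then show ?thesis using False that K by (intro far) auto
  qed
  finally show ?thesis .
 qed
 have lip: "dist (?P x) (?P y) \<le> dist x y" for x y :: "(real^'d) \<times> real \<times> real"
 proof -
  have 1: "dist (?c (fst x)) (?c (fst y)) \<le> dist (fst x) (fst y)"
   by (rule closest_point_lipschitz) (use ne in auto)
  have 2: "dist (min (fst (snd x)) K) (min (fst (snd y)) K) \<le> dist (fst (snd x)) (fst (snd y))"
   by (auto simp: dist_real_def min_def)
  show ?thesis
   unfolding dist_prod_def split_beta fst_conv snd_conv
   by (intro real_sqrt_le_mono add_mono power_mono zero_le_dist 1 2) (auto intro!: add_mono power_mono 2)
 qed
 have ucB: "uniformly_continuous_on ?B (\<lambda>(z, q, t). f z q t)" by (rule compact_uniformly_continuous[OF cB B])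
 have eqP: "(\<lambda>(z, q, t). f z q t) x = (\<lambda>(z, q, t). f z q t) (?P x)" if "x \<in> UNIV \<times> {0..} \<times> {0..T}" for x
  using that eq by (auto simp: split_beta)
 show "uniformly_continuous_on (UNIV \<times> {0..} \<times> {0..T}) (\<lambda>(z, q, t). f z q t)"
  unfolding uniformly_continuous_on_def
 proof (intro allI impI)
  fix e :: real assume "e > 0"
  then obtain d where d: "d > 0" "!!x x'. x \<in> ?B ==> x' \<in> ?B ==> dist x' x < d ==> dist ((\<lambda>(z, q, t). f z q t) x') ((\<lambda>(z, q, t). f z q t) x) < e"
   using ucB unfolding uniformly_continuous_on_def by meson
  show "\<exists>d>0. \<forall>x\<in>UNIV \<times> {0..} \<times> {0..T}. \<forall>x'\<in>UNIV \<times> {0..} \<times> {0..T}. dist x' x < d -->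
    dist ((\<lambda>(z, q, t). f z q t) x') ((\<lambda>(z, q, t). f z q t) x) < e"
  proof (intro exI[of _ d] conjI ballI impI d(1))
   fix x x' :: "(real^'d) \<times> real \<times> real"
   assume x: "x \<in> UNIV \<times> {0..} \<times> {0..T}" "x' \<in> UNIV \<times> {0..} \<times> {0..T}" and "dist x' x < d"
   then have "dist (?P x') (?P x) < d" using lip[of x' x] by linarith
   then show "dist ((\<lambda>(z, q, t). f z q t) x') ((\<lambda>(z, q, t). f z q t) x) < e"
    unfolding eqP[OF x(1)] eqP[OF x(2)] by (rule d(2)[OF Pin[OF x(1)] Pin[OF x(2)]])
  qed
 qed
 have "compact ((\<lambda>(z, q, t). f z q t) ` ?B)" by (rule compact_continuous_image[OF cB B])
 then obtain C where C: "!!x. x \<in> ?B ==> norm ((\<lambda>(z, q, t). f z q t) x) \<le> C"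
  by (meson bounded_iff compact_imp_bounded imageI)
 have "norm (f z q t) \<le> max 0 C" if "0 \<le> q" "t \<in> {0..T}" for z q t
  using C[OF Pin[of "(z, q, t)"]] eq[OF that, of z] that by (auto simp: le_max_iff_disj)
 then show "\<exists>C\<ge>0. \<forall>z q t. 0 \<le> q --> t \<in> {0..T} --> norm (f z q t) \<le> C" by (intro exI[of _ "max 0 C"]) auto
qed

section \<open>Truncated Lyapunov functions\<close>

text \<open>The rank-one matrix \<open>v v^T\<close> that the chain rule adds to the Hessian when a
  function is composed with the cap.\<close>

definition outer :: "real^'d => real^'d^'d" where "outer v = (\<chi> l k. v $ l * v $ k)"

lemma outer_mult: "outer v *v x = (v \<bullet> x) *\<^sub>R v"
 by (simp add: outer_def matrix_vector_mult_def vec_eq_iff inner_vec_def sum_distrib_left sum_distrib_right mult_ac)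

text \<open>The trace is the squared norm of \<open>transpose G *v v\<close>. Multiplied by the
  nonpositive \<open>cap2\<close>, this term may be dropped from the drift.\<close>

lemma quad_trace_outer_nonneg:
 fixes G :: "real^'m^'d"
 shows "0 \<le> quad_trace (outer v) G"
proof -
 have "quad_trace (outer v) G = (\<Sum>k\<in>UNIV. (\<Sum>i\<in>UNIV. G $ i $ k * v $ i) * (\<Sum>j\<in>UNIV. G $ j $ k * v $ j))"
  unfolding quad_trace_sum sum_product by (simp add: outer_def mult.assoc mult.left_commute mult.commute)
 also have "... \<ge> 0" by (intro sum_nonneg) (simp add: zero_le_mult_iff linear)
 finally show ?thesis .
qed

lemma quad_trace_scale: "quad_trace (a *\<^sub>R A) G = a * quad_trace A G"
 unfolding quad_trace_sum sum_distrib_left by (simp add: mult.assoc mult.left_commute)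

lemma quad_trace_add: "quad_trace (A + B) G = quad_trace A G + quad_trace B G"
 unfolding quad_trace_sum sum.distrib[symmetric] by (simp add: algebra_simps)

lemma continuous_on_outer: "continuous_on A f ==> continuous_on A (\<lambda>x. outer (f x))"
 unfolding outer_def by (intro continuous_intros)

locale lyapunov =
 fixes N :: nat and \<Gamma> :: "int => int => real" and V :: "real^'d => real => int => real" and lam c1 p :: real
 assumes gen: "generator N \<Gamma>" and C21: "C21 N V"
  and lower: "!!x t i. 0 \<le> t ==> i \<in> {1..int N} ==> c1 * norm x powr p \<le> V x t i"
  and c1: "0 < c1" and p: "0 < p" and lam: "0 \<le> lam"
begin

abbreviation "S \<equiv> {1..int N}"

lemma V_nonneg: "0 \<le> t ==> i \<in> S ==> 0 \<le> V x t i"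
 by (rule order.trans[OF _ lower]) (use c1 in auto)

lemma V_continuous:
 assumes "i \<in> S"
 shows "continuous_on (UNIV \<times> {0..}) (\<lambda>(x, t). V x t i)" "continuous_on (UNIV \<times> {0..}) (\<lambda>(x, t). V_t V x t i)"
  "continuous_on (UNIV \<times> {0..}) (\<lambda>(x, t). V_x V x t i)" "continuous_on (UNIV \<times> {0..}) (\<lambda>(x, t). V_xx V x t i)"
 using C21 assms unfolding C21_def by blast+

lemma V_partials:
 assumes "i \<in> S" "0 \<le> t"
 shows "(\<lambda>s. V x s i) differentiable (at t within {0..})" "has_partial k (\<lambda>z. V z t i) x" "has_partial l (partial k (\<lambda>z. V z t i)) x"
 using C21 assms unfolding C21_def by blast+

lemma V_section:
 fixes f :: "(real^'d) \<times> real => 'x::topological_space"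
 assumes "continuous_on (UNIV \<times> {0..}) f" "0 \<le> t"
 shows "continuous_on UNIV (\<lambda>x. f (x, t))"
 by (rule continuous_on_compose2[OF assms(1)]) (use assms(2) in \<open>auto intro!: continuous_intros\<close>)

lemma V_deriv_z:
 assumes i: "i \<in> S" and t: "0 \<le> t"
 shows "((\<lambda>s. V (z + s *\<^sub>R x) t i) has_real_derivative V_x V (z + s *\<^sub>R x) t i \<bullet> x) (at s)"
proof -
 have c: "continuous_on UNIV (partial k (\<lambda>z. V z t i))" for k
  using bounded_linear.continuous_on[OF bounded_linear_vec_nth V_section[OF V_continuous(3)[OF i] t], of k] by (simp add: V_x_def)
 have "((\<lambda>s. V (z + s *\<^sub>R x) t i) has_real_derivative (\<Sum>k\<in>UNIV. x $ k * partial k (\<lambda>z. V z t i) (z + s *\<^sub>R x))) (at s)"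
  by (rule continuous_partials_directional[where h = "\<lambda>z. V z t i", OF V_partials(2)[OF i t] c])
 then show ?thesis by (simp add: V_x_def inner_vec_def mult.commute)
qed

lemma V_deriv_zz:
 assumes i: "i \<in> S" and t: "0 \<le> t"
 shows "((\<lambda>s. V_x V (z + s *\<^sub>R x) t i \<bullet> x) has_real_derivative x \<bullet> (V_xx V (z + s *\<^sub>R x) t i *v x)) (at s)"
proof -
 have c: "continuous_on UNIV (partial l (partial k (\<lambda>z. V z t i)))" for l k
  using bounded_linear.continuous_on[OF bounded_linear_vec_nth bounded_linear.continuous_on[OF bounded_linear_vec_nth V_section[OF V_continuous(4)[OF i] t], of l], of k] by (simp add: V_xx_def)
 have "((\<lambda>s. \<Sum>k\<in>UNIV. partial k (\<lambda>z. V z t i) (z + s *\<^sub>R x) * x $ k) has_real_derivative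
   (\<Sum>k\<in>UNIV. (\<Sum>l\<in>UNIV. x $ l * partial l (partial k (\<lambda>z. V z t i)) (z + s *\<^sub>R x)) * x $ k)) (at s)"
  by (intro DERIV_sum DERIV_cmult_right continuous_partials_directional[OF V_partials(3)[OF i t] c])
 moreover have "(\<Sum>k\<in>UNIV. (\<Sum>l\<in>UNIV. x $ l * partial l (partial k (\<lambda>z. V z t i)) (z + s *\<^sub>R x)) * x $ k)
  = x \<bullet> (V_xx V (z + s *\<^sub>R x) t i *v x)"
  unfolding inner_vec_def matrix_vector_mult_def V_xx_def inner_real_def vec_lambda_beta sum_distrib_left sum_distrib_right
  by (subst sum.swap) (simp add: mult.assoc)
 ultimately show ?thesis by (simp add: V_x_def inner_vec_def)
qed

lemma V_deriv_t:
 assumes "i \<in> S" "0 \<le> t"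
 shows "((\<lambda>s. V x s i) has_real_derivative V_t V x t i) (at t within {0..})"
 using V_partials(1)[OF assms, of x]
 by (simp add: V_t_def has_real_derivative_iff_has_vector_derivative vector_derivative_works)

definition lyap :: "real^'d => real => int => real" where "lyap z t i = exp (lam * t) * V z t i"

lemma lyap_nonneg: "0 \<le> t ==> i \<in> S ==> 0 \<le> lyap z t i"
 by (simp add: lyap_def V_nonneg)

context
 fixes R K :: real
 assumes R: "0 < R" and K: "0 < K"
begin

definition tf :: "real^'d => real => real => int => real" where
 "tf z q t i = cap1 K q * cap R (lyap z t i)"
definition tfz :: "real^'d => real => real => int => real^'d" where
 "tfz z q t i = (cap1 K q * cap1 R (lyap z t i) * exp (lam * t)) *\<^sub>R V_x V z t i"
definition tfzz :: "real^'d => real => real => int => real^'d^'d" where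
 "tfzz z q t i = (cap1 K q * cap2 R (lyap z t i) * (exp (lam * t))^2) *\<^sub>R outer (V_x V z t i)
  + (cap1 K q * cap1 R (lyap z t i) * exp (lam * t)) *\<^sub>R V_xx V z t i"
definition tfq :: "real^'d => real => real => int => real" where
 "tfq z q t i = cap2 K q * cap R (lyap z t i)"
definition tft :: "real^'d => real => real => int => real" where
 "tft z q t i = cap1 K q * cap1 R (lyap z t i) * (exp (lam * t) * (lam * V z t i + V_t V z t i))"

lemmas tf_defs = tf_def tfz_def tfzz_def tfq_def tft_def

lemma tf_support:
 assumes "K \<le> q"
 shows "tf z q t i = 0 \<and> tfz z q t i = 0 \<and> tfzz z q t i = 0 \<and> tfq z q t i = 0 \<and> tft z q t i = 0"
 using cap_large[OF K assms] by (simp add: tf_defs)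

text \<open>Outside the ball of radius \<open>(R / c1) powr (1 / p)\<close> the lower bound on
  \<open>V\<close>, together with \<open>exp (lam * t) \<ge> 1\<close>, brings the argument of the
  cap to at least \<open>R\<close>, where the cap is constant. Thus no dependence on
  \<open>z\<close> is left there.\<close>

lemma tf_far:
 assumes z: "(R / c1) powr (1 / p) \<le> norm z" and t: "0 \<le> t" and i: "i \<in> S"
 shows "tf z q t i = cap1 K q * (R / 3)" "tfz z q t i = 0" "tfzz z q t i = 0" "tfq z q t i = cap2 K q * (R / 3)" "tft z q t i = 0"
proof -
 have "((R / c1) powr (1 / p)) powr p \<le> norm z powr p" by (rule powr_mono2) (use z p in auto)
 then have "R / c1 \<le> norm z powr p" using p R c1 by (simp add: powr_powr)
 then have "R \<le> c1 * norm z powr p" using c1 by (simp add: field_simps)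
 also have "... \<le> V z t i" by (rule lower[OF t i])
 also have "V z t i \<le> lyap z t i"
  unfolding lyap_def using V_nonneg[OF t i, of z] lam t by (simp add: mult_le_cancel_right1)
 finally have "R \<le> lyap z t i" .
 from cap_large[OF R this] show "tf z q t i = cap1 K q * (R / 3)" "tfz z q t i = 0" "tfzz z q t i = 0" "tfq z q t i = cap2 K q * (R / 3)" "tft z q t i = 0"
  by (simp_all add: tf_defs)
qed

lemma tf_continuous:
 assumes i: "i \<in> S"
 shows "continuous_on (UNIV \<times> {0..} \<times> {0..}) (\<lambda>(z, q, t). tf z q t i)"
  "continuous_on (UNIV \<times> {0..} \<times> {0..}) (\<lambda>(z, q, t). tfz z q t i)"
  "continuous_on (UNIV \<times> {0..} \<times> {0..}) (\<lambda>(z, q, t). tfzz z q t i)"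
  "continuous_on (UNIV \<times> {0..} \<times> {0..}) (\<lambda>(z, q, t). tfq z q t i)"
  "continuous_on (UNIV \<times> {0..} \<times> {0..}) (\<lambda>(z, q, t). tft z q t i)"
proof -
 let ?D = "UNIV \<times> {0..} \<times> {0..} :: ((real^'d) \<times> real \<times> real) set"
 have lift: "continuous_on ?D (\<lambda>x. f (fst x) (snd (snd x)))" if "continuous_on (UNIV \<times> {0..}) (\<lambda>(z, t). f z t)"
  for f :: "real^'d => real => 'x::topological_space"
 proof -
  have "continuous_on ?D (\<lambda>x. (\<lambda>(z, t). f z t) (fst x, snd (snd x)))"
   by (rule continuous_on_compose2[OF that]) (auto intro!: continuous_intros)
  then show ?thesis by simp
 qed
 note c0 = lift[OF V_continuous(1)[OF i]] and ct = lift[OF V_continuous(2)[OF i]]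
  and cx = lift[OF V_continuous(3)[OF i]] and cxx = lift[OF V_continuous(4)[OF i]]
 have q: "continuous_on ?D (\<lambda>x. fst (snd x))" by (intro continuous_intros)
 have e: "continuous_on ?D (\<lambda>x. exp (lam * snd (snd x)))" by (intro continuous_intros)
 have lyap: "continuous_on ?D (\<lambda>x. lyap (fst x) (snd (snd x)) i)" unfolding lyap_def by (intro continuous_intros c0)
 note k1 = continuous_on_compose2[OF cap_continuous(2)[OF K] q subset_UNIV] and k2 = continuous_on_compose2[OF cap_continuous(3)[OF K] q subset_UNIV]
  and r0 = continuous_on_compose2[OF cap_continuous(1)[OF R] lyap subset_UNIV] and r1 = continuous_on_compose2[OF cap_continuous(2)[OF R] lyap subset_UNIV]
  and r2 = continuous_on_compose2[OF cap_continuous(3)[OF R] lyap subset_UNIV]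
 show "continuous_on ?D (\<lambda>(z, q, t). tf z q t i)" unfolding split_beta tf_def by (intro continuous_on_mult k1 r0)
 show "continuous_on ?D (\<lambda>(z, q, t). tfz z q t i)" unfolding split_beta tfz_def
  by (intro continuous_on_scaleR continuous_on_mult k1 r1 e cx)
 show "continuous_on ?D (\<lambda>(z, q, t). tfzz z q t i)" unfolding split_beta tfzz_def
  by (intro continuous_on_add continuous_on_scaleR continuous_on_mult continuous_on_power k1 r1 r2 e cxx continuous_on_outer cx)
 show "continuous_on ?D (\<lambda>(z, q, t). tfq z q t i)" unfolding split_beta tfq_def by (intro continuous_on_mult k2 r0)
 show "continuous_on ?D (\<lambda>(z, q, t). tft z q t i)" unfolding split_beta tft_def
  by (intro continuous_on_mult continuous_on_add continuous_on_const k1 r1 e c0 ct)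
qed

text \<open>Boundedness and uniform continuity come from \<open>uniformly_continuous_clip\<close>,
  with the radius of \<open>tf_far\<close> and the level \<open>K\<close> beyond which everything
  vanishes; the finitely many states are covered by summing their constants.\<close>

lemma test_function_exists:
 assumes T: "0 \<le> T"
 shows "\<exists>C. test_function T S C tf tfz tfzz tfq tft"
proof -
 define \<rho> where "\<rho> = (R / c1) powr (1 / p)"
 have \<rho>: "0 \<le> \<rho>" by (simp add: \<rho>_def)
 have K0: "0 \<le> K" using K by simp
 have far: "tf z q t i = tf z' q t i" "tfz z q t i = tfz z' q t i" "tfzz z q t i = tfzz z' q t i"
   "tfq z q t i = tfq z' q t i" "tft z q t i = tft z' q t i"
  if "i \<in> S" "\<rho> \<le> norm z" "\<rho> \<le> norm z'" "t \<in> {0..T}" for i z z' q t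
  using that by (simp_all add: \<rho>_def tf_far)
 have late: "tf z q t i = tf z K t i" "tfz z q t i = tfz z K t i" "tfzz z q t i = tfzz z K t i"
   "tfq z q t i = tfq z K t i" "tft z q t i = tft z K t i" if "K \<le> q" for i z q t
  using tf_support[OF that, of z t i] tf_support[of K z t i] by simp_all
 note clip1 = uniformly_continuous_clip[OF tf_continuous(1) K0 T \<rho> far(1) late(1)]
  and clip2 = uniformly_continuous_clip[OF tf_continuous(2) K0 T \<rho> far(2) late(2)]
  and clip3 = uniformly_continuous_clip[OF tf_continuous(3) K0 T \<rho> far(3) late(3)]
  and clip4 = uniformly_continuous_clip[OF tf_continuous(4) K0 T \<rho> far(4) late(4)]
  and clip5 = uniformly_continuous_clip[OF tf_continuous(5) K0 T \<rho> far(5) late(5)]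
 have "\<exists>C\<ge>0. \<forall>z q t. 0 \<le> q --> t \<in> {0..T} -->
   \<bar>tf z q t i\<bar> \<le> C \<and> norm (tfz z q t i) \<le> C \<and> norm (tfzz z q t i) \<le> C \<and> \<bar>tfq z q t i\<bar> \<le> C \<and> \<bar>tft z q t i\<bar> \<le> C"
  if i: "i \<in> S" for i
 proof -
  obtain C1 where C1: "0 \<le> C1" "!!z q t. 0 \<le> q ==> t \<in> {0..T} ==> norm (tf z q t i) \<le> C1" using clip1(2)[OF i i] by blast
  obtain C2 where C2: "0 \<le> C2" "!!z q t. 0 \<le> q ==> t \<in> {0..T} ==> norm (tfz z q t i) \<le> C2" using clip2(2)[OF i i] by blast
  obtain C3 where C3: "0 \<le> C3" "!!z q t. 0 \<le> q ==> t \<in> {0..T} ==> norm (tfzz z q t i) \<le> C3" using clip3(2)[OF i i] by blast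
  obtain C4 where C4: "0 \<le> C4" "!!z q t. 0 \<le> q ==> t \<in> {0..T} ==> norm (tfq z q t i) \<le> C4" using clip4(2)[OF i i] by blast
  obtain C5 where C5: "0 \<le> C5" "!!z q t. 0 \<le> q ==> t \<in> {0..T} ==> norm (tft z q t i) \<le> C5" using clip5(2)[OF i i] by blast
  show ?thesis
  proof (intro exI[of _ "C1 + C2 + C3 + C4 + C5"] conjI allI impI)
   fix z :: "real^'d" and q t :: real assume qt: "0 \<le> q" "t \<in> {0..T}"
   note b = C1(2)[OF qt, of z] C2(2)[OF qt, of z] C3(2)[OF qt, of z] C4(2)[OF qt, of z] C5(2)[OF qt, of z]
   note nn = C1(1) C2(1) C3(1) C4(1) C5(1)
   show "\<bar>tf z q t i\<bar> \<le> C1 + C2 + C3 + C4 + C5" using b(1) nn by (simp only: real_norm_def)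
   show "norm (tfz z q t i) \<le> C1 + C2 + C3 + C4 + C5" using b(2) nn by linarith
   show "norm (tfzz z q t i) \<le> C1 + C2 + C3 + C4 + C5" using b(3) nn by linarith
   show "\<bar>tfq z q t i\<bar> \<le> C1 + C2 + C3 + C4 + C5" using b(4) nn by (simp only: real_norm_def)
   show "\<bar>tft z q t i\<bar> \<le> C1 + C2 + C3 + C4 + C5" using b(5) nn by (simp only: real_norm_def)
  qed (use C1(1) C2(1) C3(1) C4(1) C5(1) in linarith)
 qed
 then obtain Cf where Cf: "!!i. i \<in> S ==> 0 \<le> Cf i" "!!i z q t. i \<in> S ==> 0 \<le> q ==> t \<in> {0..T} ==>
   \<bar>tf z q t i\<bar> \<le> Cf i \<and> norm (tfz z q t i) \<le> Cf i \<and> norm (tfzz z q t i) \<le> Cf i \<and> \<bar>tfq z q t i\<bar> \<le> Cf i \<and> \<bar>tft z q t i\<bar> \<le> Cf i"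
  by metis
 define C where "C = (\<Sum>i\<in>S. Cf i)"
 have CfC: "Cf i \<le> C" if "i \<in> S" for i unfolding C_def by (rule member_le_sum) (use that Cf(1) in auto)
 have "test_function T S C tf tfz tfzz tfq tft"
 proof
  show "0 \<le> T" by (rule T)
  show "finite S" by simp
  show "0 \<le> C" unfolding C_def by (intro sum_nonneg Cf(1))
 next
  fix z :: "real^'d" and q t :: real and i assume *: "i \<in> S" "0 \<le> q" "t \<in> {0..T}"
  show "\<bar>tf z q t i\<bar> \<le> C \<and> norm (tfz z q t i) \<le> C \<and> norm (tfzz z q t i) \<le> C \<and> \<bar>tfq z q t i\<bar> \<le> C \<and> \<bar>tft z q t i\<bar> \<le> C"
   using Cf(2)[OF *, of z] CfC[OF *(1)] by (meson order.trans)
 next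
  fix i assume i: "i \<in> S"
  show "uniformly_continuous_on (UNIV \<times> {0..} \<times> {0..T}) (\<lambda>(z, q, t). tf z q t i)" by (rule clip1(1)[OF i i])
  show "uniformly_continuous_on (UNIV \<times> {0..} \<times> {0..T}) (\<lambda>(z, q, t). tfz z q t i)" by (rule clip2(1)[OF i i])
  show "uniformly_continuous_on (UNIV \<times> {0..} \<times> {0..T}) (\<lambda>(z, q, t). tfzz z q t i)" by (rule clip3(1)[OF i i])
  show "uniformly_continuous_on (UNIV \<times> {0..} \<times> {0..T}) (\<lambda>(z, q, t). tfq z q t i)" by (rule clip4(1)[OF i i])
  show "uniformly_continuous_on (UNIV \<times> {0..} \<times> {0..T}) (\<lambda>(z, q, t). tft z q t i)" by (rule clip5(1)[OF i i])
 next
  fix i and z x :: "real^'d" and q t s :: real assume *: "i \<in> S" "0 \<le> q" "t \<in> {0..T}"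
  then have t: "0 \<le> t" by simp
  let ?y = "\<lambda>s. z + s *\<^sub>R x"
  note dV = V_deriv_z[OF *(1) t, of z x s]
  have dw: "((\<lambda>s. lyap (?y s) t i) has_real_derivative exp (lam * t) * (V_x V (?y s) t i \<bullet> x)) (at s)"
   unfolding lyap_def by (rule DERIV_cmult[OF dV])
  note d0 = DERIV_chain2[OF cap_deriv[OF R] dw] and d1 = DERIV_chain2[OF cap1_deriv[OF R] dw]
  show "((\<lambda>s. tf (?y s) q t i) has_real_derivative tfz (?y s) q t i \<bullet> x) (at s)"
   unfolding tf_def tfz_def by (rule DERIV_cong[OF DERIV_cmult[OF d0]]) simp
  have "((\<lambda>s. cap1 K q * exp (lam * t) * (cap1 R (lyap (?y s) t i) * (V_x V (?y s) t i \<bullet> x))) has_real_derivative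
    cap1 K q * exp (lam * t) * (cap2 R (lyap (?y s) t i) * (exp (lam * t) * (V_x V (?y s) t i \<bullet> x)) * (V_x V (?y s) t i \<bullet> x)
     + x \<bullet> (V_xx V (?y s) t i *v x) * cap1 R (lyap (?y s) t i))) (at s)"
   by (rule DERIV_cmult[OF DERIV_mult[OF d1 V_deriv_zz[OF *(1) t, of z x s]]])
  moreover have "x \<bullet> (tfzz (?y s) q t i *v x) = cap1 K q * exp (lam * t) * (cap2 R (lyap (?y s) t i) * (exp (lam * t) * (V_x V (?y s) t i \<bullet> x)) * (V_x V (?y s) t i \<bullet> x)
     + x \<bullet> (V_xx V (?y s) t i *v x) * cap1 R (lyap (?y s) t i))"
   unfolding tfzz_def matrix_vector_mult_add_rdistrib scaleR_matrix_vector_assoc[symmetric] outer_mult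
   by (simp add: inner_add_right inner_commute power2_eq_square algebra_simps)
  ultimately show "((\<lambda>s. tfz (?y s) q t i \<bullet> x) has_real_derivative x \<bullet> (tfzz (?y s) q t i *v x)) (at s)"
   unfolding tfz_def by (simp add: mult_ac)
 next
  fix i and z :: "real^'d" and q t :: real assume *: "i \<in> S" "0 \<le> q" "t \<in> {0..T}"
  show "((\<lambda>q. tf z q t i) has_real_derivative tfq z q t i) (at q within {0..})"
   unfolding tf_def tfq_def by (rule DERIV_cmult_right[OF has_field_derivative_at_within[OF cap1_deriv[OF K]]])
  have e: "((\<lambda>t. exp (lam * t)) has_real_derivative lam * exp (lam * t)) (at t within {0..})"
   by (auto intro!: derivative_eq_intros)
  have "((\<lambda>t. lyap z t i) has_real_derivative exp (lam * t) * (lam * V z t i + V_t V z t i)) (at t within {0..})"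
   unfolding lyap_def
   by (rule DERIV_cong[OF DERIV_mult[OF e V_deriv_t[OF *(1)]]]) (use *(3) in \<open>auto simp: algebra_simps\<close>)
  from DERIV_cmult[OF DERIV_chain2[OF cap_deriv[OF R] this], of "cap1 K q"]
  show "((\<lambda>t. tf z q t i) has_real_derivative tft z q t i) (at t within {0..})"
   unfolding tf_def tft_def by (simp add: mult.assoc)
 qed
 then show ?thesis by blast
qed

text \<open>Since rows sum to zero, only differences between states matter; off-diagonal rates are
  nonnegative, so the tangent inequality of the cap may be applied to each jump.\<close>

lemma switch_concave:
 assumes i: "i \<in> S" and t: "0 \<le> t"
 shows "(\<Sum>j\<in>S. \<Gamma> i j * cap R (lyap z t j)) \<le> cap1 R (lyap z t i) * (\<Sum>j\<in>S. \<Gamma> i j * lyap z t j)"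
proof -
 have split: "(\<Sum>j\<in>S. \<Gamma> i j * u j) = (\<Sum>j\<in>S - {i}. \<Gamma> i j * (u j - u i))" for u :: "int => real"
 proof -
  have "(\<Sum>j\<in>S. \<Gamma> i j * u j) = \<Gamma> i i * u i + (\<Sum>j\<in>S - {i}. \<Gamma> i j * u j)"
   using i by (intro sum.remove) auto
  also have "\<Gamma> i i = - (\<Sum>j\<in>S - {i}. \<Gamma> i j)" using gen i by (simp add: generator_def)
  finally show ?thesis by (simp add: right_diff_distrib sum_subtractf sum_distrib_right)
 qed
 have "(\<Sum>j\<in>S. \<Gamma> i j * cap R (lyap z t j)) = (\<Sum>j\<in>S - {i}. \<Gamma> i j * (cap R (lyap z t j) - cap R (lyap z t i)))" by (rule split)
 also have "... \<le> (\<Sum>j\<in>S - {i}. \<Gamma> i j * (cap1 R (lyap z t i) * (lyap z t j - lyap z t i)))"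
 proof (rule sum_mono)
  fix j assume j: "j \<in> S - {i}"
  have "0 \<le> \<Gamma> i j" using gen i j by (auto simp: generator_def)
  then show "\<Gamma> i j * (cap R (lyap z t j) - cap R (lyap z t i)) \<le> \<Gamma> i j * (cap1 R (lyap z t i) * (lyap z t j - lyap z t i))"
   using cap_tangent[OF R, of "lyap z t j" "lyap z t i"] by (intro mult_left_mono) auto
 qed
 also have "... = cap1 R (lyap z t i) * (\<Sum>j\<in>S - {i}. \<Gamma> i j * (lyap z t j - lyap z t i))" by (simp add: sum_distrib_left mult_ac)
 also have "(\<Sum>j\<in>S - {i}. \<Gamma> i j * (lyap z t j - lyap z t i)) = (\<Sum>j\<in>S. \<Gamma> i j * lyap z t j)" by (rule split[symmetric])
 finally show ?thesis .
qed

text \<open>The term with \<open>tfq\<close> is nonpositive because the cutoff decreases, the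
  rank-one part of the Hessian because the cap is concave, and the switching part is handled by
  \<open>switch_concave\<close>. What remains is \<open>cap1 K q * cap1 R\<close> times the
  generator of \<open>exp (lam * t) * V\<close>; the derivative of the exponential cancels
  \<open>- lam\<close>, and \<open>cap1_mult_le\<close> absorbs the term with
  \<open>h\<close>.\<close>

lemma drift:
 fixes G :: "real^'m^'d"
 assumes i: "i \<in> S" and t: "0 \<le> t" and q: "0 \<le> q" and n: "0 \<le> n" and g: "0 \<le> g" and h: "0 \<le> h"
  and L: "V_t V z t i + V_x V z t i \<bullet> b + 1/2 * quad_trace (V_xx V z t i) G + (\<Sum>j\<in>S. \<Gamma> i j * V z t j) \<le> g + (h - lam) * V z t i"
 shows "tfz z q t i \<bullet> b + 1/2 * quad_trace (tfzz z q t i) G + tft z q t i + tfq z q t i * n + (\<Sum>j\<in>S. \<Gamma> i j * tf z q t j)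
  \<le> cap1 K q * (exp (lam * t) * g + h * cap R (lyap z t i))"
proof -
 let ?w = "lyap z t i" and ?e = "exp (lam * t)"
 have k: "0 \<le> cap1 K q" and r: "0 \<le> cap1 R ?w" "cap1 R ?w \<le> 1"
  using cap1_bounds[OF K q] cap1_bounds[OF R lyap_nonneg[OF t i]] by auto
 have 1: "tfq z q t i * n \<le> 0"
  unfolding tfq_def using cap2_nonpos[OF K, of q] cap_bounds[OF R lyap_nonneg[OF t i, of z]] n
  by (intro mult_nonpos_nonneg) auto
 have "cap2 R ?w * ?e^2 * quad_trace (outer (V_x V z t i)) G \<le> 0"
  using mult_nonpos_nonneg[OF mult_nonpos_nonneg[OF cap2_nonpos[OF R] zero_le_power2] quad_trace_outer_nonneg] .
 then have "cap1 K q * (1/2 * (cap2 R ?w * ?e^2 * quad_trace (outer (V_x V z t i)) G)) \<le> 0" by (intro mult_nonneg_nonpos[OF k]) simp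
 then have 2: "1/2 * quad_trace (tfzz z q t i) G \<le> cap1 K q * (cap1 R ?w * (?e * (1/2 * quad_trace (V_xx V z t i) G)))"
  unfolding tfzz_def quad_trace_add quad_trace_scale by (simp add: algebra_simps)
 have "(\<Sum>j\<in>S. \<Gamma> i j * tf z q t j) = cap1 K q * (\<Sum>j\<in>S. \<Gamma> i j * cap R (lyap z t j))"
  by (simp add: tf_def sum_distrib_left mult_ac)
 also have "... \<le> cap1 K q * (cap1 R ?w * (\<Sum>j\<in>S. \<Gamma> i j * lyap z t j))" by (intro mult_left_mono switch_concave i t k)
 also have "(\<Sum>j\<in>S. \<Gamma> i j * lyap z t j) = ?e * (\<Sum>j\<in>S. \<Gamma> i j * V z t j)" by (simp add: lyap_def sum_distrib_left mult_ac)
 finally have 3: "(\<Sum>j\<in>S. \<Gamma> i j * tf z q t j) \<le> cap1 K q * (cap1 R ?w * (?e * (\<Sum>j\<in>S. \<Gamma> i j * V z t j)))" .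
 have 4: "tfz z q t i \<bullet> b = cap1 K q * (cap1 R ?w * (?e * (V_x V z t i \<bullet> b)))" by (simp add: tfz_def mult.assoc)
 have 5: "tft z q t i = cap1 K q * (cap1 R ?w * (?e * (lam * V z t i + V_t V z t i)))" by (simp add: tft_def mult.assoc)
 let ?L = "V_t V z t i + V_x V z t i \<bullet> b + 1/2 * quad_trace (V_xx V z t i) G + (\<Sum>j\<in>S. \<Gamma> i j * V z t j)"
 have "tfz z q t i \<bullet> b + 1/2 * quad_trace (tfzz z q t i) G + tft z q t i + tfq z q t i * n + (\<Sum>j\<in>S. \<Gamma> i j * tf z q t j)
  \<le> cap1 K q * (cap1 R ?w * (?e * (V_x V z t i \<bullet> b))) + cap1 K q * (cap1 R ?w * (?e * (1/2 * quad_trace (V_xx V z t i) G)))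
   + cap1 K q * (cap1 R ?w * (?e * (lam * V z t i + V_t V z t i))) + cap1 K q * (cap1 R ?w * (?e * (\<Sum>j\<in>S. \<Gamma> i j * V z t j)))"
  using 1 2 3 4 5 by linarith
 also have "... = cap1 K q * (cap1 R ?w * (?e * (lam * V z t i + ?L)))" by (simp only: distrib_left[symmetric]) (simp add: algebra_simps)
 also have "... \<le> cap1 K q * (cap1 R ?w * (?e * (g + h * V z t i)))"
  using L k r by (intro mult_left_mono) (auto simp: algebra_simps)
 also have "cap1 R ?w * (?e * (g + h * V z t i)) = cap1 R ?w * (?e * g) + h * (cap1 R ?w * ?w)" by (simp add: lyap_def algebra_simps)
 also have "cap1 K q * ... \<le> cap1 K q * (?e * g + h * cap R ?w)"
  using k r g h cap1_mult_le[OF R, of ?w] by (intro mult_left_mono add_mono) (auto intro: mult_left_le_one_le)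
 finally show ?thesis .
qed

end

end

section \<open>Integral and delay inequalities\<close>

text \<open>Only boundedness of \<open>m\<close> is known, not continuity. On a block where
  \<open>\<psi>\<close> has mass at most \<open>\<delta> < 1\<close>, the supremum \<open>X\<close>
  of \<open>m\<close> satisfies \<open>X \<le> m u + a u z + \<delta> * X\<close>, which costs a
  factor \<open>1 / (1 - \<delta>)\<close>. Cutting the total mass \<open>P t\<close> into
  \<open>n\<close> equal blocks gives the power \<open>(1 - P t / n) ^ n\<close> in the denominator,
  which tends to the exponential.\<close>

lemma gronwall_integrable:
 fixes m \<psi> :: "real => real" and a :: "real => real => real"
 assumes st: "s \<le> t" and \<psi>: "set_integrable lborel {s..t} \<psi>" "!!v. 0 \<le> \<psi> v"
  and a: "!!u v. 0 \<le> a u v" "!!u v z. s \<le> u ==> u \<le> v ==> v \<le> z ==> z \<le> t ==> a u v + a v z = a u z"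
  and m: "!!v. 0 \<le> m v" "!!v. v \<in> {s..t} ==> m v \<le> B"
  and step: "!!u v. s \<le> u ==> u \<le> v ==> v \<le> t ==> m v \<le> m u + a u v + (LINT r:{u..v}|lborel. \<psi> r * m r)"
 shows "m t \<le> exp (LINT r:{s..t}|lborel. \<psi> r) * (m s + a s t)"
proof -
 define P where "P v = (LINT r:{s..v}|lborel. \<psi> r)" for v
 have sub: "set_integrable lborel {u..v} \<psi>" if "s \<le> u" "v \<le> t" for u v
  by (rule set_integrable_subset[OF \<psi>(1)]) (use that in auto)
 have P_nonneg: "0 \<le> (LINT r:{u..v}|lborel. \<psi> r)" for u v
  unfolding set_lebesgue_integral_def using \<psi>(2) by (intro Bochner_Integration.integral_nonneg) auto
 have P_split: "P v = P u + (LINT r:{u..v}|lborel. \<psi> r)" if "s \<le> u" "u \<le> v" "v \<le> t" for u v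
  unfolding P_def by (rule set_integral_Icc_split) (use that sub in auto)
 have P_cont: "continuous_on {s..t} P"
 proof (rule continuous_on_eq)
  show "continuous_on {s..t} (\<lambda>v. integral {s..v} \<psi>)"
   by (rule indefinite_integral_continuous_1[OF set_borel_integral_eq_integral(1)[OF \<psi>(1)]])
  show "integral {s..v} \<psi> = P v" if "v \<in> {s..t}" for v
   unfolding P_def by (rule set_borel_integral_eq_integral(2)[symmetric]) (use that sub in auto)
 qed
 have Ps: "P s = 0"
 proof -
  have "AE r in lborel. r \<noteq> s" by (rule AE_lborel_singleton)
  then show ?thesis unfolding P_def set_lebesgue_integral_def by (intro integral_eq_zero_AE) auto
 qed
 have piece: "m z \<le> (m u + a u z) / (1 - \<delta>)"
  if uw: "s \<le> u" "u \<le> z" "z \<le> t" and \<delta>: "(LINT r:{u..z}|lborel. \<psi> r) \<le> \<delta>" "\<delta> < 1" for u z \<delta>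
 proof -
  define X where "X = Sup (m ` {u..z})"
  have bdd: "bdd_above (m ` {u..z})" by (rule bdd_aboveI[of _ B]) (use m(2) uw in auto)
  have mX: "m v \<le> X" if "v \<in> {u..z}" for v unfolding X_def by (rule cSup_upper) (use that bdd in auto)
  have X0: "0 \<le> X" using m(1)[of z] mX[of z] uw by simp
  have "m v \<le> m u + a u z + \<delta> * X" if v: "v \<in> {u..z}" for v
  proof -
   \<comment> \<open>Integrability of the majorant is enough here: if the left integrand is not
     integrable its integral is 0 by convention, and the majorant is nonnegative.\<close>
   have "(LINT r:{u..v}|lborel. \<psi> r * m r) \<le> (LINT r|lborel. X * (indicator {u..z} r *\<^sub>R \<psi> r))"
    unfolding set_lebesgue_integral_def
   proof (rule integral_mono')
    show "integrable lborel (\<lambda>r. X * (indicator {u..z} r *\<^sub>R \<psi> r))"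
     using sub[OF uw(1,3)] by (auto simp: set_integrable_def)
    fix r
    show "0 \<le> X * (indicator {u..z} r *\<^sub>R \<psi> r)" using X0 \<psi>(2) by simp
    show "indicator {u..v} r *\<^sub>R (\<psi> r * m r) \<le> X * (indicator {u..z} r *\<^sub>R \<psi> r)"
    proof (cases "r \<in> {u..v}")
     case True
     then have r: "r \<in> {u..z}" using v by auto
     have "\<psi> r * m r \<le> \<psi> r * X" using mX[OF r] \<psi>(2) by (intro mult_left_mono) auto
     then show ?thesis using True r by (simp add: mult.commute)
    next
     case False
     then show ?thesis using X0 \<psi>(2) by simp
    qed
   qed
   also have "... = X * (LINT r:{u..z}|lborel. \<psi> r)" by (simp add: set_lebesgue_integral_def)
   also have "... \<le> X * \<delta>" using X0 \<delta>(1) by (intro mult_left_mono)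
   finally have "(LINT r:{u..v}|lborel. \<psi> r * m r) \<le> \<delta> * X" by (simp add: mult.commute)
   moreover have "a u v \<le> a u z" using a(1)[of v z] a(2)[of u v z] uw v by auto
   ultimately show ?thesis using step[of u v] uw v by auto
  qed
  then have "X \<le> m u + a u z + \<delta> * X" unfolding X_def by (intro cSup_least) (use uw in auto)
  then have "X \<le> (m u + a u z) / (1 - \<delta>)" using \<delta>(2) by (simp add: field_simps)
  then show ?thesis using mX[of z] uw by simp
 qed
 have iter: "m v \<le> (1 / (1 - \<delta>)) ^ k * (m s + a s v)"
  if "s \<le> v" "v \<le> t" "P v \<le> real k * \<delta>" "0 < \<delta>" "\<delta> < 1" for v k \<delta>
  using that(1-3)
 proof (induction k arbitrary: v)
  case 0
  have "(LINT r:{s..v}|lborel. \<psi> r) \<le> 0" using 0(3) by (simp add: P_def)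
  from piece[OF order.refl 0(1,2) this] show ?case by simp
 next
  case (Suc k)
  have d1: "1 \<le> 1 / (1 - \<delta>)" using \<open>0 < \<delta>\<close> \<open>\<delta> < 1\<close> by (simp add: field_simps)
  show ?case
  proof (cases "P v \<le> real k * \<delta>")
   case True
   have "m v \<le> (1 / (1 - \<delta>)) ^ k * (m s + a s v)" by (rule Suc.IH[OF Suc.prems(1,2) True])
   also have "... \<le> (1 / (1 - \<delta>)) ^ Suc k * (m s + a s v)"
    using d1 a(1) m(1) by (intro mult_right_mono power_increasing) (auto intro: add_nonneg_nonneg)
   finally show ?thesis .
  next
   case False
   have "continuous_on {s..v} P" by (rule continuous_on_subset[OF P_cont]) (use Suc.prems in auto)
   \<comment> \<open>The accumulated mass \<open>P\<close> is continuous, so by the intermediate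
     value theorem a last block of mass at most \<open>\<delta>\<close> can be split off.\<close>
   then obtain u where u: "s \<le> u" "u \<le> v" "P u = real k * \<delta>"
    using IVT'[of P s "real k * \<delta>" v] False Suc.prems(1) \<open>0 < \<delta>\<close> Ps by auto
   have "(LINT r:{u..v}|lborel. \<psi> r) \<le> \<delta>"
    using P_split[OF u(1,2) Suc.prems(2)] Suc.prems(3) u(3) by (simp add: algebra_simps)
   from piece[OF u(1,2) Suc.prems(2) this \<open>\<delta> < 1\<close>]
   have "m v \<le> (1 / (1 - \<delta>)) * (m u + a u v)" by simp
   also have "... \<le> (1 / (1 - \<delta>)) * ((1 / (1 - \<delta>)) ^ k * (m s + a s u) + (1 / (1 - \<delta>)) ^ k * a u v)"
   proof (intro mult_left_mono add_mono)
    show "m u \<le> (1 / (1 - \<delta>)) ^ k * (m s + a s u)" by (rule Suc.IH) (use u Suc.prems in auto)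
    have "1 \<le> (1 / (1 - \<delta>)) ^ k" by (rule one_le_power[OF d1])
    then show "a u v \<le> (1 / (1 - \<delta>)) ^ k * a u v" using a(1)[of u v] by (simp add: mult_le_cancel_right1)
   qed (use \<open>\<delta> < 1\<close> in simp)
   also have "... = (1 / (1 - \<delta>)) ^ Suc k * (m s + (a s u + a u v))" by (simp add: algebra_simps add_divide_distrib)
   also have "a s u + a u v = a s v" by (rule a(2)) (use u Suc.prems in auto)
   finally show ?thesis .
  qed
 qed
 show ?thesis
 proof (cases "P t = 0")
  case True
  then show ?thesis using piece[OF order.refl st order.refl, of 0] by (simp add: P_def)
 next
  case False
  then have Pt: "0 < P t" using P_nonneg[of s t] by (simp add: P_def)
  have "(\<lambda>n. (1 + (- P t) / real n) ^ n) \<longlonglongrightarrow> exp (- P t)" by (rule tendsto_exp_limit_sequentially)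
  then have "(\<lambda>n. inverse ((1 + (- P t) / real n) ^ n) * (m s + a s t)) \<longlonglongrightarrow> inverse (exp (- P t)) * (m s + a s t)"
   by (intro tendsto_intros) auto
  moreover have "\<forall>\<^sub>F n in sequentially. m t \<le> inverse ((1 + (- P t) / real n) ^ n) * (m s + a s t)"
   using eventually_gt_at_top[of "nat \<lceil>P t\<rceil>"]
  proof eventually_elim
   case (elim n)
   have "P t \<le> real (nat \<lceil>P t\<rceil>)" by (rule real_nat_ceiling_ge)
   then have n: "P t < real n" "0 < real n" using elim Pt by linarith+
   have "m t \<le> (1 / (1 - P t / real n)) ^ n * (m s + a s t)"
    by (rule iter[OF st order.refl]) (use n Pt in auto)
   then show ?case by (simp add: power_one_over divide_inverse power_inverse)
  qed
  ultimately have "m t \<le> inverse (exp (- P t)) * (m s + a s t)"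
   by (intro tendsto_lowerbound[of _ _ sequentially]) auto
  then show ?thesis by (simp add: exp_minus P_def)
 qed
qed

text \<open>Induction over delay intervals. A shift by \<open>\<tau>\<close> multiplies the
  exponential by \<open>exp (\<mu> * \<tau>)\<close>, so the bound
  \<open>C * exp (- \<mu> * t)\<close> reproduces itself if \<open>c + q * C \<le> C\<close>. Values
  are extended nonnegative, since finiteness of the moments of \<open>X\<close> is a result of the
  induction.\<close>

lemma delay_decay:
 fixes x :: "real => ennreal"
 assumes \<tau>: "0 < \<tau>" and \<beta>: "0 < \<beta>" "\<beta> * exp (\<mu> * \<tau>) < 1" and \<mu>: "0 \<le> \<mu>" and c: "0 \<le> c" and K: "0 \<le> K"
  and init: "!!t. -\<tau> \<le> t ==> t \<le> 0 ==> x t \<le> ennreal K"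
  and step: "!!t. 0 \<le> t ==> x t \<le> ennreal (c * exp (- \<mu> * t)) + ennreal \<beta> * x (t - \<tau>)"
 shows "\<exists>C>0. \<forall>t\<ge>0. x t \<le> ennreal (C * exp (- \<mu> * t))"
proof -
 define q where "q = \<beta> * exp (\<mu> * \<tau>)"
 \<comment> \<open>The first summand covers the initial interval, the second is the fixed point of
   the recursion, and the third makes \<open>C\<close> positive for the logarithm later.\<close>
 define C where "C = K + c / (1 - q) + 1"
 have q: "0 < q" "q < 1" using \<beta> by (auto simp: q_def)
 have C: "0 < C" "K \<le> C" "c + q * C \<le> C"
 proof -
  have "0 \<le> c / (1 - q)" using c q by simp
  then show "0 < C" "K \<le> C" using K by (auto simp: C_def)
  have "c = (1 - q) * (c / (1 - q))" using q by simp
  also have "... \<le> (1 - q) * C" using q K by (intro mult_left_mono) (auto simp: C_def)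
  finally show "c + q * C \<le> C" by (simp add: algebra_simps)
 qed
 have "x t \<le> ennreal (C * exp (- \<mu> * t))" if "-\<tau> \<le> t" "t \<le> real n * \<tau>" for n t
  using that
 proof (induction n arbitrary: t)
  case 0
  then have "x t \<le> ennreal K" by (intro init) auto
  also have "... \<le> ennreal (C * exp (- \<mu> * t))"
  proof (rule ennreal_leI)
   have "0 \<le> - \<mu> * t" using \<mu> 0 by (simp add: mult_nonneg_nonpos)
   then have "1 \<le> exp (- \<mu> * t)" by simp
   then have "C * 1 \<le> C * exp (- \<mu> * t)" using C(1) by (intro mult_left_mono) auto
   then show "K \<le> C * exp (- \<mu> * t)" using C(2) by simp
  qed
  finally show ?case .
 next
  case (Suc n)
  show ?case
  proof (cases "t \<le> real n * \<tau>")
   case True then show ?thesis using Suc by auto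
  next
   case False
   then have t: "0 \<le> t" using \<tau> by (meson linear mult_nonneg_nonneg of_nat_0_le_iff order.trans less_imp_le)
   have IH: "x (t - \<tau>) \<le> ennreal (C * exp (- \<mu> * (t - \<tau>)))"
    by (rule Suc.IH) (use t Suc.prems in \<open>auto simp: algebra_simps\<close>)
   have "x t \<le> ennreal (c * exp (- \<mu> * t)) + ennreal \<beta> * x (t - \<tau>)" by (rule step[OF t])
   also have "... \<le> ennreal (c * exp (- \<mu> * t)) + ennreal \<beta> * ennreal (C * exp (- \<mu> * (t - \<tau>)))"
    by (intro add_left_mono mult_left_mono IH) auto
   also have "... = ennreal (c * exp (- \<mu> * t) + \<beta> * (C * exp (- \<mu> * (t - \<tau>))))"
    using c C(1) \<beta>(1) by (simp add: ennreal_mult[symmetric] ennreal_plus[symmetric] del: ennreal_plus)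
   also have "c * exp (- \<mu> * t) + \<beta> * (C * exp (- \<mu> * (t - \<tau>))) = (c + q * C) * exp (- \<mu> * t)"
    by (simp add: q_def algebra_simps exp_add[symmetric])
   also have "ennreal ... \<le> ennreal (C * exp (- \<mu> * t))" by (intro ennreal_leI mult_right_mono C(3)) simp
   finally show ?thesis .
  qed
 qed
 moreover have "\<exists>n. t \<le> real n * \<tau>" for t using reals_Archimedean3[OF \<tau>] by (meson less_imp_le)
 ultimately have "x t \<le> ennreal (C * exp (- \<mu> * t))" if "0 \<le> t" for t
  using that \<tau> by (meson le_minus_iff less_imp_le neg_le_0_iff_le order.trans)
 then show ?thesis using C(1) by blast
qed

lemma delay_rate_exists:
 assumes "0 < \<tau>" "0 < \<beta>" "\<beta> < 1" "0 < l"
 shows "\<exists>\<mu>>0. \<mu> \<le> l \<and> \<beta> * exp (\<mu> * \<tau>) < (1::real)"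
proof -
 \<comment> \<open>With half of the critical rate \<open>- ln \<beta> / \<tau>\<close>, the product
   \<open>\<beta> * exp (\<mu> * \<tau>)\<close> is at most the square root of
   \<open>\<beta>\<close>.\<close>
 define \<mu> where "\<mu> = min l (- ln \<beta> / (2 * \<tau>))"
 have lb: "ln \<beta> < 0" using assms by simp
 then have "0 < \<mu>" using assms by (auto simp: \<mu>_def divide_neg_pos)
 have "\<mu> * \<tau> \<le> - ln \<beta> / (2 * \<tau>) * \<tau>" using assms by (intro mult_right_mono) (auto simp: \<mu>_def)
 also have "... = - ln \<beta> / 2" using assms by simp
 finally have "exp (\<mu> * \<tau>) < exp (- ln \<beta>)" using lb by simp
 also have "... = 1 / \<beta>" using assms by (simp add: exp_minus divide_inverse)
 finally have "\<beta> * exp (\<mu> * \<tau>) < 1" using assms by (simp add: field_simps)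
 with \<open>0 < \<mu>\<close> show ?thesis by (intro exI[of _ \<mu>]) (auto simp: \<mu>_def)
qed

lemma Limsup_elog_le:
 fixes x :: "real => ennreal"
 assumes C: "0 < C" and x: "!!t. 0 \<le> t ==> x t \<le> ennreal (C * exp (- \<mu> * t))"
 shows "Limsup at_top (\<lambda>t. elog (x t) / ereal t) \<le> ereal (- \<mu>)"
proof -
 have "elog (x t) / ereal t \<le> ereal (ln C / t - \<mu>)" if t: "0 < t" for t
 proof (cases "x t = 0")
  case True
  then show ?thesis using t by (simp add: elog_def)
 next
  case False
  have le: "x t \<le> ennreal (C * exp (- \<mu> * t))" using x[of t] t by simp
  then have fin: "x t < \<infinity>" by (rule le_less_trans) simp
  then obtain y where y: "x t = ennreal y" "0 \<le> y" by (cases "x t") auto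
  then have "0 < y" using False by (cases "y = 0") auto
  have "y \<le> C * exp (- \<mu> * t)" using le y C by simp
  then have "ln y \<le> ln (C * exp (- \<mu> * t))" using \<open>0 < y\<close> by (simp add: C)
  also have "... = ln C - \<mu> * t" using C by (simp add: ln_mult)
  finally have "ln y / t \<le> (ln C - \<mu> * t) / t" using t by (intro divide_right_mono) auto
  also have "... = ln C / t - \<mu>" using t by (simp add: diff_divide_distrib)
  finally show ?thesis using False fin y t by (simp add: elog_def)
 qed
 then have "Limsup at_top (\<lambda>t. elog (x t) / ereal t) \<le> Limsup at_top (\<lambda>t. ereal (ln C / t - \<mu>))"
  by (intro Limsup_mono) (auto intro: eventually_mono[OF eventually_gt_at_top[of 0]])
 also have "((\<lambda>t. ereal (ln C / t - \<mu>)) \<longlongrightarrow> ereal (- \<mu>)) at_top"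
  unfolding lim_ereal by real_asymp
 then have "Limsup at_top (\<lambda>t. ereal (ln C / t - \<mu>)) = ereal (- \<mu>)"
  by (intro lim_imp_Limsup) auto
 finally show ?thesis .
qed

text \<open>Convexity of the power for the combination of \<open>a / (1 - \<beta>)\<close> and
  \<open>b\<close> with weights \<open>1 - \<beta>\<close> and \<open>\<beta>\<close>. The point is
  that the coefficient of the delayed term remains \<open>\<beta>\<close>, so the recursion for
  moments contracts.\<close>

lemma convex_powr_split:
 fixes a b \<beta> p :: real
 assumes p: "1 \<le> p" and \<beta>: "0 < \<beta>" "\<beta> < 1" and ab: "0 \<le> a" "0 \<le> b"
 shows "(a + \<beta> * b) powr p \<le> (1 - \<beta>) powr (1 - p) * a powr p + \<beta> * b powr p"
proof (cases "a = 0 \<or> b = 0")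
 case True
 then show ?thesis
 proof
  assume "a = 0"
  have "\<beta> powr p \<le> \<beta> powr 1" using p \<beta> by (intro powr_mono') auto
  then have "\<beta> powr p * b powr p \<le> \<beta> * b powr p" using \<beta> by (intro mult_right_mono) auto
  then show ?thesis using \<open>a = 0\<close> ab \<beta> by (simp add: powr_mult)
 next
  assume "b = 0"
  have "(1 - \<beta>) powr 0 \<le> (1 - \<beta>) powr (1 - p)" using p \<beta> by (intro powr_mono') auto
  then have "1 * a powr p \<le> (1 - \<beta>) powr (1 - p) * a powr p" using \<beta> by (intro mult_right_mono) auto
  then show ?thesis using \<open>b = 0\<close> by simp
 qed
next
 case False
 have "((1 - \<beta>) *\<^sub>R (a / (1 - \<beta>)) + \<beta> *\<^sub>R b) powr p \<le> (1 - \<beta>) * (a / (1 - \<beta>)) powr p + \<beta> * b powr p"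
  by (rule convex_onD[OF powr_convex[OF p]]) (use \<beta> ab False in auto)
 moreover have "(1 - \<beta>) * (a / (1 - \<beta>)) powr p = (1 - \<beta>) powr (1 - p) * a powr p"
  using \<beta> ab by (simp add: powr_divide powr_diff)
 ultimately show ?thesis using \<beta> by simp
qed

section \<open>The Lyapunov function along the process\<close>

lemma (in prob_space) expectation_weighted_time_integral:
 fixes g :: "real => 'a => real" and h :: "real => real"
 assumes gm: "(\<lambda>x. g (fst x) (snd x)) \<in> borel_measurable (borel \<Otimes>\<^sub>M M)"
  and h: "set_integrable lborel {v..y} h"
  and bd: "!!u w. w \<in> space M ==> \<bar>g u w\<bar> \<le> K"
 shows "integrable M (\<lambda>w. LINT u:{v..y}|lborel. h u * g u w)"
  and "(LINT w|M. (LINT u:{v..y}|lborel. h u * g u w)) = (LINT u:{v..y}|lborel. h u * (LINT w|M. g u w))"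
proof -
 interpret P: pair_sigma_finite lborel M ..
 let ?h = "\<lambda>u. indicator {v..y} u *\<^sub>R h u"
 let ?f = "\<lambda>u w. ?h u * g u w"
 have gm': "(\<lambda>x. g (fst x) (snd x)) \<in> borel_measurable (lborel \<Otimes>\<^sub>M M)"
  using gm by (simp add: measurable_cong_sets[OF sets_pair_measure_cong[OF sets_lborel refl] refl])
 have hi: "integrable lborel ?h" using h by (simp add: set_integrable_def)
 have hm: "?h \<in> borel_measurable lborel" using hi by (rule borel_measurable_integrable)
 have gu[measurable]: "g u \<in> borel_measurable M" for u
 proof -
  have "(\<lambda>w. (u, w)) \<in> measurable M (borel \<Otimes>\<^sub>M M)" by measurable
  from measurable_compose[OF this gm] show ?thesis by simp
 qed
 have gi: "integrable M (g u)" for u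
  by (rule integrable_const_bound[of _ K]) (use bd in auto)
 have fm[measurable]: "(\<lambda>x. ?f (fst x) (snd x)) \<in> borel_measurable (lborel \<Otimes>\<^sub>M M)"
  by (intro borel_measurable_times gm' measurable_compose[OF measurable_fst hm])
 have int: "integrable (lborel \<Otimes>\<^sub>M M) (\<lambda>x. ?f (fst x) (snd x))"
 proof (rule P.Fubini_integrable[OF fm])
  show "AE u in lborel. integrable M (\<lambda>w. ?f (fst (u, w)) (snd (u, w)))"
   by (rule AE_I2) (use gi in simp)
  show "integrable lborel (\<lambda>u. \<integral>w. norm (?f (fst (u, w)) (snd (u, w))) \<partial>M)"
  proof (rule Bochner_Integration.integrable_bound[OF integrable_mult_left[OF hi, of K]])
   show "(\<lambda>u. \<integral>w. norm (?f (fst (u, w)) (snd (u, w))) \<partial>M) \<in> borel_measurable lborel"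
    using measurable_compose[OF fm borel_measurable_norm]
    by (intro borel_measurable_lebesgue_integral) (simp add: case_prod_beta')
   show "AE u in lborel. norm (LINT w|M. norm (?f (fst (u, w)) (snd (u, w)))) \<le> norm (?h u * K)"
   proof (rule AE_I2)
    fix u
    have "(LINT w|M. norm (?f u w)) \<le> (LINT w|M. \<bar>?h u\<bar> * \<bar>K\<bar>)"
    proof (rule integral_mono')
     fix w assume w: "w \<in> space M"
     have "\<bar>g u w\<bar> \<le> \<bar>K\<bar>" using bd[OF w, of u] by linarith
     then show "norm (?f u w) \<le> \<bar>?h u\<bar> * \<bar>K\<bar>" unfolding real_norm_def abs_mult by (intro mult_left_mono) auto
    qed auto
    also have "... = norm (?h u * K)" by (simp add: abs_mult prob_space)
    finally show "norm (LINT w|M. norm (?f (fst (u, w)) (snd (u, w)))) \<le> norm (?h u * K)"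
     by simp
   qed
  qed
 qed
 have int': "integrable (lborel \<Otimes>\<^sub>M M) (case_prod ?f)" using int by (simp add: case_prod_beta')
 have e: "(\<lambda>w. LINT u:{v..y}|lborel. h u * g u w) = (\<lambda>w. LINT u|lborel. ?f u w)"
  by (simp add: set_lebesgue_integral_def mult.assoc)
 show "integrable M (\<lambda>w. LINT u:{v..y}|lborel. h u * g u w)"
  unfolding e by (rule P.integrable_snd[OF int'])
 have "(LINT w|M. (LINT u|lborel. ?f u w)) = (LINT u|lborel. (LINT w|M. ?f u w))"
  by (rule P.Fubini_integral[OF int'])
 also have "... = (LINT u:{v..y}|lborel. h u * (LINT w|M. g u w))"
  by (simp add: set_lebesgue_integral_def mult.assoc)
 finally show "(LINT w|M. (LINT u:{v..y}|lborel. h u * g u w)) = (LINT u:{v..y}|lborel. h u * (LINT w|M. g u w))"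
  unfolding e .
qed

text \<open>\<open>a\<close> stands for \<open>exp (lam * t) * \<gamma> t\<close>. The functions
  \<open>a\<close> and \<open>\<psi>\<close> will be Borel versions of the given ones, which is why
  the generator inequality is asked at almost every time only.\<close>

locale lyapunov_process = ito_process M F B N \<Gamma> r b \<sigma> Zp nn uu etaeta + ly: lyapunov N \<Gamma> V lam c1 p
 for M :: "'w measure" and F and B :: "real => 'w => real^'m" and N \<Gamma> r
  and b :: "real => 'w => real^'d" and \<sigma> Zp nn uu etaeta and V :: "real^'d => real => int => real" and lam c1 p +
 fixes a \<psi> :: "real => real"
 assumes a_nonneg: "!!t. 0 \<le> a t" and \<psi>_nonneg: "!!t. 0 \<le> \<psi> t"
  and a_int: "set_integrable lborel {0..} a" and \<psi>_int: "set_integrable lborel {0..} \<psi>"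
  and generator_le: "AE v in lborel. 0 \<le> v --> (\<forall>w\<in>space M.
    V_t V (Zp v w) v (r v w) + V_x V (Zp v w) v (r v w) \<bullet> b v w + 1/2 * quad_trace (V_xx V (Zp v w) v (r v w)) (\<sigma> v w)
     + (\<Sum>j\<in>{1..int N}. \<Gamma> (r v w) j * V (Zp v w) v j)
    \<le> exp (- lam * v) * a v + (\<psi> v - lam) * V (Zp v w) v (r v w))"
begin

definition wp :: "real => 'w => real" where "wp v w = ly.lyap (Zp v w) v (r v w)"

lemma wp_nonneg: "0 \<le> v ==> w \<in> space M ==> 0 \<le> wp v w"
 unfolding wp_def by (rule ly.lyap_nonneg[OF _ r_in_S])

lemma cap_wp_prog:
 assumes R: "0 < R" and T: "0 \<le> T"
 shows "prog T (\<lambda>v w. cap R (wp v w))"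
proof -
 obtain C where "test_function T {1..int N} C (ly.tf R 1) (ly.tfz R 1) (ly.tfzz R 1) (ly.tfq R 1) (ly.tft R 1)"
  using ly.test_function_exists[OF R zero_less_one T] by blast
 then interpret tf: test_function T "{1..int N}" C "ly.tf R 1" "ly.tfz R 1" "ly.tfzz R 1" "ly.tfq R 1" "ly.tft R 1" .
 interpret st: switching_test M F B N \<Gamma> r T C "ly.tf R 1" "ly.tfz R 1" "ly.tfzz R 1" "ly.tfq R 1" "ly.tft R 1" ..
 \<comment> \<open>At \<open>q = 0\<close> the cutoff has value 1, so the test function there is the
   capped Lyapunov function, and its measurability is that of test functions.\<close>
 have "(\<lambda>x. ly.tf R 1 (Zp (clip T (fst x)) (snd x)) ((\<lambda>_. 0) x) (clip T (fst x)) (r (clip T (fst x)) (snd x))) \<in> borel_measurable (borel \<Otimes>\<^sub>M F T)"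
 proof (rule st.test_measurable(1))
  show "(\<lambda>x. Zp (clip T (fst x)) (snd x)) \<in> borel_measurable (borel \<Otimes>\<^sub>M F T)" using Zp_prog[OF T] by (simp add: prog_def)
  show "(\<lambda>x. r (clip T (fst x)) (snd x)) \<in> borel \<Otimes>\<^sub>M F T \<rightarrow>\<^sub>M count_space UNIV" by (rule r_joint[OF T])
  show "(\<lambda>x::real \<times> 'w. clip T (fst x)) \<in> borel_measurable (borel \<Otimes>\<^sub>M F T)" by measurable
  fix x assume "x \<in> space (borel \<Otimes>\<^sub>M F T :: (real \<times> 'w) measure)"
  then have x: "snd x \<in> space M" using space_F[OF T] by (simp add: space_pair_measure mem_Times_iff)
  show c: "clip T (fst x) \<in> {0..T}" by (rule clip_in[OF T])
  show "r (clip T (fst x)) (snd x) \<in> {1..int N}" by (rule r_in_S[OF x]) (use c in auto)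
 qed auto
 then show ?thesis by (simp add: prog_def ly.tf_def[OF R] wp_def cap1_def)
qed

lemma cap_wp_meas:
 assumes R: "0 < R" and v: "0 \<le> v"
 shows "(\<lambda>w. cap R (wp v w)) \<in> borel_measurable (F v)"
proof -
 have "(\<lambda>w. (v, w)) \<in> measurable (F v) (borel \<Otimes>\<^sub>M F v)" by measurable
 from measurable_compose[OF this cap_wp_prog[OF R v, unfolded prog_def]] show ?thesis
  using v by (simp add: clip_eq)
qed

lemma wp_meas:
 assumes v: "0 \<le> v"
 shows "wp v \<in> borel_measurable (F v)"
proof (rule borel_measurable_LIMSEQ_real)
 show "(\<lambda>n. cap (real (Suc n)) (wp v w)) \<longlonglongrightarrow> wp v w" if "w \<in> space (F v)" for w
  by (rule cap_tendsto) (use wp_nonneg[OF v] that space_F[OF v] in auto)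
 show "(\<lambda>w. cap (real (Suc n)) (wp v w)) \<in> borel_measurable (F v)" for n by (rule cap_wp_meas[OF _ v]) simp
qed

lemma a_int_Icc: "0 \<le> s ==> set_integrable lborel {s..t} a"
 by (rule set_integrable_subset[OF a_int]) auto

lemma \<psi>_int_Icc: "0 \<le> s ==> set_integrable lborel {s..t} \<psi>"
 by (rule set_integrable_subset[OF \<psi>_int]) auto

text \<open>Ito's formula with cutoff level \<open>n + 1\<close>, whose drift is at most
  \<open>a v + \<psi> v * cap R (wp v w)\<close>. At the earlier time and in the drift the cutoff is
  bounded by 1; at the later time it tends to 1 as \<open>n\<close> grows, with majorant
  \<open>R / 3\<close>. Fubini then moves the expectation inside the integral against
  \<open>\<psi>\<close>.\<close>

lemma capped_step:
 assumes R: "0 < R" and st: "0 \<le> s" "s \<le> t" and A: "A \<in> sets (F s)"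
 shows "(LINT w|M. indicator A w * cap R (wp t w)) \<le> (LINT w|M. indicator A w * cap R (wp s w))
  + measure M A * (LINT v:{s..t}|lborel. a v) + (LINT v:{s..t}|lborel. \<psi> v * (LINT w|M. indicator A w * cap R (wp v w)))"
proof -
 have AM: "A \<in> sets M" using A sets_F_M[OF st(1)] by auto
 have t0: "0 \<le> t" using st by simp
 let ?c = "\<lambda>v w. cap R (wp v w)"
 have cb: "0 \<le> ?c v w \<and> ?c v w \<le> R / 3" if "0 \<le> v" "w \<in> space M" for v w
  by (rule cap_bounds[OF R wp_nonneg[OF that]])
 have cm: "?c v \<in> borel_measurable M" if "0 \<le> v" for v by (rule measurable_F_M[OF that cap_wp_meas[OF R that]])
 have ci: "integrable M (\<lambda>w. indicator A w * ?c v w)" if "0 \<le> v" for v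
 proof (rule integrable_const_bound[of _ "R / 3"])
  show "AE w in M. norm (indicator A w * ?c v w) \<le> R / 3"
   using cb[OF that] R by (intro AE_I2) (auto simp: indicator_def)
  show "(\<lambda>w. indicator A w * ?c v w) \<in> borel_measurable M"
   by (intro borel_measurable_times borel_measurable_indicator AM cm that)
 qed
 let ?g = "\<lambda>u w. indicator A w * ?c (clip t u) w"
 have gm: "(\<lambda>x. ?g (fst x) (snd x)) \<in> borel_measurable (borel \<Otimes>\<^sub>M M)"
  by (intro borel_measurable_times joint_F_M[OF t0 cap_wp_prog[OF R t0, unfolded prog_def]]
    measurable_compose[OF measurable_snd borel_measurable_indicator[OF AM]])
 have gb: "\<bar>?g u w\<bar> \<le> R / 3" if "w \<in> space M" for u w
  using cb[OF _ that, of "clip t u"] clip_in[OF t0, of u] R by (auto simp: indicator_def)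
 note Fub = expectation_weighted_time_integral[OF gm \<psi>_int_Icc[OF st(1)] gb]
 have clip_st: "clip t u = u" if "u \<in> {s..t}" for u by (rule clip_eq) (use that st in auto)
 let ?I = "\<lambda>w. indicator A w * (LINT v:{s..t}|lborel. a v) + (LINT v:{s..t}|lborel. \<psi> v * ?g v w)"
 have Ii: "integrable M ?I"
 proof (rule Bochner_Integration.integrable_add)
  show "integrable M (\<lambda>w. indicator A w * (LINT v:{s..t}|lborel. a v))"
   using AM by (intro integrable_mult_left integrable_real_indicator) (auto simp: emeasure_eq_measure)
  show "integrable M (\<lambda>w. LINT v:{s..t}|lborel. \<psi> v * ?g v w)" by (rule Fub(1))
 qed
 have Ie: "(LINT w|M. ?I w) = measure M A * (LINT v:{s..t}|lborel. a v) + (LINT v:{s..t}|lborel. \<psi> v * (LINT w|M. indicator A w * ?c v w))"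
 proof -
  have "(LINT w|M. ?I w) = (LINT w|M. indicator A w * (LINT v:{s..t}|lborel. a v)) + (LINT w|M. (LINT v:{s..t}|lborel. \<psi> v * ?g v w))"
   using AM by (intro Bochner_Integration.integral_add integrable_mult_left integrable_real_indicator Fub(1)) (auto simp: emeasure_eq_measure)
  also have "(LINT w|M. indicator A w * (LINT v:{s..t}|lborel. a v)) = measure M A * (LINT v:{s..t}|lborel. a v)"
   using AM sets.sets_into_space[OF AM] by (simp add: Int_absorb1)
  also note Fub(2)
  also have "(LINT v:{s..t}|lborel. \<psi> v * (LINT w|M. ?g v w)) = (LINT v:{s..t}|lborel. \<psi> v * (LINT w|M. indicator A w * ?c v w))"
   by (rule set_lebesgue_integral_cong) (auto simp: clip_st)
  finally show ?thesis .
 qed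
 have bound: "(LINT w|M. indicator A w * (cap1 (real (Suc n)) (Qp t w) * ?c t w)) \<le> (LINT w|M. indicator A w * ?c s w) + (LINT w|M. ?I w)"
  and meas: "(\<lambda>w. cap1 (real (Suc n)) (Qp t w) * ?c t w) \<in> borel_measurable M" for n
 proof -
  let ?K = "real (Suc n)"
  have K: "0 < ?K" "0 \<le> ?K" by auto
  obtain C where "test_function t {1..int N} C (ly.tf R ?K) (ly.tfz R ?K) (ly.tfzz R ?K) (ly.tfq R ?K) (ly.tft R ?K)"
   using ly.test_function_exists[OF R K(1) t0] by blast
  then interpret tf: test_function t "{1..int N}" C "ly.tf R ?K" "ly.tfz R ?K" "ly.tfzz R ?K" "ly.tfq R ?K" "ly.tft R ?K" .
  interpret il: ito_limit M F B N \<Gamma> r b \<sigma> Zp nn uu etaeta t C "ly.tf R ?K" "ly.tfz R ?K" "ly.tfzz R ?K" "ly.tfq R ?K" "ly.tft R ?K" ?K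
  proof
   show "0 \<le> ?K" by (rule K(2))
   show "ly.tf R ?K z q t i = 0 \<and> ly.tfz R ?K z q t i = 0 \<and> ly.tfzz R ?K z q t i = 0 \<and> ly.tfq R ?K z q t i = 0 \<and> ly.tft R ?K z q t i = 0"
    if "?K \<le> q" for z q t i by (rule ly.tf_support[OF R K(1) that])
  qed
  have Phi: "il.Phip v w = cap1 ?K (Qp v w) * ?c v w" for v w
   unfolding il.Phip_def ly.tf_def[OF R K(1)] wp_def ..
  have sT: "s \<in> {0..t}" "t \<in> {0..t}" using st by auto
  show "(\<lambda>w. cap1 ?K (Qp t w) * ?c t w) \<in> borel_measurable M"
   using il.Phip_meas[OF sT(2)] unfolding Phi[abs_def] .
  have Pi: "integrable M (\<lambda>w. indicator A w * il.Phip v w)" if "v \<in> {0..t}" for v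
  proof (rule integrable_const_bound[of _ C])
   show "AE w in M. norm (indicator A w * il.Phip v w) \<le> C"
    using il.Phip_bound[OF _ that] tf.C_nonneg by (intro AE_I2) (auto simp: indicator_def)
   show "(\<lambda>w. indicator A w * il.Phip v w) \<in> borel_measurable M"
    by (intro borel_measurable_times borel_measurable_indicator AM il.Phip_meas that)
  qed
  have k1: "0 \<le> cap1 ?K (Qp v w)" "cap1 ?K (Qp v w) \<le> 1" for v w
   using cap1_bounds[OF K(1) il.Qp_nonneg[of v w]] by auto
  have "(LINT w|M. indicator A w * il.Phip t w) - (LINT w|M. indicator A w * il.Phip s w) = (LINT w|M. indicator A w * (il.Phip t w - il.Phip s w))"
   using Pi[OF sT(1)] Pi[OF sT(2)] by (simp add: right_diff_distrib)
  also have "... = (LINT w|M. indicator A w * (LINT v:{s..t}|lborel. il.Hp v w))"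
   by (rule il.ito_formula(1)[OF st order.refl A])
  also have "... \<le> (LINT w|M. ?I w)"
  proof (rule integral_mono_AE)
   show "integrable M (\<lambda>w. indicator A w * (LINT v:{s..t}|lborel. il.Hp v w))"
   proof (rule integrable_const_bound[of _ "il.C1 * (t + ?K)"])
    have nn: "0 \<le> il.C1 * (t + ?K)" using il.C1_nonneg t0 by simp
    show "AE w in M. norm (indicator A w * (LINT v:{s..t}|lborel. il.Hp v w)) \<le> il.C1 * (t + ?K)"
     using il.ito_formula(2)[OF st order.refl A]
    proof eventually_elim
     case (elim w)
     then show ?case using nn by (cases "w \<in> A") auto
    qed
    show "(\<lambda>w. indicator A w * (LINT v:{s..t}|lborel. il.Hp v w)) \<in> borel_measurable M"
     by (intro borel_measurable_times borel_measurable_indicator AM measurable_F_M[OF t0] prog_integral_Icc[OF il.Hp_prog])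
      (use st in auto)
   qed
   show "integrable M ?I" by (rule Ii)
   show "AE w in M. indicator A w * (LINT v:{s..t}|lborel. il.Hp v w) \<le> ?I w"
    using il.Hp_integrable AE_space
   proof eventually_elim
    case (elim w)
    then have w: "w \<in> space M" by simp
    have Hi: "set_integrable lborel {s..t} (\<lambda>v. il.Hp v w)"
     by (rule set_integrable_subset[OF elim(1)]) (use st in auto)
    show ?case
    proof (cases "w \<in> A")
     case True
     have ge: "?g v w = cap R (wp (clip t v) w)" for v using True by simp
     have pc: "set_integrable lborel {s..t} (\<lambda>v. \<psi> v * cap R (wp v w))"
     proof (rule set_integrable_bound[OF set_integrable_mult_left[OF \<psi>_int_Icc[OF st(1)], of t "R / 3"]])
      have "(\<lambda>v. indicator {0..t} v *\<^sub>R cap R (wp v w)) \<in> borel_measurable lborel"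
       using prog_set_measurable[OF cap_wp_prog[OF R t0] w t0] by (simp add: set_borel_measurable_def)
      moreover have "(\<lambda>v. indicator {s..t} v *\<^sub>R \<psi> v) \<in> borel_measurable lborel"
       using \<psi>_int_Icc[OF st(1), of t] unfolding set_integrable_def by (rule borel_measurable_integrable)
      ultimately have "(\<lambda>v. (indicator {s..t} v *\<^sub>R \<psi> v) * (indicator {0..t} v *\<^sub>R cap R (wp v w))) \<in> borel_measurable lborel"
       by (intro borel_measurable_times)
      also have "(\<lambda>v. (indicator {s..t} v *\<^sub>R \<psi> v) * (indicator {0..t} v *\<^sub>R cap R (wp v w))) = (\<lambda>v. indicator {s..t} v *\<^sub>R (\<psi> v * cap R (wp v w)))"
       using st by (auto simp: fun_eq_iff indicator_def)
      finally show "set_borel_measurable lborel {s..t} (\<lambda>v. \<psi> v * cap R (wp v w))" by (simp add: set_borel_measurable_def)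
      show "AE v in lborel. v \<in> {s..t} --> norm (\<psi> v * cap R (wp v w)) \<le> norm (\<psi> v * (R / 3))"
      proof (intro AE_I2 impI)
       fix v assume "v \<in> {s..t}"
       then have "0 \<le> v" using st by auto
       from cb[OF this w] have "\<psi> v * cap R (wp v w) \<le> \<psi> v * (R / 3)" "0 \<le> \<psi> v * cap R (wp v w)"
        using \<psi>_nonneg[of v] mult_left_mono[of "cap R (wp v w)" "R / 3" "\<psi> v"] mult_nonneg_nonneg[of "\<psi> v" "cap R (wp v w)"]
        by blast+
       then show "norm (\<psi> v * cap R (wp v w)) \<le> norm (\<psi> v * (R / 3))" by simp
      qed
     qed
     have "(LINT v:{s..t}|lborel. il.Hp v w) \<le> (LINT v:{s..t}|lborel. a v + \<psi> v * cap R (wp v w))"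
     proof (rule set_integral_mono_AE)
      show "set_integrable lborel {s..t} (\<lambda>v. il.Hp v w)" by (rule Hi)
      show "set_integrable lborel {s..t} (\<lambda>v. a v + \<psi> v * cap R (wp v w))" by (intro set_integral_add(1) a_int_Icc st pc)
      show "AE v\<in>{s..t} in lborel. il.Hp v w \<le> a v + \<psi> v * cap R (wp v w)"
       using generator_le
      proof eventually_elim
       case (elim v)
       show ?case
       proof
        assume "v \<in> {s..t}"
        then have v: "0 \<le> v" using st by auto
        have rS: "r v w \<in> {1..int N}" by (rule r_in_S[OF w v])
        have L: "V_t V (Zp v w) v (r v w) + V_x V (Zp v w) v (r v w) \<bullet> b v w + 1/2 * quad_trace (V_xx V (Zp v w) v (r v w)) (\<sigma> v w)
         + (\<Sum>j\<in>{1..int N}. \<Gamma> (r v w) j * V (Zp v w) v j) \<le> exp (- lam * v) * a v + (\<psi> v - lam) * V (Zp v w) v (r v w)"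
         using elim v w by blast
        have "il.Hp v w \<le> cap1 ?K (Qp v w) * (exp (lam * v) * (exp (- lam * v) * a v) + \<psi> v * cap R (ly.lyap (Zp v w) v (r v w)))"
         unfolding il.Hp_def il.H_def
         by (rule ly.drift[OF R K(1) rS v il.Qp_nonneg _ _ \<psi>_nonneg L]) (use a_nonneg in auto)
        also have "exp (lam * v) * (exp (- lam * v) * a v) = a v"
         by (simp add: mult.assoc[symmetric] exp_add[symmetric])
        also have "cap1 ?K (Qp v w) * (a v + \<psi> v * cap R (ly.lyap (Zp v w) v (r v w))) \<le> a v + \<psi> v * cap R (wp v w)"
         unfolding wp_def[symmetric] using k1 a_nonneg \<psi>_nonneg cb[OF v w]
         by (intro mult_left_le_one_le add_nonneg_nonneg mult_nonneg_nonneg) auto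
        finally show "il.Hp v w \<le> a v + \<psi> v * cap R (wp v w)" .
       qed
      qed
     qed
     also have "... = (LINT v:{s..t}|lborel. a v) + (LINT v:{s..t}|lborel. \<psi> v * cap R (wp v w))"
      by (rule set_integral_add(2)[OF a_int_Icc[OF st(1)] pc])
     also have "(LINT v:{s..t}|lborel. \<psi> v * cap R (wp v w)) = (LINT v:{s..t}|lborel. \<psi> v * ?g v w)"
      by (rule set_lebesgue_integral_cong) (auto simp: clip_st True)
     finally show ?thesis using True by simp
    next
     case False
     then show ?thesis by (simp add: set_lebesgue_integral_def)
    qed
   qed
  qed
  finally have "(LINT w|M. indicator A w * il.Phip t w) \<le> (LINT w|M. indicator A w * il.Phip s w) + (LINT w|M. ?I w)" by simp
  also have "(LINT w|M. indicator A w * il.Phip s w) \<le> (LINT w|M. indicator A w * ?c s w)"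
  proof (rule integral_mono[OF Pi[OF sT(1)] ci[OF st(1)]])
   fix w assume "w \<in> space M"
   then show "indicator A w * il.Phip s w \<le> indicator A w * ?c s w"
    unfolding Phi using k1[of s w] cb[OF st(1)] by (intro mult_left_mono mult_left_le_one_le) auto
  qed
  finally show "(LINT w|M. indicator A w * (cap1 ?K (Qp t w) * ?c t w)) \<le> (LINT w|M. indicator A w * ?c s w) + (LINT w|M. ?I w)"
   unfolding Phi by simp
 qed
 have "(\<lambda>n. \<integral>w. indicator A w * (cap1 (real (Suc n)) (Qp t w) * ?c t w) \<partial>M) \<longlonglongrightarrow> (LINT w|M. indicator A w * ?c t w)"
 proof (rule integral_dominated_convergence[where w = "\<lambda>_. R / 3"])
  show "(\<lambda>w. indicator A w * ?c t w) \<in> borel_measurable M" using ci[OF t0] by (rule borel_measurable_integrable)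
  show "(\<lambda>w. indicator A w * (cap1 (real (Suc n)) (Qp t w) * ?c t w)) \<in> borel_measurable M" for n
   by (intro borel_measurable_times[OF borel_measurable_indicator[OF AM]] meas)
  show "integrable M (\<lambda>_. R / 3)" by simp
  have lim: "(\<lambda>n. q / real (Suc n)) \<longlonglongrightarrow> 0" for q :: real by real_asymp
  show "AE w in M. (\<lambda>n. indicator A w * (cap1 (real (Suc n)) (Qp t w) * ?c t w)) \<longlonglongrightarrow> indicator A w * ?c t w"
  proof (rule AE_I2)
   fix w
   have "(\<lambda>n. cap1 (real (Suc n)) (Qp t w)) \<longlonglongrightarrow> (max 0 (1 - 0))^2"
    unfolding cap1_def by (intro tendsto_intros tendsto_max lim)
   then have "(\<lambda>n. indicator A w * (cap1 (real (Suc n)) (Qp t w) * ?c t w)) \<longlonglongrightarrow> indicator A w * (1 * ?c t w)"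
    by (intro tendsto_intros) simp
   then show "(\<lambda>n. indicator A w * (cap1 (real (Suc n)) (Qp t w) * ?c t w)) \<longlonglongrightarrow> indicator A w * ?c t w" by simp
  qed
  show "AE w in M. norm (indicator A w * (cap1 (real (Suc n)) (Qp t w) * ?c t w)) \<le> R / 3" for n
  proof (rule AE_I2)
   fix w assume w: "w \<in> space M"
   have Q0: "0 \<le> Qp t w" unfolding Qp_def set_lebesgue_integral_def
    by (rule Bochner_Integration.integral_nonneg) (auto simp: spd_def)
   have k: "0 \<le> cap1 (real (Suc n)) (Qp t w)" "cap1 (real (Suc n)) (Qp t w) \<le> 1"
    using cap1_bounds[OF _ Q0, of "real (Suc n)"] by auto
   have "cap1 (real (Suc n)) (Qp t w) * ?c t w \<le> ?c t w" using k cb[OF t0 w] by (intro mult_left_le_one_le) auto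
   then have "\<bar>cap1 (real (Suc n)) (Qp t w) * ?c t w\<bar> \<le> R / 3" using cb[OF t0 w] k by (simp add: abs_mult)
   then show "norm (indicator A w * (cap1 (real (Suc n)) (Qp t w) * ?c t w)) \<le> R / 3"
    using R by (cases "w \<in> A") auto
  qed
 qed
 then have "(LINT w|M. indicator A w * ?c t w) \<le> (LINT w|M. indicator A w * ?c s w) + (LINT w|M. ?I w)"
  by (rule LIMSEQ_le_const2) (use bound in blast)
 then show ?thesis unfolding Ie by simp
qed

text \<open>For each cap \<open>R\<close> the expectation over \<open>A\<close> is bounded and
  satisfies the integral inequality of \<open>capped_step\<close>, so Gronwall applies; Fatou's
  lemma removes the cap. Nonnegative integrals are used because finiteness is not known in
  advance.\<close>

theorem growth_estimate:
 assumes st: "0 \<le> s" "s \<le> t" and A: "A \<in> sets (F s)"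
 shows "(\<integral>\<^sup>+w\<in>A. ennreal (wp t w) \<partial>M) \<le> ennreal (exp (LINT v:{s..t}|lborel. \<psi> v)) *
  ((\<integral>\<^sup>+w\<in>A. ennreal (wp s w) \<partial>M) + emeasure M A * ennreal (LINT v:{s..t}|lborel. a v))"
proof -
 have AM: "A \<in> sets M" using A sets_F_M[OF st(1)] by auto
 have t0: "0 \<le> t" using st by simp
 let ?E = "exp (LINT v:{s..t}|lborel. \<psi> v)"
 let ?R = "\<lambda>n. real (Suc n)"
 let ?RHS = "ennreal ?E * ((\<integral>\<^sup>+w\<in>A. ennreal (wp s w) \<partial>M) + emeasure M A * ennreal (LINT v:{s..t}|lborel. a v))"
 have cm: "(\<lambda>w. cap R (wp v w)) \<in> borel_measurable M" if "0 < R" "0 \<le> v" for R v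
  by (rule measurable_F_M[OF that(2) cap_wp_meas[OF that]])
 have cb: "0 \<le> cap R (wp v w) \<and> cap R (wp v w) \<le> R / 3" if "0 < R" "0 \<le> v" "w \<in> space M" for R v w
  by (rule cap_bounds[OF that(1) wp_nonneg[OF that(2,3)]])
 have a_nn: "0 \<le> (LINT v:{u..y}|lborel. a v)" for u y
  unfolding set_lebesgue_integral_def using a_nonneg by (intro Bochner_Integration.integral_nonneg) auto
 have est: "(\<integral>\<^sup>+w. ennreal (indicator A w * cap (?R n) (wp t w)) \<partial>M) \<le> ?RHS" for n
 proof -
  have R: "0 < ?R n" by simp
  \<comment> \<open>The Gronwall lemma wants a function that is nonnegative at all real times,
    whence the extension by \<open>max 0 v\<close>.\<close>
  let ?m = "\<lambda>v. \<integral>w. indicator A w * cap (?R n) (wp (max 0 v) w) \<partial>M"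
  have ci: "integrable M (\<lambda>w. indicator A w * cap (?R n) (wp v w))" if "0 \<le> v" for v
  proof (rule integrable_const_bound[of _ "?R n / 3"])
   show "AE w in M. norm (indicator A w * cap (?R n) (wp v w)) \<le> ?R n / 3"
    using cb[OF R that] by (intro AE_I2) (auto simp: indicator_def)
   show "(\<lambda>w. indicator A w * cap (?R n) (wp v w)) \<in> borel_measurable M"
    by (intro borel_measurable_times borel_measurable_indicator AM cm R that)
  qed
  have m_nn: "0 \<le> ?m v" for v
   by (rule Bochner_Integration.integral_nonneg) (use cb[OF R, of "max 0 v"] in auto)
  have nn_eq: "(\<integral>\<^sup>+w. ennreal (indicator A w * cap (?R n) (wp v w)) \<partial>M) = ennreal (?m v)" if "0 \<le> v" for v
   using nn_integral_eq_integral[OF ci[OF that]] cb[OF R that] that by simp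
  have "?m t \<le> ?E * (?m s + measure M A * (LINT v:{s..t}|lborel. a v))"
  proof (rule gronwall_integrable[where a = "\<lambda>u y. measure M A * (LINT v:{u..y}|lborel. a v)" and B = "?R n / 3"])
   show "s \<le> t" by (rule st)
   show "set_integrable lborel {s..t} \<psi>" by (rule \<psi>_int_Icc[OF st(1)])
   show "0 \<le> \<psi> v" for v by (rule \<psi>_nonneg)
   show "0 \<le> measure M A * (LINT v:{u..y}|lborel. a v)" for u y using a_nn by simp
   show "0 \<le> ?m v" for v by (rule m_nn)
   show "?m v \<le> ?R n / 3" if "v \<in> {s..t}" for v
   proof -
    have "?m v \<le> (LINT w|M. ?R n / 3)"
     by (rule integral_mono[OF ci]) (use cb[OF R, of "max 0 v"] in \<open>auto simp: indicator_def\<close>)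
    then show ?thesis by (simp add: prob_space)
   qed
   show "measure M A * (LINT v:{u..v}|lborel. a v) + measure M A * (LINT v:{v..y}|lborel. a v) = measure M A * (LINT v:{u..y}|lborel. a v)"
    if "s \<le> u" "u \<le> v" "v \<le> y" "y \<le> t" for u v y
    using set_integral_Icc_split[OF that(2,3) a_int_Icc] that(1) st(1) by (simp add: distrib_left)
   fix u v assume uv: "s \<le> u" "u \<le> v" "v \<le> t"
   have u0: "0 \<le> u" "0 \<le> v" using uv st by auto
   have AF: "A \<in> sets (F u)" using A sets_F_mono[OF st(1) uv(1)] by auto
   have "?m v \<le> ?m u + measure M A * (LINT r:{u..v}|lborel. a r) + (LINT r:{u..v}|lborel. \<psi> r * (LINT w|M. indicator A w * cap (?R n) (wp r w)))"
    using capped_step[OF R u0(1) uv(2) AF] u0 by simp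
   also have "(LINT r:{u..v}|lborel. \<psi> r * (LINT w|M. indicator A w * cap (?R n) (wp r w))) = (LINT r:{u..v}|lborel. \<psi> r * ?m r)"
    by (rule set_lebesgue_integral_cong) (use u0 in auto)
   finally show "?m v \<le> ?m u + measure M A * (LINT r:{u..v}|lborel. a r) + (LINT r:{u..v}|lborel. \<psi> r * ?m r)" .
  qed
  then have "ennreal (?m t) \<le> ennreal (?E * (?m s + measure M A * (LINT v:{s..t}|lborel. a v)))" by (rule ennreal_leI)
  also have "... = ennreal ?E * (ennreal (?m s) + emeasure M A * ennreal (LINT v:{s..t}|lborel. a v))"
  proof -
   have "ennreal (e * (m + P * i)) = ennreal e * (ennreal m + ennreal P * ennreal i)" if "0 \<le> e" "0 \<le> m" "0 \<le> P" "0 \<le> i" for e m P i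
    using that by (simp add: ennreal_mult)
   from this[OF exp_ge_zero m_nn measure_nonneg a_nn] show ?thesis unfolding emeasure_eq_measure .
  qed
  also have "... \<le> ?RHS"
  proof (intro mult_left_mono add_right_mono)
   show "ennreal (?m s) \<le> (\<integral>\<^sup>+w\<in>A. ennreal (wp s w) \<partial>M)"
    unfolding nn_eq[OF st(1), symmetric]
    by (intro nn_integral_mono) (auto simp: indicator_def intro!: ennreal_leI cap_le)
  qed auto
  finally show ?thesis unfolding nn_eq[OF t0] .
 qed
 have "(\<integral>\<^sup>+w\<in>A. ennreal (wp t w) \<partial>M) = (\<integral>\<^sup>+w. liminf (\<lambda>n. ennreal (indicator A w * cap (?R n) (wp t w))) \<partial>M)"
 proof (rule nn_integral_cong)
  fix w assume w: "w \<in> space M"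
  have "(\<lambda>n. ennreal (indicator A w * cap (?R n) (wp t w))) \<longlonglongrightarrow> ennreal (indicator A w * wp t w)"
   by (intro tendsto_ennrealI tendsto_intros cap_tendsto wp_nonneg t0 w)
  from lim_imp_Liminf[OF _ this] show "ennreal (wp t w) * indicator A w = liminf (\<lambda>n. ennreal (indicator A w * cap (?R n) (wp t w)))"
   by (simp add: indicator_def)
 qed
 also have "... \<le> liminf (\<lambda>n. \<integral>\<^sup>+w. ennreal (indicator A w * cap (?R n) (wp t w)) \<partial>M)"
  by (rule nn_integral_liminf)
   (intro measurable_compose[OF _ measurable_ennreal] borel_measurable_times borel_measurable_indicator AM cm t0, simp)
 also have "... \<le> ?RHS"
  by (rule order.trans[OF Liminf_le_Limsup[OF sequentially_bot] Limsup_bounded[OF always_eventually]]) (intro allI est)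
 finally show ?thesis .
qed

end

section \<open>Maximal inequality\<close>

text \<open>First-passage argument. The quantity \<open>c\<close> times the probability that the
  level has been reached by step \<open>k\<close>, plus the integral of \<open>U k\<close> where it
  has not, never exceeds the initial mean: the supermartingale step is used on the set not yet
  reached, an event of \<open>G k\<close>, and the paths that reach the level at
  \<open>k + 1\<close> are then split off.\<close>

lemma (in prob_space) maximal_inequality_finite:
 fixes U :: "nat => 'a => ennreal"
 assumes G: "!!k. k \<le> n ==> sets (G k) \<subseteq> sets M" "!!k. k \<le> n ==> space (G k) = space M"
   "!!j k. j \<le> k ==> k \<le> n ==> sets (G j) \<subseteq> sets (G k)"
  and U: "!!k. k \<le> n ==> U k \<in> borel_measurable (G k)"
  and step: "!!k A. k < n ==> A \<in> sets (G k) ==> (\<integral>\<^sup>+w\<in>A. U (Suc k) w \<partial>M) \<le> (\<integral>\<^sup>+w\<in>A. U k w \<partial>M)"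
 shows "c * emeasure M {w \<in> space M. \<exists>k\<le>n. c \<le> U k w} \<le> (\<integral>\<^sup>+w. U 0 w \<partial>M)"
proof -
 let ?B = "\<lambda>k. {w \<in> space M. \<forall>j\<le>k. U j w < c}"
 let ?D = "\<lambda>k. {w \<in> space M. c \<le> U k w}"
 have UG: "U j \<in> borel_measurable (G k)" if "j \<le> k" "k \<le> n" for j k
  by (rule measurable_from_subalg[OF _ U]) (use that G in \<open>auto simp: subalgebra_def\<close>)
 have UM: "U j \<in> borel_measurable M" if "j \<le> n" for j
  by (rule measurable_from_subalg[OF _ U]) (use that G in \<open>auto simp: subalgebra_def\<close>)
 have BG: "?B k \<in> sets (G k)" if "k \<le> n" for k
 proof -
  have "{w \<in> space (G k). \<forall>j\<in>{..k}. U j w < c} \<in> sets (G k)"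
  proof (rule sets.sets_Collect_finite_All)
   fix j assume "j \<in> {..k}"
   then have [measurable]: "U j \<in> borel_measurable (G k)" using that by (intro UG) auto
   show "{w \<in> space (G k). U j w < c} \<in> sets (G k)" by measurable
  qed simp
  moreover have "{w \<in> space (G k). \<forall>j\<in>{..k}. U j w < c} = ?B k" unfolding G(2)[OF that] by auto
  ultimately show ?thesis by (simp only:)
 qed
 have BM: "?B k \<in> sets M" if "k \<le> n" for k using BG[OF that] G(1)[OF that] by blast
 have DM: "?D k \<in> sets M" if "k \<le> n" for k
 proof -
  have [measurable]: "U k \<in> borel_measurable M" by (rule UM[OF that])
  show ?thesis by measurable
 qed
 have "c * emeasure M (space M - ?B k) + (\<integral>\<^sup>+w\<in>?B k. U k w \<partial>M) \<le> (\<integral>\<^sup>+w. U 0 w \<partial>M)" if "k \<le> n" for k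
  using that
 proof (induction k)
  case 0
  have "c * emeasure M (space M - ?B 0) = (\<integral>\<^sup>+w\<in>space M - ?B 0. c \<partial>M)"
   using BM[of 0] by (simp add: nn_integral_cmult_indicator sets.compl_sets)
  also have "... + (\<integral>\<^sup>+w\<in>?B 0. U 0 w \<partial>M) = (\<integral>\<^sup>+w. c * indicator (space M - ?B 0) w + U 0 w * indicator (?B 0) w \<partial>M)"
   using BM[of 0] UM[of 0] by (intro nn_integral_add[symmetric]) auto
  also have "... \<le> (\<integral>\<^sup>+w. U 0 w \<partial>M)"
   by (intro nn_integral_mono) (auto simp: indicator_def)
  finally show ?case .
 next
  case (Suc k)
  let ?E = "?B k \<inter> ?D (Suc k)"
  have EM: "?E \<in> sets M" by (rule sets.Int[OF BM DM]) (use Suc.prems in auto)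
  have sp: "space M - ?B (Suc k) = (space M - ?B k) \<union> ?E" "(space M - ?B k) \<inter> ?E = {}"
   by (auto simp: le_Suc_eq not_less)
  have e: "emeasure M (space M - ?B (Suc k)) = emeasure M (space M - ?B k) + emeasure M ?E"
   unfolding sp(1) by (rule plus_emeasure[symmetric, OF sets.compl_sets[OF BM] EM sp(2)]) (use Suc.prems in simp)
  have "c * emeasure M ?E + (\<integral>\<^sup>+w\<in>?B (Suc k). U (Suc k) w \<partial>M) = (\<integral>\<^sup>+w. c * indicator ?E w \<partial>M) + (\<integral>\<^sup>+w\<in>?B (Suc k). U (Suc k) w \<partial>M)"
   by (simp only: nn_integral_cmult_indicator[OF EM])
  also have "... = (\<integral>\<^sup>+w. c * indicator ?E w + U (Suc k) w * indicator (?B (Suc k)) w \<partial>M)"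
   by (rule nn_integral_add[symmetric])
    (intro borel_measurable_times_ennreal borel_measurable_const borel_measurable_indicator EM BM UM Suc.prems)+
  also have "... \<le> (\<integral>\<^sup>+w\<in>?B k. U (Suc k) w \<partial>M)"
   by (intro nn_integral_mono) (auto simp: indicator_def le_Suc_eq)
  also have "... \<le> (\<integral>\<^sup>+w\<in>?B k. U k w \<partial>M)" by (rule step[OF _ BG]) (use Suc.prems in auto)
  finally have "c * emeasure M (space M - ?B k) + (c * emeasure M ?E + (\<integral>\<^sup>+w\<in>?B (Suc k). U (Suc k) w \<partial>M))
    \<le> c * emeasure M (space M - ?B k) + (\<integral>\<^sup>+w\<in>?B k. U k w \<partial>M)" by (rule add_left_mono)
  also have "... \<le> (\<integral>\<^sup>+w. U 0 w \<partial>M)" by (rule Suc.IH) (use Suc.prems in simp)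
  finally show ?case unfolding e distrib_left add.assoc .
 qed
 from this[OF order.refl] have "c * emeasure M (space M - ?B n) \<le> (\<integral>\<^sup>+w. U 0 w \<partial>M)"
  by (rule order.trans[rotated]) simp
 also have "space M - ?B n = {w \<in> space M. \<exists>k\<le>n. c \<le> U k w}" by (auto simp: not_less)
 finally show ?thesis .
qed

context lyapunov_process
begin

definition Psi :: "real => real" where "Psi t = (LINT v:{0..t}|lborel. \<psi> v)"
definition Atail :: "real => real" where "Atail t = (LINT v:{0..}|lborel. a v) - (LINT v:{0..t}|lborel. a v)"
definition U :: "real => 'w => ennreal" where
 "U t w = ennreal (exp (- Psi t)) * ennreal (wp t w) + ennreal (Atail t)"

lemma Icc_le_half_line:
 fixes h :: "real => real"
 assumes h: "set_integrable lborel {0..} h" "!!t. 0 \<le> h t"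
 shows "(LINT v:{0..t}|lborel. h v) \<le> (LINT v:{0..}|lborel. h v)" "0 \<le> (LINT v:{s..t}|lborel. h v)"
proof -
 show "(LINT v:{0..t}|lborel. h v) \<le> (LINT v:{0..}|lborel. h v)"
  unfolding set_lebesgue_integral_def
  by (rule integral_mono') (use h in \<open>auto simp: set_integrable_def indicator_def\<close>)
 show "0 \<le> (LINT v:{s..t}|lborel. h v)"
  unfolding set_lebesgue_integral_def using h(2) by (intro Bochner_Integration.integral_nonneg) auto
qed

lemma Psi_bounds: "0 \<le> Psi t" "Psi t \<le> (LINT v:{0..}|lborel. \<psi> v)"
 unfolding Psi_def using Icc_le_half_line[OF \<psi>_int \<psi>_nonneg] by auto

lemma Atail_nonneg: "0 \<le> Atail t"
 unfolding Atail_def using Icc_le_half_line[OF a_int a_nonneg] by simp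

lemma U_meas: "0 \<le> t ==> U t \<in> borel_measurable (F t)"
 unfolding U_def[abs_def] using wp_meas[of t] by measurable

text \<open>The factor lost in \<open>growth_estimate\<close> is compensated by
  \<open>exp (- Psi t)\<close>, and the added integral of \<open>a\<close> by the decrease of
  \<open>Atail\<close>; for the latter \<open>exp (- Psi s)\<close> is estimated by 1.\<close>

lemma U_supermartingale:
 assumes st: "0 \<le> s" "s \<le> t" and A: "A \<in> sets (F s)"
 shows "(\<integral>\<^sup>+w\<in>A. U t w \<partial>M) \<le> (\<integral>\<^sup>+w\<in>A. U s w \<partial>M)"
proof -
 have AM[measurable]: "A \<in> sets M" using A sets_F_M[OF st(1)] by auto
 have t0: "0 \<le> t" using st by simp
 let ?I = "LINT v:{s..t}|lborel. a v"
 have I: "0 \<le> ?I" by (rule Icc_le_half_line[OF a_int a_nonneg])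
 have split: "Psi t = Psi s + (LINT v:{s..t}|lborel. \<psi> v)" "Atail s = ?I + Atail t"
  unfolding Psi_def Atail_def
  using set_integral_Icc_split[OF st \<psi>_int_Icc] set_integral_Icc_split[OF st a_int_Icc] by auto
 have UA: "(\<integral>\<^sup>+w\<in>A. U v w \<partial>M) = ennreal (exp (- Psi v)) * (\<integral>\<^sup>+w\<in>A. ennreal (wp v w) \<partial>M) + ennreal (Atail v) * emeasure M A" if v: "0 \<le> v" for v
 proof -
  have [measurable]: "wp v \<in> borel_measurable M" by (rule measurable_F_M[OF v wp_meas[OF v]])
  have "(\<integral>\<^sup>+w\<in>A. U v w \<partial>M) = (\<integral>\<^sup>+w. ennreal (exp (- Psi v)) * (ennreal (wp v w) * indicator A w) + ennreal (Atail v) * indicator A w \<partial>M)"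
   unfolding U_def by (intro nn_integral_cong) (simp add: distrib_right mult.assoc)
  also have "... = (\<integral>\<^sup>+w. ennreal (exp (- Psi v)) * (ennreal (wp v w) * indicator A w) \<partial>M) + (\<integral>\<^sup>+w. ennreal (Atail v) * indicator A w \<partial>M)"
   by (intro nn_integral_add) measurable
  also have "(\<integral>\<^sup>+w. ennreal (exp (- Psi v)) * (ennreal (wp v w) * indicator A w) \<partial>M) = ennreal (exp (- Psi v)) * (\<integral>\<^sup>+w\<in>A. ennreal (wp v w) \<partial>M)"
   by (intro nn_integral_cmult) measurable
  also have "(\<integral>\<^sup>+w. ennreal (Atail v) * indicator A w \<partial>M) = ennreal (Atail v) * emeasure M A"
   using AM by (intro nn_integral_cmult_indicator)
  finally show ?thesis .
 qed
 let ?W = "\<integral>\<^sup>+w\<in>A. ennreal (wp s w) \<partial>M"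
 have "ennreal (exp (- Psi t)) * (\<integral>\<^sup>+w\<in>A. ennreal (wp t w) \<partial>M)
   \<le> ennreal (exp (- Psi t)) * (ennreal (exp (LINT v:{s..t}|lborel. \<psi> v)) * (?W + emeasure M A * ennreal ?I))"
  by (intro mult_left_mono growth_estimate st A) simp
 also have "... = ennreal (exp (- Psi s)) * (?W + emeasure M A * ennreal ?I)"
  unfolding mult.assoc[symmetric] by (simp add: ennreal_mult[symmetric] exp_add[symmetric] split(1))
 also have "... = ennreal (exp (- Psi s)) * ?W + ennreal (exp (- Psi s)) * (emeasure M A * ennreal ?I)"
  by (rule distrib_left)
 also have "... \<le> ennreal (exp (- Psi s)) * ?W + 1 * (emeasure M A * ennreal ?I)"
  using Psi_bounds(1)[of s] by (intro add_left_mono mult_right_mono) (auto simp: ennreal_le_1)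
 finally have 1: "ennreal (exp (- Psi t)) * (\<integral>\<^sup>+w\<in>A. ennreal (wp t w) \<partial>M) \<le> ennreal (exp (- Psi s)) * ?W + emeasure M A * ennreal ?I" by simp
 have "(\<integral>\<^sup>+w\<in>A. U t w \<partial>M) \<le> (ennreal (exp (- Psi s)) * ?W + emeasure M A * ennreal ?I) + ennreal (Atail t) * emeasure M A"
  unfolding UA[OF t0] by (intro add_right_mono 1)
 also have "... = ennreal (exp (- Psi s)) * ?W + ennreal (Atail s) * emeasure M A"
  unfolding split(2) using I Atail_nonneg[of t] by (simp add: distrib_right distrib_left add.assoc mult.commute)
 finally show ?thesis unfolding UA[OF st(1)] .
qed

text \<open>Mesh \<open>1 / 2 ^ n\<close> with \<open>4 ^ n\<close> steps covers times up to
  \<open>2 ^ n\<close>; mesh and horizon improve together, so the sets increase and exhaust all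
  dyadic times.\<close>

definition grid :: "ennreal => nat => 'w set" where
 "grid c n = {w \<in> space M. \<exists>k\<le>4 ^ n. c \<le> U (real k / 2 ^ n) w}"

lemma grid_sets: "grid c n \<in> sets M"
proof -
 have "grid c n = (\<Union>k\<in>{..4 ^ n}. {w \<in> space M. c \<le> U (real k / 2 ^ n) w})" by (auto simp: grid_def)
 also have "... \<in> sets M"
 proof (intro sets.finite_UN)
  fix k :: nat
  have [measurable]: "U (real k / 2 ^ n) \<in> borel_measurable M" by (rule measurable_F_M[OF _ U_meas]) auto
  show "{w \<in> space M. c \<le> U (real k / 2 ^ n) w} \<in> sets M" by measurable
 qed simp
 finally show ?thesis .
qed

lemma grid_bound: "c * emeasure M (grid c n) \<le> (\<integral>\<^sup>+w. U 0 w \<partial>M)"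
proof -
 have "c * emeasure M {w \<in> space M. \<exists>k\<le>4 ^ n. c \<le> U (real k / 2 ^ n) w} \<le> (\<integral>\<^sup>+w. U (real 0 / 2 ^ n) w \<partial>M)"
 proof (rule maximal_inequality_finite[where G = "\<lambda>k. F (real k / 2 ^ n)"])
  show "sets (F (real k / 2 ^ n)) \<subseteq> sets M" for k by (rule sets_F_M) simp
  show "space (F (real k / 2 ^ n)) = space M" for k by (rule space_F) simp
  show "sets (F (real j / 2 ^ n)) \<subseteq> sets (F (real k / 2 ^ n))" if "j \<le> k" for j k
   by (rule sets_F_mono) (use that in \<open>auto simp: divide_right_mono\<close>)
  show "U (real k / 2 ^ n) \<in> borel_measurable (F (real k / 2 ^ n))" for k by (rule U_meas) simp
  show "(\<integral>\<^sup>+w\<in>A. U (real (Suc k) / 2 ^ n) w \<partial>M) \<le> (\<integral>\<^sup>+w\<in>A. U (real k / 2 ^ n) w \<partial>M)"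
   if "A \<in> sets (F (real k / 2 ^ n))" for k A
   by (rule U_supermartingale[OF _ _ that]) (auto simp: divide_right_mono)
 qed
 then show ?thesis by (simp add: grid_def)
qed

lemma grid_incseq: "incseq (grid c)"
proof (rule incseq_SucI, rule subsetI)
 fix n w assume "w \<in> grid c n"
 then obtain k where k: "k \<le> 4 ^ n" "c \<le> U (real k / 2 ^ n) w" "w \<in> space M" by (auto simp: grid_def)
 have "2 * k \<le> 4 ^ Suc n" using k(1) by simp
 moreover have "c \<le> U (real (2 * k) / 2 ^ Suc n) w" using k(2) by simp
 ultimately have "\<exists>k\<le>4 ^ Suc n. c \<le> U (real k / 2 ^ Suc n) w" by (intro exI[of _ "2 * k"] conjI)
 then show "w \<in> grid c (Suc n)" using k(3) unfolding grid_def mem_Collect_eq by (intro conjI)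
qed

text \<open>By \<open>grid_bound\<close> the probability that \<open>U\<close> reaches
  \<open>m + 1\<close> at some dyadic time is at most its initial mean divided by
  \<open>m + 1\<close>. The paths that reach every level therefore form a null set, and on the
  others \<open>exp (Psi t)\<close> is bounded by its value for the whole half-line.\<close>

lemma dyadic_bound:
 assumes w0: "(\<integral>\<^sup>+w. ennreal (wp 0 w) \<partial>M) < \<infinity>"
 shows "AE w in M. \<exists>c. \<forall>n k. wp (real k / 2 ^ n) w \<le> c"
proof -
 let ?I = "\<integral>\<^sup>+w. U 0 w \<partial>M"
 have [measurable]: "wp 0 \<in> borel_measurable M" by (rule measurable_F_M[OF _ wp_meas]) auto
 have "?I \<le> (\<integral>\<^sup>+w. ennreal (wp 0 w) + ennreal (Atail 0) \<partial>M)"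
 proof (rule nn_integral_mono)
  fix w
  have "ennreal (exp (- Psi 0)) * ennreal (wp 0 w) \<le> 1 * ennreal (wp 0 w)"
   using Psi_bounds(1)[of 0] by (intro mult_right_mono) (auto simp: ennreal_le_1)
  then show "U 0 w \<le> ennreal (wp 0 w) + ennreal (Atail 0)"
   unfolding U_def by (intro add_right_mono) simp
 qed
 also have "... = (\<integral>\<^sup>+w. ennreal (wp 0 w) \<partial>M) + ennreal (Atail 0)"
  by (subst nn_integral_add) (auto simp: emeasure_space_1)
 also have "... < \<infinity>" using w0 by simp
 finally have I: "?I < \<infinity>" .
 define Nul where "Nul = (\<Inter>m. \<Union>n. grid (ennreal (real (Suc m))) n)"
 have Nm: "Nul \<in> sets M" unfolding Nul_def using grid_sets by auto
 have le: "ennreal (real (Suc m)) * emeasure M Nul \<le> ?I" for m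
 proof -
  have "emeasure M Nul \<le> emeasure M (\<Union>n. grid (ennreal (real (Suc m))) n)"
   by (rule emeasure_mono) (use grid_sets in \<open>auto simp: Nul_def\<close>)
  also have "... = (SUP n. emeasure M (grid (ennreal (real (Suc m))) n))"
   by (rule SUP_emeasure_incseq[symmetric, OF _ grid_incseq]) (use grid_sets in auto)
  finally have "ennreal (real (Suc m)) * emeasure M Nul \<le> ennreal (real (Suc m)) * (SUP n. emeasure M (grid (ennreal (real (Suc m))) n))"
   by (intro mult_left_mono) auto
  also have "... = (SUP n. ennreal (real (Suc m)) * emeasure M (grid (ennreal (real (Suc m))) n))"
   by (rule SUP_mult_left_ennreal)
  also have "... \<le> ?I" by (intro SUP_least grid_bound)
  finally show ?thesis .
 qed
 have "emeasure M Nul = 0"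
 proof (rule ccontr)
  assume ne: "emeasure M Nul \<noteq> 0"
  obtain i where i: "?I = ennreal i" "0 \<le> i" using I by (cases ?I) auto
  have e: "emeasure M Nul = ennreal (measure M Nul)" by (rule emeasure_eq_measure)
  then have pos: "0 < measure M Nul" using ne zero_less_measure_iff by fastforce
  obtain m where m: "i < real m * measure M Nul" using reals_Archimedean3[OF pos] by blast
  have "real (Suc m) * measure M Nul \<le> i"
   using le[of m] i unfolding e by (simp add: ennreal_mult[symmetric] del: of_nat_Suc)
  moreover have "real m * measure M Nul \<le> real (Suc m) * measure M Nul" using pos by (intro mult_right_mono) auto
  ultimately show False using m by linarith
 qed
 then have "Nul \<in> null_sets M" using Nm by auto
 then have "AE w in M. w \<notin> Nul" by (rule AE_not_in)
 then show ?thesis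
  using AE_space
 proof eventually_elim
  case (elim w)
  then obtain m where m: "!!n. w \<notin> grid (ennreal (real (Suc m))) n" by (auto simp: Nul_def)
  have "wp (real k / 2 ^ n) w \<le> exp (LINT v:{0..}|lborel. \<psi> v) * real (Suc m)" for n k
  proof -
   let ?t = "real k / 2 ^ n"
   \<comment> \<open>Rewriting the dyadic number at the finer level \<open>n + k\<close> brings its
     numerator into the range of the grid.\<close>
   have "k * 2 ^ k \<le> 4 ^ (n + k)"
   proof -
    have "k * 2 ^ k \<le> 2 ^ k * (2 ^ k :: nat)" by (intro mult_right_mono) (auto intro: less_imp_le)
    also have "... = 4 ^ k" by (simp add: power_mult_distrib[symmetric])
    also have "... \<le> 4 ^ (n + k)" by (intro power_increasing) auto
    finally show ?thesis .
   qed
   moreover have "real (k * 2 ^ k) / 2 ^ (n + k) = ?t" by (simp add: power_add)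
   ultimately have "\<not> ennreal (real (Suc m)) \<le> U ?t w"
    using m[of "n + k"] elim(2) unfolding grid_def mem_Collect_eq by fastforce
   then have "U ?t w \<le> ennreal (real (Suc m))" by (simp add: not_le less_imp_le)
   then have "ennreal (exp (- Psi ?t)) * ennreal (wp ?t w) \<le> ennreal (real (Suc m))"
    unfolding U_def by (rule order.trans[rotated]) simp
   moreover have y: "0 \<le> wp ?t w" by (rule wp_nonneg[OF _ elim(2)]) simp
   ultimately have "exp (- Psi ?t) * wp ?t w \<le> real (Suc m)"
    by (simp add: ennreal_mult[symmetric] del: of_nat_Suc)
   then have "exp (Psi ?t) * (exp (- Psi ?t) * wp ?t w) \<le> exp (Psi ?t) * real (Suc m)" by (intro mult_left_mono) auto
   then have "wp ?t w \<le> exp (Psi ?t) * real (Suc m)" by (simp add: mult.assoc[symmetric] exp_add[symmetric])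
   also have "... \<le> exp (LINT v:{0..}|lborel. \<psi> v) * real (Suc m)" using Psi_bounds(2) by (intro mult_right_mono) auto
   finally show ?thesis .
  qed
  then show ?case by blast
 qed
qed

text \<open>The lower bound on \<open>V\<close> turns the dyadic estimate into one on
  \<open>norm (Zp t w) powr p\<close>, and right continuity of the path carries it from dyadic times
  to all times.\<close>

lemma path_bound:
 assumes w0: "(\<integral>\<^sup>+w. ennreal (wp 0 w) \<partial>M) < \<infinity>"
  and rc: "!!w t. w \<in> space M ==> 0 \<le> t ==> continuous (at_right t) (\<lambda>s. Zp s w)"
 shows "AE w in M. \<exists>c. \<forall>t\<ge>0. exp (lam * t) * norm (Zp t w) powr p \<le> c"
 using dyadic_bound[OF w0] AE_space
proof eventually_elim
 case (elim w)
 then obtain c where c: "!!n k. wp (real k / 2 ^ n) w \<le> c" and w: "w \<in> space M" by blast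
 let ?h = "\<lambda>t. exp (lam * t) * norm (Zp t w) powr p"
 have dy: "?h (real k / 2 ^ n) \<le> c / c1" for n k :: nat
 proof -
  let ?t = "real k / 2 ^ n"
  have "exp (lam * ?t) * (c1 * norm (Zp ?t w) powr p) \<le> wp ?t w"
   unfolding wp_def ly.lyap_def by (intro mult_left_mono ly.lower r_in_S w) auto
  then show ?thesis using c[of k n] ly.c1 by (simp add: field_simps)
 qed
 have "?h t \<le> c / c1" if t: "0 \<le> t" for t
 proof -
  \<comment> \<open>The added 1 selects a dyadic number strictly to the right of \<open>t\<close>,
    so that the right-hand limit is the one taken.\<close>
  define sq where "sq n = real (nat (\<lfloor>t * 2 ^ n\<rfloor> + 1)) / 2 ^ n" for n :: nat
  have sq: "t < sq n" "sq n \<le> t + 1 / 2 ^ n" for n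
  proof -
   have f: "t * 2 ^ n < of_int (\<lfloor>t * 2 ^ n\<rfloor> + 1)" "of_int \<lfloor>t * 2 ^ n\<rfloor> \<le> t * 2 ^ n" by linarith+
   have "0 \<le> \<lfloor>t * 2 ^ n\<rfloor> + 1" using t by (simp add: add_nonneg_nonneg)
   then have e: "real (nat (\<lfloor>t * 2 ^ n\<rfloor> + 1)) = of_int \<lfloor>t * 2 ^ n\<rfloor> + 1" by simp
   show "t < sq n" using f(1) by (simp add: sq_def e field_simps)
   have "of_int \<lfloor>t * 2 ^ n\<rfloor> + 1 \<le> t * 2 ^ n + 1" using f(2) by simp
   then have "(of_int \<lfloor>t * 2 ^ n\<rfloor> + 1) / 2 ^ n \<le> (t * 2 ^ n + 1) / 2 ^ n" by (intro divide_right_mono) auto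
   also have "... = t + 1 / 2 ^ n" by (simp add: add_divide_distrib)
   finally show "sq n \<le> t + 1 / 2 ^ n" unfolding sq_def e .
  qed
  have lim: "sq \<longlonglongrightarrow> t"
  proof (rule tendsto_sandwich[OF _ _ tendsto_const])
   show "\<forall>\<^sub>F n in sequentially. t \<le> sq n" by (intro always_eventually allI less_imp_le[OF sq(1)])
   show "\<forall>\<^sub>F n in sequentially. sq n \<le> t + 1 / 2 ^ n" by (intro always_eventually allI sq(2))
   show "(\<lambda>n. t + 1 / 2 ^ n) \<longlonglongrightarrow> t" by real_asymp
  qed
  then have at: "filterlim sq (at_right t) sequentially"
   unfolding filterlim_at using sq(1) by (intro conjI always_eventually allI) (auto simp: less_imp_neq[symmetric])
  have "((\<lambda>s. Zp s w) \<longlongrightarrow> Zp t w) (at_right t)" using rc[OF w t] by (simp add: continuous_within)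
  from filterlim_compose[OF this at] have Z: "(\<lambda>n. Zp (sq n) w) \<longlonglongrightarrow> Zp t w" .
  have "(\<lambda>n. ?h (sq n)) \<longlonglongrightarrow> ?h t"
   by (intro tendsto_intros lim tendsto_powr' Z tendsto_norm) (use ly.p in auto)
  then show ?thesis by (rule LIMSEQ_le_const2) (use dy in \<open>auto simp: sq_def\<close>)
 qed
 then show ?case by blast
qed

text \<open>\<open>growth_estimate\<close> from time 0 on the whole space; extending the integrals
  of \<open>\<psi>\<close> and \<open>a\<close> to the half-line makes the constant independent of
  \<open>t\<close>.\<close>

lemma moment_bound:
 assumes w0: "(\<integral>\<^sup>+w. ennreal (wp 0 w) \<partial>M) < \<infinity>"
 shows "\<exists>c\<ge>0. \<forall>t\<ge>0. (\<integral>\<^sup>+w. ennreal (norm (Zp t w) powr p) \<partial>M) \<le> ennreal (c * exp (- lam * t))"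
proof -
 obtain i where i: "(\<integral>\<^sup>+w. ennreal (wp 0 w) \<partial>M) = ennreal i" "0 \<le> i" using w0 by (cases "\<integral>\<^sup>+w. ennreal (wp 0 w) \<partial>M") auto
 let ?P = "LINT v:{0..}|lborel. \<psi> v" and ?A = "LINT v:{0..}|lborel. a v"
 have A0: "0 \<le> ?A" using Icc_le_half_line[OF a_int a_nonneg, of 0] Icc_le_half_line(2)[OF a_int a_nonneg, of 0 0] by linarith
 show ?thesis
 proof (intro exI[of _ "exp ?P * (i + ?A) / c1"] conjI allI impI)
  show "0 \<le> exp ?P * (i + ?A) / c1" using i A0 ly.c1 by simp
  fix t :: real assume t: "0 \<le> t"
  have sp: "space M \<in> sets (F 0)" using sets.top[of "F 0"] space_F[of 0] by simp
  have "(\<integral>\<^sup>+w. ennreal (wp t w) \<partial>M) = (\<integral>\<^sup>+w\<in>space M. ennreal (wp t w) \<partial>M)"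
   by (intro nn_integral_cong) simp
  also have "... \<le> ennreal (exp (Psi t)) * ((\<integral>\<^sup>+w\<in>space M. ennreal (wp 0 w) \<partial>M) + emeasure M (space M) * ennreal (LINT v:{0..t}|lborel. a v))"
   unfolding Psi_def by (rule growth_estimate[OF order.refl t sp])
  also have "(\<integral>\<^sup>+w\<in>space M. ennreal (wp 0 w) \<partial>M) = ennreal i" unfolding i(1)[symmetric] by (intro nn_integral_cong) simp
  also have "ennreal (exp (Psi t)) * (ennreal i + emeasure M (space M) * ennreal (LINT v:{0..t}|lborel. a v)) \<le> ennreal (exp ?P) * (ennreal i + 1 * ennreal ?A)"
   unfolding emeasure_space_1
   by (intro mult_mono add_mono ennreal_leI order.refl) (use Psi_bounds(2) Icc_le_half_line[OF a_int a_nonneg] in auto)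
  also have "... = ennreal (exp ?P * (i + ?A))" using i A0 by (simp add: ennreal_mult)
  finally have 1: "(\<integral>\<^sup>+w. ennreal (wp t w) \<partial>M) \<le> ennreal (exp ?P * (i + ?A))" .
  have [measurable]: "wp t \<in> borel_measurable M" by (rule measurable_F_M[OF t wp_meas[OF t]])
  have "(\<integral>\<^sup>+w. ennreal (norm (Zp t w) powr p) \<partial>M) \<le> (\<integral>\<^sup>+w. ennreal (exp (- lam * t) / c1) * ennreal (wp t w) \<partial>M)"
  proof (rule nn_integral_mono)
   fix w assume w: "w \<in> space M"
   have "exp (lam * t) * (c1 * norm (Zp t w) powr p) \<le> wp t w"
    unfolding wp_def ly.lyap_def by (intro mult_left_mono ly.lower r_in_S w t) auto
   then have "exp (- lam * t) / c1 * (exp (lam * t) * (c1 * norm (Zp t w) powr p)) \<le> exp (- lam * t) / c1 * wp t w"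
    using ly.c1 by (intro mult_left_mono) auto
   moreover have "exp (- lam * t) / c1 * (exp (lam * t) * (c1 * norm (Zp t w) powr p)) = norm (Zp t w) powr p"
    using ly.c1 by (simp add: exp_minus field_simps)
   ultimately have "norm (Zp t w) powr p \<le> exp (- lam * t) / c1 * wp t w" by simp
   then show "ennreal (norm (Zp t w) powr p) \<le> ennreal (exp (- lam * t) / c1) * ennreal (wp t w)"
    using ly.c1 wp_nonneg[OF t w] by (simp add: ennreal_mult[symmetric] ennreal_leI)
  qed
  also have "... = ennreal (exp (- lam * t) / c1) * (\<integral>\<^sup>+w. ennreal (wp t w) \<partial>M)" by (rule nn_integral_cmult) measurable
  also have "... \<le> ennreal (exp (- lam * t) / c1) * ennreal (exp ?P * (i + ?A))" by (intro mult_left_mono 1) simp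
  also have "... = ennreal (exp ?P * (i + ?A) / c1 * exp (- lam * t))"
   using ly.c1 i A0 by (simp add: ennreal_mult[symmetric] mult_ac)
  finally show "(\<integral>\<^sup>+w. ennreal (norm (Zp t w) powr p) \<partial>M) \<le> ennreal (exp ?P * (i + ?A) / c1 * exp (- lam * t))" .
 qed
qed

end

section \<open>The delay equation\<close>

text \<open>A preimage under \<open>g\<close> differs from that under \<open>f\<close> only inside a
  null set, all of whose subsets belong to \<open>G\<close>. Completeness of the filtration puts
  every \<open>F t\<close> in this position.\<close>

lemma measurable_AE_eq_null:
 assumes G: "space G = space M" "!!Nul A. Nul \<in> null_sets M ==> A \<subseteq> Nul ==> A \<in> sets G"
  and f: "f \<in> measurable G N" and eq: "AE w in M. f w = g w" and g: "!!w. w \<in> space M ==> g w \<in> space N"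
 shows "g \<in> measurable G N"
proof (rule measurableI)
 obtain Nul where Nul: "Nul \<in> null_sets M" "!!w. w \<in> space M ==> w \<notin> Nul ==> f w = g w"
  using AE_E3[OF eq] by (metis (mono_tags, lifting) DiffI)
 show "g w \<in> space N" if "w \<in> space G" for w using g that G(1) by simp
 fix A assume A: "A \<in> sets N"
 have "g -` A \<inter> space G = ((f -` A \<inter> space G) - Nul) \<union> (g -` A \<inter> space G \<inter> Nul)"
  using Nul(2) G(1) by auto
 moreover have "(f -` A \<inter> space G) - Nul \<in> sets G"
  using measurable_sets[OF f A] G(2)[OF Nul(1) order.refl] by auto
 moreover have "g -` A \<inter> space G \<inter> Nul \<in> sets G" by (rule G(2)[OF Nul(1)]) auto
 ultimately show "g -` A \<inter> space G \<in> sets G" by (metis sets.Un)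
qed

lemma (in filtered_prob) measurable_AE_eq:
 assumes "0 \<le> v" "f \<in> measurable (F v) N" "AE w in M. f w = g w" "!!w. w \<in> space M ==> g w \<in> space N"
 shows "g \<in> measurable (F v) N"
 by (rule measurable_AE_eq_null[OF space_F[OF assms(1)] null_F[OF _ _ assms(1)] assms(2-4)])

lemma (in filtered_prob) measurable_M_AE_eq:
 assumes "f \<in> measurable M N" "AE w in M. f w = g w" "!!w. w \<in> space M ==> g w \<in> space N"
 shows "g \<in> measurable M N"
 by (rule measurable_AE_eq_null[OF refl subsetD[OF sets_F_M[OF order.refl] null_F[OF _ _ order.refl]] assms])

lemma (in filtered_prob) null_in_prob_AE_eq:
 assumes Z: "null_in_prob M Z" and eq: "!!n. AE w in M. Z n w = Z' n w"
 shows "null_in_prob M Z'"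
proof -
 have Zm: "Z n \<in> borel_measurable M" for n using Z by (simp add: null_in_prob_def)
 have Zm': "Z' n \<in> borel_measurable M" for n by (rule measurable_M_AE_eq[OF Zm eq]) simp
 have "measure M {w\<in>space M. Z n w > ennreal eps} = measure M {w\<in>space M. Z' n w > ennreal eps}" for n eps
 proof (rule measure_eq_AE)
  show "AE w in M. w \<in> {w\<in>space M. Z n w > ennreal eps} \<longleftrightarrow> w \<in> {w\<in>space M. Z' n w > ennreal eps}"
   using eq[of n] by eventually_elim simp
  have [measurable]: "Z n \<in> borel_measurable M" "Z' n \<in> borel_measurable M" by (rule Zm, rule Zm')
  show "{w\<in>space M. Z n w > ennreal eps} \<in> sets M" "{w\<in>space M. Z' n w > ennreal eps} \<in> sets M" by measurable
 qed
 then show ?thesis using Z Zm' by (simp add: null_in_prob_def)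
qed

lemma (in filtered_prob) brownian_modification:
 fixes B B' :: "real => 'w => real^'m"
 assumes B: "brownian_motion M F B" and eq: "AE w in M. \<forall>t. B t w = B' t w"
 shows "brownian_motion M F B'"
proof -
 have eqt: "AE w in M. B t w = B' t w" for t using eq by eventually_elim simp
 have m: "B' t \<in> borel_measurable (F t)" if "0 \<le> t" for t
  by (rule measurable_AE_eq[OF that _ eqt]) (use B that in \<open>auto simp: brownian_motion_def\<close>)
 have B_M: "B t \<in> borel_measurable M" "B' t \<in> borel_measurable M" if "0 \<le> t" for t
  using measurable_F_M[OF that] m[OF that] B that by (auto simp: brownian_motion_def)
 have eqd: "AE w in M. B t w - B s w = B' t w - B' s w" for s t using eq by eventually_elim simp
 have zero: "AE w in M. B' 0 w = 0"
 proof -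
  have "AE w in M. B 0 w = 0" using B by (simp add: brownian_motion_def)
  then show ?thesis using eqt[of 0] by eventually_elim simp
 qed
 have cont: "AE w in M. continuous_on {0..} (\<lambda>t. B' t w)"
 proof -
  have "AE w in M. continuous_on {0..} (\<lambda>t. B t w)" using B by (simp add: brownian_motion_def)
  then show ?thesis using eq by eventually_elim simp
 qed
 have inc: "distributed M lborel (\<lambda>w. B' t w - B' s w) (\<lambda>x. ennreal (\<Prod>k\<in>UNIV. normal_density 0 (sqrt (t - s)) (x $ k)))"
  and ind: "indep_set (sets (F s)) (sets (vimage_algebra (space M) (\<lambda>w. B' t w - B' s w) borel))"
  if st: "0 \<le> s" "s < t" for s t
 proof -
  have t0: "0 \<le> t" using st by simp
  let ?d = "\<lambda>w. B t w - B s w" and ?d' = "\<lambda>w. B' t w - B' s w"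
  have dm: "?d \<in> borel_measurable M" "?d' \<in> borel_measurable M"
   using B_M[OF t0] B_M[OF st(1)] by (auto intro: borel_measurable_diff)
  have D: "distributed M lborel ?d (\<lambda>x. ennreal (\<Prod>k\<in>UNIV. normal_density 0 (sqrt (t - s)) (x $ k)))"
   and I: "indep_set (sets (F s)) (sets (vimage_algebra (space M) ?d borel))"
   using B st by (auto simp: brownian_motion_def)
  have "distr M lborel ?d = distr M lborel ?d'"
   by (rule distr_cong_AE[OF refl refl eqd]) (use dm in auto)
  then show "distributed M lborel ?d' (\<lambda>x. ennreal (\<Prod>k\<in>UNIV. normal_density 0 (sqrt (t - s)) (x $ k)))"
   using D dm by (simp add: distributed_def)
  have va: "sets (vimage_algebra (space M) h borel) = {h -` A \<inter> space M | A. A \<in> sets borel}" for h :: "'w => real^'m"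
   by (rule sets_vimage_algebra2) simp
  show "indep_set (sets (F s)) (sets (vimage_algebra (space M) ?d' borel))"
  proof (rule indep_setI)
   show "sets (F s) \<subseteq> events" by (rule sets_F_M[OF st(1)])
   show "sets (vimage_algebra (space M) ?d' borel) \<subseteq> events"
    unfolding va using measurable_sets[OF dm(2)] by auto
   fix a e assume a: "a \<in> sets (F s)" and "e \<in> sets (vimage_algebra (space M) ?d' borel)"
   then obtain A where A: "A \<in> sets borel" "e = ?d' -` A \<inter> space M" unfolding va by auto
   have aM: "a \<in> sets M" using a sets_F_M[OF st(1)] by auto
   have s1: "?d -` A \<inter> space M \<in> sets M" "?d' -` A \<inter> space M \<in> sets M"
    using measurable_sets[OF dm(1) A(1)] measurable_sets[OF dm(2) A(1)] by auto
   have "prob (a \<inter> (?d -` A \<inter> space M)) = prob a * prob (?d -` A \<inter> space M)"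
    by (rule indep_setD[OF I a]) (use A va in auto)
   moreover have "prob (a \<inter> (?d -` A \<inter> space M)) = prob (a \<inter> e)"
    unfolding A(2)
   proof (rule measure_eq_AE)
    show "AE w in M. w \<in> a \<inter> (?d -` A \<inter> space M) \<longleftrightarrow> w \<in> a \<inter> (?d' -` A \<inter> space M)"
     using eqd[of t s] by eventually_elim (simp add: vimage_def)
   qed (use aM s1 in auto)
   moreover have "prob (?d -` A \<inter> space M) = prob e"
    unfolding A(2)
   proof (rule measure_eq_AE)
    show "AE w in M. w \<in> ?d -` A \<inter> space M \<longleftrightarrow> w \<in> ?d' -` A \<inter> space M"
     using eqd[of t s] by eventually_elim (simp add: vimage_def)
   qed (use s1 in auto)
   ultimately show "prob (a \<inter> e) = prob a * prob e" by simp
  qed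
 qed
 show ?thesis unfolding brownian_motion_def
  by (intro conjI allI impI m zero cont inc ind; (elim conjE)?; assumption)
qed

text \<open>Exceptional paths are replaced by 0, which gives the everywhere continuous Brownian
  motion that the construction of \<open>Z\<close> for simple integrands relies on; adaptedness
  survives because the filtration is complete.\<close>

lemma (in filtered_prob) brownian_continuous_version:
 fixes B :: "real => 'w => real^'m"
 assumes B: "brownian_motion M F B"
 obtains B' where "brownian_motion M F B'" "AE w in M. \<forall>t. B t w = B' t w"
  "!!w. w \<in> space M ==> continuous_on {0..} (\<lambda>t. B' t w)"
proof -
 define B' where "B' t w = (if continuous_on {0..} (\<lambda>t. B t w) then B t w else 0)" for t w
 have "AE w in M. continuous_on {0..} (\<lambda>t. B t w)" using B by (simp add: brownian_motion_def)
 then have eq: "AE w in M. \<forall>t. B t w = B' t w" by eventually_elim (simp add: B'_def)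
 show ?thesis
 proof (rule that[OF brownian_modification[OF B eq] eq])
  fix w
  show "continuous_on {0..} (\<lambda>t. B' t w)" by (cases "continuous_on {0..} (\<lambda>t. B t w)") (simp_all add: B'_def)
 qed
qed

text \<open>The integrability assumptions concern the completed measure, while the Fubini arguments
  are carried out with \<open>lborel\<close>. Taking \<open>max 0\<close> makes the version
  nonnegative at every time and not only almost everywhere.\<close>

lemma lebesgue_borel_version:
 fixes h :: "real => real"
 assumes h: "set_integrable lebesgue {0..} h" and nn: "!!t. 0 \<le> t ==> 0 \<le> h t"
 obtains h' where "!!t. 0 \<le> h' t" "set_integrable lborel {0..} h'" "AE t in lborel. 0 \<le> t --> h t = h' t"
proof -
 let ?h = "\<lambda>t. indicator {0..} t *\<^sub>R h t"
 have hi: "integrable lebesgue ?h" using h by (simp add: set_integrable_def)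
 then have "?h \<in> borel_measurable lebesgue" by (rule borel_measurable_integrable)
 then obtain g where g: "g \<in> borel_measurable lborel" "AE t in lborel. ?h t = g t"
  using completion_ex_borel_measurable_real by blast
 let ?g = "\<lambda>t. max 0 (g t)"
 have gm: "?g \<in> borel_measurable lborel" using g(1) by measurable
 have eq: "AE t in lborel. ?h t = ?g t"
  using g(2)
 proof eventually_elim
  case (elim t)
  have "0 \<le> ?h t" using nn by (simp add: indicator_def)
  then show ?case using elim by simp
 qed
 have "integrable lebesgue ?g"
  using hi by (subst integrable_cong_AE[where g = ?h])
   (use gm AE_completion[OF eq] \<open>?h \<in> borel_measurable lebesgue\<close> in \<open>auto intro: measurable_completion\<close>)
 then have gi: "integrable lborel ?g" using integrable_completion[OF gm] by simp
 show ?thesis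
 proof (rule that[of ?g])
  show "set_integrable lborel {0..} ?g"
   unfolding set_integrable_def by (rule integrable_mult_indicator[OF _ gi]) simp
  show "AE t in lborel. 0 \<le> t --> h t = ?g t" using eq by eventually_elim auto
 qed simp
qed

locale switched_delay_equation = markov_space M F N \<Gamma> r
 for M :: "'w measure" and F N \<Gamma> r +
 fixes B :: "real => 'w => real^'m" and D :: "real^'d => int => real^'d"
  and f :: "real^'d => real^'d => real => int => real^'d"
  and g :: "real^'d => real^'d => real => int => real^'m^'d"
  and \<tau> \<beta> :: real and \<xi> X :: "real => 'w => real^'d"
 assumes bm: "brownian_motion M F B" and \<tau>: "0 < \<tau>" and \<beta>: "0 < \<beta>" "\<beta> < 1"
  and D_meas: "!!i. i \<in> {1..int N} ==> (\<lambda>x. D x i) \<in> borel_measurable borel"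
  and f_meas: "!!i. i \<in> {1..int N} ==> (\<lambda>(x, y, t). f x y t i) \<in> borel_measurable (restrict_space borel (UNIV \<times> UNIV \<times> {0..}))"
  and g_meas: "!!i. i \<in> {1..int N} ==> (\<lambda>(x, y, t). g x y t i) \<in> borel_measurable (restrict_space borel (UNIV \<times> UNIV \<times> {0..}))"
  and D_lip: "!!x y i. i \<in> {1..int N} ==> norm (D x i - D y i) \<le> \<beta> * norm (x - y)"
  and D_0: "!!i. i \<in> {1..int N} ==> D 0 i = 0"
  and init: "initial_datum M F \<tau> \<xi>" and sol: "nsdde_solution M F r B D f g \<tau> \<xi> X"
begin

definition drift :: "real => 'w => real^'d" where
 "drift t w = f (X t w) (X (t - \<tau>) w) t (r t w)"
definition diffusion :: "real => 'w => real^'m^'d" where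
 "diffusion t w = g (X t w) (X (t - \<tau>) w) t (r t w)"
definition Z :: "real => 'w => real^'d" where
 "Z t w = X t w - D (X (t - \<tau>) w) (r t w)"

lemma X_meas_F: "- \<tau> \<le> t ==> X t \<in> borel_measurable (F (max 0 t))"
 using sol by (simp add: nsdde_solution_def)

lemma X_meas: "- \<tau> \<le> t ==> X t \<in> borel_measurable M"
 by (rule measurable_F_M[OF _ X_meas_F]) auto

lemma X_right_continuous: "w \<in> space M ==> - \<tau> \<le> t ==> continuous (at_right t) (\<lambda>s. X s w)"
 using sol by (simp add: nsdde_solution_def)

lemma X_delay_right_continuous:
 assumes "w \<in> space M" "0 \<le> t"
 shows "continuous (at_right t) (\<lambda>s. X (s - \<tau>) w)"
proof -
 have "((\<lambda>s. X s w) \<longlongrightarrow> X (t - \<tau>) w) (at_right (t - \<tau>))"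
  using X_right_continuous[OF assms(1), of "t - \<tau>"] assms(2) by (simp add: continuous_within)
 moreover have "filterlim (\<lambda>s. s - \<tau>) (at_right (t - \<tau>)) (at_right t)"
  unfolding filterlim_at
  by (auto intro!: tendsto_intros eventually_at_right_less eventually_mono[OF eventually_at_right_less[of t]])
 ultimately show ?thesis unfolding continuous_within by (rule filterlim_compose)
qed

lemma X_prog:
 assumes T: "0 \<le> T"
 shows "prog T X" "prog T (\<lambda>t. X (t - \<tau>))"
proof -
 show "prog T X"
  unfolding prog_def
 proof (rule right_continuous_joint[OF T])
  fix t assume t: "t \<in> {0..T}"
  show "X t \<in> borel_measurable (F T)"
   by (rule measurable_F_mono[of "max 0 t", OF _ _ X_meas_F]) (use t \<tau> in auto)
  show "continuous (at_right t) (\<lambda>s. X s w)" if "w \<in> space M" for w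
   by (rule X_right_continuous[OF that]) (use t \<tau> in auto)
 qed
 show "prog T (\<lambda>t. X (t - \<tau>))"
  unfolding prog_def
 proof (rule right_continuous_joint[OF T])
  fix t assume t: "t \<in> {0..T}"
  show "X (t - \<tau>) \<in> borel_measurable (F T)"
   by (rule measurable_F_mono[of "max 0 (t - \<tau>)", OF _ _ X_meas_F]) (use t \<tau> in auto)
  show "continuous (at_right t) (\<lambda>s. X (s - \<tau>) w)" if "w \<in> space M" for w
   by (rule X_delay_right_continuous[OF that]) (use t in auto)
 qed
qed

lemma coefficient_prog:
 fixes h :: "real^'d => real^'d => real => int => 'b::{banach, second_countable_topology}"
 assumes T: "0 \<le> T" and h: "!!i. i \<in> {1..int N} ==> (\<lambda>(x, y, t). h x y t i) \<in> borel_measurable (restrict_space borel (UNIV \<times> UNIV \<times> {0..}))"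
 shows "prog T (\<lambda>t w. h (X t w) (X (t - \<tau>) w) t (r t w))"
 unfolding prog_def
proof (rule measurable_switch[OF r_joint[OF T], where f = "\<lambda>i x. h (X (clip T (fst x)) (snd x)) (X (clip T (fst x) - \<tau>) (snd x)) (clip T (fst x)) i"])
 fix x assume "x \<in> space (borel \<Otimes>\<^sub>M F T :: (real \<times> 'w) measure)"
 then have x: "snd x \<in> space M" using space_F[OF T] by (simp add: space_pair_measure mem_Times_iff)
 show "r (clip T (fst x)) (snd x) \<in> {1..int N}" by (rule r_in_S[OF x]) (use clip_in[OF T, of "fst x"] in auto)
next
 fix i assume i: "i \<in> {1..int N}"
 have "(\<lambda>x. (X (clip T (fst x)) (snd x), X (clip T (fst x) - \<tau>) (snd x), clip T (fst x))) \<in> borel_measurable (borel \<Otimes>\<^sub>M F T)"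
  using X_prog[OF T] unfolding prog_def by (intro borel_measurable_Pair) simp_all
 then have "(\<lambda>x. (X (clip T (fst x)) (snd x), X (clip T (fst x) - \<tau>) (snd x), clip T (fst x)))
   \<in> measurable (borel \<Otimes>\<^sub>M F T) (restrict_space borel (UNIV \<times> UNIV \<times> {0..}))"
  by (intro measurable_restrict_space2) (use clip_in[OF T] in auto)
 from measurable_compose[OF this h[OF i]]
 show "(\<lambda>x. h (X (clip T (fst x)) (snd x)) (X (clip T (fst x) - \<tau>) (snd x)) (clip T (fst x)) i) \<in> borel_measurable (borel \<Otimes>\<^sub>M F T)"
  by simp
qed

lemma drift_prog: "0 \<le> T ==> prog T drift"
 unfolding drift_def[abs_def] by (rule coefficient_prog[OF _ f_meas])

lemma diffusion_prog: "0 \<le> T ==> prog T diffusion"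
 unfolding diffusion_def[abs_def] by (rule coefficient_prog[OF _ g_meas])

lemma Z_prog:
 assumes T: "0 \<le> T"
 shows "prog T Z"
proof -
 have "(\<lambda>(x :: real^'d, y, t :: real). D y i) \<in> borel_measurable (restrict_space borel (UNIV \<times> UNIV \<times> {0..}))" if "i \<in> {1..int N}" for i
 proof -
  have "(\<lambda>q. D (fst (snd q)) i) \<in> borel_measurable (borel :: ((real^'d) \<times> (real^'d) \<times> real) measure)"
   by (rule measurable_compose[OF _ D_meas[OF that]])
    (intro borel_measurable_continuous_onI continuous_intros)
  then show ?thesis by (intro measurable_restrict_space1) (simp add: case_prod_beta')
 qed
 from coefficient_prog[OF T this] X_prog(1)[OF T] show ?thesis
  unfolding prog_def Z_def by (intro borel_measurable_diff) simp_all
qed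

text \<open>A right-continuous chain with discrete values is constant just after \<open>t\<close>,
  so near \<open>t\<close> only the continuous function of the current state is involved. The
  statement is for every path.\<close>

lemma Z_right_continuous:
 assumes w: "w \<in> space M" and t: "0 \<le> t"
 shows "continuous (at_right t) (\<lambda>s. Z s w)"
proof -
 have i: "r t w \<in> {1..int N}" by (rule r_in_S[OF w t])
 have "continuous (at_right t) (\<lambda>s. r s w)" using mc w t unfolding markov_chain_def by auto
 then have ev: "\<forall>\<^sub>F s in at_right t. r s w = r t w" unfolding continuous_within tendsto_discrete .
 have Xt: "((\<lambda>s. X s w) \<longlongrightarrow> X t w) (at_right t)"
  using X_right_continuous[OF w, of t] t \<tau> by (simp add: continuous_within)
 have Yt: "((\<lambda>s. X (s - \<tau>) w) \<longlongrightarrow> X (t - \<tau>) w) (at_right t)"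
  using X_delay_right_continuous[OF w t] by (simp add: continuous_within)
 have "continuous_on UNIV (\<lambda>x. D x (r t w))"
  by (rule lipschitz_on_continuous_on[where L = \<beta>], rule lipschitz_onI) (use D_lip[OF i] \<beta> in \<open>auto simp: dist_norm\<close>)
 then have "((\<lambda>s. D (X (s - \<tau>) w) (r t w)) \<longlongrightarrow> D (X (t - \<tau>) w) (r t w)) (at_right t)"
  by (rule continuous_on_tendsto_compose[OF _ Yt]) auto
 from tendsto_diff[OF Xt this] have "((\<lambda>s. X s w - D (X (s - \<tau>) w) (r t w)) \<longlongrightarrow> Z t w) (at_right t)"
  unfolding Z_def .
 then have "((\<lambda>s. Z s w) \<longlongrightarrow> Z t w) (at_right t)"
  by (rule Lim_transform_eventually) (use ev in \<open>auto elim!: eventually_mono simp: Z_def\<close>)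
 then show ?thesis by (simp add: continuous_within)
qed

lemma D_le: "i \<in> {1..int N} ==> norm (D y i) \<le> \<beta> * norm y"
 using D_lip[of i y 0] D_0[of i] by simp

lemma norm_X_le:
 assumes "w \<in> space M" "0 \<le> t"
 shows "norm (X t w) \<le> norm (Z t w) + \<beta> * norm (X (t - \<tau>) w)"
proof -
 have "X t w = Z t w + D (X (t - \<tau>) w) (r t w)" by (simp add: Z_def)
 then have "norm (X t w) \<le> norm (Z t w) + norm (D (X (t - \<tau>) w) (r t w))" by (simp add: norm_triangle_ineq)
 also have "norm (D (X (t - \<tau>) w) (r t w)) \<le> \<beta> * norm (X (t - \<tau>) w)" by (rule D_le[OF r_in_S[OF assms]])
 finally show ?thesis by simp
qed

lemma X_initial_bound: "\<exists>K\<ge>0. AE w in M. \<forall>s\<in>{-\<tau>..0}. norm (X s w) \<le> K"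
proof -
 obtain K where K: "!!w s. w \<in> space M ==> s \<in> {-\<tau>..0} ==> norm (\<xi> s w) \<le> K"
  using init unfolding initial_datum_def by blast
 have "AE w in M. \<forall>s\<in>{-\<tau>..0}. X s w = \<xi> s w" using sol by (simp add: nsdde_solution_def)
 then have "AE w in M. \<forall>s\<in>{-\<tau>..0}. norm (X s w) \<le> max 0 K"
  using AE_space by eventually_elim (use K in \<open>auto simp: le_max_iff_disj\<close>)
 then show ?thesis by (intro exI[of _ "max 0 K"]) auto
qed

lemma Z_initial_bound: "\<exists>K\<ge>0. AE w in M. norm (Z 0 w) \<le> K"
proof -
 obtain K where K: "0 \<le> K" "AE w in M. \<forall>s\<in>{-\<tau>..0}. norm (X s w) \<le> K" using X_initial_bound by blast
 have "AE w in M. norm (Z 0 w) \<le> K + \<beta> * K"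
  using K(2) AE_space
 proof eventually_elim
  case (elim w)
  have "norm (Z 0 w) \<le> norm (X 0 w) + norm (D (X (0 - \<tau>) w) (r 0 w))" unfolding Z_def by (rule norm_triangle_ineq4)
  also have "norm (D (X (0 - \<tau>) w) (r 0 w)) \<le> \<beta> * norm (X (0 - \<tau>) w)" by (rule D_le[OF r_in_S[OF elim(2)]]) simp
  also have "\<beta> * norm (X (0 - \<tau>) w) \<le> \<beta> * K" using elim(1) \<tau> \<beta> by (intro mult_left_mono) auto
  also have "norm (X 0 w) \<le> K" using elim(1) \<tau> by auto
  finally show ?case by simp
 qed
 then show ?thesis using K(1) \<beta> by (intro exI[of _ "K + \<beta> * K"]) auto
qed

text \<open>The integral equation says that, off one null set and for all times, the stochastic
  integral equals \<open>Z\<close> minus its initial value minus the integrated drift. The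
  approximating sequence of that integral thus serves for \<open>Z\<close>, and passing to the
  continuous Brownian version changes it on null sets only.\<close>

lemma ito_process_exists:
 "\<exists>B' nn uu etaeta. ito_process M F B' N \<Gamma> r drift diffusion Z nn uu etaeta"
proof -
 obtain B' where B': "brownian_motion M F B'" "AE w in M. \<forall>t. B t w = B' t w"
   "!!w. w \<in> space M ==> continuous_on {0..} (\<lambda>t. B' t w)"
  by (rule brownian_continuous_version[OF bm], rule that)
 obtain I where I: "ito_integral M F B diffusion I"
  "AE w in M. \<forall>t\<ge>0. X t w - D (X (t - \<tau>) w) (r t w) = X 0 w - D (X (- \<tau>) w) (r 0 w)
   + (LINT s:{0..t}|lborel. f (X s w) (X (s - \<tau>) w) s (r s w)) + I t w"
  using sol unfolding nsdde_solution_def diffusion_def[abs_def] by blast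
 have Ieq: "AE w in M. \<forall>t\<ge>0. I t w = Z t w - Z 0 w - (LINT s:{0..t}|lborel. drift s w)"
  using I(2) by eventually_elim (simp add: Z_def drift_def)
 obtain nn uu etaeta where S: "\<forall>j. simple_process M F (nn j) (uu j) (etaeta j)"
   "\<forall>T\<ge>0. null_in_prob M (\<lambda>j w. \<integral>\<^sup>+s\<in>{0..T}. ennreal ((norm (simple_val (nn j) (uu j) (etaeta j) s w - diffusion s w))^2) \<partial>lborel)"
   "\<forall>t\<ge>0. null_in_prob M (\<lambda>j w. ennreal (norm (simple_integral B (nn j) (uu j) (etaeta j) t w - I t w)))"
  using I(1) unfolding ito_integral_def by (elim conjE exE) (rule that; assumption)
 have "ito_process M F B' N \<Gamma> r drift diffusion Z nn uu etaeta"
 proof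
  show "brownian_motion M F B'" by (rule B'(1))
  show "continuous_on {0..} (\<lambda>t. B' t w)" if "w \<in> space M" for w by (rule B'(3)[OF that])
  show "prog v drift" "prog v diffusion" "prog v Z" if "0 \<le> v" for v
   using drift_prog[OF that] diffusion_prog[OF that] Z_prog[OF that] .
  show "AE w in M. \<forall>t\<ge>0. set_integrable lborel {0..t} (\<lambda>s. drift s w)"
   using sol by (simp add: nsdde_solution_def drift_def)
  show "AE w in M. \<forall>t\<ge>0. (\<integral>\<^sup>+s\<in>{0..t}. ennreal ((norm (diffusion s w))^2) \<partial>lborel) < \<infinity>"
   using I(1) by (simp add: ito_integral_def)
  show "simple_process M F (nn j) (uu j) (etaeta j)" for j by (rule S(1)[rule_format])
  show "null_in_prob M (\<lambda>j w. \<integral>\<^sup>+s\<in>{0..v}. ennreal ((norm (simple_val (nn j) (uu j) (etaeta j) s w - diffusion s w))^2) \<partial>lborel)" if "0 \<le> v" for v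
   by (rule S(2)[rule_format, OF that])
  show "null_in_prob M (\<lambda>j w. ennreal (norm (simple_integral B' (nn j) (uu j) (etaeta j) v w - (Z v w - Z 0 w - (LINT s:{0..v}|lborel. drift s w)))))"
   if v: "0 \<le> v" for v
  proof (rule null_in_prob_AE_eq[OF S(3)[rule_format, OF v]])
   fix j
   show "AE w in M. ennreal (norm (simple_integral B (nn j) (uu j) (etaeta j) v w - I v w)) =
     ennreal (norm (simple_integral B' (nn j) (uu j) (etaeta j) v w - (Z v w - Z 0 w - (LINT s:{0..v}|lborel. drift s w))))"
    using B'(2) Ieq by eventually_elim (simp add: simple_integral_def v)
  qed
 qed
 then show ?thesis by blast
qed

end

section \<open>From the decay of \<open>Z\<close> to the decay of \<open>X\<close>\<close>

context switched_delay_equation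
begin

text \<open>\<open>delay_decay\<close> is applied twice to \<open>norm_X_le\<close>: to the moments,
  where \<open>convex_powr_split\<close> keeps the factor \<open>\<beta>\<close> and the rate is at
  most \<open>lam\<close>, and along single paths, where the root of order \<open>p\<close> leaves a
  rate of at most \<open>lam / p\<close>. Both rates are deterministic, as the definition of almost
  sure stability demands.\<close>

theorem exponentially_stable:
 assumes p: "1 \<le> p" and lam: "0 < lam"
  and moment: "\<exists>c\<ge>0. \<forall>t\<ge>0. (\<integral>\<^sup>+w. ennreal (norm (Z t w) powr p) \<partial>M) \<le> ennreal (c * exp (- lam * t))"
  and path: "AE w in M. \<exists>c. \<forall>t\<ge>0. exp (lam * t) * norm (Z t w) powr p \<le> c"
 shows "moment_exp_stable M p X" and "as_exp_stable M X"
proof -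
 obtain K where K: "0 \<le> K" "AE w in M. \<forall>s\<in>{-\<tau>..0}. norm (X s w) \<le> K" using X_initial_bound by blast
 have p0: "0 < p" using p by simp
 obtain \<mu> where \<mu>: "0 < \<mu>" "\<mu> \<le> lam" "\<beta> * exp (\<mu> * \<tau>) < 1"
  using delay_rate_exists[OF \<tau> \<beta> lam] by blast
 obtain c where c: "0 \<le> c" "!!t. 0 \<le> t ==> (\<integral>\<^sup>+w. ennreal (norm (Z t w) powr p) \<partial>M) \<le> ennreal (c * exp (- lam * t))"
  using moment by blast
 let ?x = "\<lambda>t. \<integral>\<^sup>+w. ennreal (norm (X t w) powr p) \<partial>M"
 let ?b = "(1 - \<beta>) powr (1 - p)"
 have "\<exists>C>0. \<forall>t\<ge>0. ?x t \<le> ennreal (C * exp (- \<mu> * t))"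
 proof (rule delay_decay[OF \<tau> \<beta>(1) \<mu>(3)])
  show "0 \<le> \<mu>" using \<mu> by simp
  show "0 \<le> ?b * c" using c by simp
  show "0 \<le> K powr p" by simp
  show "?x t \<le> ennreal (K powr p)" if t: "- \<tau> \<le> t" "t \<le> 0" for t
  proof -
   have "?x t \<le> (\<integral>\<^sup>+w. ennreal (K powr p) \<partial>M)"
   proof (rule nn_integral_mono_AE)
    show "AE w in M. ennreal (norm (X t w) powr p) \<le> ennreal (K powr p)"
     using K(2) by eventually_elim (use t p in \<open>auto intro!: ennreal_leI powr_mono2\<close>)
   qed
   then show ?thesis by (simp add: emeasure_space_1)
  qed
  show "?x t \<le> ennreal (?b * c * exp (- \<mu> * t)) + ennreal \<beta> * ?x (t - \<tau>)" if t: "0 \<le> t" for t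
  proof -
   have Zm: "Z t \<in> borel_measurable M"
   proof -
    have "(\<lambda>w. (t, w)) \<in> measurable (F t) (borel \<Otimes>\<^sub>M F t)" by measurable
    from measurable_compose[OF this Z_prog[OF t, unfolded prog_def]] have "Z t \<in> borel_measurable (F t)"
     using t by (simp add: clip_eq)
    then show ?thesis by (rule measurable_F_M[OF t])
   qed
   have [measurable]: "Z t \<in> borel_measurable M" "X (t - \<tau>) \<in> borel_measurable M"
    by (rule Zm, rule X_meas) (use t in simp)
   have "?x t \<le> (\<integral>\<^sup>+w. ennreal ?b * ennreal (norm (Z t w) powr p) + ennreal \<beta> * ennreal (norm (X (t - \<tau>) w) powr p) \<partial>M)"
   proof (rule nn_integral_mono)
    fix w assume w: "w \<in> space M"
    have "norm (X t w) powr p \<le> (norm (Z t w) + \<beta> * norm (X (t - \<tau>) w)) powr p"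
     using norm_X_le[OF w t] p by (intro powr_mono2) auto
    also have "... \<le> ?b * norm (Z t w) powr p + \<beta> * norm (X (t - \<tau>) w) powr p"
     by (rule convex_powr_split[OF p \<beta>]) auto
    finally have "ennreal (norm (X t w) powr p) \<le> ennreal (?b * norm (Z t w) powr p + \<beta> * norm (X (t - \<tau>) w) powr p)"
     by (rule ennreal_leI)
    then show "ennreal (norm (X t w) powr p) \<le> ennreal ?b * ennreal (norm (Z t w) powr p) + ennreal \<beta> * ennreal (norm (X (t - \<tau>) w) powr p)"
     using \<beta> by (simp add: ennreal_mult)
   qed
   also have "... = ennreal ?b * (\<integral>\<^sup>+w. ennreal (norm (Z t w) powr p) \<partial>M) + ennreal \<beta> * ?x (t - \<tau>)"
    by (simp add: nn_integral_add nn_integral_cmult)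
   also have "... \<le> ennreal ?b * ennreal (c * exp (- lam * t)) + ennreal \<beta> * ?x (t - \<tau>)"
    by (intro add_right_mono mult_left_mono c(2) t) simp
   also have "ennreal ?b * ennreal (c * exp (- lam * t)) \<le> ennreal (?b * c * exp (- \<mu> * t))"
   proof -
    have "exp (- lam * t) \<le> exp (- \<mu> * t)" using \<mu>(2) t by (simp add: mult_right_mono)
    then have "?b * c * exp (- lam * t) \<le> ?b * c * exp (- \<mu> * t)" using c(1) by (intro mult_left_mono) auto
    then show ?thesis using c(1) by (simp add: ennreal_mult[symmetric] mult.assoc ennreal_leI)
   qed
   finally show ?thesis by (simp add: add_right_mono)
  qed
 qed
 then obtain C where "0 < C" "!!t. 0 \<le> t ==> ?x t \<le> ennreal (C * exp (- \<mu> * t))" by blast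
 from Limsup_elog_le[OF this] have "Limsup at_top (\<lambda>t. elog (?x t) / ereal t) \<le> ereal (- \<mu>)" .
 also have "... < 0" using \<mu>(1) by simp
 finally show "moment_exp_stable M p X" by (simp add: moment_exp_stable_def)

 have lp: "0 < lam / p" using lam p by simp
 obtain \<kappa> where \<kappa>: "0 < \<kappa>" "\<kappa> \<le> lam / p" "\<beta> * exp (\<kappa> * \<tau>) < 1"
  using delay_rate_exists[OF \<tau> \<beta> lp] by blast
 have "AE w in M. Limsup at_top (\<lambda>t. elog (ennreal (norm (X t w))) / ereal t) \<le> ereal (- \<kappa>)"
  using path K(2) AE_space
 proof eventually_elim
  case (elim w)
  obtain c where c: "!!t. 0 \<le> t ==> exp (lam * t) * norm (Z t w) powr p \<le> c" using elim(1) by blast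
  have c0: "0 \<le> c" using order.trans[OF _ c[of 0]] by simp
  have Zle: "norm (Z t w) \<le> c powr (1 / p) * exp (- \<kappa> * t)" if t: "0 \<le> t" for t
  proof -
   have "norm (Z t w) powr p = exp (- lam * t) * (exp (lam * t) * norm (Z t w) powr p)"
    by (simp add: exp_minus)
   also have "... \<le> exp (- lam * t) * c" by (intro mult_left_mono c t) simp
   finally have "(norm (Z t w) powr p) powr (1 / p) \<le> (exp (- lam * t) * c) powr (1 / p)"
    using p by (intro powr_mono2) auto
   then have "norm (Z t w) \<le> exp (- lam * t) powr (1 / p) * c powr (1 / p)"
    using p0 c0 by (simp add: powr_powr powr_mult)
   also have "exp (- lam * t) powr (1 / p) = exp (- (lam / p) * t)" by (simp add: powr_def)
   also have "... \<le> exp (- \<kappa> * t)" using \<kappa>(2) t by (simp only: exp_le_cancel_iff minus_mult_left[symmetric] neg_le_iff_le mult_right_mono)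
   finally show ?thesis by (simp add: mult.commute mult_right_mono)
  qed
  have "\<exists>C>0. \<forall>t\<ge>0. ennreal (norm (X t w)) \<le> ennreal (C * exp (- \<kappa> * t))"
  proof (rule delay_decay[OF \<tau> \<beta>(1) \<kappa>(3)])
   show "0 \<le> \<kappa>" using \<kappa> by simp
   show "0 \<le> c powr (1 / p)" by simp
   show "0 \<le> K" by (rule K(1))
   show "ennreal (norm (X t w)) \<le> ennreal K" if "- \<tau> \<le> t" "t \<le> 0" for t
    using elim(2) that by (intro ennreal_leI) auto
   show "ennreal (norm (X t w)) \<le> ennreal (c powr (1 / p) * exp (- \<kappa> * t)) + ennreal \<beta> * ennreal (norm (X (t - \<tau>) w))" if t: "0 \<le> t" for t
   proof -
    have "norm (X t w) \<le> c powr (1 / p) * exp (- \<kappa> * t) + \<beta> * norm (X (t - \<tau>) w)"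
     using norm_X_le[OF elim(3) t] Zle[OF t] by linarith
    then have "ennreal (norm (X t w)) \<le> ennreal (c powr (1 / p) * exp (- \<kappa> * t) + \<beta> * norm (X (t - \<tau>) w))" by (rule ennreal_leI)
    then show ?thesis using \<beta> by (simp add: ennreal_mult)
   qed
  qed
  then obtain C where "0 < C" "!!t. 0 \<le> t ==> ennreal (norm (X t w)) \<le> ennreal (C * exp (- \<kappa> * t))" by blast
  from Limsup_elog_le[OF this] show ?case .
 qed
 then show "as_exp_stable M X" unfolding as_exp_stable_def using \<kappa>(1) by blast
qed

end

theorem corollary4p4:
  fixes M :: "'w measure" and F :: "real \<Rightarrow> 'w measure"
    and N :: nat and \<Gamma> :: "int \<Rightarrow> int \<Rightarrow> real" and r :: "real \<Rightarrow> 'w \<Rightarrow> int" and i0 :: int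
    and \<Delta> :: "int \<Rightarrow> int \<Rightarrow> real set" and \<nu> :: "'w \<Rightarrow> (real \<times> real) measure"
    and B :: "real \<Rightarrow> 'w \<Rightarrow> real^'m"
    and \<tau> \<beta> p c1 c2 lam \<alpha> :: real and \<xi> :: "real \<Rightarrow> 'w \<Rightarrow> real^'d"
    and D :: "real^'d \<Rightarrow> int \<Rightarrow> real^'d"
    and f :: "real^'d \<Rightarrow> real^'d \<Rightarrow> real \<Rightarrow> int \<Rightarrow> real^'d"
    and g :: "real^'d \<Rightarrow> real^'d \<Rightarrow> real \<Rightarrow> int \<Rightarrow> real^'m^'d"
    and V :: "real^'d \<Rightarrow> real \<Rightarrow> int \<Rightarrow> real" and \<gamma> \<psi> :: "real \<Rightarrow> real"
    and X :: "real \<Rightarrow> 'w \<Rightarrow> real^'d"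
  assumes "prob_space M" and "complete_filtration M F"
    and "generator N \<Gamma>" and "markov_chain M F N \<Gamma> r"
    and "i0 \<in> {1..int N}" and "\<forall>\<omega>\<in>space M. r 0 \<omega> = i0"
    and "jump_intervals N \<Gamma> \<Delta>" and "poisson_random_measure M F \<nu>"
    and "poisson_representation M \<nu> (jump_fun N \<Delta>) r"
    and "brownian_motion M F B" and "indep_processes M B r"
    and "\<tau> > 0" and "initial_datum M F \<tau> \<xi>"
    and "\<forall>i\<in>{1..int N}. (\<lambda>x. D x i) \<in> borel_measurable borel"
    and "\<forall>i\<in>{1..int N}. (\<lambda>(x, y, t). f x y t i)
           \<in> borel_measurable (restrict_space borel (UNIV \<times> UNIV \<times> {0..}))"
    and "\<forall>i\<in>{1..int N}. (\<lambda>(x, y, t). g x y t i)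
           \<in> borel_measurable (restrict_space borel (UNIV \<times> UNIV \<times> {0..}))"
    and "local_lipschitz_coeffs N f g"
    and "0 < \<beta>" and "\<beta> < 1"
    and "\<forall>x y. \<forall>i\<in>{1..int N}. norm (D x i - D y i) \<le> \<beta> * norm (x - y)"
    and "\<forall>i\<in>{1..int N}. D 0 i = 0"
    and "\<forall>t\<ge>0. \<forall>i\<in>{1..int N}. f 0 0 t i = 0 \<and> g 0 0 t i = 0"
    and "p \<ge> 1"
    and "C21 N V" and "\<forall>x. \<forall>t\<ge>0. \<forall>i\<in>{1..int N}. V x t i \<ge> 0"
    and "\<forall>t\<ge>0. \<gamma> t \<ge> 0" and "\<forall>t\<ge>0. \<psi> t \<ge> 0"
    and "set_integrable lebesgue {0..} \<psi>"
    and "c1 > 0" and "c2 > 0" and "lam > 0" and "\<alpha> > 0"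
    and "set_integrable lebesgue {0..} (\<lambda>t. exp (lam * t) * \<gamma> t)"
    and "\<forall>x. \<forall>t\<ge>0. \<forall>i\<in>{1..int N}.
           c1 * norm x powr p \<le> V x t i \<and> V x t i \<le> c2 * norm x powr p"
    and "\<forall>x y. \<forall>t\<ge>0. \<forall>i\<in>{1..int N}.
           L_op N \<Gamma> D f g V x y t i \<le> \<gamma> t + (\<psi> t - lam) * V (x - D y i) t i"
    and "\<forall>x y. \<forall>t\<ge>0. \<forall>i\<in>{1..int N}.
           (norm (transpose (g x y t i) *v V_x V (x - D y i) t i))\<^sup>2
           + (LINT l|lborel.
                \<bar>V (x - D y i) t (i + jump_fun N \<Delta> i l) - V (x - D y i) t i\<bar>\<^sup>2)
           \<le> \<alpha> * (V (x - D y i) t i)\<^sup>2"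
    and "nsdde_solution M F r B D f g \<tau> \<xi> X"
  shows "moment_exp_stable M p X \<and> as_exp_stable M X"
proof -
 interpret prob_space M by fact
 interpret E: switched_delay_equation M F N \<Gamma> r B D f g \<tau> \<beta> \<xi> X
  by unfold_locales (use assms in blast)+
 have \<psi>_nn: "0 \<le> \<psi> t" and a_nn: "0 \<le> exp (lam * t) * \<gamma> t" if "0 \<le> t" for t
  using assms(26,27) that by auto
 \<comment> \<open>Borel versions, nonnegative everywhere, of \<psi> and of the weighted \<gamma>;
   they agree with the given functions at almost every time, so the inequality for
   \<open>L_op\<close> carries over almost everywhere.\<close>
 obtain \<psi>' where \<psi>': "!!t. 0 \<le> \<psi>' t" "set_integrable lborel {0..} \<psi>'" "AE t in lborel. 0 \<le> t --> \<psi> t = \<psi>' t"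
  by (rule lebesgue_borel_version[OF assms(28) \<psi>_nn], assumption, rule that)
 obtain a where a: "!!t. 0 \<le> a t" "set_integrable lborel {0..} a" "AE t in lborel. 0 \<le> t --> exp (lam * t) * \<gamma> t = a t"
  by (rule lebesgue_borel_version[OF assms(33) a_nn], assumption, rule that)
 obtain B' nn uu etaeta where "ito_process M F B' N \<Gamma> r E.drift E.diffusion E.Z nn uu etaeta"
  using E.ito_process_exists by blast
 then interpret I: ito_process M F B' N \<Gamma> r E.drift E.diffusion E.Z nn uu etaeta .
 interpret L: lyapunov_process M F B' N \<Gamma> r E.drift E.diffusion E.Z nn uu etaeta V lam c1 p a \<psi>'
 proof
  show "generator N \<Gamma>" "C21 N V" "0 < c1" "0 < p" "0 \<le> lam" using assms by auto
  show "c1 * norm x powr p \<le> V x t i" if "0 \<le> t" "i \<in> {1..int N}" for x t i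
   using assms(34) that by blast
  show "0 \<le> a t" "0 \<le> \<psi>' t" for t by (rule a(1), rule \<psi>'(1))
  show "set_integrable lborel {0..} a" "set_integrable lborel {0..} \<psi>'" by (rule a(2), rule \<psi>'(2))
  show "AE v in lborel. 0 \<le> v --> (\<forall>w\<in>space M.
    V_t V (E.Z v w) v (r v w) + V_x V (E.Z v w) v (r v w) \<bullet> E.drift v w
     + 1/2 * quad_trace (V_xx V (E.Z v w) v (r v w)) (E.diffusion v w)
     + (\<Sum>j\<in>{1..int N}. \<Gamma> (r v w) j * V (E.Z v w) v j)
    \<le> exp (- lam * v) * a v + (\<psi>' v - lam) * V (E.Z v w) v (r v w))"
   using \<psi>'(3) a(3)
  proof eventually_elim
   case (elim v)
   show ?case
   proof (intro impI ballI)
    fix w assume v: "0 \<le> v" and w: "w \<in> space M"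
    have i: "r v w \<in> {1..int N}" by (rule E.r_in_S[OF w v])
    have "L_op N \<Gamma> D f g V (X v w) (X (v - \<tau>) w) v (r v w) \<le> \<gamma> v + (\<psi> v - lam) * V (X v w - D (X (v - \<tau>) w) (r v w)) v (r v w)"
     using assms(35) v i by blast
    moreover have "\<gamma> v = exp (- lam * v) * a v" "\<psi> v = \<psi>' v"
     using elim v by (auto simp: exp_minus field_simps)
    ultimately show "V_t V (E.Z v w) v (r v w) + V_x V (E.Z v w) v (r v w) \<bullet> E.drift v w
     + 1/2 * quad_trace (V_xx V (E.Z v w) v (r v w)) (E.diffusion v w)
     + (\<Sum>j\<in>{1..int N}. \<Gamma> (r v w) j * V (E.Z v w) v j)
    \<le> exp (- lam * v) * a v + (\<psi>' v - lam) * V (E.Z v w) v (r v w)"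
     unfolding L_op_def E.Z_def E.drift_def E.diffusion_def quad_trace_def by simp
   qed
  qed
 qed
 obtain K where K: "0 \<le> K" "AE w in M. norm (E.Z 0 w) \<le> K" using E.Z_initial_bound by blast
 \<comment> \<open>The upper bound with \<open>c2\<close> and the bounded initial data make the
   Lyapunov function at time 0 bounded; this finite start feeds both the moment and the pathwise
   estimate.\<close>
 have w0: "(\<integral>\<^sup>+w. ennreal (L.wp 0 w) \<partial>M) < \<infinity>"
 proof -
  have "(\<integral>\<^sup>+w. ennreal (L.wp 0 w) \<partial>M) \<le> (\<integral>\<^sup>+w. ennreal (c2 * K powr p) \<partial>M)"
  proof (rule nn_integral_mono_AE)
   show "AE w in M. ennreal (L.wp 0 w) \<le> ennreal (c2 * K powr p)"
    using K(2) AE_space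
   proof eventually_elim
    case (elim w)
    have i: "r 0 w \<in> {1..int N}" by (rule E.r_in_S[OF elim(2)]) simp
    have "L.wp 0 w = V (E.Z 0 w) 0 (r 0 w)" by (simp add: L.wp_def L.ly.lyap_def)
    also have "... \<le> c2 * norm (E.Z 0 w) powr p" using assms(34) i by blast
    also have "... \<le> c2 * K powr p" using assms(23,30) elim(1) by (intro mult_left_mono powr_mono2) auto
    finally show ?case by (rule ennreal_leI)
   qed
  qed
  also have "... < \<infinity>" by (simp add: emeasure_space_1)
  finally show ?thesis .
 qed
 have "\<exists>c\<ge>0. \<forall>t\<ge>0. (\<integral>\<^sup>+w. ennreal (norm (E.Z t w) powr p) \<partial>M) \<le> ennreal (c * exp (- lam * t))"
  by (rule L.moment_bound[OF w0])
 moreover have "AE w in M. \<exists>c. \<forall>t\<ge>0. exp (lam * t) * norm (E.Z t w) powr p \<le> c"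
  by (rule L.path_bound[OF w0 E.Z_right_continuous])
 ultimately show ?thesis
  using E.exponentially_stable[OF assms(23,31)] by blast
qed

end
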